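(* Let $\hat a_n$ be estimators of $a_0$, stochastically independent of $X^{(n)}$, satisfying $\|\hat a_n-a_0\|_{L^2(F_0)}=O_{P_0}(\rho_n)$ for some sequence $\rho_n\to0$, and $\|\hat a_n\|_\infty=O_{P_0}(1)$. Consider the prior on $b$ given by $$b(z)=\Psi\bigl(W^b_z+\lambda\,\hat a_n(z)\bigr),$$ where $W^b$ is a continuous stochastic process and $\lambda\sim N(0,\sigma_n^2)$ is a random variable independent of $W^b$, and assign $F$ an independent Dirichlet process prior. Assume that there exist measurable sets $\mathcal H_n^b$ of functions such that, for every $t\in\mathbb R$ and some numbers $u_n,\varepsilon_n^b\to0$, $$\Pi\bigl(\lambda:|\lambda|\le u_n\sigma_n^2\sqrt n\mid X^{(n)}\bigr)\to^{P_0}1,$$ $$\Pi\bigl((w,\lambda):w+(\lambda+tn^{-1/2})\hat a_n\in\mathcal H_n^b\mid X^{(n)}\bigr)\to^{P_0}1,$$ $$\sup_{b=\Psi(\eta^b):\,\eta^b\in\mathcal H_n^b}\|b-b_0\|_{L^2(F_0)}\le\varepsilon_n^b,\qquad \sup_{b=\Psi(\eta^b):\,\eta^b\in\mathcal H_n^b}\bigl|\mathbb G_n[b-b_0]\bigr|\to^{P_0}0 .$$ If $n\sigma_n^2\to\infty$ and $\sqrt n\,\rho_n\varepsilon_n^b\to0$, then the posterior distribution of $\chi=\int b\,dF$ satisfies the semiparametric Bernstein--von Mises theorem.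
   Context: Model. Let $\mathcal Z$ be a Polish space. One observes $X^{(n)}=(X_1,\dots,X_n)$, i.i.d. copies of $X=(Z,R,RY)$, where $Z\in\mathcal Z$, $R,Y\in\{0,1\}$, and $R,Y$ are conditionally independent given $Z$. Parameters: $F$ = law of $Z$, $1/a(z)=P(R=1\mid Z=z)$, $b(z)=P(Y=1\mid Z=z)$; $\Psi(x)=1/(1+e^{-x})$ and $\eta^b=\Psi^{-1}(b)$. The true parameters are $(a_0,b_0,F_0)$; $P_0$ denotes the law of the data (jointly with $\hat a_n$ where relevant), and $\to^{P_0}$ convergence in $P_0$-probability (outer probability if needed). Standing assumption: $1/a_0$ and $b_0$ are bounded away from $0$ and $1$, and the density $f_0$ of $F_0$ with respect to a dominating measure is bounded away from $0$ and $\infty$. For $h$ a function of $X$ (or of $Z$), $\mathbb G_n[h]=\sqrt n\bigl(n^{-1}\sum_{i=1}^n h(X_i)-P_0h\bigr)$. Posterior. In forming the posterior, $\hat a_n$ is treated as a given function. The posterior of $(w,\lambda)$ (values of $(W^b,\lambda)$) has density proportional to $\prod_{i=1}^n b(Z_i)^{R_iY_i}(1-b(Z_i))^{R_i(1-Y_i)}$, $b=\Psi(w+\lambda\hat a_n)$, with respect to the prior law of $(W^b,\lambda)$. Given the data, $F$ is independent of $b$ with $F\sim DP(\nu+n\mathbb F_n)$ (Dirichlet process), $\mathbb F_n=n^{-1}\sum_{i=1}^n\delta_{Z_i}$, $\nu$ a finite measure on $\mathcal Z$ ($\nu=0$ allowed). (Any independent prior on $a$ cancels and is irrelevant.) Semiparametric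 Bernstein--von Mises theorem. Let $\chi=\int b\,dF$, $\chi_0=\int b_0\,dF_0$, $\widetilde\chi_0(X)=Ra_0(Z)(Y-b_0(Z))+b_0(Z)-\chi_0$, $V_0=P_0\widetilde\chi_0^2=\int a_0b_0(1-b_0)\,dF_0+\int b_0^2\,dF_0-\chi_0^2$, and let $\widehat\chi_n$ be any random sequence with $\widehat\chi_n=\chi_0+n^{-1}\sum_{i=1}^n\widetilde\chi_0(X_i)+o_{P_0}(n^{-1/2})$. The posterior satisfies the semiparametric Bernstein--von Mises theorem if $d_{BL}\bigl(\mathcal L(\sqrt n(\chi-\widehat\chi_n)\mid X^{(n)}),N(0,V_0)\bigr)\to^{P_0}0$, where $\mathcal L(\cdot\mid X^{(n)})$ is the posterior law and $d_{BL}$ is the bounded Lipschitz distance between probability measures on $\mathbb R$. *)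

theory Defs
  imports "HOL-Probability.Probability"
begin

section \<open>Convergence in outer probability\<close>

text \<open>
  Random quantities are extended nonnegative functions on the probability spaces \<open>P n\<close>. They need
  not be measurable; on measurable events \<^const>\<open>outer_measure_of\<close> is the probability itself.
\<close>

definition prob_tendsto_0 :: "(nat \<Rightarrow> 'w measure) \<Rightarrow> (nat \<Rightarrow> 'w \<Rightarrow> ennreal) \<Rightarrow> bool" where
  "prob_tendsto_0 P T \<longleftrightarrow>
     (\<forall>e>0. (\<lambda>n. outer_measure_of (P n) {\<omega> \<in> space (P n). T n \<omega> > ennreal e}) \<longlonglongrightarrow> 0)"

definition prob_tendsto :: "(nat \<Rightarrow> 'w measure) \<Rightarrow> (nat \<Rightarrow> 'w \<Rightarrow> real) \<Rightarrow> real \<Rightarrow> bool" where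
  "prob_tendsto P T c \<longleftrightarrow> prob_tendsto_0 P (\<lambda>n \<omega>. ennreal \<bar>T n \<omega> - c\<bar>)"

definition prob_bigo :: "(nat \<Rightarrow> 'w measure) \<Rightarrow> (nat \<Rightarrow> 'w \<Rightarrow> ennreal) \<Rightarrow> (nat \<Rightarrow> real) \<Rightarrow> bool" where
  "prob_bigo P T r \<longleftrightarrow>
     (\<forall>e>0. \<exists>C. \<forall>\<^sub>F n in sequentially.
        outer_measure_of (P n) {\<omega> \<in> space (P n). T n \<omega> > ennreal (C * \<bar>r n\<bar>)} \<le> ennreal e)"


section \<open>Norms and the bounded Lipschitz distance\<close>

definition L2_norm :: "'z measure \<Rightarrow> ('z \<Rightarrow> real) \<Rightarrow> ennreal" where
  "L2_norm F f =
     (if integrable F (\<lambda>z. (f z)\<^sup>2) then ennreal (sqrt (\<integral>z. (f z)\<^sup>2 \<partial>F)) else \<infinity>)"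

definition sup_norm :: "('z \<Rightarrow> real) \<Rightarrow> ennreal" where
  "sup_norm f = (SUP z. ennreal \<bar>f z\<bar>)"

definition d_BL :: "real measure \<Rightarrow> real measure \<Rightarrow> real" where
  "d_BL M N =
     Sup {\<bar>(\<integral>x. f x \<partial>M) - (\<integral>x. f x \<partial>N)\<bar> | f. 1-lipschitz_on UNIV f \<and> (\<forall>x. \<bar>f x\<bar> \<le> 1)}"

text \<open>The second parameter is the standard deviation, and must be positive.\<close>

definition normal_law :: "real \<Rightarrow> real \<Rightarrow> real measure" where
  "normal_law m s = density lborel (normal_density m s)"


section \<open>The Dirichlet process\<close>

definition gamma_law :: "real \<Rightarrow> real measure" where
  "gamma_law s =
     (if s = 0 then return borel 0
      else density lborel
        (\<lambda>x. ennreal (indicator {0<..} x * x powr (s - 1) * exp (- x) / Gamma s)))"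

text \<open>
  Normalised independent Gamma variables. Parameters may vanish (the corresponding coordinate is
  then identically zero), as long as they do not all vanish.
\<close>

definition dirichlet_law :: "'i set \<Rightarrow> ('i \<Rightarrow> real) \<Rightarrow> ('i \<Rightarrow> real) measure" where
  "dirichlet_law I s =
     distr (Pi\<^sub>M I (\<lambda>i. gamma_law (s i))) (Pi\<^sub>M I (\<lambda>_. borel)) (\<lambda>g. \<lambda>i\<in>I. g i / (\<Sum>j\<in>I. g j))"

definition dirichlet_process :: "'z::topological_space measure \<Rightarrow> 'z measure measure \<Rightarrow> bool" where
  "dirichlet_process \<alpha> D \<longleftrightarrow>
     prob_space D \<and> sets D = sets (prob_algebra borel) \<and>
     (\<forall>k. \<forall>A :: nat \<Rightarrow> 'z set.
        (\<forall>i<k. A i \<in> sets borel) \<and> disjoint_family_on A {..<k} \<and> (\<Union>i<k. A i) = UNIV \<longrightarrow>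
        distr D (Pi\<^sub>M {..<k} (\<lambda>_. borel)) (\<lambda>F. \<lambda>i\<in>{..<k}. measure F (A i)) =
        dirichlet_law {..<k} (\<lambda>i. measure \<alpha> (A i)))"


section \<open>The model\<close>

definition logistic :: "real \<Rightarrow> real" where
  "logistic x = 1 / (1 + exp (- x))"

text \<open>An observation is a triple \<open>(Z, R, RY)\<close>; truth values encode \<open>{0, 1}\<close>.\<close>

type_synonym 'z obs = "'z \<times> bool \<times> bool"

abbreviation obs_space :: "'z::topological_space obs measure" where
  "obs_space \<equiv> borel \<Otimes>\<^sub>M (count_space UNIV \<Otimes>\<^sub>M count_space UNIV)"

text \<open>
  Law of \<open>(Z, R, RY)\<close> when \<open>Z\<close> has law \<open>F\<close> and, conditionally on \<open>Z = z\<close>, the variables \<open>R\<close> and \<open>Y\<close>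
  are independent Bernoulli variables with success probabilities \<open>1 / a z\<close> and \<open>b z\<close>.
\<close>

definition obs_law ::
    "('z::topological_space \<Rightarrow> real) \<Rightarrow> ('z \<Rightarrow> real) \<Rightarrow> 'z measure \<Rightarrow> 'z obs measure" where
  "obs_law a b F =
     F \<bind> (\<lambda>z. distr (measure_pmf (pair_pmf (bernoulli_pmf (1 / a z)) (bernoulli_pmf (b z))))
                obs_space (\<lambda>(r, y). (z, r, r \<and> y)))"

definition chi :: "('z \<Rightarrow> real) \<Rightarrow> 'z measure \<Rightarrow> real" where
  "chi b F = (\<integral>z. b z \<partial>F)"

definition sample_law ::
    "('z::topological_space \<Rightarrow> real) \<Rightarrow> ('z \<Rightarrow> real) \<Rightarrow> 'z measure \<Rightarrow> nat \<Rightarrow> (nat \<Rightarrow> 'z obs) measure" where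
  "sample_law a b F n = Pi\<^sub>M {..<n} (\<lambda>_. obs_law a b F)"

definition emp_mean :: "nat \<Rightarrow> (nat \<Rightarrow> 'o) \<Rightarrow> ('o \<Rightarrow> real) \<Rightarrow> real" where
  "emp_mean n x h = (\<Sum>i<n. h (x i)) / real n"

definition emp_process :: "'o measure \<Rightarrow> nat \<Rightarrow> (nat \<Rightarrow> 'o) \<Rightarrow> ('o \<Rightarrow> real) \<Rightarrow> real" where
  "emp_process P n x h = sqrt (real n) * (emp_mean n x h - (\<integral>v. h v \<partial>P))"


section \<open>Prior and posterior\<close>

text \<open>
  A continuous stochastic process is represented by its law on the continuous functions, equipped
  with the sigma-algebra generated by the point evaluations.
\<close>

definition path_space :: "('z::topological_space \<Rightarrow> real) measure" where
  "path_space = restrict_space (Pi\<^sub>M UNIV (\<lambda>_. borel)) {w. continuous_on UNIV w}"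

definition shift_path :: "('z \<Rightarrow> real) \<Rightarrow> ('z \<Rightarrow> real) \<Rightarrow> real \<Rightarrow> 'z \<Rightarrow> real" where
  "shift_path a w l = (\<lambda>z. w z + l * a z)"

text \<open>Joint law of the process and the independent variable \<open>\<lambda>\<close>.\<close>

definition prior_law :: "('z \<Rightarrow> real) measure \<Rightarrow> real \<Rightarrow> (('z \<Rightarrow> real) \<times> real) measure" where
  "prior_law Q \<sigma> = Q \<Otimes>\<^sub>M normal_law 0 \<sigma>"

definition likelihood :: "nat \<Rightarrow> (nat \<Rightarrow> 'z obs) \<Rightarrow> ('z \<Rightarrow> real) \<Rightarrow> real" where
  "likelihood n x b =
     (\<Prod>i<n. case x i of (z, r, ry) \<Rightarrow>
        b z ^ of_bool ry * (1 - b z) ^ of_bool (r \<and> \<not> ry))"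

definition posterior ::
    "('z \<Rightarrow> real) \<Rightarrow> ('z \<Rightarrow> real) measure \<Rightarrow> real \<Rightarrow> nat \<Rightarrow> (nat \<Rightarrow> 'z obs) \<Rightarrow>
     (('z \<Rightarrow> real) \<times> real) measure" where
  "posterior a Q \<sigma> n x =
     (let L = (\<lambda>(w, l). ennreal (likelihood n x (\<lambda>z. logistic (shift_path a w l z))))
      in density (prior_law Q \<sigma>) (\<lambda>p. L p / (\<integral>\<^sup>+q. L q \<partial>prior_law Q \<sigma>)))"

text \<open>The measure \<open>\<nu> + \<Sum>i<n. \<delta>(Z\<^sub>i)\<close>.\<close>

definition dp_base :: "'z::topological_space measure \<Rightarrow> nat \<Rightarrow> (nat \<Rightarrow> 'z obs) \<Rightarrow> 'z measure" where
  "dp_base \<nu> n x =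
     measure_of UNIV (sets borel) (\<lambda>A. emeasure \<nu> A + (\<Sum>i<n. indicator A (fst (x i))))"

text \<open>
  Posterior law of \<open>\<chi> = \<integral>b dF\<close>, where \<open>D\<close> is the posterior law of \<open>F\<close>; given the data, \<open>b\<close> and \<open>F\<close>
  are independent.
\<close>

definition posterior_chi ::
    "('z \<Rightarrow> real) \<Rightarrow> ('z \<Rightarrow> real) measure \<Rightarrow> real \<Rightarrow> 'z measure measure \<Rightarrow> nat \<Rightarrow>
     (nat \<Rightarrow> 'z obs) \<Rightarrow> real measure" where
  "posterior_chi a Q \<sigma> D n x =
     distr (posterior a Q \<sigma> n x \<Otimes>\<^sub>M D) borel
       (\<lambda>((w, l), F). chi (\<lambda>z. logistic (shift_path a w l z)) F)"


section \<open>The semiparametric Bernstein--von Mises property\<close>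

definition eff_influence ::
    "('z \<Rightarrow> real) \<Rightarrow> ('z \<Rightarrow> real) \<Rightarrow> 'z measure \<Rightarrow> 'z obs \<Rightarrow> real" where
  "eff_influence a b F = (\<lambda>(z, r, ry). a z * (of_bool ry - of_bool r * b z) + b z - chi b F)"

definition eff_variance ::
    "('z::topological_space \<Rightarrow> real) \<Rightarrow> ('z \<Rightarrow> real) \<Rightarrow> 'z measure \<Rightarrow> real" where
  "eff_variance a b F = (\<integral>v. (eff_influence a b F v)\<^sup>2 \<partial>obs_law a b F)"

text \<open>
  \<open>P n\<close> is the joint law of the sample and of an auxiliary variable carrying the randomness of the
  estimator; \<open>post n \<omega>\<close> is the posterior law of \<open>\<chi>\<close> when the data are \<open>\<omega>\<close>.
\<close>

definition semiparametric_BvM ::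
    "('z::topological_space \<Rightarrow> real) \<Rightarrow> ('z \<Rightarrow> real) \<Rightarrow> 'z measure \<Rightarrow>
     (nat \<Rightarrow> ((nat \<Rightarrow> 'z obs) \<times> 's) measure) \<Rightarrow>
     (nat \<Rightarrow> (nat \<Rightarrow> 'z obs) \<times> 's \<Rightarrow> real measure) \<Rightarrow> bool" where
  "semiparametric_BvM a0 b0 F0 P post \<longleftrightarrow>
     (\<forall>\<chi>hat. (\<forall>n. \<chi>hat n \<in> borel_measurable (P n)) \<and>
        prob_tendsto P
          (\<lambda>n \<omega>. sqrt (real n) *
             (\<chi>hat n \<omega> - (chi b0 F0 + emp_mean n (fst \<omega>) (eff_influence a0 b0 F0)))) 0 \<longrightarrow>
        prob_tendsto P
          (\<lambda>n \<omega>. d_BL (distr (post n \<omega>) borel (\<lambda>c. sqrt (real n) * (c - \<chi>hat n \<omega>)))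
                      (normal_law 0 (sqrt (eff_variance a0 b0 F0)))) 0)"

end

theory Submission
  imports Defs
begin

text \<open>
  The posterior of \<open>\<chi>\<close> is the law of a sum of two parts. Given \<open>b\<close>, the Dirichlet posterior of \<open>F\<close> makes
  \<open>\<surd>n (\<integral>b dF - F\<^sub>n b)\<close> asymptotically normal with variance \<open>F\<^sub>0 b\<^sub>0\<^sup>2 - (F\<^sub>0 b\<^sub>0)\<^sup>2\<close>, while \<open>\<surd>n F\<^sub>0 (b - b\<^sub>0)\<close>, centred
  at the score, is handled through its Laplace transform. Replacing \<open>\<lambda>\<close> by \<open>\<lambda> + t/\<surd>n\<close> perturbs the prior
  negligibly, since \<open>n \<sigma>\<^sub>n\<^sup>2 \<rightarrow> \<infinity>\<close>, and perturbs \<open>\<eta>\<^sup>b\<close> along the estimated least favourable direction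
  \<open>t ahat\<^sub>n/\<surd>n\<close>; the quadratic expansion of the loglikelihood then gives the transform of a normal
  law with variance \<open>F\<^sub>0 a\<^sub>0 b\<^sub>0 (1 - b\<^sub>0)\<close>.

  The remainder contains the empirical processes of \<open>R ahat\<^sub>n (b - b\<^sub>0)\<close>, whereas only those of \<open>b - b\<^sub>0\<close> are
  assumed to be uniformly small, and the class is arbitrary and possibly nonmeasurable. They are
  controlled by resampling: measure-preserving random exchanges of sample points for independent
  copies turn a large weighted process into a large unweighted one with probability bounded below.
\<close>

section \<open>Laplace transforms and the bounded Lipschitz distance\<close>

text \<open>Expanding the loglikelihood along \<open>ahat\<close> rather than \<open>a0\<close>
  leaves the bias sqrt n times the integral of \<open>(1 - ahat / a0) * (b - b0)\<close>. It is a
  product of two errors, so Cauchy-Schwarz bounds it by sqrt n times the two rates; this is where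
  \<open>n\<rho>\<epsilon>\<close> enters. All limits are quantitative:
  \<open>posterior_BvM_bound\<close> treats one fixed sample under finitely many inequalities, each
  of which holds with high outer probability. The stochastic bounds on the estimator are used with
  arbitrary fixed constants, and \<open>prob_bigo_whp\<close> chooses the constants afterwards. The
  exchange argument takes two rounds. An exchange with probability built from the weight shifts the
  process by a multiple of the weighted process, plus noise whose variance involves the empirical
  mean square of \<open>h\<close>. The hypotheses bound only the population mean square, so fair
  coins must first control the empirical one. The weights \<open>R * ahat\<close> are mapped
  affinely into the interval from 1/4 to 3/4, where products serve as exchange probabilities bounded
  away from 0. Independence of estimator and sample permits exchanges that depend on the
  estimator.\<close>

lemma power_fact_le_exp:
  fixes y :: real
  assumes "0 \<le> y"
  shows "y ^ j / fact j \<le> exp y"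
proof -
  have s: "(\<lambda>n. y ^ n / fact n) sums exp y"
    using exp_converges[of y] by (simp add: field_simps)
  have "sum (\<lambda>n. y ^ n / fact n) {j} \<le> (\<Sum>n. y ^ n / fact n)"
    using s assms by (intro sum_le_suminf) (auto simp: sums_iff)
  then show ?thesis using s by (simp add: sums_iff)
qed

lemma exp_abs_le:
  fixes y :: real
  shows "exp \<bar>y\<bar> \<le> exp y + exp (- y)"
  by (cases "0 \<le> y") auto

lemma abs_le_exp_add_exp:
  fixes y :: real
  shows "\<bar>y\<bar> \<le> exp y + exp (- y)"
  using exp_abs_le[of y] exp_ge_add_one_self[of "\<bar>y\<bar>"] by linarith

lemma moment_le_laplace:
  fixes M :: "real measure"
  assumes [measurable_cong]: "sets M = sets borel" and R: "R > 0"
    and int: "integrable M (\<lambda>x. exp (R * x))" "integrable M (\<lambda>x. exp (- (R * x)))"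
  shows "integrable M (\<lambda>x. x ^ j / fact j)"
    and "(\<integral>x. \<bar>x ^ j / fact j\<bar> \<partial>M)
           \<le> ((\<integral>x. exp (R * x) \<partial>M) + (\<integral>x. exp (- (R * x)) \<partial>M)) / R ^ j"
proof -
  have le: "\<bar>x ^ j / fact j\<bar> \<le> (exp (R * x) + exp (- (R * x))) / R ^ j" for x :: real
  proof -
    have "(R * \<bar>x\<bar>) ^ j / fact j \<le> exp (R * \<bar>x\<bar>)"
      using R by (intro power_fact_le_exp) auto
    also have "\<dots> \<le> exp (R * x) + exp (- (R * x))"
      using exp_abs_le[of "R * x"] R by (simp add: abs_mult)
    finally show ?thesis
      using R by (simp add: abs_mult power_abs field_simps power_mult_distrib)
  qed
  have dom: "integrable M (\<lambda>x. (exp (R * x) + exp (- (R * x))) / R ^ j)"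
    using int by auto
  show *: "integrable M (\<lambda>x. x ^ j / fact j)"
    by (rule Bochner_Integration.integrable_bound[OF dom]) (use le R in \<open>auto simp: abs_of_pos\<close>)
  have "(\<integral>x. \<bar>x ^ j / fact j\<bar> \<partial>M) \<le> (\<integral>x. (exp (R * x) + exp (- (R * x))) / R ^ j \<partial>M)"
    by (intro integral_mono[OF integrable_abs[OF *] dom] le)
  also have "\<dots> = ((\<integral>x. exp (R * x) \<partial>M) + (\<integral>x. exp (- (R * x)) \<partial>M)) / R ^ j"
    using int by simp
  finally show "(\<integral>x. \<bar>x ^ j / fact j\<bar> \<partial>M)
           \<le> ((\<integral>x. exp (R * x) \<partial>M) + (\<integral>x. exp (- (R * x)) \<partial>M)) / R ^ j" .
qed

text \<open>One series with real coefficients serves real \<open>z\<close> (Laplace transform) and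
  imaginary \<open>z\<close> (characteristic function), so convergence of the coefficients carries
  information from the former to the latter. The interchange of sum and integral is dominated by a
  geometric series of ratio \<open>norm z / R\<close>.\<close>

lemma laplace_power_series:
  fixes M :: "real measure" and z :: complex
  assumes s[measurable_cong]: "sets M = sets borel" and R: "R > 0"
    and int: "integrable M (\<lambda>x. exp (R * x))" "integrable M (\<lambda>x. exp (- (R * x)))"
    and z: "norm z < R"
  shows "(\<lambda>j. of_real (\<integral>x. x ^ j / fact j \<partial>M) * z ^ j) sums (\<integral>x. exp (z * of_real x) \<partial>M)"
proof -
  let ?K = "(\<integral>x. exp (R * x) \<partial>M) + (\<integral>x. exp (- (R * x)) \<partial>M)"
  let ?f = "\<lambda>j x. of_real (x ^ j / fact j) * z ^ j :: complex"
  have ser: "(\<lambda>j. ?f j x) sums exp (z * of_real x)" for x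
    using exp_converges[of "z * of_real x"]
    by (simp add: power_mult_distrib field_simps scaleR_conv_of_real)
  have nrm: "norm (?f j x) = \<bar>x ^ j / fact j\<bar> * norm z ^ j" for j x
    by (simp add: norm_mult norm_power norm_divide power_abs)
  have i: "integrable M (\<lambda>x. x ^ j / fact j)" for j
    by (rule moment_le_laplace(1)[OF s R int])
  have intf: "integrable M (?f j)" for j
    by (intro integrable_mult_left integrable_of_real i)
  have "(\<lambda>j. integral\<^sup>L M (?f j)) sums (\<integral>x. (\<Sum>j. ?f j x) \<partial>M)"
  proof (rule sums_integral[OF intf])
    show "AE x in M. summable (\<lambda>j. norm (?f j x))"
    proof (rule AE_I2)
      fix x
      have "summable (\<lambda>j. norm ((z * of_real x) ^ j /\<^sub>R fact j))"
        by (rule summable_norm_exp)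
      then show "summable (\<lambda>j. norm (?f j x))"
        by (simp add: norm_mult norm_power norm_divide power_abs power_mult_distrib field_simps)
    qed
    show "summable (\<lambda>j. \<integral>x. norm (?f j x) \<partial>M)"
    proof (rule summable_comparison_test)
      show "summable (\<lambda>j. ?K * (norm z / R) ^ j)"
        using z R by (intro summable_mult summable_geometric) auto
      show "\<exists>N. \<forall>j\<ge>N. norm (\<integral>x. norm (?f j x) \<partial>M) \<le> ?K * (norm z / R) ^ j"
      proof (intro exI allI impI)
        fix j
        have "(\<integral>x. norm (?f j x) \<partial>M) = (\<integral>x. \<bar>x ^ j / fact j\<bar> \<partial>M) * norm z ^ j"
          unfolding nrm by simp
        also have "\<dots> \<le> ?K / R ^ j * norm z ^ j"
          by (intro mult_right_mono moment_le_laplace(2)[OF s R int]) auto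
        also have "\<dots> = ?K * (norm z / R) ^ j" by (simp add: power_divide)
        finally show "norm (\<integral>x. norm (?f j x) \<partial>M) \<le> ?K * (norm z / R) ^ j" by simp
      qed
    qed
  qed
  moreover have "(\<Sum>j. ?f j x) = exp (z * of_real x)" for x
    using ser by (simp add: sums_iff)
  moreover have "integral\<^sup>L M (?f j) = of_real (\<integral>x. x ^ j / fact j \<partial>M) * z ^ j" for j
  proof -
    have "integral\<^sup>L M (?f j) = (\<integral>x. complex_of_real (x ^ j / fact j) \<partial>M) * z ^ j"
      by (rule integral_mult_left_zero)
    also have "(\<integral>x. complex_of_real (x ^ j / fact j) \<partial>M) = of_real (\<integral>x. x ^ j / fact j \<partial>M)"
      by (rule integral_complex_of_real)
    finally show ?thesis .
  qed
  ultimately show ?thesis by (simp only:)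
qed

text \<open>
  Evaluating at \<open>t = 1/(m+2)\<close> with \<open>m\<close> large isolates the lowest coefficient that is not yet known
  to converge.
\<close>

lemma power_series_coeffs_tendsto_0:
  fixes d :: "nat \<Rightarrow> nat \<Rightarrow> real"
  assumes bound: "\<And>j. \<forall>\<^sub>F k in sequentially. \<forall>i. \<bar>d k i\<bar> \<le> K"
    and sums: "\<And>m. (\<lambda>k. \<Sum>j. d k j * (1 / real (m + 2)) ^ j) \<longlonglongrightarrow> 0"
  shows "(\<lambda>k. d k j) \<longlonglongrightarrow> 0"
proof (induction j rule: less_induct)
  case (less j)
  show ?case
  proof (rule tendstoI)
    fix e :: real assume e: "0 < e"
    have K: "0 \<le> K"
      using bound by (force dest: eventually_happens)
    \<comment> \<open>The terms beyond \<open>j\<close>, divided by \<open>t ^ j\<close>, add up to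
      at most \<open>2 * K * t\<close>, the factor 2 coming from \<open>1 / (1 - t) \<le> 2\<close>.
      This choice of \<open>m\<close> brings that below \<open>e / 2\<close>.\<close>
    obtain m :: nat where m: "2 * K / e * 2 < real m"
      using reals_Archimedean2 by blast
    define t where "t = 1 / real (m + 2)"
    have t: "0 < t" "t \<le> 1/2" by (auto simp: t_def field_simps)
    have Kt: "2 * K * t < e / 2"
      using m e K by (simp add: t_def field_simps)
    let ?S = "\<lambda>k. \<bar>\<Sum>j. d k j * t ^ j\<bar> + (\<Sum>i<j. \<bar>d k i\<bar> * t ^ i)"
    have "(\<lambda>k. ?S k / t ^ j) \<longlonglongrightarrow> (\<bar>0\<bar> + (\<Sum>i<j. \<bar>0\<bar> * t ^ i)) / t ^ j"
      unfolding t_def using t sums less.IH by (intro tendsto_intros) auto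
    then have "(\<lambda>k. ?S k / t ^ j) \<longlonglongrightarrow> 0" by simp
    then have "\<forall>\<^sub>F k in sequentially. ?S k / t ^ j < e / 2"
      using e by (intro order_tendstoD) auto
    then show "\<forall>\<^sub>F k in sequentially. dist (d k j) 0 < e"
      using bound
    proof eventually_elim
      case (elim k)
      have b: "\<bar>d k i\<bar> \<le> K" for i using elim by blast
      have tail0: "summable (\<lambda>i. K * t ^ i)"
        using t by (intro summable_mult summable_geometric) auto
      have absum: "summable (\<lambda>i. \<bar>d k i * t ^ i\<bar>)"
        by (rule summable_comparison_test'[OF tail0, of 0])
           (use t b in \<open>auto simp: abs_mult power_abs intro!: mult_right_mono\<close>)
      then have summ: "summable (\<lambda>i. d k i * t ^ i)" by (rule summable_rabs_cancel)
      have "(\<Sum>i. d k i * t ^ i) = (\<Sum>i. d k (i + Suc j) * t ^ (i + Suc j)) + (\<Sum>i<Suc j. d k i * t ^ i)"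
        by (rule suminf_split_initial_segment[OF summ])
      then have eq: "d k j * t ^ j = (\<Sum>i. d k i * t ^ i) - (\<Sum>i<j. d k i * t ^ i)
          - (\<Sum>i. d k (i + Suc j) * t ^ (i + Suc j))"
        by simp
      have "\<bar>\<Sum>i. d k (i + Suc j) * t ^ (i + Suc j)\<bar> \<le> (\<Sum>i. \<bar>d k (i + Suc j) * t ^ (i + Suc j)\<bar>)"
        by (rule summable_rabs) (rule summable_ignore_initial_segment[OF absum])
      also have "\<dots> \<le> (\<Sum>i. K * t ^ Suc j * t ^ i)"
      proof (rule suminf_le)
        show "\<bar>d k (i + Suc j) * t ^ (i + Suc j)\<bar> \<le> K * t ^ Suc j * t ^ i" for i
          using b[of "i + Suc j"] t by (auto simp: abs_mult power_abs power_add mult_right_mono mult_ac)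
        show "summable (\<lambda>i. \<bar>d k (i + Suc j) * t ^ (i + Suc j)\<bar>)"
          by (rule summable_ignore_initial_segment[OF absum])
        show "summable (\<lambda>i. K * t ^ Suc j * t ^ i)"
          using t by (intro summable_mult summable_geometric) auto
      qed
      also have "\<dots> = K * t ^ Suc j * (1 / (1 - t))"
        using t by (subst suminf_mult) (auto simp: suminf_geometric summable_geometric)
      also have "\<dots> \<le> K * t ^ Suc j * 2"
        using t K by (intro mult_left_mono) (auto simp: field_simps)
      finally have tail: "\<bar>\<Sum>i. d k (i + Suc j) * t ^ (i + Suc j)\<bar> \<le> 2 * K * t * t ^ j"
        by (simp add: mult_ac)
      have head: "\<bar>\<Sum>i<j. d k i * t ^ i\<bar> \<le> (\<Sum>i<j. \<bar>d k i\<bar> * t ^ i)"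
        using t by (intro order_trans[OF sum_abs]) (auto simp: abs_mult power_abs)
      have "\<bar>d k j\<bar> * t ^ j = \<bar>d k j * t ^ j\<bar>" using t by (simp add: abs_mult power_abs)
      also have "\<dots> \<le> ?S k + 2 * K * t * t ^ j"
        unfolding eq using tail head by linarith
      finally have "\<bar>d k j\<bar> \<le> ?S k / t ^ j + 2 * K * t"
        using t by (simp add: field_simps)
      then have "\<bar>d k j\<bar> < e" using elim(1) Kt by linarith
      then show ?case by (simp add: dist_real_def)
    qed
  qed
qed

definition BL_unit :: "(real \<Rightarrow> real) set" where
  "BL_unit = {f. 1-lipschitz_on UNIV f \<and> (\<forall>x. \<bar>f x\<bar> \<le> 1)}"

lemma BL_unitD:
  assumes "f \<in> BL_unit"
  shows "\<bar>f x\<bar> \<le> 1" "\<bar>f x - f y\<bar> \<le> \<bar>x - y\<bar>" "\<bar>f x - f y\<bar> \<le> 2" "continuous_on UNIV f"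
proof -
  show *: "\<bar>f x\<bar> \<le> 1" for x using assms by (auto simp: BL_unit_def)
  show "\<bar>f x - f y\<bar> \<le> 2" using *[of x] *[of y] by linarith
  show "\<bar>f x - f y\<bar> \<le> \<bar>x - y\<bar>"
    using assms lipschitz_onD[of 1 UNIV f x y] by (simp add: BL_unit_def dist_real_def)
  show "continuous_on UNIV f"
    using assms by (auto simp: BL_unit_def intro: lipschitz_on_continuous_on)
qed

lemma BL_unitI:
  assumes "\<And>x. \<bar>f x\<bar> \<le> 1" "\<And>x y. \<bar>f x - f y\<bar> \<le> \<bar>x - y\<bar>"
  shows "f \<in> BL_unit"
  using assms by (auto simp: BL_unit_def dist_real_def intro!: lipschitz_onI)

lemma BL_unit_measurable: "f \<in> BL_unit \<Longrightarrow> f \<in> borel_measurable borel"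
  by (intro borel_measurable_continuous_onI BL_unitD(4))

lemma BL_unit_translate: "f \<in> BL_unit \<Longrightarrow> (\<lambda>x. f (x + c)) \<in> BL_unit"
  by (rule BL_unitI) (auto dest: BL_unitD(1) BL_unitD(2)[of f "_ + c" "_ + c"])

lemma (in prob_space) BL_unit_integrable:
  assumes "f \<in> BL_unit" "X \<in> borel_measurable M"
  shows "integrable M (\<lambda>x. f (X x))"
  using assms BL_unit_measurable[OF assms(1)]
  by (intro integrable_const_bound[where B=1] measurable_compose[OF assms(2)]) (auto dest: BL_unitD(1))

lemma (in prob_space) BL_unit_integral_bound:
  assumes "f \<in> BL_unit" "X \<in> borel_measurable M"
  shows "\<bar>\<integral>x. f (X x) \<partial>M\<bar> \<le> 1"
proof -
  have "\<bar>\<integral>x. f (X x) \<partial>M\<bar> \<le> (\<integral>x. \<bar>f (X x)\<bar> \<partial>M)" by (rule integral_abs_bound)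
  also have "\<dots> \<le> (\<integral>x. 1 \<partial>M)"
    using BL_unit_integrable[OF assms] BL_unitD(1)[OF assms(1)] by (intro integral_mono) auto
  finally show ?thesis by (simp add: prob_space)
qed

text \<open>The test function changes with \<open>n\<close>, so weak convergence cannot be applied
  to it directly. A Skorohod coupling replaces the laws by pointwise convergent variables, and the
  common Lipschitz constant then controls all test functions at once.\<close>

lemma weak_conv_imp_BL_tendsto_0:
  assumes M: "\<And>n. real_distribution (M n)" and N: "real_distribution N"
    and conv: "weak_conv_m M N" and f: "\<And>n. f n \<in> BL_unit"
  shows "(\<lambda>n. (\<integral>x. f n x \<partial>M n) - (\<integral>x. f n x \<partial>N)) \<longlonglongrightarrow> 0"
proof -
  obtain \<Omega> :: "real measure" and Y :: "nat \<Rightarrow> real \<Rightarrow> real" and Z where \<Omega>: "prob_space \<Omega>"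
    and Y[measurable]: "\<And>n. Y n \<in> measurable \<Omega> borel" and dY: "\<And>n. distr \<Omega> borel (Y n) = M n"
    and Z: "Z \<in> measurable \<Omega> lborel" and dZ: "distr \<Omega> borel Z = N"
    and lim: "\<And>x. x \<in> space \<Omega> \<Longrightarrow> (\<lambda>n. Y n x) \<longlonglongrightarrow> Z x"
    using Skorohod[OF M N conv] by blast
  interpret \<Omega>: prob_space \<Omega> by fact
  have Z'[measurable]: "Z \<in> measurable \<Omega> borel" using Z by simp
  note [measurable] = BL_unit_measurable[OF f]
  have "(\<lambda>n. \<integral>x. f n (Y n x) - f n (Z x) \<partial>\<Omega>) \<longlonglongrightarrow> (\<integral>x. 0 \<partial>\<Omega>)"
  proof (rule integral_dominated_convergence[where w="\<lambda>_. 2"])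
    show "AE x in \<Omega>. (\<lambda>n. f n (Y n x) - f n (Z x)) \<longlonglongrightarrow> 0"
    proof (rule AE_I2)
      fix x assume x: "x \<in> space \<Omega>"
      have "(\<lambda>n. \<bar>Y n x - Z x\<bar>) \<longlonglongrightarrow> 0"
        using lim[OF x] by (intro tendsto_rabs_zero) (rule LIM_zero)
      then show "(\<lambda>n. f n (Y n x) - f n (Z x)) \<longlonglongrightarrow> 0"
        by (rule Lim_null_comparison[rotated]) (auto intro!: always_eventually BL_unitD(2)[OF f])
    qed
  qed (use BL_unitD(3)[OF f] in auto)
  moreover have "(\<integral>x. f n (Y n x) - f n (Z x) \<partial>\<Omega>) = (\<integral>x. f n x \<partial>M n) - (\<integral>x. f n x \<partial>N)" for n
    using \<Omega>.BL_unit_integrable[OF f]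
    by (simp add: dY[symmetric] dZ[symmetric] integral_distr)
  ultimately show ?thesis by simp
qed

text \<open>The points \<open>1 / (m + 2)\<close> accumulate at 0 and identify the limits of the
  scaled moments; the integers provide exponential moments of every order, hence geometric bounds on
  these moments with arbitrary ratio. Together they give convergence of the power series at
  imaginary arguments, that is of characteristic functions, and Levy's theorem applies. Countably
  many parameters suffice, which later allows a reduction to finitely many.\<close>

lemma laplace_conv_imp_weak_conv:
  fixes M :: "nat \<Rightarrow> real measure" and N :: "real measure"
  assumes M: "\<And>n. real_distribution (M n)" and N: "real_distribution N"
    and intN: "\<And>t. integrable N (\<lambda>x. exp (t * x))"
    and intM: "\<And>t. t \<in> range (\<lambda>m. 1 / real (m + 2)) \<union> \<int> \<Longrightarrow>
                 \<forall>\<^sub>F n in sequentially. integrable (M n) (\<lambda>x. exp (t * x))"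
    and conv: "\<And>t. t \<in> range (\<lambda>m. 1 / real (m + 2)) \<union> \<int> \<Longrightarrow>
                 (\<lambda>n. \<integral>x. exp (t * x) \<partial>M n) \<longlonglongrightarrow> (\<integral>x. exp (t * x) \<partial>N)"
  shows "weak_conv_m M N"
proof -
  interpret M: real_distribution "M n" for n by fact
  interpret N: real_distribution N by fact
  have sN: "sets N = sets borel" and sM: "sets (M n) = sets borel" for n by auto
  let ?c = "\<lambda>n j. (\<integral>x. x ^ j / fact j \<partial>M n)" and ?d = "\<lambda>j. (\<integral>x. x ^ j / fact j \<partial>N)"
  \<comment> \<open>The transforms at \<open>R\<close> and \<open>- R\<close> converge, so a single
    \<open>K\<close> dominates \<open>R ^ j\<close> times the scaled moment of order
    \<open>j\<close>, for all \<open>j\<close> and all large \<open>n\<close>.\<close>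
  have bd: "\<exists>K. 0 \<le> K \<and> (\<forall>j. \<bar>?d j\<bar> \<le> K / R ^ j) \<and>
      (\<forall>\<^sub>F n in sequentially. integrable (M n) (\<lambda>x. exp (R * x)) \<and> integrable (M n) (\<lambda>x. exp (- (R * x)))
         \<and> (\<forall>j. \<bar>?c n j\<bar> \<le> K / R ^ j))"
    if R: "R \<in> \<int>" "R > 0" for R
  proof -
    let ?L = "\<lambda>M. (\<integral>x. exp (R * x) \<partial>M) + (\<integral>x. exp (- (R * x)) \<partial>M)"
    define K where "K = ?L N + 1"
    have R': "- R \<in> \<int>" using R by auto
    have "(\<lambda>n. ?L (M n)) \<longlonglongrightarrow> ?L N"
      using conv[of R] conv[of "-R"] R R' by (intro tendsto_add) auto
    then have ev: "\<forall>\<^sub>F n in sequentially. ?L (M n) < K"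
      by (intro order_tendstoD) (auto simp: K_def)
    have iN: "integrable N (\<lambda>x. exp (R * x))" "integrable N (\<lambda>x. exp (- (R * x)))"
      using intN[of R] intN[of "-R"] by auto
    have bound: "\<bar>\<integral>x. x ^ j / fact j \<partial>M'\<bar> \<le> K / R ^ j"
      if "sets M' = sets borel" "integrable M' (\<lambda>x. exp (R * x))" "integrable M' (\<lambda>x. exp (- (R * x)))"
        "?L M' \<le> K" for M' j
    proof -
      have "\<bar>\<integral>x. x ^ j / fact j \<partial>M'\<bar> \<le> (\<integral>x. \<bar>x ^ j / fact j\<bar> \<partial>M')"
        by (rule integral_abs_bound)
      also have "\<dots> \<le> ?L M' / R ^ j"
        using moment_le_laplace(2)[OF that(1) R(2) that(2,3)] .
      also have "\<dots> \<le> K / R ^ j"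
        using that R by (intro divide_right_mono) auto
      finally show ?thesis .
    qed
    show ?thesis
    proof (intro exI[of _ K] conjI allI)
      show "0 \<le> K" unfolding K_def by (intro add_nonneg_nonneg integral_nonneg) auto
      show "\<bar>?d j\<bar> \<le> K / R ^ j" for j using bound[OF sN iN] by (simp add: K_def)
      have R'': "\<forall>\<^sub>F n in sequentially. integrable (M n) (\<lambda>x. exp (- (R * x)))"
        using intM[of "-R"] R' by simp
      show "\<forall>\<^sub>F n in sequentially. integrable (M n) (\<lambda>x. exp (R * x)) \<and> integrable (M n) (\<lambda>x. exp (- (R * x)))
         \<and> (\<forall>j. \<bar>?c n j\<bar> \<le> K / R ^ j)"
        using ev intM[of R, OF UnI2[OF R(1)]] R'' by eventually_elim (use bound[OF sM] in auto)
    qed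
  qed
  have coeff: "(\<lambda>n. ?c n j - ?d j) \<longlonglongrightarrow> 0" for j
  proof -
    obtain K where K: "0 \<le> K" "\<And>j. \<bar>?d j\<bar> \<le> K / 1 ^ j"
      "\<forall>\<^sub>F n in sequentially. integrable (M n) (\<lambda>x. exp (1 * x)) \<and> integrable (M n) (\<lambda>x. exp (- (1 * x)))
         \<and> (\<forall>j. \<bar>?c n j\<bar> \<le> K / 1 ^ j)"
      using bd[of 1] by auto
    show ?thesis
    proof (rule power_series_coeffs_tendsto_0[where K="2 * K"])
      show "\<forall>\<^sub>F n in sequentially. \<forall>i. \<bar>?c n i - ?d i\<bar> \<le> 2 * K"
        using K(3)
      proof eventually_elim
        case (elim n)
        show ?case
        proof
          fix i
          have "\<bar>?c n i\<bar> \<le> K" using elim by simp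
          moreover have "\<bar>?d i\<bar> \<le> K" using K(2)[of i] by simp
          ultimately show "\<bar>?c n i - ?d i\<bar> \<le> 2 * K" by linarith
        qed
      qed
      fix m
      define t where "t = 1 / real (m + 2)"
      have t: "0 < t" "t < 1" by (auto simp: t_def)
      have ser: "(\<lambda>j. (\<integral>x. x ^ j / fact j \<partial>M') * t ^ j) sums (\<integral>x. exp (t * x) \<partial>M')"
        if "sets M' = sets borel" "integrable M' (\<lambda>x. exp (1 * x))" "integrable M' (\<lambda>x. exp (- (1 * x)))" for M'
      proof -
        have "(\<lambda>j. complex_of_real ((\<integral>x. x ^ j / fact j \<partial>M') * t ^ j)) sums
            (\<integral>x. exp (of_real t * of_real x) \<partial>M')"
          using laplace_power_series[OF that(1) _ that(2,3), of "of_real t"] t by simp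
        also have "(\<integral>x. exp (complex_of_real t * of_real x) \<partial>M') = of_real (\<integral>x. exp (t * x) \<partial>M')"
          unfolding integral_complex_of_real[symmetric]
          by (rule Bochner_Integration.integral_cong) (simp_all flip: exp_of_real)
        finally show ?thesis unfolding sums_of_real_iff .
      qed
      have serN: "(\<lambda>j. ?d j * t ^ j) sums (\<integral>x. exp (t * x) \<partial>N)"
        using intN[of 1] intN[of "-1"] by (intro ser sN) auto
      have "(\<lambda>n. (\<integral>x. exp (t * x) \<partial>M n) - (\<integral>x. exp (t * x) \<partial>N)) \<longlonglongrightarrow> 0"
        by (intro LIM_zero conv) (auto simp: t_def)
      moreover have "\<forall>\<^sub>F n in sequentially. (\<integral>x. exp (t * x) \<partial>M n) - (\<integral>x. exp (t * x) \<partial>N) = (\<Sum>j. (?c n j - ?d j) * t ^ j)"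
        using K(3)
      proof eventually_elim
        case (elim n)
        have "(\<lambda>j. ?c n j * t ^ j) sums (\<integral>x. exp (t * x) \<partial>M n)"
          using elim by (intro ser sM) auto
        from sums_diff[OF this serN] show ?case
          by (simp add: sums_iff left_diff_distrib)
      qed
      ultimately show "(\<lambda>n. \<Sum>j. (?c n j - ?d j) * (1 / real (m + 2)) ^ j) \<longlonglongrightarrow> 0"
        unfolding t_def[symmetric] by (rule Lim_transform_eventually)
    qed
  qed
  have "(\<lambda>n. char (M n) \<xi>) \<longlonglongrightarrow> char N \<xi>" for \<xi>
  proof -
    \<comment> \<open>An integer radius beyond the argument makes the series at
      \<open>\<i> * \<xi>\<close> converge geometrically with ratio \<open>q < 1\<close>, uniformly
      in large \<open>n\<close>. Cutting it at \<open>J\<close> leaves finitely many coefficients,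
      which converge.\<close>
    obtain r :: nat where r: "\<bar>\<xi>\<bar> < real r" using reals_Archimedean2 by blast
    let ?R = "real r"
    have R0: "0 < ?R" using r by linarith
    obtain K where K: "0 \<le> K" "\<And>j. \<bar>?d j\<bar> \<le> K / ?R ^ j"
      "\<forall>\<^sub>F n in sequentially. integrable (M n) (\<lambda>x. exp (?R * x)) \<and> integrable (M n) (\<lambda>x. exp (- (?R * x)))
         \<and> (\<forall>j. \<bar>?c n j\<bar> \<le> K / ?R ^ j)"
      using bd[of ?R] R0 by auto
    define z where "z = \<i> * complex_of_real \<xi>"
    have z: "norm z < ?R" using r by (simp add: z_def norm_mult)
    have char: "char M' \<xi> = (\<integral>x. exp (z * of_real x) \<partial>M')" for M'
      by (simp add: char_def z_def mult_ac)
    have serN: "(\<lambda>j. of_real (?d j) * z ^ j) sums char N \<xi>"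
      unfolding char using intN[of ?R] intN[of "-?R"] R0 by (intro laplace_power_series[OF sN R0] z) auto
    have "\<forall>\<^sub>F n in sequentially. (\<Sum>j. of_real (?c n j) * z ^ j) = char (M n) \<xi>"
      using K(3)
    proof eventually_elim
      case (elim n)
      then have "(\<lambda>j. of_real (?c n j) * z ^ j) sums char (M n) \<xi>"
        unfolding char by (intro laplace_power_series[OF sM R0] z) auto
      then show ?case by (simp add: sums_iff)
    qed
    moreover have "(\<lambda>n. \<Sum>j. of_real (?c n j) * z ^ j) \<longlonglongrightarrow> (\<Sum>j. of_real (?d j) * z ^ j)"
    proof (rule tendstoI)
      fix e :: real assume e: "0 < e"
      define q where "q = norm z / ?R"
      have q: "0 \<le> q" "q < 1" using z R0 by (auto simp: q_def)
      have "(\<lambda>J. 2 * K * q ^ J / (1 - q)) \<longlonglongrightarrow> 2 * K * 0 / (1 - q)"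
        using q by (intro tendsto_intros LIMSEQ_power_zero) auto
      then have "\<forall>\<^sub>F J in sequentially. 2 * K * q ^ J / (1 - q) < e / 2"
        using e by (intro order_tendstoD) auto
      then obtain J where J: "2 * K * q ^ J / (1 - q) < e / 2"
        using eventually_happens'[OF sequentially_bot] by blast
      have "(\<lambda>n. \<Sum>j<J. \<bar>?c n j - ?d j\<bar> * norm z ^ j) \<longlonglongrightarrow> (\<Sum>j<J. \<bar>0\<bar> * norm z ^ j)"
        by (intro tendsto_intros coeff)
      then have "\<forall>\<^sub>F n in sequentially. (\<Sum>j<J. \<bar>?c n j - ?d j\<bar> * norm z ^ j) < e / 2"
        using e by (intro order_tendstoD) auto
      then show "\<forall>\<^sub>F n in sequentially. dist (\<Sum>j. of_real (?c n j) * z ^ j) (\<Sum>j. of_real (?d j) * z ^ j) < e"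
        using K(3)
      proof eventually_elim
        case (elim n)
        let ?g = "\<lambda>j. of_real (?c n j - ?d j) * z ^ j"
        have serM: "(\<lambda>j. of_real (?c n j) * z ^ j) sums char (M n) \<xi>"
          unfolding char using elim by (intro laplace_power_series[OF sM R0] z) auto
        have g: "?g sums ((\<Sum>j. of_real (?c n j) * z ^ j) - (\<Sum>j. of_real (?d j) * z ^ j))"
          using sums_diff[OF serM serN] serM serN by (simp add: sums_iff left_diff_distrib)
        have gb: "norm (?g j) \<le> 2 * K * q ^ j" for j
        proof -
          have "\<bar>?c n j\<bar> \<le> K / ?R ^ j" using elim by simp
          then have "\<bar>?c n j - ?d j\<bar> \<le> 2 * K / ?R ^ j" using K(2)[of j] by linarith
          then have "\<bar>?c n j - ?d j\<bar> * norm z ^ j \<le> 2 * K / ?R ^ j * norm z ^ j"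
            by (intro mult_right_mono) auto
          moreover have "norm (?g j) = \<bar>?c n j - ?d j\<bar> * norm z ^ j"
            by (simp only: norm_mult norm_of_real norm_power)
          ultimately show ?thesis by (simp add: q_def power_divide)
        qed
        have geo: "summable (\<lambda>j. 2 * K * q ^ j)"
          using q by (intro summable_mult summable_geometric) auto
        have sg: "summable ?g" using g by (simp add: sums_iff)
        have sng: "summable (\<lambda>j. norm (?g j))"
          by (rule summable_comparison_test'[OF geo, of 0]) (use gb in simp)
        have "norm (\<Sum>j. ?g j) \<le> norm (\<Sum>j. ?g (j + J)) + norm (\<Sum>j<J. ?g j)"
          unfolding suminf_split_initial_segment[OF sg, of J] by (rule norm_triangle_ineq)
        also have "norm (\<Sum>j. ?g (j + J)) \<le> (\<Sum>j. norm (?g (j + J)))"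
          by (rule summable_norm) (rule summable_ignore_initial_segment[OF sng])
        also have "\<dots> \<le> (\<Sum>j. 2 * K * q ^ (j + J))"
          by (intro suminf_le gb summable_ignore_initial_segment[OF sng] summable_ignore_initial_segment[OF geo])
        also have "\<dots> = 2 * K * q ^ J / (1 - q)"
        proof -
          have "(\<lambda>j. (2 * K * q ^ J) * q ^ j) sums ((2 * K * q ^ J) * (1 / (1 - q)))"
            using q by (intro sums_mult geometric_sums) auto
          then show ?thesis by (simp add: sums_iff power_add mult_ac)
        qed
        also have "norm (\<Sum>j<J. ?g j) \<le> (\<Sum>j<J. \<bar>?c n j - ?d j\<bar> * norm z ^ j)"
          by (intro order_trans[OF norm_sum] sum_mono) (simp only: norm_mult norm_of_real norm_power order_refl)
        finally have "norm (\<Sum>j. ?g j) < e" using J elim(1) by linarith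
        then show ?case using g by (simp add: sums_iff dist_norm)
      qed
    qed
    ultimately have "(\<lambda>n. char (M n) \<xi>) \<longlonglongrightarrow> (\<Sum>j. of_real (?d j) * z ^ j)"
      by (rule Lim_transform_eventually[rotated])
    then show ?thesis using serN by (simp only: sums_iff)
  qed
  then show ?thesis by (rule levy_continuity[OF M N])
qed

text \<open>
  Only finitely many values of the Laplace transform enter, so that the criterion applies to random
  laws on varying probability spaces, where no almost surely convergent subsequence is available.
\<close>

lemma laplace_close_imp_BL_close:
  fixes N :: "real measure"
  assumes N: "real_distribution N" and intN: "\<And>t. integrable N (\<lambda>x. exp (t * x))" and e: "e > 0"
  obtains T \<delta> where "finite T" "\<delta> > 0"
    "\<And>M f. real_distribution M \<Longrightarrow>
       (\<And>t. t \<in> T \<Longrightarrow> integrable M (\<lambda>x. exp (t * x)) \<and>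
              \<bar>(\<integral>x. exp (t * x) \<partial>M) - (\<integral>x. exp (t * x) \<partial>N)\<bar> \<le> \<delta>) \<Longrightarrow>
       f \<in> BL_unit \<Longrightarrow> \<bar>(\<integral>x. f x \<partial>M) - (\<integral>x. f x \<partial>N)\<bar> \<le> e"
proof -
  define T where "T k = (\<lambda>m. 1 / real (m + 2)) ` {..k} \<union> real_of_int ` {- int k..int k}" for k :: nat
  define close where "close M \<delta> k \<longleftrightarrow> (\<forall>t\<in>T k. integrable M (\<lambda>x. exp (t * x)) \<and>
              \<bar>(\<integral>x. exp (t * x) \<partial>M) - (\<integral>x. exp (t * x) \<partial>N)\<bar> \<le> \<delta>)" for M \<delta> k
  have "\<exists>k. \<forall>M f. real_distribution M \<longrightarrow> close M (1 / real (Suc k)) k \<longrightarrow> f \<in> BL_unit \<longrightarrow>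
      \<bar>(\<integral>x. f x \<partial>M) - (\<integral>x. f x \<partial>N)\<bar> \<le> e"
  \<comment> \<open>A compactness argument: if no finite set of parameters with tolerance
    \<open>1 / Suc k\<close> sufficed, the counterexamples for successive \<open>k\<close> would
    form a sequence of laws whose transforms converge at every parameter of the criterion, yet whose
    integrals stay more than \<open>e\<close> away from those of \<open>N\<close>.\<close>
  proof (rule ccontr)
    assume "\<not> ?thesis"
    then obtain M f where M: "\<And>k. real_distribution (M k)" and c: "\<And>k. close (M k) (1 / real (Suc k)) k"
      and f: "\<And>k. f k \<in> BL_unit" and far: "\<And>k. \<bar>(\<integral>x. f k x \<partial>M k) - (\<integral>x. f k x \<partial>N)\<bar> > e"
      by (metis not_le)
    have T: "\<forall>\<^sub>F k in sequentially. t \<in> T k" if t: "t \<in> range (\<lambda>m. 1 / real (m + 2)) \<union> \<int>" for t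
      using t
    proof
      assume "t \<in> range (\<lambda>m. 1 / real (m + 2))"
      then obtain m where "t = 1 / real (m + 2)" by auto
      then show ?thesis
        unfolding eventually_sequentially T_def by (intro exI[of _ m]) auto
    next
      assume "t \<in> \<int>"
      then obtain i where "t = of_int i" by (auto elim: Ints_cases)
      then show ?thesis
        unfolding eventually_sequentially T_def
        by (intro exI[of _ "nat \<bar>i\<bar>"] allI impI UnI2) (auto intro!: imageI)
    qed
    have "weak_conv_m M N"
    proof (rule laplace_conv_imp_weak_conv[OF M N intN])
      fix t assume t: "t \<in> range (\<lambda>m. 1 / real (m + 2)) \<union> \<int>"
      show "\<forall>\<^sub>F n in sequentially. integrable (M n) (\<lambda>x. exp (t * x))"
        using T[OF t] by eventually_elim (use c in \<open>auto simp: close_def\<close>)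
      have "(\<lambda>n. (\<integral>x. exp (t * x) \<partial>M n) - (\<integral>x. exp (t * x) \<partial>N)) \<longlonglongrightarrow> 0"
      proof (rule Lim_null_comparison)
        show "\<forall>\<^sub>F n in sequentially. norm ((\<integral>x. exp (t * x) \<partial>M n) - (\<integral>x. exp (t * x) \<partial>N)) \<le> 1 / real (Suc n)"
          using T[OF t] by eventually_elim (use c in \<open>auto simp: close_def\<close>)
        show "(\<lambda>n. 1 / real (Suc n)) \<longlonglongrightarrow> 0" using LIMSEQ_inverse_real_of_nat by (simp add: inverse_eq_divide)
      qed
      then show "(\<lambda>n. \<integral>x. exp (t * x) \<partial>M n) \<longlonglongrightarrow> (\<integral>x. exp (t * x) \<partial>N)"
        by (rule LIM_zero_cancel)
    qed
    then have "(\<lambda>n. (\<integral>x. f n x \<partial>M n) - (\<integral>x. f n x \<partial>N)) \<longlonglongrightarrow> 0"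
      by (rule weak_conv_imp_BL_tendsto_0[OF M N _ f])
    from tendstoD[OF this e] obtain n where "\<bar>(\<integral>x. f n x \<partial>M n) - (\<integral>x. f n x \<partial>N)\<bar> < e"
      unfolding eventually_sequentially by (auto simp: dist_real_def)
    then show False using far[of n] by linarith
  qed
  then obtain k where k: "\<And>M f. real_distribution M \<Longrightarrow> close M (1 / real (Suc k)) k \<Longrightarrow> f \<in> BL_unit \<Longrightarrow>
      \<bar>(\<integral>x. f x \<partial>M) - (\<integral>x. f x \<partial>N)\<bar> \<le> e" by blast
  show ?thesis
    by (rule that[of "T k" "1 / real (Suc k)"]) (auto simp: T_def close_def intro!: k)
qed

text \<open>Parametrised by the variance and allowing 0: the contribution of \<open>F\<close> to the
  limit has the variance of \<open>b0\<close> under \<open>F0\<close>, which vanishes for constant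
  \<open>b0\<close>, while \<open>normal_law\<close> requires a positive standard deviation.\<close>

definition gauss :: "real \<Rightarrow> real measure" where
  "gauss v = (if v = 0 then return borel 0 else normal_law 0 (sqrt v))"

lemma sets_normal_law [measurable_cong, simp]: "sets (normal_law m s) = sets borel"
  and space_normal_law [simp]: "space (normal_law m s) = UNIV"
  by (simp_all add: normal_law_def)

lemma prob_space_normal_law: "s > 0 \<Longrightarrow> prob_space (normal_law m s)"
  unfolding normal_law_def by (rule prob_space_normal_density)

lemma exp_mult_normal_density:
  assumes "s > 0"
  shows "exp (t * x) * normal_density 0 s x = exp (s\<^sup>2 * t\<^sup>2 / 2) * normal_density (s\<^sup>2 * t) s x"
proof -
  have "t * x + - (x - 0)\<^sup>2 / (2 * s\<^sup>2) = s\<^sup>2 * t\<^sup>2 / 2 + - (x - s\<^sup>2 * t)\<^sup>2 / (2 * s\<^sup>2)"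
    using assms by (simp add: field_simps power2_eq_square)
  then have "exp (t * x) * exp (- (x - 0)\<^sup>2 / (2 * s\<^sup>2)) = exp (s\<^sup>2 * t\<^sup>2 / 2) * exp (- (x - s\<^sup>2 * t)\<^sup>2 / (2 * s\<^sup>2))"
    unfolding exp_add[symmetric] by simp
  then show ?thesis by (simp add: normal_density_def field_simps)
qed

lemma real_distribution_gauss: "v \<ge> 0 \<Longrightarrow> real_distribution (gauss v)"
  using prob_space_normal_law[of "sqrt v" 0] prob_space_return[of 0 "borel::real measure"]
  by (auto simp: real_distribution_def real_distribution_axioms_def gauss_def)

lemma gauss_laplace:
  assumes "v \<ge> 0"
  shows "integrable (gauss v) (\<lambda>x. exp (t * x))" "(\<integral>x. exp (t * x) \<partial>gauss v) = exp (v * t\<^sup>2 / 2)"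
proof -
  have "integrable (gauss v) (\<lambda>x. exp (t * x)) \<and> (\<integral>x. exp (t * x) \<partial>gauss v) = exp (v * t\<^sup>2 / 2)"
  proof (cases "v = 0")
    case True
    interpret prob_space "return borel (0::real)" by (rule prob_space_return) simp
    have "integrable (return borel 0) (\<lambda>x::real. exp (t * x))"
      by (rule integrable_cong_AE_imp[of _ "\<lambda>_. 1"]) (auto simp: AE_return)
    then show ?thesis using True by (simp add: gauss_def integral_return)
  next
    case False
    then have s: "sqrt v > 0" using assms by auto
    have *: "exp (t * x) * normal_density 0 (sqrt v) x = exp (v * t\<^sup>2 / 2) * normal_density (v * t) (sqrt v) x" for x
      using exp_mult_normal_density[OF s, of t x] assms by (simp only: real_sqrt_pow2)
    then have eq: "normal_density 0 (sqrt v) x * exp (t * x) = exp (v * t\<^sup>2 / 2) * normal_density (v * t) (sqrt v) x" for x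
      using *[of x] by (simp only: mult.commute)
    show ?thesis using False s
      by (simp add: gauss_def normal_law_def integrable_density integral_density eq)
  qed
  then show "integrable (gauss v) (\<lambda>x. exp (t * x))" "(\<integral>x. exp (t * x) \<partial>gauss v) = exp (v * t\<^sup>2 / 2)"
    by auto
qed

lemma gauss_BL_criterion:
  assumes "v \<ge> 0" "e > 0"
  obtains T \<delta> where "finite T" "\<delta> > 0"
    "\<And>M f. real_distribution M \<Longrightarrow>
       (\<And>t. t \<in> T \<Longrightarrow> integrable M (\<lambda>x. exp (t * x)) \<and>
              \<bar>(\<integral>x. exp (t * x) \<partial>M) - exp (v * t\<^sup>2 / 2)\<bar> \<le> \<delta>) \<Longrightarrow>
       f \<in> BL_unit \<Longrightarrow> \<bar>(\<integral>x. f x \<partial>M) - (\<integral>x. f x \<partial>gauss v)\<bar> \<le> e"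
  by (rule laplace_close_imp_BL_close[OF real_distribution_gauss[OF assms(1)] gauss_laplace(1)[OF assms(1)] assms(2)])
     (rule that, auto simp: gauss_laplace(2)[OF assms(1)])

text \<open>The law of the sum and \<open>gauss (v + w)\<close> have equal Laplace transforms, so
  the criterion applies with every tolerance and the two integrals agree.\<close>

lemma gauss_convolution:
  assumes v: "v \<ge> 0" and w: "w \<ge> 0" and f: "f \<in> BL_unit"
  shows "(\<integral>x. (\<integral>y. f (x + y) \<partial>gauss w) \<partial>gauss v) = (\<integral>x. f x \<partial>gauss (v + w))"
proof -
  interpret V: real_distribution "gauss v" by (rule real_distribution_gauss[OF v])
  interpret W: real_distribution "gauss w" by (rule real_distribution_gauss[OF w])
  interpret VW: pair_prob_space "gauss v" "gauss w" ..
  note [measurable] = BL_unit_measurable[OF f]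
  let ?M = "distr (gauss v \<Otimes>\<^sub>M gauss w) borel (\<lambda>(x, y). x + y)"
  have M: "real_distribution ?M"
    by (auto simp: real_distribution_def real_distribution_axioms_def intro!: VW.prob_space_distr)
  have int: "integrable ?M (\<lambda>x. exp (t * x))"
    and lap: "(\<integral>x. exp (t * x) \<partial>?M) = exp ((v + w) * t\<^sup>2 / 2)" for t
  proof -
    have prod: "exp (t * (x + y)) = exp (t * x) * exp (t * y)" for x y by (simp add: exp_add distrib_left)
    have i: "integrable (gauss v \<Otimes>\<^sub>M gauss w) (\<lambda>p. exp (t * fst p) * exp (t * snd p))"
      using gauss_laplace(1)[OF v, of t] gauss_laplace(1)[OF w, of t]
      by (auto intro!: VW.Fubini_integrable simp: abs_mult)
    then show "integrable ?M (\<lambda>x. exp (t * x))"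
      by (subst integrable_distr_eq) (auto simp: prod case_prod_beta)
    have "(\<integral>x. exp (t * x) \<partial>?M) = (\<integral>p. exp (t * fst p) * exp (t * snd p) \<partial>(gauss v \<Otimes>\<^sub>M gauss w))"
      by (subst integral_distr) (auto simp: prod case_prod_beta)
    also have "\<dots> = (\<integral>x. (\<integral>y. exp (t * x) * exp (t * y) \<partial>gauss w) \<partial>gauss v)"
      using VW.integral_fst'[OF i] by simp
    also have "\<dots> = exp ((v + w) * t\<^sup>2 / 2)"
      using v w by (simp add: gauss_laplace add_divide_distrib distrib_right exp_add)
    finally show "(\<integral>x. exp (t * x) \<partial>?M) = exp ((v + w) * t\<^sup>2 / 2)" .
  qed
  have "\<bar>(\<integral>x. f x \<partial>?M) - (\<integral>x. f x \<partial>gauss (v + w))\<bar> \<le> e" if "e > 0" for e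
  proof -
    obtain T \<delta> where T: "\<delta> > 0" "\<And>M f. real_distribution M \<Longrightarrow>
       (\<And>t. t \<in> T \<Longrightarrow> integrable M (\<lambda>x. exp (t * x)) \<and>
              \<bar>(\<integral>x. exp (t * x) \<partial>M) - exp ((v + w) * t\<^sup>2 / 2)\<bar> \<le> \<delta>) \<Longrightarrow>
       f \<in> BL_unit \<Longrightarrow> \<bar>(\<integral>x. f x \<partial>M) - (\<integral>x. f x \<partial>gauss (v + w))\<bar> \<le> e"
      by (rule gauss_BL_criterion[OF add_nonneg_nonneg[OF v w] \<open>e > 0\<close>]) blast
    show ?thesis using T(1) by (intro T(2) M f) (auto simp: int lap)
  qed
  then have "\<bar>(\<integral>x. f x \<partial>?M) - (\<integral>x. f x \<partial>gauss (v + w))\<bar> \<le> 0"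
    by (rule field_le_epsilon) simp
  moreover have "(\<integral>x. f x \<partial>?M) = (\<integral>x. (\<integral>y. f (x + y) \<partial>gauss w) \<partial>gauss v)"
  proof -
    have i: "integrable (gauss v \<Otimes>\<^sub>M gauss w) (\<lambda>(x, y). f (x + y))"
      using VW.BL_unit_integrable[OF f, of "\<lambda>(x, y). x + y"] by (simp add: case_prod_beta')
    show ?thesis
      using VW.integral_fst'[OF i] by (subst integral_distr) (auto simp: case_prod_beta')
  qed
  ultimately show ?thesis by simp
qed

section \<open>The Dirichlet process\<close>

lemma abs_exp_diff_le:
  fixes y z \<kappa> :: real
  assumes "\<bar>y - z\<bar> \<le> \<kappa>" "\<kappa> \<le> 1"
  shows "\<bar>exp y - exp z\<bar> \<le> 2 * \<kappa> * exp z"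
proof -
  have "\<bar>exp (y - z) - 1\<bar> \<le> 2 * \<bar>y - z\<bar>"
    using assms exp_bound_lemma[of "y - z"] exp_ge_add_one_self[of "y - z"]
      exp_bound[of "y - z"] power2_eq_square[of "y - z"]
    by (smt (verit, best) mult_left_le mult_nonneg_nonneg one_le_exp_iff)
  then have "\<bar>exp (y - z) - 1\<bar> * exp z \<le> 2 * \<kappa> * exp z"
    using assms by (intro mult_right_mono) auto
  moreover have "exp y - exp z = (exp (y - z) - 1) * exp z"
    by (simp add: left_diff_distrib exp_diff)
  ultimately show ?thesis by (simp add: abs_mult)
qed

lemma gauss_BL_criterion_exp:
  assumes v: "v \<ge> 0" and e: "e > 0"
  obtains T \<kappa> where "finite T" "\<kappa> > 0"
    "\<And>M f. real_distribution M \<Longrightarrow>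
       (\<And>t. t \<in> T \<Longrightarrow> integrable M (\<lambda>x. exp (t * x)) \<and>
          exp (v * t\<^sup>2 / 2 - \<kappa>) - \<kappa> \<le> (\<integral>x. exp (t * x) \<partial>M) \<and>
          (\<integral>x. exp (t * x) \<partial>M) \<le> exp (v * t\<^sup>2 / 2 + \<kappa>) + \<kappa>) \<Longrightarrow>
       f \<in> BL_unit \<Longrightarrow> \<bar>(\<integral>x. f x \<partial>M) - (\<integral>x. f x \<partial>gauss v)\<bar> \<le> e"
proof -
  obtain T \<delta> where T: "finite T" "\<delta> > 0"
    "\<And>M f. real_distribution M \<Longrightarrow>
       (\<And>t. t \<in> T \<Longrightarrow> integrable M (\<lambda>x. exp (t * x)) \<and>
              \<bar>(\<integral>x. exp (t * x) \<partial>M) - exp (v * t\<^sup>2 / 2)\<bar> \<le> \<delta>) \<Longrightarrow>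
       f \<in> BL_unit \<Longrightarrow> \<bar>(\<integral>x. f x \<partial>M) - (\<integral>x. f x \<partial>gauss v)\<bar> \<le> e"
    by (rule gauss_BL_criterion[OF v e]) blast
  define B where "B = Max (insert 1 ((\<lambda>t. exp (v * t\<^sup>2 / 2)) ` T))"
  have B: "1 \<le> B" "\<And>t. t \<in> T \<Longrightarrow> exp (v * t\<^sup>2 / 2) \<le> B"
    using T(1) by (auto simp: B_def intro!: Max_ge)
  \<comment> \<open>A perturbation of the exponent by \<open>\<kappa> \<le> 1\<close> moves the
    exponential by at most \<open>2 * \<kappa> * B\<close>. With the additive
    \<open>\<kappa>\<close> and \<open>1 \<le> B\<close> the total is at most
    \<open>3 * \<kappa> * B\<close>.\<close>
  define \<kappa> where "\<kappa> = min 1 (\<delta> / (3 * B))"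
  have \<kappa>: "0 < \<kappa>" "\<kappa> \<le> 1" using T B by (auto simp: \<kappa>_def)
  have "\<kappa> * (3 * B) \<le> \<delta>" using B by (auto simp: \<kappa>_def min_def field_simps)
  then have \<kappa>B: "2 * \<kappa> * B + \<kappa> \<le> \<delta>"
    using mult_left_mono[OF B(1), of \<kappa>] \<kappa> by linarith
  show ?thesis
  proof (rule that[OF T(1) \<kappa>(1)], rule T(3))
    fix M f t
    assume *: "\<And>t. t \<in> T \<Longrightarrow> integrable M (\<lambda>x. exp (t * x)) \<and>
          exp (v * t\<^sup>2 / 2 - \<kappa>) - \<kappa> \<le> (\<integral>x. exp (t * x) \<partial>M) \<and>
          (\<integral>x. exp (t * x) \<partial>M) \<le> exp (v * t\<^sup>2 / 2 + \<kappa>) + \<kappa>" and t: "t \<in> T"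
    have "2 * \<kappa> * exp (v * t\<^sup>2 / 2) \<le> 2 * \<kappa> * B"
      using B(2)[OF t] \<kappa> by (intro mult_left_mono) auto
    then have "\<bar>exp y - exp (v * t\<^sup>2 / 2)\<bar> \<le> 2 * \<kappa> * B" if "\<bar>y - v * t\<^sup>2 / 2\<bar> \<le> \<kappa>" for y
      using abs_exp_diff_le[OF that \<kappa>(2)] by linarith
    from this[of "v * t\<^sup>2 / 2 + \<kappa>"] this[of "v * t\<^sup>2 / 2 - \<kappa>"]
    have "\<bar>exp (v * t\<^sup>2 / 2 + \<kappa>) - exp (v * t\<^sup>2 / 2)\<bar> \<le> 2 * \<kappa> * B"
      "\<bar>exp (v * t\<^sup>2 / 2 - \<kappa>) - exp (v * t\<^sup>2 / 2)\<bar> \<le> 2 * \<kappa> * B"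
      using \<kappa> by auto
    then show "integrable M (\<lambda>x. exp (t * x)) \<and> \<bar>(\<integral>x. exp (t * x) \<partial>M) - exp (v * t\<^sup>2 / 2)\<bar> \<le> \<delta>"
      using *[OF t] \<kappa>B by auto
  qed
qed

section \<open>Gamma variables and their normalisation\<close>

lemma sets_gamma_law [measurable_cong, simp]: "sets (gamma_law s) = sets borel"
  by (simp add: gamma_law_def)

text \<open>Substituting \<open>(1 - c) * x\<close> in Euler's integral yields the transform
  \<open>(1 - c) powr (- s)\<close>. It is written as an exponential so that products over
  coordinates become sums, and so that the degenerate case \<open>s = 0\<close> fits the same
  formula.\<close>

lemma nn_integral_gamma_law_exp:
  assumes s: "s \<ge> 0" and c: "c < 1"
  shows "(\<integral>\<^sup>+x. ennreal (exp (c * x)) \<partial>gamma_law s) = ennreal (exp (- s * ln (1 - c)))"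
proof (cases "s = 0")
  case True
  then show ?thesis by (simp add: gamma_law_def nn_integral_return)
next
  case False
  with s have s: "s > 0" by simp
  let ?h = "\<lambda>x::real. indicator {0..} x * x powr (s - 1) / exp x"
  let ?k = "\<lambda>x. indicator {0<..} x * x powr (s - 1) * exp (- x) / Gamma s * exp (c * x)"
  have G: "Gamma s > 0" using s by (rule Gamma_real_pos)
  have "ennreal (Gamma s) = (\<integral>\<^sup>+x. ennreal (?h x) \<partial>lborel)"
    using Gamma_conv_nn_integral_real[OF s] .
  also have "\<dots> = \<bar>1 - c\<bar> * (\<integral>\<^sup>+x. ennreal (?h (0 + (1 - c) * x)) \<partial>lborel)"
    using c by (intro nn_integral_real_affine) auto
  also have "(\<integral>\<^sup>+x. ennreal (?h (0 + (1 - c) * x)) \<partial>lborel)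
      = (\<integral>\<^sup>+x. ennreal (Gamma s * (1 - c) powr (s - 1)) * ennreal (?k x) \<partial>lborel)"
  proof (rule nn_integral_cong)
    fix x :: real
    show "ennreal (?h (0 + (1 - c) * x)) = ennreal (Gamma s * (1 - c) powr (s - 1)) * ennreal (?k x)"
    proof (cases "x > 0")
      case True
      have e: "exp (- x) * exp (c * x) = 1 / exp ((1 - c) * x)"
        by (simp add: exp_diff left_diff_distrib exp_minus field_simps)
      have "?h (0 + (1 - c) * x) = (1 - c) powr (s - 1) * x powr (s - 1) * (1 / exp ((1 - c) * x))"
        using True c by (simp add: powr_mult)
      also have "\<dots> = (Gamma s * (1 - c) powr (s - 1)) * ?k x"
        unfolding e[symmetric] using True G by simp
      finally show ?thesis using G by (subst ennreal_mult'[symmetric]) simp_all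
    next
      case False
      then show ?thesis using c by (cases "x = 0") (auto simp: indicator_def zero_le_mult_iff)
    qed
  qed
  also have "\<dots> = ennreal (Gamma s * (1 - c) powr (s - 1)) * (\<integral>\<^sup>+x. ennreal (?k x) \<partial>lborel)"
    by (intro nn_integral_cmult) auto
  also have "ennreal \<bar>1 - c\<bar> * (\<dots>) = ennreal (Gamma s * (1 - c) powr s) * (\<integral>\<^sup>+x. ennreal (?k x) \<partial>lborel)"
  proof -
    have *: "\<bar>1 - c\<bar> * (Gamma s * (1 - c) powr (s - 1)) = Gamma s * (1 - c) powr s"
      using c by (simp add: powr_diff)
    then have "ennreal \<bar>1 - c\<bar> * ennreal (Gamma s * (1 - c) powr (s - 1)) = ennreal (Gamma s * (1 - c) powr s)"
      by (subst ennreal_mult'[symmetric]) (simp_all only: * abs_ge_zero)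
    then show ?thesis by (simp only: mult.assoc[symmetric])
  qed
  finally have eq: "ennreal (Gamma s) = ennreal (Gamma s * (1 - c) powr s) * (\<integral>\<^sup>+x. ennreal (?k x) \<partial>lborel)" .
  have "(\<integral>\<^sup>+x. ennreal (exp (c * x)) \<partial>gamma_law s) = (\<integral>\<^sup>+x. ennreal (?k x) \<partial>lborel)"
    using s G by (simp add: gamma_law_def nn_integral_density ennreal_mult'[symmetric])
  also have "\<dots> = ennreal (Gamma s) / ennreal (Gamma s * (1 - c) powr s)"
    using eq G c by (subst eq) (simp add: ennreal_divide_times mult_divide_eq_ennreal mult.commute[of "ennreal _"])
  also have "\<dots> = ennreal (exp (- s * ln (1 - c)))"
    using G c by (subst divide_ennreal) (auto simp: powr_def exp_minus field_simps)
  finally show ?thesis .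
qed

lemma prob_space_gamma_law: "s \<ge> 0 \<Longrightarrow> prob_space (gamma_law s)"
  using nn_integral_gamma_law_exp[of s 0] by (intro prob_spaceI) simp

lemma ln_one_minus_bound:
  fixes c :: real
  assumes c: "\<bar>c\<bar> \<le> 1/2"
  shows "\<bar>- ln (1 - c) - c - c\<^sup>2 / 2\<bar> \<le> 2 * \<bar>c\<bar> ^ 3"
proof -
  let ?f = "\<lambda>c::real. - ln (1 - c) - c - c\<^sup>2 / 2"
  have "norm (?f c - ?f 0) \<le> 2 * c\<^sup>2 * norm (c - 0)"
  proof (rule field_differentiable_bound[where S="{-\<bar>c\<bar>..\<bar>c\<bar>}" and f'="\<lambda>c. 1 / (1 - c) - 1 - c"])
    fix z assume "z \<in> {-\<bar>c\<bar>..\<bar>c\<bar>}"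
    then have z: "\<bar>z\<bar> \<le> \<bar>c\<bar>" "z \<le> 1/2" using c by auto
    show "(?f has_field_derivative (1 / (1 - z) - 1 - z)) (at z within {-\<bar>c\<bar>..\<bar>c\<bar>})"
      using z by (auto intro!: derivative_eq_intros simp: field_simps)
    have "1 / (1 - z) - 1 - z = z\<^sup>2 * (1 / (1 - z))" using z by (simp add: field_simps power2_eq_square)
    moreover have "z\<^sup>2 * (1 / (1 - z)) \<le> z\<^sup>2 * 2" using z by (intro mult_left_mono) (auto simp: field_simps)
    moreover have "0 \<le> z\<^sup>2 * (1 / (1 - z))" using z by auto
    moreover have "z\<^sup>2 \<le> c\<^sup>2" using z by (rule_tac abs_le_square_iff[THEN iffD1])
    ultimately show "norm (1 / (1 - z) - 1 - z) \<le> 2 * c\<^sup>2"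
      by (simp only: real_norm_def abs_le_iff) linarith
  qed auto
  also have "2 * c\<^sup>2 * norm (c - 0) = 2 * \<bar>c\<bar> ^ 3"
    by (simp add: power3_eq_cube power2_eq_square abs_mult_self_eq)
  finally show ?thesis by simp
qed

lemma nn_integral_PiM_gamma_exp:
  assumes I: "finite I" and s: "\<And>i. i \<in> I \<Longrightarrow> s i \<ge> 0" and c: "\<And>i. i \<in> I \<Longrightarrow> c i < 1"
  shows "(\<integral>\<^sup>+g. ennreal (exp (\<Sum>i\<in>I. c i * g i)) \<partial>Pi\<^sub>M I (\<lambda>i. gamma_law (s i)))
           = ennreal (exp (\<Sum>i\<in>I. - s i * ln (1 - c i)))"
proof -
  \<comment> \<open>The product locale quantifies over all indices, whereas nonnegativity is known
    on \<open>I\<close> only; outside \<open>I\<close> the parameter is reset to 0.\<close>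
  define s' where "s' i = (if i \<in> I then s i else 0)" for i
  have "\<And>i. prob_space (gamma_law (s' i))"
    using s by (auto simp: s'_def intro!: prob_space_gamma_law)
  then interpret P: product_sigma_finite "\<lambda>i. gamma_law (s' i)"
    by (auto simp: product_sigma_finite_def prob_space_imp_sigma_finite)
  have eq: "Pi\<^sub>M I (\<lambda>i. gamma_law (s i)) = Pi\<^sub>M I (\<lambda>i. gamma_law (s' i))"
    by (rule PiM_cong) (auto simp: s'_def)
  have "(\<integral>\<^sup>+g. ennreal (exp (\<Sum>i\<in>I. c i * g i)) \<partial>Pi\<^sub>M I (\<lambda>i. gamma_law (s i)))
      = (\<integral>\<^sup>+g. (\<Prod>i\<in>I. ennreal (exp (c i * g i))) \<partial>Pi\<^sub>M I (\<lambda>i. gamma_law (s' i)))"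
    unfolding eq using I by (simp add: exp_sum prod_ennreal)
  also have "\<dots> = (\<Prod>i\<in>I. \<integral>\<^sup>+x. ennreal (exp (c i * x)) \<partial>gamma_law (s' i))"
    by (rule P.product_nn_integral_prod[OF I]) auto
  also have "\<dots> = (\<Prod>i\<in>I. ennreal (exp (- s i * ln (1 - c i))))"
    using s c by (intro prod.cong refl) (simp add: nn_integral_gamma_law_exp s'_def)
  also have "\<dots> = ennreal (exp (\<Sum>i\<in>I. - s i * ln (1 - c i)))"
    using I by (simp add: exp_sum prod_ennreal)
  finally show ?thesis .
qed

lemma prob_space_PiM_gamma:
  assumes "\<And>i. i \<in> I \<Longrightarrow> s i \<ge> 0"
  shows "prob_space (Pi\<^sub>M I (\<lambda>i. gamma_law (s i)))"
  by (rule prob_space_PiM) (auto intro!: prob_space_gamma_law assms)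

abbreviation gamma_prod :: "'i set \<Rightarrow> ('i \<Rightarrow> real) \<Rightarrow> ('i \<Rightarrow> real) measure" where
  "gamma_prod I s \<equiv> Pi\<^sub>M I (\<lambda>i. gamma_law (s i))"

context
  fixes I :: "'i set" and s :: "'i \<Rightarrow> real" and N :: real
  assumes I: "finite I" and s: "\<And>i. i \<in> I \<Longrightarrow> s i \<ge> 0" and N: "N = (\<Sum>i\<in>I. s i)" "N \<ge> 16"
begin

text \<open>Each logarithm \<open>- ln (1 - c i)\<close> is expanded to second order. The linear
  terms cancel against the centring, the quadratic ones give the variance, and the cubic remainders
  add up to at most \<open>N * (2 * (\<bar>t\<bar> / sqrt N) ^ 3)\<close>, which is of order
  \<open>1 / sqrt N\<close>.\<close>

lemma gamma_sum_laplace: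
  assumes x: "\<And>i. i \<in> I \<Longrightarrow> \<bar>x i\<bar> \<le> 1" and t: "\<bar>t\<bar> / sqrt N \<le> 1/2"
  shows "integrable (gamma_prod I s) (\<lambda>g. exp (t * ((\<Sum>i\<in>I. x i * g i) - (\<Sum>i\<in>I. x i * s i)) / sqrt N))"
    and "\<exists>r. \<bar>r - t\<^sup>2 * ((\<Sum>i\<in>I. s i * (x i)\<^sup>2) / N) / 2\<bar> \<le> 2 * \<bar>t\<bar> ^ 3 / sqrt N \<and>
           (\<integral>g. exp (t * ((\<Sum>i\<in>I. x i * g i) - (\<Sum>i\<in>I. x i * s i)) / sqrt N) \<partial>gamma_prod I s) = exp r"
proof -
  define c where "c i = t * x i / sqrt N" for i
  have N0: "N > 0" using N by simp
  have c: "\<bar>c i\<bar> \<le> \<bar>t\<bar> / sqrt N" "\<bar>c i\<bar> \<le> 1/2" if "i \<in> I" for i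
  proof -
    have "\<bar>t\<bar> * \<bar>x i\<bar> \<le> \<bar>t\<bar> * 1" using x[OF that] by (intro mult_left_mono) auto
    then show "\<bar>c i\<bar> \<le> \<bar>t\<bar> / sqrt N" using N0 by (simp add: c_def abs_mult divide_right_mono)
    then show "\<bar>c i\<bar> \<le> 1/2" using t by linarith
  qed
  have c1: "c i < 1" if "i \<in> I" for i using c(2)[OF that] by linarith
  let ?b = "\<Sum>i\<in>I. c i * s i"
  define r where "r = (\<Sum>i\<in>I. - s i * ln (1 - c i)) - ?b"
  have eq: "exp (t * ((\<Sum>i\<in>I. x i * g i) - (\<Sum>i\<in>I. x i * s i)) / sqrt N) = exp (- ?b) * exp (\<Sum>i\<in>I. c i * g i)" for g
    unfolding exp_add[symmetric] by (simp add: c_def sum_distrib_left sum_divide_distrib right_diff_distrib diff_divide_distrib mult_ac)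
  have "(\<integral>\<^sup>+g. ennreal (exp (- ?b) * exp (\<Sum>i\<in>I. c i * g i)) \<partial>gamma_prod I s) = ennreal (exp (- ?b)) * (\<integral>\<^sup>+g. ennreal (exp (\<Sum>i\<in>I. c i * g i)) \<partial>gamma_prod I s)"
    by (subst nn_integral_cmult[symmetric]) (auto simp: ennreal_mult')
  also have "\<dots> = ennreal (exp r)"
    using nn_integral_PiM_gamma_exp[OF I s c1] by (simp add: r_def ennreal_mult'[symmetric] exp_add[symmetric])
  finally have nn: "(\<integral>\<^sup>+g. ennreal (exp (- ?b) * exp (\<Sum>i\<in>I. c i * g i)) \<partial>gamma_prod I s) = ennreal (exp r)" .
  then have *: "integrable (gamma_prod I s) (\<lambda>g. exp (- ?b) * exp (\<Sum>i\<in>I. c i * g i)) \<and> (\<integral>g. exp (- ?b) * exp (\<Sum>i\<in>I. c i * g i) \<partial>gamma_prod I s) = exp r"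
    by (subst (asm) nn_integral_eq_integrable) auto
  then show "integrable (gamma_prod I s) (\<lambda>g. exp (t * ((\<Sum>i\<in>I. x i * g i) - (\<Sum>i\<in>I. x i * s i)) / sqrt N))"
    unfolding eq by simp
  have "r - t\<^sup>2 * ((\<Sum>i\<in>I. s i * (x i)\<^sup>2) / N) / 2 = (\<Sum>i\<in>I. s i * (- ln (1 - c i) - c i - (c i)\<^sup>2 / 2))"
    using N0 by (simp add: r_def c_def sum_subtractf sum_distrib_left sum_divide_distrib right_diff_distrib
        power_divide power_mult_distrib sum_negf mult_ac)
  also have "\<bar>\<dots>\<bar> \<le> (\<Sum>i\<in>I. s i * (2 * (\<bar>t\<bar> / sqrt N) ^ 3))"
  proof (rule order_trans[OF sum_abs], rule sum_mono)
    fix i assume i: "i \<in> I"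
    have "\<bar>- ln (1 - c i) - c i - (c i)\<^sup>2 / 2\<bar> \<le> 2 * \<bar>c i\<bar> ^ 3" by (rule ln_one_minus_bound[OF c(2)[OF i]])
    also have "\<dots> \<le> 2 * (\<bar>t\<bar> / sqrt N) ^ 3" by (intro mult_left_mono power_mono c(1)[OF i]) auto
    finally show "\<bar>s i * (- ln (1 - c i) - c i - (c i)\<^sup>2 / 2)\<bar> \<le> s i * (2 * (\<bar>t\<bar> / sqrt N) ^ 3)"
      using s[OF i] by (simp add: abs_mult mult_left_mono)
  qed
  also have "\<dots> = N * (2 * (\<bar>t\<bar> / sqrt N) ^ 3)" by (simp add: N(1) sum_distrib_right)
  also have "\<dots> = 2 * \<bar>t\<bar> ^ 3 * (N / sqrt N ^ 3)" by (simp add: power_divide)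
  also have "N / sqrt N ^ 3 = 1 / sqrt N"
    using N0 by (simp add: power3_eq_cube field_simps)
  finally have "\<bar>r - t\<^sup>2 * ((\<Sum>i\<in>I. s i * (x i)\<^sup>2) / N) / 2\<bar> \<le> 2 * \<bar>t\<bar> ^ 3 / sqrt N" by simp
  then show "\<exists>r. \<bar>r - t\<^sup>2 * ((\<Sum>i\<in>I. s i * (x i)\<^sup>2) / N) / 2\<bar> \<le> 2 * \<bar>t\<bar> ^ 3 / sqrt N \<and>
           (\<integral>g. exp (t * ((\<Sum>i\<in>I. x i * g i) - (\<Sum>i\<in>I. x i * s i)) / sqrt N) \<partial>gamma_prod I s) = exp r"
    unfolding eq using * by blast
qed

text \<open>Since an absolute value is at most the sum of the exponentials of the variable and of
  its negative, the transforms at 1 and -1 bound the first absolute moment. For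
  \<open>N \<ge> 16\<close> the variance term and the remainder in their exponents are each at most
  1/2, so that both transforms are at most \<open>exp 1\<close>.\<close>

lemma gamma_sum_abs:
  assumes x: "\<And>i. i \<in> I \<Longrightarrow> \<bar>x i\<bar> \<le> 1"
  shows "integrable (gamma_prod I s) (\<lambda>g. ((\<Sum>i\<in>I. x i * g i) - (\<Sum>i\<in>I. x i * s i)) / sqrt N)"
    and "(\<integral>g. \<bar>((\<Sum>i\<in>I. x i * g i) - (\<Sum>i\<in>I. x i * s i)) / sqrt N\<bar> \<partial>gamma_prod I s) \<le> 2 * exp 1"
proof -
  let ?U = "\<lambda>g. ((\<Sum>i\<in>I. x i * g i) - (\<Sum>i\<in>I. x i * s i)) / sqrt N"
  have N4: "4 \<le> sqrt N" using N real_le_rsqrt[of 4 N] by simp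
  have v: "(\<Sum>i\<in>I. s i * (x i)\<^sup>2) / N \<le> 1"
  proof -
    have "(\<Sum>i\<in>I. s i * (x i)\<^sup>2) \<le> (\<Sum>i\<in>I. s i * 1)"
      using x s by (intro sum_mono mult_left_mono) (auto simp: abs_square_le_1)
    then show ?thesis using N by simp
  qed
  have *: "integrable (gamma_prod I s) (\<lambda>g. exp (t * ?U g)) \<and> (\<integral>g. exp (t * ?U g) \<partial>gamma_prod I s) \<le> exp 1" if t: "t = 1 \<or> t = -1" for t
  proof -
    have "1 / sqrt N \<le> 1/2" using N4 N(2) by (subst divide_le_eq) auto
    then have t': "\<bar>t\<bar> / sqrt N \<le> 1/2" using t by auto
    obtain r where r: "\<bar>r - t\<^sup>2 * ((\<Sum>i\<in>I. s i * (x i)\<^sup>2) / N) / 2\<bar> \<le> 2 * \<bar>t\<bar> ^ 3 / sqrt N"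
      "(\<integral>g. exp (t * ((\<Sum>i\<in>I. x i * g i) - (\<Sum>i\<in>I. x i * s i)) / sqrt N) \<partial>gamma_prod I s) = exp r"
      using gamma_sum_laplace(2)[of x t, OF x t'] by blast
    have "2 / sqrt N \<le> 1/2" using N4 N(2) by (subst divide_le_eq) auto
    then have "2 * \<bar>t\<bar> ^ 3 / sqrt N \<le> 1/2" using t by auto
    moreover have "t\<^sup>2 = 1" using t by auto
    ultimately have "r \<le> 1" using r(1) v by (simp add: abs_le_iff)
    then show ?thesis using gamma_sum_laplace(1)[OF x t'] r(2) by simp
  qed
  from *[of 1] *[of "-1"] have **: "integrable (gamma_prod I s) (\<lambda>g. exp (?U g))" "(\<integral>g. exp (?U g) \<partial>gamma_prod I s) \<le> exp 1"
    "integrable (gamma_prod I s) (\<lambda>g. exp (- ?U g))" "(\<integral>g. exp (- ?U g) \<partial>gamma_prod I s) \<le> exp 1"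
    by (simp_all only: mult_1_left mult_minus1 simp_thms)
  have ii: "integrable (gamma_prod I s) (\<lambda>g. exp (?U g) + exp (- ?U g))"
    using **(1,3) by (rule Bochner_Integration.integrable_add)
  show i: "integrable (gamma_prod I s) ?U"
  proof (rule Bochner_Integration.integrable_bound[OF ii])
    show "AE g in gamma_prod I s. norm (?U g) \<le> norm (exp (?U g) + exp (- ?U g))"
      unfolding real_norm_def by (intro AE_I2 order_trans[OF abs_le_exp_add_exp abs_ge_self])
  qed measurable
  have "(\<integral>g. \<bar>?U g\<bar> \<partial>gamma_prod I s) \<le> (\<integral>g. exp (?U g) + exp (- ?U g) \<partial>gamma_prod I s)"
    by (intro integral_mono[OF integrable_abs[OF i] ii] abs_le_exp_add_exp)
  also have "\<dots> = (\<integral>g. exp (?U g) \<partial>gamma_prod I s) + (\<integral>g. exp (- ?U g) \<partial>gamma_prod I s)"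
    using **(1,3) by (rule Bochner_Integration.integral_add)
  also have "\<dots> \<le> 2 * exp 1" using **(2,4) by linarith
  finally show "(\<integral>g. \<bar>?U g\<bar> \<partial>gamma_prod I s) \<le> 2 * exp 1" .
qed

text \<open>The normalised and centred Dirichlet sum is \<open>?U\<close> times
  \<open>N / ?S\<close>, where the Gamma total \<open>?S\<close> has mean \<open>N\<close> and
  fluctuations of order \<open>sqrt N\<close>. If \<open>?S\<close> is close to \<open>N\<close> the
  Lipschitz property of \<open>f\<close> absorbs the factor; otherwise the difference is at most 2
  and Markov's inequality takes over.\<close>

lemma dirichlet_law_slutsky:
  assumes x: "\<And>i. i \<in> I \<Longrightarrow> 0 \<le> x i \<and> x i \<le> 1" and f: "f \<in> BL_unit"
  defines "m \<equiv> (\<Sum>i\<in>I. x i * s i) / N"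
  shows "\<bar>(\<integral>y. f (sqrt N * ((\<Sum>i\<in>I. x i * y i) - m)) \<partial>dirichlet_law I s)
            - (\<integral>g. f ((\<Sum>i\<in>I. (x i - m) * g i) / sqrt N) \<partial>gamma_prod I s)\<bar> \<le> 8 * exp 1 / sqrt (sqrt N)"
proof -
  interpret G: prob_space "gamma_prod I s" by (rule prob_space_PiM_gamma[OF s])
  note [measurable] = BL_unit_measurable[OF f]
  have N0: "N > 0" using N by simp
  have m: "0 \<le> m" "m \<le> 1"
  proof -
    have "(\<Sum>i\<in>I. x i * s i) \<le> (\<Sum>i\<in>I. 1 * s i)" using x s by (intro sum_mono mult_right_mono) auto
    then show "m \<le> 1" using N by (simp add: m_def)
    show "0 \<le> m" unfolding m_def using x s N by (intro divide_nonneg_nonneg sum_nonneg) auto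
  qed
  have N4: "4 \<le> sqrt N" using N real_le_rsqrt[of 4 N] by simp
  have x1: "\<bar>x i - m\<bar> \<le> 1" if "i \<in> I" for i using x[OF that] m by auto
  have cent: "(\<Sum>i\<in>I. (x i - m) * s i) = 0"
  proof -
    have "(\<Sum>i\<in>I. (x i - m) * s i) = (\<Sum>i\<in>I. x i * s i) - m * N"
      unfolding N(1) sum_distrib_left by (simp add: left_diff_distrib sum_subtractf)
    then show ?thesis using N0 by (simp add: m_def)
  qed
  let ?S = "\<lambda>g. \<Sum>i\<in>I. g i"
  let ?U = "\<lambda>g. (\<Sum>i\<in>I. (x i - m) * g i) / sqrt N"
  let ?W = "\<lambda>g. (?S g - N) / sqrt N"
  let ?D = "\<lambda>g. sqrt N * ((\<Sum>i\<in>I. x i * (g i / ?S g)) - m)"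
  have U: "integrable (gamma_prod I s) ?U" "(\<integral>g. \<bar>?U g\<bar> \<partial>gamma_prod I s) \<le> 2 * exp 1"
    using gamma_sum_abs[of "\<lambda>i. x i - m"] x1 cent by auto
  have W: "integrable (gamma_prod I s) ?W" "(\<integral>g. \<bar>?W g\<bar> \<partial>gamma_prod I s) \<le> 2 * exp 1"
    using gamma_sum_abs[of "\<lambda>i. 1"] N(1) by auto
  \<comment> \<open>The power -1/4 of \<open>N\<close> balances the two cases: a relative deviation
    of \<open>?S\<close> below \<open>\<eta>\<close> costs a multiple of \<open>\<eta>\<close>, and
    a larger one costs a multiple of \<open>1 / (\<eta> * sqrt N)\<close>, which equals
    \<open>\<eta>\<close>.\<close>
  define \<eta> where "\<eta> = 1 / sqrt (sqrt N)"
  have q: "2 \<le> sqrt (sqrt N)" using N(2) N4 by (intro real_le_rsqrt) auto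
  have \<eta>: "0 < \<eta>" "\<eta> \<le> 1/2" by (use q N(2) in \<open>auto simp: \<eta>_def divide_le_eq\<close>)
  have \<eta>N: "1 / (\<eta> * sqrt N) = \<eta>"
  proof -
    have "sqrt (sqrt N) * sqrt (sqrt N) = sqrt N" using N0 by simp
    then show ?thesis using q N0 by (simp add: \<eta>_def field_simps)
  qed
  have pt: "\<bar>f (?D g) - f (?U g)\<bar> \<le> 2 * \<eta> * \<bar>?U g\<bar> + 2 * (\<eta> * \<bar>?W g\<bar>)" for g
  proof (cases "\<bar>?S g - N\<bar> \<le> \<eta> * N")
    case True
    have "\<eta> * N \<le> 1/2 * N" using \<eta> N0 by (intro mult_right_mono) auto
    with True have S: "?S g \<ge> N / 2" "?S g > 0" using N0 by linarith+
    have "?D g = sqrt N * ((\<Sum>i\<in>I. x i * g i) / ?S g - m)"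
      by (simp add: sum_divide_distrib)
    also have "\<dots> = sqrt N * ((\<Sum>i\<in>I. (x i - m) * g i) / ?S g)"
      using S by (simp add: left_diff_distrib sum_subtractf sum_distrib_left[symmetric] diff_divide_distrib)
    also have "\<dots> = ?U g * (N / ?S g)"
      using S N0 by (simp add: field_simps)
    finally have D: "?D g = ?U g * (N / ?S g)" .
    have "N / ?S g - 1 = (N - ?S g) / ?S g" using S by (simp add: diff_divide_distrib)
    then have "\<bar>N / ?S g - 1\<bar> = \<bar>?S g - N\<bar> / ?S g"
      using S by (simp only: abs_divide abs_of_pos abs_minus_commute)
    also have "\<dots> \<le> (\<eta> * N) / (N / 2)" using True S N0 \<eta> by (intro frac_le) auto
    also have "\<dots> = 2 * \<eta>" using N0 by simp
    finally have r: "\<bar>N / ?S g - 1\<bar> \<le> 2 * \<eta>" .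
    have "\<bar>f (?D g) - f (?U g)\<bar> \<le> \<bar>?D g - ?U g\<bar>" by (rule BL_unitD(2)[OF f])
    also have "?D g - ?U g = ?U g * (N / ?S g - 1)" unfolding D by (simp add: right_diff_distrib)
    also have "\<bar>\<dots>\<bar> \<le> \<bar>?U g\<bar> * (2 * \<eta>)" unfolding abs_mult by (intro mult_left_mono r) auto
    finally have "\<bar>f (?D g) - f (?U g)\<bar> \<le> 2 * \<eta> * \<bar>?U g\<bar>" by (simp add: mult_ac)
    moreover have "0 \<le> 2 * (\<eta> * \<bar>?W g\<bar>)" using \<eta> by simp
    ultimately show ?thesis by linarith
  next
    case False
    have "1 \<le> \<bar>?S g - N\<bar> / (\<eta> * N)" using False \<eta> N0 by (subst le_divide_eq) auto
    also have "\<dots> = \<bar>?W g\<bar> * (1 / (\<eta> * sqrt N))"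
      using N0 \<eta> by (simp add: abs_divide field_simps)
    also have "\<dots> = \<eta> * \<bar>?W g\<bar>" unfolding \<eta>N by simp
    finally have "2 \<le> 2 * (\<eta> * \<bar>?W g\<bar>)" by simp
    moreover have "0 \<le> 2 * \<eta> * \<bar>?U g\<bar>" using \<eta> by simp
    ultimately show ?thesis using BL_unitD(3)[OF f, of "?D g" "?U g"] by linarith
  qed
  have mD: "?D \<in> borel_measurable (gamma_prod I s)" by measurable
  have iD: "integrable (gamma_prod I s) (\<lambda>g. f (?D g))" by (rule G.BL_unit_integrable[OF f mD])
  have iU: "integrable (gamma_prod I s) (\<lambda>g. f (?U g))" by (rule G.BL_unit_integrable[OF f]) measurable
  have "(\<integral>y. f (sqrt N * ((\<Sum>i\<in>I. x i * y i) - m)) \<partial>dirichlet_law I s) = (\<integral>g. f (?D g) \<partial>gamma_prod I s)"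
    unfolding dirichlet_law_def
    by (subst integral_distr) (auto intro!: Bochner_Integration.integral_cong sum.cong arg_cong[where f=f])
  then have "\<bar>(\<integral>y. f (sqrt N * ((\<Sum>i\<in>I. x i * y i) - m)) \<partial>dirichlet_law I s) - (\<integral>g. f (?U g) \<partial>gamma_prod I s)\<bar>
      = \<bar>\<integral>g. f (?D g) - f (?U g) \<partial>gamma_prod I s\<bar>"
    using iD iU by simp
  also have "\<dots> \<le> (\<integral>g. \<bar>f (?D g) - f (?U g)\<bar> \<partial>gamma_prod I s)" by (rule integral_abs_bound)
  also have "\<dots> \<le> (\<integral>g. 2 * \<eta> * \<bar>?U g\<bar> + 2 * (\<eta> * \<bar>?W g\<bar>) \<partial>gamma_prod I s)"
    using U(1) W(1) iD iU pt
    by (intro integral_mono Bochner_Integration.integrable_add integrable_mult_right integrable_abs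
        Bochner_Integration.integrable_diff) auto
  also have "\<dots> = 2 * \<eta> * (\<integral>g. \<bar>?U g\<bar> \<partial>gamma_prod I s) + 2 * (\<eta> * (\<integral>g. \<bar>?W g\<bar> \<partial>gamma_prod I s))"
    using integrable_abs[OF U(1)] integrable_abs[OF W(1)]
    by (subst Bochner_Integration.integral_add) (auto simp del: abs_divide)
  also have "\<dots> \<le> 2 * \<eta> * (2 * exp 1) + 2 * (\<eta> * (2 * exp 1))"
    using U(2) W(2) \<eta> by (intro add_mono mult_left_mono) auto
  also have "\<dots> = 8 * exp 1 / sqrt (sqrt N)" by (simp add: \<eta>_def)
  finally show ?thesis .
qed

end

text \<open>The thresholds depend on \<open>V\<close> and \<open>e\<close> alone. Uniformity over
  the index set matters because it will be a discretisation refined as \<open>N\<close> grows, and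
  uniformity over \<open>x\<close> because the values come from a function \<open>b\<close> drawn
  from the posterior.\<close>

lemma dirichlet_law_clt:
  assumes V: "V \<ge> 0" and e: "e > 0"
  obtains N0 \<delta> where "\<delta> > 0"
    "\<And>(I :: 'i set) s x f N m. finite I \<Longrightarrow> (\<And>i. i \<in> I \<Longrightarrow> s i \<ge> 0) \<Longrightarrow> N = (\<Sum>i\<in>I. s i) \<Longrightarrow> N0 \<le> N \<Longrightarrow>
       (\<And>i. i \<in> I \<Longrightarrow> 0 \<le> x i \<and> x i \<le> 1) \<Longrightarrow> m = (\<Sum>i\<in>I. x i * s i) / N \<Longrightarrow>
       \<bar>(\<Sum>i\<in>I. (x i)\<^sup>2 * s i) / N - m\<^sup>2 - V\<bar> \<le> \<delta> \<Longrightarrow> f \<in> BL_unit \<Longrightarrow>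
       \<bar>(\<integral>y. f (sqrt N * ((\<Sum>i\<in>I. x i * y i) - m)) \<partial>dirichlet_law I s) - (\<integral>x. f x \<partial>gauss V)\<bar> \<le> e"
proof -
  obtain T \<kappa> where T: "finite T" "\<kappa> > 0"
    and crit: "\<And>M f. real_distribution M \<Longrightarrow>
       (\<And>t. t \<in> T \<Longrightarrow> integrable M (\<lambda>x. exp (t * x)) \<and>
          exp (V * t\<^sup>2 / 2 - \<kappa>) - \<kappa> \<le> (\<integral>x. exp (t * x) \<partial>M) \<and>
          (\<integral>x. exp (t * x) \<partial>M) \<le> exp (V * t\<^sup>2 / 2 + \<kappa>) + \<kappa>) \<Longrightarrow>
       f \<in> BL_unit \<Longrightarrow> \<bar>(\<integral>x. f x \<partial>M) - (\<integral>x. f x \<partial>gauss V)\<bar> \<le> e / 2"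
    by (rule gauss_BL_criterion_exp[OF V half_gt_zero[OF e]]) blast
  define K where "K = Max (insert 1 (abs ` T))"
  have K: "1 \<le> K" "\<And>t. t \<in> T \<Longrightarrow> \<bar>t\<bar> \<le> K" using T(1) by (auto simp: K_def intro!: Max_ge)
  \<comment> \<open>With \<open>\<bar>t\<bar> \<le> K\<close>, an error \<open>\<delta>\<close> in
    the variance moves the exponent by at most \<open>\<kappa> / 2\<close>. The entries of
    \<open>B\<close>, a lower bound for \<open>sqrt N\<close>, ensure in turn
    \<open>N \<ge> 16\<close>, arguments at most 1/2, a cubic remainder of at most
    \<open>\<kappa> / 2\<close>, and a normalisation error of at most \<open>e / 2\<close>.\<close>
  define \<delta> where "\<delta> = \<kappa> / K\<^sup>2"
  define B where "B = max 4 (max (2 * K) (max (4 * K ^ 3 / \<kappa>) ((16 * exp 1 / e)\<^sup>2)))"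
  have B: "4 \<le> B" "2 * K \<le> B" "4 * K ^ 3 / \<kappa> \<le> B" "(16 * exp 1 / e)\<^sup>2 \<le> B" by (auto simp: B_def)
  have \<delta>: "\<delta> > 0" using T K by (auto simp: \<delta>_def)
  show ?thesis
  proof (rule that[OF \<delta>, of "B\<^sup>2"])
    fix I :: "'i set" and s x f N m
    assume I: "finite I" and s: "\<And>i. i \<in> I \<Longrightarrow> s i \<ge> (0::real)" and N: "N = (\<Sum>i\<in>I. s i)" "B\<^sup>2 \<le> N"
      and x: "\<And>i. i \<in> I \<Longrightarrow> 0 \<le> x i \<and> x i \<le> (1::real)" and m: "m = (\<Sum>i\<in>I. x i * s i) / N"
      and v: "\<bar>(\<Sum>i\<in>I. (x i)\<^sup>2 * s i) / N - m\<^sup>2 - V\<bar> \<le> \<delta>" and f: "f \<in> BL_unit"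
    have "4\<^sup>2 \<le> B\<^sup>2" using B by (intro power_mono) auto
    then have N16: "16 \<le> N" using N(2) by simp
    then have N0: "N > 0" by simp
    have rN: "B \<le> sqrt N" using N(2) by (intro real_le_rsqrt)
    interpret G: prob_space "Pi\<^sub>M I (\<lambda>i. gamma_law (s i))" by (rule prob_space_PiM_gamma[OF s])
    let ?G = "Pi\<^sub>M I (\<lambda>i. gamma_law (s i))"
    let ?U = "\<lambda>g. (\<Sum>i\<in>I. (x i - m) * g i) / sqrt N"
    have mm: "0 \<le> m" "m \<le> 1"
    proof -
      have "(\<Sum>i\<in>I. x i * s i) \<le> (\<Sum>i\<in>I. 1 * s i)" using x s by (intro sum_mono mult_right_mono) auto
      then show "m \<le> 1" using N N0 by (simp add: m)
      show "0 \<le> m" unfolding m using x s N0 by (intro divide_nonneg_nonneg sum_nonneg) auto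
    qed
    have x1: "\<bar>x i - m\<bar> \<le> 1" if "i \<in> I" for i using x[OF that] mm by auto
    have xs: "(\<Sum>i\<in>I. x i * s i) = m * N" using N0 by (simp add: m)
    have cent: "(\<Sum>i\<in>I. (x i - m) * s i) = 0"
      using xs N(1) by (simp add: left_diff_distrib sum_subtractf sum_distrib_left[symmetric])
    have "(\<Sum>i\<in>I. s i * (x i - m)\<^sup>2) = (\<Sum>i\<in>I. (x i)\<^sup>2 * s i - 2 * m * (x i * s i) + m\<^sup>2 * s i)"
      by (intro sum.cong refl) (simp add: power2_eq_square algebra_simps)
    also have "\<dots> = (\<Sum>i\<in>I. (x i)\<^sup>2 * s i) - 2 * m * (m * N) + m\<^sup>2 * N"
      unfolding sum.distrib sum_subtractf sum_distrib_left[symmetric] xs N(1)[symmetric] by (rule refl)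
    finally have var: "(\<Sum>i\<in>I. s i * (x i - m)\<^sup>2) / N = (\<Sum>i\<in>I. (x i)\<^sup>2 * s i) / N - m\<^sup>2"
      using N0 by (simp add: power2_eq_square add_divide_distrib diff_divide_distrib)
    let ?M = "distr ?G borel ?U"
    have M: "real_distribution ?M"
      by (auto simp: real_distribution_def real_distribution_axioms_def intro!: G.prob_space_distr)
    have lap: "integrable ?M (\<lambda>x. exp (t * x)) \<and>
          exp (V * t\<^sup>2 / 2 - \<kappa>) - \<kappa> \<le> (\<integral>x. exp (t * x) \<partial>?M) \<and>
          (\<integral>x. exp (t * x) \<partial>?M) \<le> exp (V * t\<^sup>2 / 2 + \<kappa>) + \<kappa>" if t: "t \<in> T" for t
    proof -
      have tK: "\<bar>t\<bar> \<le> K" by (rule K(2)[OF t])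
      have sN: "0 < sqrt N" "2 * K \<le> sqrt N" "4 * K ^ 3 / \<kappa> \<le> sqrt N" using rN B N0 by auto
      have t': "\<bar>t\<bar> / sqrt N \<le> 1/2" using tK sN by (simp add: field_simps)
      obtain r where r: "\<bar>r - t\<^sup>2 * ((\<Sum>i\<in>I. s i * (x i - m)\<^sup>2) / N) / 2\<bar> \<le> 2 * \<bar>t\<bar> ^ 3 / sqrt N"
        "(\<integral>g. exp (t * ?U g) \<partial>?G) = exp r"
        and int: "integrable ?G (\<lambda>g. exp (t * ?U g))"
        using gamma_sum_laplace[OF I s N(1) N16, of "\<lambda>i. x i - m" t] x1 t' cent by auto
      have "2 * \<bar>t\<bar> ^ 3 / sqrt N \<le> 2 * K ^ 3 / sqrt N"
        using tK sN by (intro divide_right_mono mult_left_mono power_mono) auto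
      also have "\<dots> \<le> \<kappa> / 2" using sN T by (simp add: field_simps)
      finally have r1: "\<bar>r - t\<^sup>2 * ((\<Sum>i\<in>I. (x i)\<^sup>2 * s i) / N - m\<^sup>2) / 2\<bar> \<le> \<kappa> / 2"
        using r(1) unfolding var by linarith
      have "\<bar>t\<^sup>2 * ((\<Sum>i\<in>I. (x i)\<^sup>2 * s i) / N - m\<^sup>2) / 2 - V * t\<^sup>2 / 2\<bar>
          = t\<^sup>2 * \<bar>(\<Sum>i\<in>I. (x i)\<^sup>2 * s i) / N - m\<^sup>2 - V\<bar> / 2"
        (is "\<bar>t\<^sup>2 * ?A / 2 - _\<bar> = _")
      proof -
        have "t\<^sup>2 * ?A / 2 - V * t\<^sup>2 / 2 = t\<^sup>2 * ((?A - V) / 2)"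
          by (simp only: right_diff_distrib diff_divide_distrib mult.commute times_divide_eq_right)
        then show ?thesis by (simp only: abs_mult abs_divide abs_power2)
      qed
      also have "\<dots> \<le> K\<^sup>2 * \<delta> / 2"
        using v tK by (intro divide_right_mono mult_mono) (auto simp: abs_le_square_iff[symmetric])
      also have "\<dots> = \<kappa> / 2" using K by (simp add: \<delta>_def)
      finally have "\<bar>r - V * t\<^sup>2 / 2\<bar> \<le> \<kappa>" using r1 by linarith
      then have "exp (V * t\<^sup>2 / 2 - \<kappa>) \<le> exp r" "exp r \<le> exp (V * t\<^sup>2 / 2 + \<kappa>)" by auto
      moreover have "(\<integral>x. exp (t * x) \<partial>?M) = exp r"
        unfolding r(2)[symmetric] by (subst integral_distr) auto
      moreover have "integrable ?M (\<lambda>x. exp (t * x))"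
        using int by (subst integrable_distr_eq) auto
      ultimately show ?thesis using T(2) by (intro conjI) linarith+
    qed
    note [measurable] = BL_unit_measurable[OF f]
    have "\<bar>(\<integral>x. f x \<partial>?M) - (\<integral>x. f x \<partial>gauss V)\<bar> \<le> e / 2" by (rule crit[OF M lap f])
    moreover have "(\<integral>x. f x \<partial>?M) = (\<integral>g. f (?U g) \<partial>?G)" by (subst integral_distr) auto
    moreover have "\<bar>(\<integral>y. f (sqrt N * ((\<Sum>i\<in>I. x i * y i) - m)) \<partial>dirichlet_law I s)
            - (\<integral>g. f (?U g) \<partial>?G)\<bar> \<le> 8 * exp 1 / sqrt (sqrt N)"
      unfolding m by (rule dirichlet_law_slutsky[OF I s N(1) N16 x f])
    moreover have "8 * exp 1 / sqrt (sqrt N) \<le> e / 2"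
    proof -
      have "(16 * exp 1 / e)\<^sup>2 \<le> sqrt N" using B(4) rN by linarith
      then have "16 * exp 1 / e \<le> sqrt (sqrt N)" by (rule real_le_rsqrt)
      then show ?thesis using e N0 by (simp add: field_simps)
    qed
    ultimately show "\<bar>(\<integral>y. f (sqrt N * ((\<Sum>i\<in>I. x i * y i) - m)) \<partial>dirichlet_law I s) - (\<integral>x. f x \<partial>gauss V)\<bar> \<le> e"
      by linarith
  qed
qed

section \<open>From finite partitions to integrals of functions\<close>

lemma AE_space_dirichlet_process:
  assumes D: "dirichlet_process \<alpha> D" and F: "F \<in> space D"
  shows "prob_space F" "sets F = sets borel" "space F = UNIV"
proof -
  have "F \<in> space (prob_algebra borel)"
    using F D sets_eq_imp_space_eq[of D "prob_algebra borel"] by (simp add: dirichlet_process_def)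
  then show "prob_space F" and s: "sets F = sets borel" by (auto simp: space_prob_algebra)
  show "space F = UNIV" using sets_eq_imp_space_eq[OF s] by simp
qed

lemma measurable_chi_prob_algebra:
  fixes g :: "'z::topological_space \<Rightarrow> real"
  assumes g[measurable]: "g \<in> borel_measurable borel" and b: "\<And>z. 0 \<le> g z \<and> g z \<le> 1"
  shows "(\<lambda>F. \<integral>z. g z \<partial>F) \<in> borel_measurable (prob_algebra borel)"
proof -
  have "(\<lambda>F. enn2real (\<integral>\<^sup>+z. ennreal (g z) \<partial>F)) \<in> borel_measurable (prob_algebra borel)"
    unfolding prob_algebra_def
    by (intro borel_measurable_enn2real measurable_restrict_space1 nn_integral_measurable_subprob_algebra) simp
  also have "?this \<longleftrightarrow> ?thesis"
    by (intro measurable_cong) (auto simp: space_prob_algebra integral_eq_nn_integral b intro!: AE_I2)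
  finally show ?thesis .
qed

text \<open>A Dirichlet process is specified through finite partitions, so \<open>g\<close> is
  rounded down to a step function on its level sets. With mesh at most \<open>1 / N\<close> the
  rounding changes both the integral and its centring by at most \<open>1 / N\<close>, which remains
  negligible after multiplication by \<open>sqrt N\<close>.\<close>

lemma dirichlet_process_clt:
  assumes V: "V \<ge> 0" and e: "e > 0"
  obtains N0 \<delta> where "\<delta> > 0"
    "\<And>(\<alpha> :: 'z::topological_space measure) D g f N m. finite_measure \<alpha> \<Longrightarrow> sets \<alpha> = sets borel \<Longrightarrow> dirichlet_process \<alpha> D \<Longrightarrow>
       N = measure \<alpha> UNIV \<Longrightarrow> N0 \<le> N \<Longrightarrow>
       g \<in> borel_measurable borel \<Longrightarrow> (\<And>z. 0 \<le> g z \<and> g z \<le> 1) \<Longrightarrow> m = (\<integral>z. g z \<partial>\<alpha>) / N \<Longrightarrow>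
       \<bar>(\<integral>z. (g z)\<^sup>2 \<partial>\<alpha>) / N - m\<^sup>2 - V\<bar> \<le> \<delta> \<Longrightarrow> f \<in> BL_unit \<Longrightarrow>
       \<bar>(\<integral>F. f (sqrt N * ((\<integral>z. g z \<partial>F) - m)) \<partial>D) - (\<integral>x. f x \<partial>gauss V)\<bar> \<le> e"
proof -
  obtain N1 \<delta> where \<delta>: "\<delta> > 0" and clt: "\<And>(I :: nat set) s x f N m. finite I \<Longrightarrow> (\<And>i. i \<in> I \<Longrightarrow> s i \<ge> 0) \<Longrightarrow> N = (\<Sum>i\<in>I. s i) \<Longrightarrow> N1 \<le> N \<Longrightarrow>
       (\<And>i. i \<in> I \<Longrightarrow> 0 \<le> x i \<and> x i \<le> 1) \<Longrightarrow> m = (\<Sum>i\<in>I. x i * s i) / N \<Longrightarrow>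
       \<bar>(\<Sum>i\<in>I. (x i)\<^sup>2 * s i) / N - m\<^sup>2 - V\<bar> \<le> \<delta> \<Longrightarrow> f \<in> BL_unit \<Longrightarrow>
       \<bar>(\<integral>y. f (sqrt N * ((\<Sum>i\<in>I. x i * y i) - m)) \<partial>dirichlet_law I s) - (\<integral>x. f x \<partial>gauss V)\<bar> \<le> e / 2"
    by (rule dirichlet_law_clt[OF V half_gt_zero[OF e]]) blast
  \<comment> \<open>Rounding changes the variance by at most \<open>4 / N\<close>, which
    \<open>8 / \<delta>\<close> brings below \<open>\<delta> / 2\<close>, and the argument of
    \<open>f\<close> by at most \<open>2 / sqrt N\<close>, which \<open>(4 / e)\<^sup>2\<close>
    brings below \<open>e / 2\<close>.\<close>
  define N0 where "N0 = max 1 (max N1 (max (8 / \<delta>) ((4 / e)\<^sup>2)))"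
  have N0: "1 \<le> N0" "N1 \<le> N0" "8 / \<delta> \<le> N0" "(4 / e)\<^sup>2 \<le> N0" by (auto simp: N0_def)
  show ?thesis
  proof (rule that[of "\<delta> / 2" N0])
    show "\<delta> / 2 > 0" using \<delta> by simp
    fix \<alpha> :: "'z measure" and D g f N m
    assume \<alpha>: "finite_measure \<alpha>" and sa[measurable_cong]: "sets \<alpha> = sets borel" and D: "dirichlet_process \<alpha> D"
      and N: "N = measure \<alpha> UNIV" "N0 \<le> N" and g[measurable]: "g \<in> borel_measurable borel"
      and g01: "\<And>z. 0 \<le> g z \<and> g z \<le> 1" and m: "m = (\<integral>z. g z \<partial>\<alpha>) / N"
      and v: "\<bar>(\<integral>z. (g z)\<^sup>2 \<partial>\<alpha>) / N - m\<^sup>2 - V\<bar> \<le> \<delta> / 2" and f: "f \<in> BL_unit"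
    interpret \<alpha>: finite_measure \<alpha> by fact
    have N1: "1 \<le> N" "N1 \<le> N" "8 / \<delta> \<le> N" "(4 / e)\<^sup>2 \<le> N" using N N0 by auto
    have spa: "space \<alpha> = UNIV" using sets_eq_imp_space_eq[OF sa] by simp
    \<comment> \<open>The levels run from 0 to \<open>M\<close> with both ends attained,
      \<open>M\<close> itself where \<open>g\<close> equals 1; hence the partition has
      \<open>Suc M\<close> cells.\<close>
    define M where "M = nat \<lceil>N\<rceil>"
    have M: "N \<le> real M" "0 < real M" using N1 by (auto simp: M_def)
    define h where "h z = nat \<lfloor>real M * g z\<rfloor>" for z
    have h: "real (h z) \<le> real M * g z" "real M * g z \<le> real (h z) + 1" "h z < Suc M" for z
    proof -
      have "0 \<le> real M * g z" "real M * g z \<le> real M * 1" using g01 M by (auto intro!: mult_left_mono)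
      then show "real (h z) \<le> real M * g z" "real M * g z \<le> real (h z) + 1" "h z < Suc M"
        by (auto simp: h_def, linarith+)
    qed
    have hm[measurable]: "h \<in> measurable borel (count_space UNIV)" unfolding h_def by measurable
    define A where "A i = {z. h z = i}" for i
    have A[measurable]: "A i \<in> sets borel" for i
      unfolding A_def using measurable_sets[OF hm, of "{i}"] by (simp add: vimage_def)
    have Apart: "disjoint_family_on A {..<Suc M}" "(\<Union>i<Suc M. A i) = UNIV"
      using h(3) by (auto simp: A_def disjoint_family_on_def)
    define x where "x i = real i / real M" for i
    have simple: "(\<integral>z. p (h z) \<partial>F) = (\<Sum>i<Suc M. p i * measure F (A i))"
      if "finite_measure F" and sF[measurable_cong]: "sets F = sets borel" for F :: "'z measure" and p :: "nat \<Rightarrow> real"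
    proof -
      interpret F: finite_measure F by fact
      have spF: "space F = UNIV" using sets_eq_imp_space_eq[OF sF] by simp
      have "p (h z) = (\<Sum>i<Suc M. p i * indicator (A i) z)" for z
        using h(3)[of z] by (auto simp: A_def indicator_def if_distrib[of "\<lambda>x. _ * x"] sum.delta cong: if_cong)
      then have "(\<integral>z. p (h z) \<partial>F) = (\<integral>z. (\<Sum>i<Suc M. p i * indicator (A i) z) \<partial>F)" by simp
      also have "\<dots> = (\<Sum>i<Suc M. \<integral>z. p i * indicator (A i) z \<partial>F)"
        by (intro Bochner_Integration.integral_sum) (auto simp: F.emeasure_finite less_top[symmetric])
      finally show ?thesis using spF by simp
    qed
    have intb: "integrable F p" if "finite_measure F" "sets F = sets borel" "p \<in> borel_measurable borel" "\<And>z. \<bar>p z\<bar> \<le> 1"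
      for F :: "'z measure" and p :: "'z \<Rightarrow> real"
      using that by (intro finite_measure.integrable_const_bound[where B=1])
        (auto simp: measurable_cong_sets[OF that(2) refl])
    have xh: "0 \<le> x (h z)" "x (h z) \<le> 1" "x (h z) \<le> g z" "g z \<le> x (h z) + 1 / real M" for z
      using h[of z] g01[of z] M by (auto simp: x_def field_simps)
    have close: "\<bar>(\<integral>z. g z \<partial>F) - (\<integral>z. x (h z) \<partial>F)\<bar> \<le> measure F UNIV / real M"
      and close2: "\<bar>(\<integral>z. (g z)\<^sup>2 \<partial>F) - (\<integral>z. (x (h z))\<^sup>2 \<partial>F)\<bar> \<le> 2 * measure F UNIV / real M"
      if "finite_measure F" and sF[measurable_cong]: "sets F = sets borel" for F :: "'z measure"
    proof -
      interpret F: finite_measure F by fact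
      have spF: "space F = UNIV" using sets_eq_imp_space_eq[OF sF] by simp
      note i = intb[OF that]
      have mx: "(\<lambda>z. x (h z)) \<in> borel_measurable borel" by measurable
      have ig: "integrable F g" using g01 by (intro i) auto
      have ix: "integrable F (\<lambda>z. x (h z))" using xh by (intro i mx) auto
      have ig2: "integrable F (\<lambda>z. (g z)\<^sup>2)" using g01 by (intro i) (auto simp: power_le_one)
      have ix2: "integrable F (\<lambda>z. (x (h z))\<^sup>2)" using xh mx by (intro i) (auto simp: power_le_one)
      have le: "\<bar>g z - x (h z)\<bar> \<le> 1 / real M" for z using xh[of z] by (auto simp: abs_le_iff)
      have "\<bar>(\<integral>z. g z \<partial>F) - (\<integral>z. x (h z) \<partial>F)\<bar> = \<bar>\<integral>z. g z - x (h z) \<partial>F\<bar>" using ig ix by simp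
      also have "\<dots> \<le> (\<integral>z. \<bar>g z - x (h z)\<bar> \<partial>F)" by (rule integral_abs_bound)
      also have "\<dots> \<le> (\<integral>z. 1 / real M \<partial>F)"
        using ig ix by (intro integral_mono le) auto
      finally show "\<bar>(\<integral>z. g z \<partial>F) - (\<integral>z. x (h z) \<partial>F)\<bar> \<le> measure F UNIV / real M" using spF by simp
      have le2: "\<bar>(g z)\<^sup>2 - (x (h z))\<^sup>2\<bar> \<le> 2 / real M" for z
      proof -
        have "\<bar>(g z)\<^sup>2 - (x (h z))\<^sup>2\<bar> = \<bar>g z - x (h z)\<bar> * \<bar>g z + x (h z)\<bar>"
          by (simp add: power2_eq_square abs_mult[symmetric] algebra_simps)
        also have "\<dots> \<le> 1 / real M * 2" using le xh[of z] g01[of z] by (intro mult_mono) auto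
        finally show ?thesis by simp
      qed
      have "\<bar>(\<integral>z. (g z)\<^sup>2 \<partial>F) - (\<integral>z. (x (h z))\<^sup>2 \<partial>F)\<bar> = \<bar>\<integral>z. (g z)\<^sup>2 - (x (h z))\<^sup>2 \<partial>F\<bar>" using ig2 ix2 by simp
      also have "\<dots> \<le> (\<integral>z. \<bar>(g z)\<^sup>2 - (x (h z))\<^sup>2\<bar> \<partial>F)" by (rule integral_abs_bound)
      also have "\<dots> \<le> (\<integral>z. 2 / real M \<partial>F)"
        using ig2 ix2 by (intro integral_mono le2) auto
      finally show "\<bar>(\<integral>z. (g z)\<^sup>2 \<partial>F) - (\<integral>z. (x (h z))\<^sup>2 \<partial>F)\<bar> \<le> 2 * measure F UNIV / real M"
        using spF by (simp add: mult.commute)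
    qed
    define s where "s i = measure \<alpha> (A i)" for i
    have Ns: "N = (\<Sum>i<Suc M. s i)"
      using simple[OF \<alpha> sa, of "\<lambda>_. 1"] spa by (simp add: N(1) s_def)
    define m' where "m' = (\<Sum>i<Suc M. x i * s i) / N"
    have m': "m' = (\<integral>z. x (h z) \<partial>\<alpha>) / N" unfolding m'_def s_def simple[OF \<alpha> sa] by (rule refl)
    have inv: "1 / real M \<le> 1 / N" using M N1 by (intro divide_left_mono) auto
    have mm': "\<bar>m - m'\<bar> \<le> 1 / N"
    proof -
      have "\<bar>m - m'\<bar> = \<bar>(\<integral>z. g z \<partial>\<alpha>) - (\<integral>z. x (h z) \<partial>\<alpha>)\<bar> / N"
        using N1 unfolding m m' by (simp add: diff_divide_distrib[symmetric])
      also have "\<dots> \<le> (N / real M) / N" using close[OF \<alpha> sa] N N1 by (intro divide_right_mono) auto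
      finally show ?thesis using inv N1 by simp
    qed
    have m01: "0 \<le> m" "m \<le> 1" "0 \<le> m'" "m' \<le> 1"
    proof -
      have *: "0 \<le> (\<integral>z. p z \<partial>\<alpha>) / N \<and> (\<integral>z. p z \<partial>\<alpha>) / N \<le> 1" if "p \<in> borel_measurable borel" "\<And>z. 0 \<le> p z \<and> p z \<le> 1" for p :: "'z \<Rightarrow> real"
      proof -
        have "(\<integral>z. p z \<partial>\<alpha>) \<le> (\<integral>z. 1 \<partial>\<alpha>)"
          using that by (intro integral_mono intb[OF \<alpha> sa]) auto
        then show ?thesis using that N N1 spa by (auto intro!: divide_nonneg_nonneg integral_nonneg)
      qed
      have mx: "(\<lambda>z. x (h z)) \<in> borel_measurable borel" by measurable
      show "0 \<le> m" "m \<le> 1" using *[of g] g01 by (auto simp: m)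
      show "0 \<le> m'" "m' \<le> 1" using *[OF mx] xh by (auto simp: m')
    qed
    have v': "\<bar>(\<Sum>i<Suc M. (x i)\<^sup>2 * s i) / N - m'\<^sup>2 - V\<bar> \<le> \<delta>"
    proof -
      have "\<bar>m\<^sup>2 - m'\<^sup>2\<bar> = \<bar>m - m'\<bar> * \<bar>m + m'\<bar>" by (simp add: power2_eq_square abs_mult[symmetric] algebra_simps)
      also have "\<dots> \<le> 1 / N * 2" using mm' m01 N1 by (intro mult_mono) auto
      finally have 1: "\<bar>m\<^sup>2 - m'\<^sup>2\<bar> \<le> 2 / N" by simp
      have "\<bar>(\<integral>z. (g z)\<^sup>2 \<partial>\<alpha>) / N - (\<integral>z. (x (h z))\<^sup>2 \<partial>\<alpha>) / N\<bar> = \<bar>(\<integral>z. (g z)\<^sup>2 \<partial>\<alpha>) - (\<integral>z. (x (h z))\<^sup>2 \<partial>\<alpha>)\<bar> / N"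
        using N1 by (simp add: diff_divide_distrib[symmetric])
      also have "\<dots> \<le> (2 * N / real M) / N" using close2[OF \<alpha> sa] N N1 by (intro divide_right_mono) auto
      also have "\<dots> = 2 * (1 / real M)" using N1 by simp
      finally have 2: "\<bar>(\<integral>z. (g z)\<^sup>2 \<partial>\<alpha>) / N - (\<integral>z. (x (h z))\<^sup>2 \<partial>\<alpha>) / N\<bar> \<le> 2 / N" using inv by simp
      have 3: "(\<integral>z. (x (h z))\<^sup>2 \<partial>\<alpha>) = (\<Sum>i<Suc M. (x i)\<^sup>2 * s i)"
        unfolding s_def by (rule simple[OF \<alpha> sa])
      have "4 / N \<le> \<delta> / 2" using N1 \<delta> by (simp add: field_simps)
      then show ?thesis using 1 2 v unfolding 3 by linarith
    qed
    note [measurable] = BL_unit_measurable[OF f]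
    have sD[measurable_cong]: "sets D = sets (prob_algebra borel)" and pD: "prob_space D"
      and fd: "distr D (Pi\<^sub>M {..<Suc M} (\<lambda>_. borel)) (\<lambda>F. \<lambda>i\<in>{..<Suc M}. measure F (A i)) = dirichlet_law {..<Suc M} s"
      using D A Apart by (auto simp: dirichlet_process_def s_def[abs_def] simp del: lessThan_Suc)
    interpret D: prob_space D by fact
    note FD = AE_space_dirichlet_process[OF D]
    have mA[measurable]: "(\<lambda>F. measure F (A i)) \<in> borel_measurable (prob_algebra borel)" for i
      unfolding prob_algebra_def by (rule measurable_restrict_space1) measurable
    have mr: "(\<lambda>F. \<lambda>i\<in>{..<Suc M}. measure F (A i)) \<in> measurable D (Pi\<^sub>M {..<Suc M} (\<lambda>_. borel))"
      by (intro measurable_restrict) measurable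
    have "\<bar>(\<integral>y. f (sqrt N * ((\<Sum>i<Suc M. x i * y i) - m')) \<partial>dirichlet_law {..<Suc M} s) - (\<integral>x. f x \<partial>gauss V)\<bar> \<le> e / 2"
    proof (rule clt[OF _ _ Ns _ _ m'_def v' f])
      show "0 \<le> s i" for i by (simp add: s_def)
      show "0 \<le> x i \<and> x i \<le> 1" if "i \<in> {..<Suc M}" for i using that M by (auto simp: x_def)
    qed (use N1 in auto)
    also have "(\<integral>y. f (sqrt N * ((\<Sum>i<Suc M. x i * y i) - m')) \<partial>dirichlet_law {..<Suc M} s)
        = (\<integral>F. f (sqrt N * ((\<Sum>i<Suc M. x i * measure F (A i)) - m')) \<partial>D)"
      unfolding fd[symmetric] using mr
      by (subst integral_distr) (auto simp del: sum.lessThan_Suc lessThan_Suc)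
    finally have c1: "\<bar>(\<integral>F. f (sqrt N * ((\<Sum>i<Suc M. x i * measure F (A i)) - m')) \<partial>D) - (\<integral>x. f x \<partial>gauss V)\<bar> \<le> e / 2" .
    have mg: "(\<lambda>F. \<integral>z. g z \<partial>F) \<in> borel_measurable D"
      using measurable_chi_prob_algebra[OF g g01] by (simp add: measurable_cong_sets[OF sD refl])
    have i1: "integrable D (\<lambda>F. f (sqrt N * ((\<Sum>i<Suc M. x i * measure F (A i)) - m')))"
      by (intro D.BL_unit_integrable[OF f]) measurable
    have i2: "integrable D (\<lambda>F. f (sqrt N * ((\<integral>z. g z \<partial>F) - m)))"
      by (intro D.BL_unit_integrable[OF f] borel_measurable_times borel_measurable_diff borel_measurable_const mg)
    have "\<bar>(\<integral>F. f (sqrt N * ((\<integral>z. g z \<partial>F) - m)) \<partial>D) - (\<integral>F. f (sqrt N * ((\<Sum>i<Suc M. x i * measure F (A i)) - m')) \<partial>D)\<bar>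
       = \<bar>\<integral>F. f (sqrt N * ((\<integral>z. g z \<partial>F) - m)) - f (sqrt N * ((\<Sum>i<Suc M. x i * measure F (A i)) - m')) \<partial>D\<bar>"
      using i1 i2 by simp
    also have "\<dots> \<le> (\<integral>F. \<bar>f (sqrt N * ((\<integral>z. g z \<partial>F) - m)) - f (sqrt N * ((\<Sum>i<Suc M. x i * measure F (A i)) - m'))\<bar> \<partial>D)"
      by (rule integral_abs_bound)
    also have "\<dots> \<le> (\<integral>F. e / 2 \<partial>D)"
    proof (rule integral_mono)
      show "integrable D (\<lambda>F. \<bar>f (sqrt N * ((\<integral>z. g z \<partial>F) - m)) - f (sqrt N * ((\<Sum>i<Suc M. x i * measure F (A i)) - m'))\<bar>)"
        using i1 i2 by (intro integrable_abs Bochner_Integration.integrable_diff)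
      fix F assume F: "F \<in> space D"
      interpret F: prob_space F by (rule FD(1)[OF F])
      have fF: "finite_measure F" by (rule F.finite_measure_axioms)
      have "(\<Sum>i<Suc M. x i * measure F (A i)) = (\<integral>z. x (h z) \<partial>F)"
        by (rule simple[OF fF FD(2)[OF F], symmetric])
      moreover have "\<bar>(\<integral>z. g z \<partial>F) - (\<integral>z. x (h z) \<partial>F)\<bar> \<le> 1 / N"
        using close[OF fF FD(2)[OF F]] inv F.prob_space FD(3)[OF F] by simp
      ultimately have le: "\<bar>((\<integral>z. g z \<partial>F) - m) - ((\<Sum>i<Suc M. x i * measure F (A i)) - m')\<bar> \<le> 2 / N"
        using mm' by (simp only: abs_le_iff) linarith
      have "\<bar>f (sqrt N * ((\<integral>z. g z \<partial>F) - m)) - f (sqrt N * ((\<Sum>i<Suc M. x i * measure F (A i)) - m'))\<bar>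
          \<le> \<bar>sqrt N * ((\<integral>z. g z \<partial>F) - m) - sqrt N * ((\<Sum>i<Suc M. x i * measure F (A i)) - m')\<bar>"
        by (rule BL_unitD(2)[OF f])
      also have "\<dots> = sqrt N * \<bar>((\<integral>z. g z \<partial>F) - m) - ((\<Sum>i<Suc M. x i * measure F (A i)) - m')\<bar>"
        unfolding right_diff_distrib[symmetric] abs_mult using N1 by simp
      also have "\<dots> \<le> sqrt N * (2 / N)" using le N1 by (intro mult_left_mono) auto
      also have "\<dots> = 2 / sqrt N" using N1 by (simp add: field_simps)
      also have "\<dots> \<le> e / 2"
      proof -
        have "4 / e \<le> sqrt N" using N1 by (intro real_le_rsqrt)
        then show ?thesis using e N1 by (simp add: field_simps)
      qed
      finally show "\<bar>f (sqrt N * ((\<integral>z. g z \<partial>F) - m)) - f (sqrt N * ((\<Sum>i<Suc M. x i * measure F (A i)) - m'))\<bar> \<le> e / 2" .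
    qed simp
    finally have "\<bar>(\<integral>F. f (sqrt N * ((\<integral>z. g z \<partial>F) - m)) \<partial>D) - (\<integral>F. f (sqrt N * ((\<Sum>i<Suc M. x i * measure F (A i)) - m')) \<partial>D)\<bar> \<le> e / 2"
      by (simp add: D.prob_space)
    then show "\<bar>(\<integral>F. f (sqrt N * ((\<integral>z. g z \<partial>F) - m)) \<partial>D) - (\<integral>x. f x \<partial>gauss V)\<bar> \<le> e"
      using c1 by linarith
  qed
qed

section \<open>Events of high outer probability\<close>

lemma outer_measure_of_Un:
  assumes "A \<subseteq> space M" "B \<subseteq> space M"
  shows "outer_measure_of M (A \<union> B) \<le> outer_measure_of M A + outer_measure_of M B"
proof -
  obtain E where E: "E \<in> sets M" "A \<subseteq> E" "outer_measure_of M A = emeasure M E"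
    using outer_measure_of_attain[OF assms(1)] by blast
  obtain F where F: "F \<in> sets M" "B \<subseteq> F" "outer_measure_of M B = emeasure M F"
    using outer_measure_of_attain[OF assms(2)] by blast
  have "outer_measure_of M (A \<union> B) \<le> outer_measure_of M (E \<union> F)"
    using E F by (intro outer_measure_of_mono) auto
  also have "\<dots> = emeasure M (E \<union> F)" using E F by (intro outer_measure_of_eq) auto
  also have "\<dots> \<le> emeasure M E + emeasure M F" using E F by (intro emeasure_subadditive)
  finally show ?thesis using E F by simp
qed

text \<open>Formulated through the complement: the events need not be measurable, and for
  intersections only subadditivity of the outer measure is then needed.\<close>

definition whp :: "(nat \<Rightarrow> 'w measure) \<Rightarrow> (nat \<Rightarrow> 'w \<Rightarrow> bool) \<Rightarrow> bool" where
  "whp P A \<longleftrightarrow> (\<lambda>n. outer_measure_of (P n) {\<omega> \<in> space (P n). \<not> A n \<omega>}) \<longlonglongrightarrow> 0"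

lemma whpI:
  assumes "\<forall>\<^sub>F n in sequentially. outer_measure_of (P n) {\<omega> \<in> space (P n). \<not> A n \<omega>} \<le> f n"
    and "f \<longlonglongrightarrow> 0"
  shows "whp P A"
  unfolding whp_def by (rule tendsto_sandwich[OF _ assms(1) tendsto_const assms(2)]) simp

lemma whp_mono:
  assumes "whp P A" "\<forall>\<^sub>F n in sequentially. \<forall>\<omega>\<in>space (P n). A n \<omega> \<longrightarrow> B n \<omega>"
  shows "whp P B"
proof (rule whpI)
  show "\<forall>\<^sub>F n in sequentially. outer_measure_of (P n) {\<omega> \<in> space (P n). \<not> B n \<omega>}
          \<le> outer_measure_of (P n) {\<omega> \<in> space (P n). \<not> A n \<omega>}"
    using assms(2) by eventually_elim (auto intro!: outer_measure_of_mono)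
qed (use assms(1) in \<open>simp add: whp_def\<close>)

lemma whp_conj:
  assumes "whp P A" "whp P B"
  shows "whp P (\<lambda>n \<omega>. A n \<omega> \<and> B n \<omega>)"
proof (rule whpI[OF always_eventually], rule allI)
  fix n
  have "{\<omega> \<in> space (P n). \<not> (A n \<omega> \<and> B n \<omega>)} = {\<omega> \<in> space (P n). \<not> A n \<omega>} \<union> {\<omega> \<in> space (P n). \<not> B n \<omega>}"
    by auto
  then show "outer_measure_of (P n) {\<omega> \<in> space (P n). \<not> (A n \<omega> \<and> B n \<omega>)}
      \<le> outer_measure_of (P n) {\<omega> \<in> space (P n). \<not> A n \<omega>} + outer_measure_of (P n) {\<omega> \<in> space (P n). \<not> B n \<omega>}"
    by (simp add: outer_measure_of_Un)
next
  show "(\<lambda>n. outer_measure_of (P n) {\<omega> \<in> space (P n). \<not> A n \<omega>}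
      + outer_measure_of (P n) {\<omega> \<in> space (P n). \<not> B n \<omega>}) \<longlonglongrightarrow> 0"
    using tendsto_add[OF assms[unfolded whp_def]] by simp
qed

lemma whp_True: "whp P (\<lambda>n \<omega>. True)"
  using outer_measure_of_eq[OF sets.empty_sets] by (simp add: whp_def)

lemma whp_ball:
  assumes "finite T" "\<And>t. t \<in> T \<Longrightarrow> whp P (\<lambda>n \<omega>. A t n \<omega>)"
  shows "whp P (\<lambda>n \<omega>. \<forall>t\<in>T. A t n \<omega>)"
  using assms by (induction T rule: finite_induct) (auto simp: whp_True intro: whp_conj)

lemma prob_tendsto_0_whp:
  "prob_tendsto_0 P T \<longleftrightarrow> (\<forall>e>0. whp P (\<lambda>n \<omega>. T n \<omega> \<le> ennreal e))"
  by (simp add: prob_tendsto_0_def whp_def not_le)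

lemma prob_tendsto_whp:
  "prob_tendsto P T c \<longleftrightarrow> (\<forall>e>0. whp P (\<lambda>n \<omega>. \<bar>T n \<omega> - c\<bar> \<le> e))"
  by (simp add: prob_tendsto_def prob_tendsto_0_whp)

text \<open>Allows a stochastic bound to be treated as a bound with a fixed constant. The constant
  \<open>C\<close> is chosen after the level \<open>e\<close>, and this is harmless because the
  implication is assumed for every \<open>C\<close>.\<close>

lemma prob_bigo_whp:
  assumes T: "prob_bigo P T r" and A: "\<And>C. whp P (\<lambda>n \<omega>. T n \<omega> \<le> ennreal (C * \<bar>r n\<bar>) \<longrightarrow> A n \<omega>)"
  shows "whp P A"
  unfolding whp_def
proof (rule order_tendstoI)
  fix a :: ennreal assume "0 < a"
  then obtain e where e: "0 < e" "ennreal (2 * e) < a"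
  proof -
    obtain b where b: "0 < b" "b < a" using dense[OF \<open>0 < a\<close>] by blast
    then have "b < top" using less_trans[OF b(2)] by (metis dual_order.strict_trans1 less_top top_greatest)
    then have "ennreal (2 * (enn2real b / 2)) < a" using b by simp
    moreover have "0 < enn2real b / 2" using b \<open>b < top\<close> by (simp add: enn2real_positive_iff)
    ultimately show ?thesis using that by blast
  qed
  obtain C where C: "\<forall>\<^sub>F n in sequentially.
        outer_measure_of (P n) {\<omega> \<in> space (P n). T n \<omega> > ennreal (C * \<bar>r n\<bar>)} \<le> ennreal e"
    using T e(1) unfolding prob_bigo_def by blast
  have "\<forall>\<^sub>F n in sequentially. outer_measure_of (P n) {\<omega> \<in> space (P n). \<not> (T n \<omega> \<le> ennreal (C * \<bar>r n\<bar>) \<longrightarrow> A n \<omega>)} < ennreal e"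
    using A[of C] e(1) unfolding whp_def by (intro order_tendstoD) auto
  with C show "\<forall>\<^sub>F n in sequentially. outer_measure_of (P n) {\<omega> \<in> space (P n). \<not> A n \<omega>} < a"
  proof eventually_elim
    case (elim n)
    have "outer_measure_of (P n) {\<omega> \<in> space (P n). \<not> A n \<omega>} \<le>
      outer_measure_of (P n) ({\<omega> \<in> space (P n). T n \<omega> > ennreal (C * \<bar>r n\<bar>)} \<union>
        {\<omega> \<in> space (P n). \<not> (T n \<omega> \<le> ennreal (C * \<bar>r n\<bar>) \<longrightarrow> A n \<omega>)})"
      by (intro outer_measure_of_mono) (auto simp: not_less)
    also have "\<dots> \<le> ennreal e + ennreal e"
      using elim by (intro order_trans[OF outer_measure_of_Un] add_mono) auto
    also have "\<dots> = ennreal (2 * e)" using e(1) by (simp add: ennreal_plus[symmetric] del: ennreal_plus)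
    finally show ?case using e(2) by simp
  qed
qed simp

text \<open>
  If a set can be reached from each point of another one with probability at least \<open>p\<close> by a
  randomised, measure-preserving move, then its outer measure controls that of the other one.
\<close>

lemma outer_measure_of_resample:
  assumes N: "sigma_finite_measure N"
    and \<Phi>[measurable]: "\<Phi> \<in> measurable (\<Omega> \<Otimes>\<^sub>M N) \<Omega>" and inv: "distr (\<Omega> \<Otimes>\<^sub>M N) \<Omega> \<Phi> = \<Omega>"
    and E: "E \<subseteq> space \<Omega>" "E' \<subseteq> space \<Omega>" and p: "p > 0"
    and reach: "\<And>\<omega>. \<omega> \<in> E' \<Longrightarrow> \<exists>A\<in>sets N. ennreal p \<le> emeasure N A \<and> (\<forall>a\<in>A. \<Phi> (\<omega>, a) \<in> E)"
  shows "outer_measure_of \<Omega> E' \<le> ennreal (1 / p) * outer_measure_of \<Omega> E"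
proof -
  interpret N: sigma_finite_measure N by fact
  obtain G where G[measurable]: "G \<in> sets \<Omega>" and EG: "E \<subseteq> G" "outer_measure_of \<Omega> E = emeasure \<Omega> G"
    using outer_measure_of_attain[OF E(1)] by blast
  \<comment> \<open>The chance that the move from a given point ends in the measurable cover
    \<open>G\<close> of \<open>E\<close>. It is at least \<open>p\<close> on \<open>E'\<close>, and
    by invariance its mean is the measure of \<open>G\<close>, so Markov's inequality gives the
    factor \<open>1 / p\<close>.\<close>
  define u where "u \<omega> = (\<integral>\<^sup>+a. indicator G (\<Phi> (\<omega>, a)) \<partial>N)" for \<omega>
  have u[measurable]: "u \<in> borel_measurable \<Omega>" unfolding u_def by measurable
  have "E' \<subseteq> {\<omega> \<in> space \<Omega>. 1 \<le> ennreal (1 / p) * u \<omega>}"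
  proof
    fix \<omega> assume \<omega>: "\<omega> \<in> E'"
    obtain A where A: "A \<in> sets N" "ennreal p \<le> emeasure N A" "\<And>a. a \<in> A \<Longrightarrow> \<Phi> (\<omega>, a) \<in> E"
      using reach[OF \<omega>] by blast
    have "ennreal p \<le> (\<integral>\<^sup>+a. indicator A a \<partial>N)" using A by simp
    also have "\<dots> \<le> u \<omega>" unfolding u_def using A EG by (intro nn_integral_mono) (auto simp: indicator_def)
    finally have "ennreal (1 / p) * ennreal p \<le> ennreal (1 / p) * u \<omega>" by (intro mult_left_mono) auto
    moreover have "ennreal (1 / p) * ennreal p = 1"
      using p by (subst ennreal_mult'[symmetric]) auto
    ultimately show "\<omega> \<in> {\<omega> \<in> space \<Omega>. 1 \<le> ennreal (1 / p) * u \<omega>}"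
      using \<omega> E by auto
  qed
  then have "outer_measure_of \<Omega> E' \<le> outer_measure_of \<Omega> {\<omega> \<in> space \<Omega>. 1 \<le> ennreal (1 / p) * u \<omega>}"
    by (rule outer_measure_of_mono)
  also have "\<dots> = emeasure \<Omega> {\<omega> \<in> space \<Omega>. 1 \<le> ennreal (1 / p) * u \<omega>}"
    by (intro outer_measure_of_eq) measurable
  also have "\<dots> \<le> ennreal (1 / p) * (\<integral>\<^sup>+\<omega>. u \<omega> * indicator (space \<Omega>) \<omega> \<partial>\<Omega>)"
    by (intro nn_integral_Markov_inequality) auto
  also have "(\<integral>\<^sup>+\<omega>. u \<omega> * indicator (space \<Omega>) \<omega> \<partial>\<Omega>) = (\<integral>\<^sup>+\<omega>. u \<omega> \<partial>\<Omega>)"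
    by (intro nn_integral_cong) auto
  also have "\<dots> = (\<integral>\<^sup>+x. indicator G (\<Phi> x) \<partial>(\<Omega> \<Otimes>\<^sub>M N))"
    unfolding u_def by (rule N.nn_integral_fst) measurable
  also have "\<dots> = (\<integral>\<^sup>+x. indicator G x \<partial>distr (\<Omega> \<Otimes>\<^sub>M N) \<Omega> \<Phi>)"
    by (subst nn_integral_distr) auto
  also have "\<dots> = emeasure \<Omega> G" unfolding inv by simp
  finally show ?thesis unfolding EG(2) .
qed

section \<open>Random moves of the sample that preserve its law\<close>

lemma distr_PiM_coordinatewise:
  assumes I: "finite I" and M: "prob_space M" and A: "prob_space A"
    and g[measurable]: "g \<in> measurable (M \<Otimes>\<^sub>M A) M" and inv: "distr (M \<Otimes>\<^sub>M A) M g = M"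
  defines "\<Psi> \<equiv> \<lambda>(x, a). \<lambda>i\<in>I. g (x i, a i)"
  shows "\<Psi> \<in> measurable (Pi\<^sub>M I (\<lambda>_. M) \<Otimes>\<^sub>M Pi\<^sub>M I (\<lambda>_. A)) (Pi\<^sub>M I (\<lambda>_. M))"
    and "distr (Pi\<^sub>M I (\<lambda>_. M) \<Otimes>\<^sub>M Pi\<^sub>M I (\<lambda>_. A)) (Pi\<^sub>M I (\<lambda>_. M)) \<Psi> = Pi\<^sub>M I (\<lambda>_. M)"
proof -
  interpret M: prob_space M by fact
  interpret A: prob_space A by fact
  interpret QA: prob_space "Pi\<^sub>M I (\<lambda>_. A)" by (rule prob_space_PiM) (rule A)
  interpret PM: product_prob_space "\<lambda>_. M" I ..
  interpret PA: product_prob_space "\<lambda>_. A" I ..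
  let ?P = "Pi\<^sub>M I (\<lambda>_. M) \<Otimes>\<^sub>M Pi\<^sub>M I (\<lambda>_. A)"
  show \<Psi>[measurable]: "\<Psi> \<in> measurable ?P (Pi\<^sub>M I (\<lambda>_. M))"
    unfolding \<Psi>_def case_prod_beta
    by (intro measurable_restrict measurable_compose[OF _ g] measurable_Pair
        measurable_compose[OF measurable_fst measurable_component_singleton]
        measurable_compose[OF measurable_snd measurable_component_singleton])
  show "distr ?P (Pi\<^sub>M I (\<lambda>_. M)) \<Psi> = Pi\<^sub>M I (\<lambda>_. M)"
  proof (rule PM.PiM_eqI[OF I])
    fix B assume B: "\<And>i. i \<in> I \<Longrightarrow> B i \<in> sets M"
    have Bm: "Pi\<^sub>E I B \<in> sets (Pi\<^sub>M I (\<lambda>_. M))" using B I by (intro sets_PiM_I_finite) auto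
    have ind: "(\<lambda>p. indicator (B i) (g p) :: ennreal) \<in> borel_measurable (M \<Otimes>\<^sub>M A)" if "i \<in> I" for i
      using B[OF that] by measurable
    have "emeasure (distr ?P (Pi\<^sub>M I (\<lambda>_. M)) \<Psi>) (Pi\<^sub>E I B) = (\<integral>\<^sup>+p. indicator (Pi\<^sub>E I B) (\<Psi> p) \<partial>?P)"
      using Bm by (subst nn_integral_indicator[symmetric], simp, subst nn_integral_distr) auto
    also have "\<dots> = (\<integral>\<^sup>+x. \<integral>\<^sup>+a. indicator (Pi\<^sub>E I B) (\<Psi> (x, a)) \<partial>Pi\<^sub>M I (\<lambda>_. A) \<partial>Pi\<^sub>M I (\<lambda>_. M))"
      by (intro QA.nn_integral_fst[symmetric] measurable_compose[OF \<Psi> borel_measurable_indicator[OF Bm]])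
    also have "\<dots> = (\<integral>\<^sup>+x. \<integral>\<^sup>+a. (\<Prod>i\<in>I. indicator (B i) (g (x i, a i))) \<partial>Pi\<^sub>M I (\<lambda>_. A) \<partial>Pi\<^sub>M I (\<lambda>_. M))"
    proof (intro nn_integral_cong)
      fix x a
      show "indicator (Pi\<^sub>E I B) (\<Psi> (x, a)) = (\<Prod>i\<in>I. indicator (B i) (g (x i, a i)) :: ennreal)"
        using I by (cases "\<forall>i\<in>I. g (x i, a i) \<in> B i")
          (auto simp: \<Psi>_def indicator_def PiE_iff extensional_def intro!: prod.neutral[symmetric] prod_zero[symmetric] sym[OF prod_zero])
    qed
    also have "\<dots> = (\<integral>\<^sup>+x. (\<Prod>i\<in>I. \<integral>\<^sup>+a. indicator (B i) (g (x i, a)) \<partial>A) \<partial>Pi\<^sub>M I (\<lambda>_. M))"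
      using ind by (intro nn_integral_cong PA.product_nn_integral_prod[OF I] measurable_Pair2[OF ind])
        (auto simp: space_PiM)
    also have "\<dots> = (\<Prod>i\<in>I. \<integral>\<^sup>+x. \<integral>\<^sup>+a. indicator (B i) (g (x, a)) \<partial>A \<partial>M)"
      using ind by (intro PM.product_nn_integral_prod[OF I] A.borel_measurable_nn_integral_fst)
    also have "\<dots> = (\<Prod>i\<in>I. emeasure M (B i))"
    proof (intro prod.cong refl)
      fix i assume i: "i \<in> I"
      have "(\<integral>\<^sup>+x. \<integral>\<^sup>+a. indicator (B i) (g (x, a)) \<partial>A \<partial>M) = (\<integral>\<^sup>+p. indicator (B i) (g p) \<partial>(M \<Otimes>\<^sub>M A))"
        using ind[OF i] by (rule A.nn_integral_fst)
      also have "\<dots> = (\<integral>\<^sup>+y. indicator (B i) y \<partial>distr (M \<Otimes>\<^sub>M A) M g)"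
        using B[OF i] by (subst nn_integral_distr) auto
      finally show "(\<integral>\<^sup>+x. \<integral>\<^sup>+a. indicator (B i) (g (x, a)) \<partial>A \<partial>M) = emeasure M (B i)"
        using B[OF i] by (simp add: inv)
    qed
    finally show "emeasure (distr ?P (Pi\<^sub>M I (\<lambda>_. M)) \<Psi>) (Pi\<^sub>E I B) = (\<Prod>i\<in>I. emeasure M (B i))" .
  qed simp
qed

text \<open>The component \<open>s\<close> will carry the estimator. Being independent of the sample
  it can be frozen, so a move that preserves the law for each fixed \<open>s\<close> preserves the
  joint law although its rule depends on \<open>s\<close>.\<close>

lemma distr_PiM_coordinatewise_param:
  fixes M :: "'a measure" and A :: "'b measure" and S :: "'s measure"
  assumes I: "finite I" and M: "prob_space M" and A: "prob_space A" and S: "prob_space S"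
    and g[measurable]: "(\<lambda>(s, x, a). g s (x, a)) \<in> measurable (S \<Otimes>\<^sub>M (M \<Otimes>\<^sub>M A)) M"
    and inv: "\<And>s. s \<in> space S \<Longrightarrow> distr (M \<Otimes>\<^sub>M A) M (g s) = M"
  defines "\<Phi> \<equiv> \<lambda>((x, s), a). (\<lambda>i\<in>I. g s (x i, a i), s)"
  shows "\<Phi> \<in> measurable ((Pi\<^sub>M I (\<lambda>_. M) \<Otimes>\<^sub>M S) \<Otimes>\<^sub>M Pi\<^sub>M I (\<lambda>_. A)) (Pi\<^sub>M I (\<lambda>_. M) \<Otimes>\<^sub>M S)" (is "_ \<in> measurable ?P _")
    and "distr ((Pi\<^sub>M I (\<lambda>_. M) \<Otimes>\<^sub>M S) \<Otimes>\<^sub>M Pi\<^sub>M I (\<lambda>_. A)) (Pi\<^sub>M I (\<lambda>_. M) \<Otimes>\<^sub>M S) \<Phi> = Pi\<^sub>M I (\<lambda>_. M) \<Otimes>\<^sub>M S"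
proof -
  interpret M: prob_space M by fact
  interpret A: prob_space A by fact
  interpret S: prob_space S by fact
  interpret QA: prob_space "Pi\<^sub>M I (\<lambda>_. A)" by (rule prob_space_PiM) (rule A)
  interpret QM: prob_space "Pi\<^sub>M I (\<lambda>_. M)" by (rule prob_space_PiM) (rule M)
  interpret QS: pair_prob_space "Pi\<^sub>M I (\<lambda>_. M)" S ..
  let ?M = "Pi\<^sub>M I (\<lambda>_. M)" and ?A = "Pi\<^sub>M I (\<lambda>_. A)"
  have gi: "(\<lambda>p. g (snd (fst p)) (fst (fst p) i, snd p i)) \<in> measurable ?P M" if "i \<in> I" for i
  proof -
    have "(\<lambda>p. (snd (fst p), fst (fst p) i, snd p i)) \<in> measurable ?P (S \<Otimes>\<^sub>M (M \<Otimes>\<^sub>M A))"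
      using that by measurable
    from measurable_compose[OF this g] show ?thesis by simp
  qed
  show \<Phi>[measurable]: "\<Phi> \<in> measurable ?P (?M \<Otimes>\<^sub>M S)"
    unfolding \<Phi>_def case_prod_beta by (intro measurable_Pair measurable_restrict gi) measurable
  have gs: "g s \<in> measurable (M \<Otimes>\<^sub>M A) M" if "s \<in> space S" for s
    using measurable_Pair2[OF g that] by simp
  show "distr ?P (?M \<Otimes>\<^sub>M S) \<Phi> = ?M \<Otimes>\<^sub>M S"
  proof (rule measure_eqI)
    fix G assume "G \<in> sets (distr ?P (?M \<Otimes>\<^sub>M S) \<Phi>)"
    then have G[measurable]: "G \<in> sets (?M \<Otimes>\<^sub>M S)" by simp
    have "emeasure (distr ?P (?M \<Otimes>\<^sub>M S) \<Phi>) G = (\<integral>\<^sup>+p. indicator G (\<Phi> p) \<partial>?P)"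
      by (subst nn_integral_indicator[symmetric], simp, subst nn_integral_distr) auto
    also have "\<dots> = (\<integral>\<^sup>+w. \<integral>\<^sup>+a. indicator G (\<Phi> (w, a)) \<partial>?A \<partial>(?M \<Otimes>\<^sub>M S))"
      by (intro QA.nn_integral_fst[symmetric]) measurable
    also have "\<dots> = (\<integral>\<^sup>+s. \<integral>\<^sup>+x. \<integral>\<^sup>+a. indicator G (\<Phi> ((x, s), a)) \<partial>?A \<partial>?M \<partial>S)"
      by (intro QS.nn_integral_snd[symmetric]) measurable
    also have "\<dots> = (\<integral>\<^sup>+s. \<integral>\<^sup>+x. indicator G (x, s) \<partial>?M \<partial>S)"
    proof (rule nn_integral_cong)
      fix s assume s: "s \<in> space S"
      note D = distr_PiM_coordinatewise[OF I M A gs[OF s] inv[OF s]]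
      let ?\<Psi> = "\<lambda>(x, a). \<lambda>i\<in>I. g s (x i, a i)"
      note [measurable] = D(1)
      have ms: "(\<lambda>y. indicator G (y, s) :: ennreal) \<in> borel_measurable ?M"
        using s by measurable
      have "(\<integral>\<^sup>+x. \<integral>\<^sup>+a. indicator G (\<Phi> ((x, s), a)) \<partial>?A \<partial>?M) = (\<integral>\<^sup>+x. \<integral>\<^sup>+a. indicator G (?\<Psi> (x, a), s) \<partial>?A \<partial>?M)"
        by (simp add: \<Phi>_def)
      also have "\<dots> = (\<integral>\<^sup>+p. indicator G (?\<Psi> p, s) \<partial>(?M \<Otimes>\<^sub>M ?A))"
        using measurable_compose[OF D(1) ms] by (rule QA.nn_integral_fst)
      also have "\<dots> = (\<integral>\<^sup>+y. indicator G (y, s) \<partial>distr (?M \<Otimes>\<^sub>M ?A) ?M ?\<Psi>)"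
        using ms by (subst nn_integral_distr[OF D(1)]) auto
      finally show "(\<integral>\<^sup>+x. \<integral>\<^sup>+a. indicator G (\<Phi> ((x, s), a)) \<partial>?A \<partial>?M) = (\<integral>\<^sup>+x. indicator G (x, s) \<partial>?M)"
        unfolding D(2) .
    qed
    also have "\<dots> = (\<integral>\<^sup>+p. indicator G p \<partial>(?M \<Otimes>\<^sub>M S))"
      by (intro QS.nn_integral_snd) measurable
    finally show "emeasure (distr ?P (?M \<Otimes>\<^sub>M S) \<Phi>) G = emeasure (?M \<Otimes>\<^sub>M S) G" by simp
  qed simp
qed

lemma PiM_Chebyshev:
  fixes Z :: "'i \<Rightarrow> 'a \<Rightarrow> real"
  assumes I: "finite I" and A: "prob_space A"
    and Z[measurable]: "\<And>i. i \<in> I \<Longrightarrow> Z i \<in> borel_measurable A"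
    and bound: "\<And>i a. i \<in> I \<Longrightarrow> a \<in> space A \<Longrightarrow> \<bar>Z i a\<bar> \<le> B"
    and mean: "\<And>i. i \<in> I \<Longrightarrow> (\<integral>a. Z i a \<partial>A) = 0" and c: "c > 0"
  shows "measure (Pi\<^sub>M I (\<lambda>_. A)) {a \<in> space (Pi\<^sub>M I (\<lambda>_. A)). \<bar>\<Sum>i\<in>I. Z i (a i)\<bar> \<ge> c}
           \<le> (\<Sum>i\<in>I. \<integral>a. (Z i a)\<^sup>2 \<partial>A) / c\<^sup>2"
proof -
  interpret A: prob_space A by fact
  let ?P = "Pi\<^sub>M I (\<lambda>_. A)"
  interpret P: prob_space ?P by (rule prob_space_PiM) (rule A)
  interpret PA: product_prob_space "\<lambda>_. A" I ..
  have Zi: "(\<lambda>a. Z i (a i)) \<in> borel_measurable ?P" if "i \<in> I" for i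
    using that by measurable
  have int: "integrable A (Z i)" if "i \<in> I" for i
    using bound[OF that] Z[OF that] by (intro A.integrable_const_bound[where B=B]) auto
  have intP: "integrable ?P (\<lambda>a. Z i (a i) * Z j (a j))" if "i \<in> I" "j \<in> I" for i j
  proof (rule P.integrable_const_bound[where B="B * B"])
    show "(\<lambda>a. Z i (a i) * Z j (a j)) \<in> borel_measurable ?P"
      using that by (intro borel_measurable_times Zi)
    show "AE a in ?P. norm (Z i (a i) * Z j (a j)) \<le> B * B"
    proof (rule AE_I2)
      fix a assume "a \<in> space ?P"
      then have "\<bar>Z i (a i)\<bar> \<le> B" "\<bar>Z j (a j)\<bar> \<le> B"
        using that by (auto intro!: bound simp: space_PiM)
      then show "norm (Z i (a i) * Z j (a j)) \<le> B * B"
        unfolding real_norm_def abs_mult by (intro mult_mono) auto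
    qed
  qed
  have off: "(\<integral>a. Z i (a i) * Z j (a j) \<partial>?P) = 0" if ij: "i \<in> I" "j \<in> I" "i \<noteq> j" for i j
  proof -
    \<comment> \<open>Padding with the constant 1 turns the mixed moment into a full product over
      \<open>I\<close>, which factorises; the factor at \<open>i\<close> is a mean and
      vanishes.\<close>
    let ?f = "\<lambda>k. if k = i then Z i else if k = j then Z j else (\<lambda>_. 1)"
    have "(\<Prod>k\<in>I. ?f k (a k)) = Z i (a i) * Z j (a j)" for a
    proof -
      have "(\<Prod>k\<in>I. ?f k (a k)) = ?f i (a i) * (\<Prod>k\<in>I - {i}. ?f k (a k))" by (rule prod.remove[OF I ij(1)])
      also have "(\<Prod>k\<in>I - {i}. ?f k (a k)) = ?f j (a j) * (\<Prod>k\<in>I - {i} - {j}. ?f k (a k))"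
        using ij I by (intro prod.remove) auto
      also have "(\<Prod>k\<in>I - {i} - {j}. ?f k (a k)) = 1" by (intro prod.neutral) auto
      finally show ?thesis using ij by simp
    qed
    then have "(\<integral>a. Z i (a i) * Z j (a j) \<partial>?P) = (\<integral>a. (\<Prod>k\<in>I. ?f k (a k)) \<partial>?P)" by simp
    also have "\<dots> = (\<Prod>k\<in>I. integral\<^sup>L A (?f k))"
      using int ij by (intro PA.product_integral_prod[OF I]) auto
    also have "\<dots> = 0" using ij mean I by (intro prod_zero bexI[of _ i]) auto
    finally show ?thesis .
  qed
  have diag: "(\<integral>a. Z i (a i) * Z i (a i) \<partial>?P) = (\<integral>a. (Z i a)\<^sup>2 \<partial>A)" if i: "i \<in> I" for i
  proof -
    have "(\<integral>a. (Z i a)\<^sup>2 \<partial>A) = (\<integral>a. (Z i a)\<^sup>2 \<partial>distr ?P A (\<lambda>a. a i))"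
      using PA.PiM_component[OF i] by simp
    also have "\<dots> = (\<integral>a. (Z i (a i))\<^sup>2 \<partial>?P)"
      using i by (intro integral_distr) measurable
    finally show ?thesis by (simp add: power2_eq_square)
  qed
  let ?X = "\<lambda>a. \<Sum>i\<in>I. Z i (a i)"
  have sq: "(?X a)\<^sup>2 = (\<Sum>i\<in>I. \<Sum>j\<in>I. Z i (a i) * Z j (a j))" for a
    by (simp add: power2_eq_square sum_product)
  have X[measurable]: "?X \<in> borel_measurable ?P" by (intro borel_measurable_sum Zi)
  have intX: "integrable ?P (\<lambda>a. (?X a)\<^sup>2)"
    unfolding sq by (intro Bochner_Integration.integrable_sum intP)
  have "(\<integral>a. (?X a)\<^sup>2 \<partial>?P) = (\<Sum>i\<in>I. \<Sum>j\<in>I. \<integral>a. Z i (a i) * Z j (a j) \<partial>?P)"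
    unfolding sq using intP by (subst Bochner_Integration.integral_sum) (auto intro!: sum.cong Bochner_Integration.integral_sum Bochner_Integration.integrable_sum)
  also have "\<dots> = (\<Sum>i\<in>I. \<integral>a. (Z i a)\<^sup>2 \<partial>A)"
  proof (rule sum.cong[OF refl])
    fix i assume i: "i \<in> I"
    have "(\<Sum>j\<in>I. \<integral>a. Z i (a i) * Z j (a j) \<partial>?P) = (\<integral>a. Z i (a i) * Z i (a i) \<partial>?P) + (\<Sum>j\<in>I - {i}. \<integral>a. Z i (a i) * Z j (a j) \<partial>?P)"
      by (rule sum.remove[OF I i])
    also have "(\<Sum>j\<in>I - {i}. \<integral>a. Z i (a i) * Z j (a j) \<partial>?P) = 0" using off i by (intro sum.neutral) auto
    finally show "(\<Sum>j\<in>I. \<integral>a. Z i (a i) * Z j (a j) \<partial>?P) = (\<integral>a. (Z i a)\<^sup>2 \<partial>A)" using diag[OF i] by simp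
  qed
  finally have EX: "(\<integral>a. (?X a)\<^sup>2 \<partial>?P) = (\<Sum>i\<in>I. \<integral>a. (Z i a)\<^sup>2 \<partial>A)" .
  have "{a \<in> space ?P. \<bar>?X a\<bar> \<ge> c} = {a \<in> space ?P. (?X a)\<^sup>2 \<ge> c\<^sup>2}"
    using c by (auto simp: abs_le_square_iff[symmetric])
  also have "measure ?P \<dots> \<le> (\<integral>a. (?X a)\<^sup>2 \<partial>?P) / c\<^sup>2"
    using c by (intro integral_Markov_inequality_measure[OF intX, of "{}"]) auto
  finally show ?thesis unfolding EX .
qed

text \<open>Whenever \<open>G'\<close> fails, the exchanged sample violates \<open>G\<close> with
  conditional probability at least \<open>p\<close>. As the exchanged sample has the original law,
  the failures of \<open>G'\<close> have at most \<open>1 / p\<close> times the outer probability of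
  those of \<open>G\<close>. The rule \<open>g\<close> may depend on the estimator through
  \<open>s\<close>.\<close>

lemma whp_resample:
  fixes M :: "'a measure" and A :: "'b measure" and S :: "nat \<Rightarrow> 's measure"
  assumes M: "prob_space M" and A: "prob_space A" and S: "\<And>n. prob_space (S n)"
    and P: "\<And>n. P n = Pi\<^sub>M {..<n} (\<lambda>_. M) \<Otimes>\<^sub>M S n"
    and g: "\<And>n. (\<lambda>(s, x, a). g n s x a) \<in> measurable (S n \<Otimes>\<^sub>M (M \<Otimes>\<^sub>M A)) M"
    and inv: "\<And>n s. s \<in> space (S n) \<Longrightarrow> distr (M \<Otimes>\<^sub>M A) M (\<lambda>(x, a). g n s x a) = M"
    and good: "whp P (\<lambda>n (x, s). G n x s)" and p: "p > 0"
    and reach: "\<forall>\<^sub>F n in sequentially. \<forall>x s. (x, s) \<in> space (P n) \<longrightarrow> \<not> G' n x s \<longrightarrow>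
      (\<exists>B\<in>sets (Pi\<^sub>M {..<n} (\<lambda>_. A)). ennreal p \<le> emeasure (Pi\<^sub>M {..<n} (\<lambda>_. A)) B \<and>
         (\<forall>a\<in>B. \<not> G n (\<lambda>i\<in>{..<n}. g n s (x i) (a i)) s))"
  shows "whp P (\<lambda>n (x, s). G' n x s)"
proof (rule whpI)
  let ?E = "\<lambda>n. {\<omega> \<in> space (P n). \<not> (case \<omega> of (x, s) \<Rightarrow> G n x s)}"
  let ?E' = "\<lambda>n. {\<omega> \<in> space (P n). \<not> (case \<omega> of (x, s) \<Rightarrow> G' n x s)}"
  show "\<forall>\<^sub>F n in sequentially. outer_measure_of (P n) (?E' n) \<le> ennreal (1 / p) * outer_measure_of (P n) (?E n)"
    using reach
  proof eventually_elim
    case (elim n)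
    let ?N = "Pi\<^sub>M {..<n} (\<lambda>_. A)"
    let ?\<Phi> = "\<lambda>((x, s), a). (\<lambda>i\<in>{..<n}. (\<lambda>(x, a). g n s x a) (x i, a i), s)"
    have g': "(\<lambda>(s, x, a). (\<lambda>(x, a). g n s x a) (x, a)) \<in> measurable (S n \<Otimes>\<^sub>M (M \<Otimes>\<^sub>M A)) M"
      using g[of n] by simp
    note \<Phi> = distr_PiM_coordinatewise_param[OF finite_lessThan[of n] M A S[of n] g' inv[where n=n], folded P[of n]]
    have N: "prob_space ?N" by (rule prob_space_PiM) (rule A)
    show ?case
    proof (rule outer_measure_of_resample[OF prob_space_imp_sigma_finite[OF N] _ _ _ _ p])
      show m: "?\<Phi> \<in> measurable (P n \<Otimes>\<^sub>M ?N) (P n)" using \<Phi>(1) by simp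
      show "distr (P n \<Otimes>\<^sub>M ?N) (P n) ?\<Phi> = P n" using \<Phi>(2) by simp
      fix \<omega> assume "\<omega> \<in> ?E' n"
      moreover obtain x s where \<omega>: "\<omega> = (x, s)" by (cases \<omega>)
      ultimately have xs: "(x, s) \<in> space (P n)" "\<not> G' n x s" by auto
      from mp[OF mp[OF spec[OF spec[OF elim]] xs(1)] xs(2)] obtain B where B: "B \<in> sets ?N"
        "ennreal p \<le> emeasure ?N B \<and> (\<forall>a\<in>B. \<not> G n (\<lambda>i\<in>{..<n}. g n s (x i) (a i)) s)"
        by (rule bexE)
      have "?\<Phi> (\<omega>, a) \<in> ?E n" if a: "a \<in> B" for a
      proof -
        have "(\<omega>, a) \<in> space (P n \<Otimes>\<^sub>M ?N)"
          using sets.sets_into_space[OF B(1)] a xs \<omega> by (auto simp: space_pair_measure)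
        from measurable_space[OF m this] show ?thesis using bspec[OF conjunct2[OF B(2)] a] \<omega> by simp
      qed
      then show "\<exists>A\<in>sets ?N. ennreal p \<le> emeasure ?N A \<and> (\<forall>a\<in>A. ?\<Phi> (\<omega>, a) \<in> ?E n)"
        using B by (intro bexI[of _ B]) auto
    qed auto
  qed
  have "(\<lambda>n. ennreal (1 / p) * outer_measure_of (P n) (?E n)) \<longlonglongrightarrow> ennreal (1 / p) * 0"
    using good unfolding whp_def by (intro ennreal_tendsto_cmult) auto
  then show "(\<lambda>n. ennreal (1 / p) * outer_measure_of (P n) (?E n)) \<longlonglongrightarrow> 0"
    by simp
qed

text \<open>Given \<open>s\<close> the summands are independent, identically distributed and
  centred. Chebyshev's inequality holds conditionally with a bound free of \<open>s\<close>, and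
  integrating over \<open>s\<close> preserves it.\<close>

lemma whp_Chebyshev:
  fixes M :: "'a measure" and S :: "nat \<Rightarrow> 's measure" and Z :: "nat \<Rightarrow> 's \<Rightarrow> 'a \<Rightarrow> real"
  assumes M: "prob_space M" and S: "\<And>n. prob_space (S n)"
    and P: "\<And>n. P n = Pi\<^sub>M {..<n} (\<lambda>_. M) \<Otimes>\<^sub>M S n"
    and Z: "\<And>n. (\<lambda>(s, x). Z n s x) \<in> borel_measurable (S n \<Otimes>\<^sub>M M)"
    and bound: "\<And>n s x. s \<in> space (S n) \<Longrightarrow> x \<in> space M \<Longrightarrow> \<bar>Z n s x\<bar> \<le> B n"
    and mean: "\<And>n s. s \<in> space (S n) \<Longrightarrow> (\<integral>x. Z n s x \<partial>M) = 0"
    and var: "\<And>n s. s \<in> space (S n) \<Longrightarrow> (\<integral>x. (Z n s x)\<^sup>2 \<partial>M) \<le> v n" "v \<longlonglongrightarrow> 0" and c: "c > 0"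
  shows "whp P (\<lambda>n (x, s). \<bar>\<Sum>i<n. Z n s (x i)\<bar> \<le> c * sqrt (real n))"
proof (rule whpI)
  interpret M: prob_space M by fact
  show "\<forall>\<^sub>F n in sequentially. outer_measure_of (P n) {\<omega> \<in> space (P n). \<not> (case \<omega> of (x, s) \<Rightarrow> \<bar>\<Sum>i<n. Z n s (x i)\<bar> \<le> c * sqrt (real n))}
      \<le> ennreal (v n / c\<^sup>2)"
    using eventually_gt_at_top[of 0]
  proof eventually_elim
    case (elim n)
    interpret S: prob_space "S n" by (rule S)
    let ?M = "Pi\<^sub>M {..<n} (\<lambda>_. M)"
    interpret QM: prob_space ?M by (rule prob_space_PiM) (rule M)
    interpret QS: pair_prob_space ?M "S n" ..
    have Zi: "(\<lambda>w. Z n (snd w) (fst w i)) \<in> borel_measurable (P n)" if "i \<in> {..<n}" for i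
    proof -
      have "(\<lambda>w. (snd w, fst w i)) \<in> measurable (P n) (S n \<Otimes>\<^sub>M M)" using that unfolding P by measurable
      from measurable_compose[OF this Z] show ?thesis by simp
    qed
    let ?E = "{w \<in> space (P n). \<bar>\<Sum>i<n. Z n (snd w) (fst w i)\<bar> \<ge> c * sqrt (real n)}"
    have sm: "(\<lambda>w. \<bar>\<Sum>i<n. Z n (snd w) (fst w i)\<bar>) \<in> borel_measurable (P n)"
      by (intro borel_measurable_abs borel_measurable_sum Zi)
    have E: "?E \<in> sets (P n)" using sm by measurable
    have "outer_measure_of (P n) {\<omega> \<in> space (P n). \<not> (case \<omega> of (x, s) \<Rightarrow> \<bar>\<Sum>i<n. Z n s (x i)\<bar> \<le> c * sqrt (real n))}
        \<le> outer_measure_of (P n) ?E"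
      by (intro outer_measure_of_mono) auto
    also have "\<dots> = emeasure (P n) ?E" using E by (rule outer_measure_of_eq)
    also have "\<dots> = (\<integral>\<^sup>+s. emeasure ?M ((\<lambda>x. (x, s)) -` ?E) \<partial>S n)"
      using E unfolding P by (rule QS.emeasure_pair_measure_alt2)
    also have "\<dots> \<le> (\<integral>\<^sup>+s. ennreal (v n / c\<^sup>2) \<partial>S n)"
    proof (rule nn_integral_mono)
      fix s assume s: "s \<in> space (S n)"
      have Zs: "Z n s \<in> borel_measurable M" using measurable_Pair2[OF Z s] by simp
      have eq: "(\<lambda>x. (x, s)) -` ?E = {x \<in> space ?M. \<bar>\<Sum>i<n. Z n s (x i)\<bar> \<ge> c * sqrt (real n)}"
        using s by (auto simp: P space_pair_measure)
      have "emeasure ?M ((\<lambda>x. (x, s)) -` ?E) = ennreal (measure ?M {x \<in> space ?M. \<bar>\<Sum>i<n. Z n s (x i)\<bar> \<ge> c * sqrt (real n)})"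
        unfolding eq by (rule QM.emeasure_eq_measure)
      also have "\<dots> \<le> ennreal ((\<Sum>i<n. \<integral>x. (Z n s x)\<^sup>2 \<partial>M) / (c * sqrt (real n))\<^sup>2)"
        using elim c bound[OF s] mean[OF s] Zs
        by (intro ennreal_leI PiM_Chebyshev[OF finite_lessThan M]) auto
      also have "\<dots> \<le> ennreal (v n / c\<^sup>2)"
      proof (rule ennreal_leI)
        have "(\<Sum>i<n. \<integral>x. (Z n s x)\<^sup>2 \<partial>M) / (c * sqrt (real n))\<^sup>2 = (\<integral>x. (Z n s x)\<^sup>2 \<partial>M) / c\<^sup>2"
          using elim c by (simp add: power_mult_distrib)
        also have "\<dots> \<le> v n / c\<^sup>2" using var(1)[OF s] by (intro divide_right_mono) auto
        finally show "(\<Sum>i<n. \<integral>x. (Z n s x)\<^sup>2 \<partial>M) / (c * sqrt (real n))\<^sup>2 \<le> v n / c\<^sup>2" .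
      qed
      finally show "emeasure ?M ((\<lambda>x. (x, s)) -` ?E) \<le> ennreal (v n / c\<^sup>2)" .
    qed
    finally show ?case by (simp add: S.emeasure_space_1)
  qed
  have "(\<lambda>n. v n / c\<^sup>2) \<longlonglongrightarrow> 0 / c\<^sup>2" using c by (intro tendsto_intros var(2)) auto
  from tendsto_ennrealI[OF this] show "(\<lambda>n. ennreal (v n / c\<^sup>2)) \<longlonglongrightarrow> 0"
    by (simp only: div_0 ennreal_0)
qed

section \<open>Exchanging a point for an independent copy\<close>

definition unit_law :: "real measure" where
  "unit_law = uniform_measure lborel {0..1}"

lemma sets_unit_law [measurable_cong, simp]: "sets unit_law = sets borel"
  and space_unit_law [simp]: "space unit_law = UNIV"
  by (simp_all add: unit_law_def)

lemma prob_space_unit_law: "prob_space unit_law"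
  unfolding unit_law_def by (intro prob_space_uniform_measure) auto

lemma measure_unit_law_less:
  assumes "0 \<le> r" "r \<le> 1"
  shows "measure unit_law {u. u < r} = r" "measure unit_law {u. \<not> u < r} = 1 - r"
proof -
  interpret prob_space unit_law by (rule prob_space_unit_law)
  have "emeasure lborel ({0..1} \<inter> {u. u < r}) = ennreal r"
  proof -
    have "{0..1} \<inter> {u. u < r} = {0..<r}" using assms by auto
    then show ?thesis using assms by simp
  qed
  then show 1: "measure unit_law {u. u < r} = r"
    using assms unfolding unit_law_def by (subst measure_uniform_measure) (auto simp: measure_def)
  have "measure unit_law (space unit_law - {u. u < r}) = 1 - measure unit_law {u. u < r}"
    by (rule prob_compl) measurable
  then show "measure unit_law {u. \<not> u < r} = 1 - r"
    using 1 by (simp add: set_diff_eq)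
qed

text \<open>
  Exchanging \<open>x\<close> for an independent copy is reversible, hence preserves the law, as soon as
  the exchange probability is symmetric.
\<close>

lemma distr_exchange:
  assumes M: "prob_space M" and U: "prob_space U"
    and c[measurable]: "Measurable.pred (U \<Otimes>\<^sub>M (M \<Otimes>\<^sub>M M)) (\<lambda>(u, x, y). c u x y)"
    and sym: "\<And>x y. x \<in> space M \<Longrightarrow> y \<in> space M \<Longrightarrow>
                emeasure U {u \<in> space U. c u x y} = emeasure U {u \<in> space U. c u y x}"
  shows "distr (M \<Otimes>\<^sub>M (U \<Otimes>\<^sub>M M)) M (\<lambda>(x, u, y). if c u x y then y else x) = M"
proof (rule measure_eqI)
  interpret M: prob_space M by fact
  interpret U: prob_space U by fact
  interpret MM: pair_prob_space M M ..
  interpret UM: pair_prob_space U M ..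
  let ?g = "\<lambda>(x, u, y). if c u x y then y else x"
  have c'[measurable]: "Measurable.pred (M \<Otimes>\<^sub>M (U \<Otimes>\<^sub>M M)) (\<lambda>(x, u, y). c u x y)"
  proof -
    have "(\<lambda>w. (fst (snd w), fst w, snd (snd w))) \<in> measurable (M \<Otimes>\<^sub>M (U \<Otimes>\<^sub>M M)) (U \<Otimes>\<^sub>M (M \<Otimes>\<^sub>M M))"
      by measurable
    from measurable_compose[OF this c] show ?thesis by (simp add: case_prod_beta')
  qed
  have g[measurable]: "?g \<in> measurable (M \<Otimes>\<^sub>M (U \<Otimes>\<^sub>M M)) M"
    using c' unfolding case_prod_beta' by measurable
  fix B assume "B \<in> sets (distr (M \<Otimes>\<^sub>M (U \<Otimes>\<^sub>M M)) M ?g)"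
  then have B[measurable]: "B \<in> sets M" by simp
  define R where "R x y = emeasure U {u \<in> space U. c u x y}" for x y
  have R[measurable]: "(\<lambda>(x, y). R x y) \<in> borel_measurable (M \<Otimes>\<^sub>M M)"
  proof -
    have "(\<lambda>w. \<integral>\<^sup>+u. indicator {u \<in> space U. c u (fst w) (snd w)} u \<partial>U) \<in> borel_measurable (M \<Otimes>\<^sub>M M)"
    proof (rule U.borel_measurable_nn_integral)
      have "(\<lambda>(w, u). of_bool (c u (fst w) (snd w)) :: ennreal) \<in> borel_measurable ((M \<Otimes>\<^sub>M M) \<Otimes>\<^sub>M U)"
      proof -
        have "(\<lambda>v. (snd v, fst v)) \<in> measurable ((M \<Otimes>\<^sub>M M) \<Otimes>\<^sub>M U) (U \<Otimes>\<^sub>M (M \<Otimes>\<^sub>M M))" by measurable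
        from measurable_compose[OF this c]
        have [measurable]: "Measurable.pred ((M \<Otimes>\<^sub>M M) \<Otimes>\<^sub>M U) (\<lambda>v. c (snd v) (fst (fst v)) (snd (fst v)))"
          by (simp add: case_prod_beta')
        show ?thesis unfolding case_prod_beta' of_bool_def by measurable
      qed
      also have "?this \<longleftrightarrow> (\<lambda>(w, u). indicator {u \<in> space U. c u (fst w) (snd w)} u :: ennreal) \<in> borel_measurable ((M \<Otimes>\<^sub>M M) \<Otimes>\<^sub>M U)"
        by (intro measurable_cong) (auto simp: space_pair_measure indicator_def)
      finally show "(\<lambda>(w, u). indicator {u \<in> space U. c u (fst w) (snd w)} u :: ennreal) \<in> borel_measurable ((M \<Otimes>\<^sub>M M) \<Otimes>\<^sub>M U)" .
    qed
    also have "?this \<longleftrightarrow> ?thesis"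
    proof (intro measurable_cong)
      fix w assume w: "w \<in> space (M \<Otimes>\<^sub>M M)"
      have "Measurable.pred U (\<lambda>u. c u (fst w) (snd w))"
        using measurable_Pair1[OF c w] by (simp add: case_prod_beta')
      then show "(\<integral>\<^sup>+u. indicator {u \<in> space U. c u (fst w) (snd w)} u \<partial>U) = (case w of (x, y) \<Rightarrow> R x y)"
        by (simp add: R_def case_prod_beta' pred_def)
    qed
    finally show ?thesis .
  qed
  have cu: "Measurable.pred U (\<lambda>u. c u x y)" if "x \<in> space M" "y \<in> space M" for x y
    using measurable_Pair1[OF c, of "(x, y)"] that by (simp add: space_pair_measure)
  have "emeasure (distr (M \<Otimes>\<^sub>M (U \<Otimes>\<^sub>M M)) M ?g) B = (\<integral>\<^sup>+w. indicator B (?g w) \<partial>(M \<Otimes>\<^sub>M (U \<Otimes>\<^sub>M M)))"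
    by (subst nn_integral_indicator[symmetric], simp, subst nn_integral_distr) auto
  also have "\<dots> = (\<integral>\<^sup>+x. \<integral>\<^sup>+v. indicator B (?g (x, v)) \<partial>(U \<Otimes>\<^sub>M M) \<partial>M)"
    by (rule UM.nn_integral_fst[symmetric]) measurable
  also have "\<dots> = (\<integral>\<^sup>+x. \<integral>\<^sup>+y. R x y * indicator B y + (1 - R x y) * indicator B x \<partial>M \<partial>M)"
  proof (rule nn_integral_cong)
    fix x assume x: "x \<in> space M"
    have mv: "(\<lambda>v. indicator B (?g (x, v)) :: ennreal) \<in> borel_measurable (U \<Otimes>\<^sub>M M)"
      using x by measurable
    have "(\<integral>\<^sup>+v. indicator B (?g (x, v)) \<partial>(U \<Otimes>\<^sub>M M)) = (\<integral>\<^sup>+y. \<integral>\<^sup>+u. indicator B (?g (x, u, y)) \<partial>U \<partial>M)"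
      using UM.nn_integral_snd[of "\<lambda>v. indicator B (?g (x, v))"] mv by (simp add: case_prod_beta')
    also have "\<dots> = (\<integral>\<^sup>+y. R x y * indicator B y + (1 - R x y) * indicator B x \<partial>M)"
    proof (rule nn_integral_cong)
      fix y assume y: "y \<in> space M"
      let ?C = "{u \<in> space U. c u x y}"
      have C: "?C \<in> sets U" using cu[OF x y] by (simp add: pred_def)
      have "(\<integral>\<^sup>+u. indicator B (?g (x, u, y)) \<partial>U)
          = (\<integral>\<^sup>+u. indicator B y * indicator ?C u + indicator B x * indicator (space U - ?C) u \<partial>U)"
        by (intro nn_integral_cong) (auto simp: indicator_def)
      also have "\<dots> = indicator B y * emeasure U ?C + indicator B x * emeasure U (space U - ?C)"
        using C by (subst nn_integral_add) (auto simp: nn_integral_cmult_indicator)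
      also have "emeasure U (space U - ?C) = 1 - R x y"
        using C by (subst emeasure_compl) (auto simp: U.emeasure_space_1 R_def)
      finally show "(\<integral>\<^sup>+u. indicator B (?g (x, u, y)) \<partial>U) = R x y * indicator B y + (1 - R x y) * indicator B x"
        by (simp add: R_def mult.commute)
    qed
    finally show "(\<integral>\<^sup>+v. indicator B (?g (x, v)) \<partial>(U \<Otimes>\<^sub>M M)) = (\<integral>\<^sup>+y. R x y * indicator B y + (1 - R x y) * indicator B x \<partial>M)" .
  qed
  also have "\<dots> = (\<integral>\<^sup>+w. R (fst w) (snd w) * indicator B (snd w) + (1 - R (fst w) (snd w)) * indicator B (fst w) \<partial>(M \<Otimes>\<^sub>M M))"
    using R by (subst M.nn_integral_fst[symmetric]) (auto simp: case_prod_beta')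
  also have "\<dots> = (\<integral>\<^sup>+w. R (fst w) (snd w) * indicator B (snd w) \<partial>(M \<Otimes>\<^sub>M M))
       + (\<integral>\<^sup>+w. (1 - R (fst w) (snd w)) * indicator B (fst w) \<partial>(M \<Otimes>\<^sub>M M))"
    using R by (intro nn_integral_add) (auto simp: case_prod_beta')
  \<comment> \<open>Reversibility: relabelling the two independent copies and using the symmetry of
    \<open>R\<close> shows that the mass moved into \<open>B\<close> equals the mass moved out of
    it.\<close>
  also have "(\<integral>\<^sup>+w. R (fst w) (snd w) * indicator B (snd w) \<partial>(M \<Otimes>\<^sub>M M))
      = (\<integral>\<^sup>+w. R (fst w) (snd w) * indicator B (fst w) \<partial>(M \<Otimes>\<^sub>M M))"
  proof -
    have "(\<integral>\<^sup>+w. R (fst w) (snd w) * indicator B (snd w) \<partial>(M \<Otimes>\<^sub>M M))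
        = (\<integral>\<^sup>+y. \<integral>\<^sup>+x. R x y * indicator B y \<partial>M \<partial>M)"
      using R by (subst MM.nn_integral_snd[symmetric]) (auto simp: case_prod_beta')
    also have "\<dots> = (\<integral>\<^sup>+y. \<integral>\<^sup>+x. R y x * indicator B y \<partial>M \<partial>M)"
      by (intro nn_integral_cong) (simp add: R_def sym)
    also have "\<dots> = (\<integral>\<^sup>+w. R (fst w) (snd w) * indicator B (fst w) \<partial>(M \<Otimes>\<^sub>M M))"
      using R by (subst M.nn_integral_fst[symmetric]) (auto simp: case_prod_beta')
    finally show ?thesis .
  qed
  also have "(\<integral>\<^sup>+w. R (fst w) (snd w) * indicator B (fst w) \<partial>(M \<Otimes>\<^sub>M M))
       + (\<integral>\<^sup>+w. (1 - R (fst w) (snd w)) * indicator B (fst w) \<partial>(M \<Otimes>\<^sub>M M))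
      = (\<integral>\<^sup>+w. R (fst w) (snd w) * indicator B (fst w) + (1 - R (fst w) (snd w)) * indicator B (fst w) \<partial>(M \<Otimes>\<^sub>M M))"
    using R by (intro nn_integral_add[symmetric]) (auto simp: case_prod_beta')
  also have "\<dots> = (\<integral>\<^sup>+w. indicator B (fst w) \<partial>(M \<Otimes>\<^sub>M M))"
  proof (intro nn_integral_cong)
    fix w :: "'a \<times> 'a"
    have "R (fst w) (snd w) \<le> 1" unfolding R_def by (rule U.emeasure_le_1)
    then show "R (fst w) (snd w) * indicator B (fst w) + (1 - R (fst w) (snd w)) * indicator B (fst w) = (indicator B (fst w) :: ennreal)"
      by (simp add: distrib_right[symmetric] add_diff_inverse_ennreal)
  qed
  also have "\<dots> = (\<integral>\<^sup>+x. \<integral>\<^sup>+y. indicator B x \<partial>M \<partial>M)"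
    by (subst M.nn_integral_fst[symmetric]) auto
  also have "\<dots> = emeasure M B" by (simp add: M.emeasure_space_1)
  finally show "emeasure (distr (M \<Otimes>\<^sub>M (U \<Otimes>\<^sub>M M)) M ?g) B = emeasure M B" .
qed simp

section \<open>Multipliers of uniformly small empirical processes\<close>

lemma cos_bounds:
  fixes y :: real
  assumes "\<bar>y\<bar> \<le> 1"
  shows "0 \<le> cos y" "cos y \<le> 1 - y\<^sup>2 / 4"
proof -
  have "cmod (iexp y - (\<Sum>k\<le>3. (\<i> * y) ^ k / fact k)) \<le> \<bar>y\<bar> ^ Suc 3 / fact (Suc 3)"
    by (rule iexp_approx1)
  then have "\<bar>Re (iexp y - (\<Sum>k\<le>3. (\<i> * y) ^ k / fact k))\<bar> \<le> \<bar>y\<bar> ^ 4 / 24"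
    using abs_Re_le_cmod[of "iexp y - (\<Sum>k\<le>3. (\<i> * y) ^ k / fact k)"]
    by (simp add: fact_numeral)
  also have "Re (iexp y - (\<Sum>k\<le>3. (\<i> * y) ^ k / fact k)) = cos y - (1 - y\<^sup>2 / 2)"
    by (simp add: numeral_3_eq_3 Re_exp power2_eq_square eval_nat_numeral)
  finally have b: "\<bar>cos y - (1 - y\<^sup>2 / 2)\<bar> \<le> \<bar>y\<bar> ^ 4 / 24" .
  have y2: "y\<^sup>2 \<le> 1" using assms by (simp add: abs_square_le_1)
  have "\<bar>y\<bar> ^ 4 = y\<^sup>2 * y\<^sup>2" by (simp add: power4_eq_xxxx power2_eq_square abs_mult[symmetric] mult.assoc)
  also have "\<dots> \<le> y\<^sup>2 * 1" using y2 by (intro mult_left_mono) auto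
  finally have y4: "\<bar>y\<bar> ^ 4 \<le> y\<^sup>2" by simp
  show "cos y \<le> 1 - y\<^sup>2 / 4" using b y4 zero_le_power2[of y] by linarith
  show "0 \<le> cos y" using b y4 y2 zero_le_power2[of y] by linarith
qed

lemma cos_ge_quadratic: "cos y \<ge> 1 - y\<^sup>2 / 2" for y :: real
proof -
  have "cos y = 1 - 2 * (sin (y / 2))\<^sup>2" using cos_double_sin[of "y / 2"] by simp
  moreover have "(sin (y / 2))\<^sup>2 \<le> (y / 2)\<^sup>2"
    using abs_sin_x_le_abs_x[of "y / 2"] by (simp only: abs_le_square_iff)
  ultimately show ?thesis by (simp add: power_divide)
qed

text \<open>The class may vary with \<open>n\<close> and has no entropy or separability structure;
  only its members are measurable. Every statement about all of its members therefore concerns a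
  possibly nonmeasurable event, which is why resampling replaces symmetrisation in
  expectation.\<close>

locale empirical_class =
  fixes M :: "'a measure" and S :: "nat \<Rightarrow> 's measure" and P :: "nat \<Rightarrow> ((nat \<Rightarrow> 'a) \<times> 's) measure"
    and K :: "nat \<Rightarrow> ('a \<Rightarrow> real) set" and \<epsilon> :: "nat \<Rightarrow> real"
  assumes M: "prob_space M" and S: "\<And>n. prob_space (S n)"
    and P: "\<And>n. P n = Pi\<^sub>M {..<n} (\<lambda>_. M) \<Otimes>\<^sub>M S n"
    and K_measurable: "\<And>n h. h \<in> K n \<Longrightarrow> h \<in> borel_measurable M"
    and K_bound: "\<And>n h x. h \<in> K n \<Longrightarrow> \<bar>h x\<bar> \<le> 1"
    and K_L2: "\<And>n h. h \<in> K n \<Longrightarrow> (\<integral>x. (h x)\<^sup>2 \<partial>M) \<le> (\<epsilon> n)\<^sup>2"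
    and \<epsilon>: "\<epsilon> \<longlonglongrightarrow> 0"
    and K_empirical: "\<And>c. c > 0 \<Longrightarrow> whp P (\<lambda>n (x, s). \<forall>h\<in>K n. \<bar>emp_process M n x h\<bar> \<le> c)"
begin

sublocale M: prob_space M by (rule M)

lemma K_integrable:
  assumes "h \<in> K n"
  shows "integrable M h" "integrable M (\<lambda>x. (h x)\<^sup>2)"
proof -
  show "integrable M h"
    using K_bound[OF assms] K_measurable[OF assms] by (intro M.integrable_const_bound[where B=1]) auto
  have "\<bar>(h x)\<^sup>2\<bar> \<le> 1" for x using K_bound[OF assms, of x] by (simp add: abs_square_le_1)
  then show "integrable M (\<lambda>x. (h x)\<^sup>2)"
    using K_measurable[OF assms] by (intro M.integrable_const_bound[where B=1]) auto
qed

lemma K_L1: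
  assumes "h \<in> K n"
  shows "(\<integral>x. \<bar>h x\<bar> \<partial>M) \<le> \<bar>\<epsilon> n\<bar>"
proof -
  have i: "integrable M (\<lambda>x. \<bar>h x\<bar>)" using K_integrable[OF assms] by auto
  have "0 \<le> (\<integral>x. (\<bar>h x\<bar>)\<^sup>2 \<partial>M) - (\<integral>x. \<bar>h x\<bar> \<partial>M)\<^sup>2"
    using M.variance_positive[of "\<lambda>x. \<bar>h x\<bar>"] M.variance_eq[OF i] K_integrable[OF assms] by simp
  then have "(\<integral>x. \<bar>h x\<bar> \<partial>M)\<^sup>2 \<le> (\<epsilon> n)\<^sup>2" using K_L2[OF assms] by simp
  then have "\<bar>\<integral>x. \<bar>h x\<bar> \<partial>M\<bar> \<le> \<bar>\<epsilon> n\<bar>" by (simp only: abs_le_square_iff)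
  then show ?thesis by linarith
qed

lemma \<epsilon>_small: "c > 0 \<Longrightarrow> \<forall>\<^sub>F n in sequentially. (\<epsilon> n)\<^sup>2 \<le> c"
proof -
  assume "c > 0"
  have "(\<lambda>n. (\<epsilon> n)\<^sup>2) \<longlonglongrightarrow> 0\<^sup>2" by (intro tendsto_power \<epsilon>)
  then have "\<forall>\<^sub>F n in sequentially. (\<epsilon> n)\<^sup>2 < c" using \<open>c > 0\<close> by (intro order_tendstoD) auto
  then show ?thesis by eventually_elim simp
qed

abbreviation "aux \<equiv> unit_law \<Otimes>\<^sub>M M"

lemma prob_space_aux: "prob_space aux"
proof -
  interpret prob_space unit_law by (rule prob_space_unit_law)
  interpret pair_prob_space unit_law M ..
  show ?thesis by unfold_locales
qed

text \<open>
  Exchanging the sample points for independent copies according to fair coins, and according to the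
  complementary coins, gives two samples of the original law. Their empirical processes differ by a
  sum of random signs, whose characteristic function shows that it is small only if the squares are.
\<close>

lemma half_exchange_cos:
  assumes h: "h \<in> K n" and n: "n \<ge> 4"
  defines "\<tau> \<equiv> \<lambda>(u, y) b. (if u < 1/2 then h y - h b else h b - h y) / sqrt (real n)"
  shows "(\<integral>a. cos (\<Sum>i<n. \<tau> (a i) (x i)) \<partial>Pi\<^sub>M {..<n} (\<lambda>_. aux))
           \<le> exp (- (emp_mean n x (\<lambda>x. (h x)\<^sup>2) / 2 - (\<epsilon> n)\<^sup>2) / 4)"
proof -
  interpret U: prob_space unit_law by (rule prob_space_unit_law)
  interpret A: prob_space aux by (rule prob_space_aux)
  interpret UM: pair_prob_space unit_law M ..
  let ?Q = "Pi\<^sub>M {..<n} (\<lambda>_. aux)"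
  interpret Q: prob_space ?Q by (rule prob_space_PiM) (rule prob_space_aux)
  interpret PA: product_prob_space "\<lambda>_. aux" "{..<n}" ..
  note [measurable] = K_measurable[OF h]
  \<comment> \<open>Differences of values of \<open>h\<close> are at most 2, so
    \<open>n \<ge> 4\<close> keeps each scaled increment within the range where
    \<open>cos_bounds\<close> applies.\<close>
  have sn: "sqrt (real n) \<ge> 2" using n by (intro real_le_rsqrt) auto
  have \<tau>m[measurable]: "(\<lambda>a. \<tau> a b) \<in> borel_measurable aux" for b
    unfolding \<tau>_def case_prod_beta' by measurable
  have dm[measurable]: "(\<lambda>y. (h y - h b) / sqrt (real n)) \<in> borel_measurable M" for b by measurable
  have d1: "\<bar>(h y - h b) / sqrt (real n)\<bar> \<le> 1" for y b
  proof -
    have "\<bar>h y - h b\<bar> \<le> sqrt (real n)" using K_bound[OF h, of y] K_bound[OF h, of b] sn by linarith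
    then show ?thesis using n by (simp add: abs_divide)
  qed
  have ex: "(\<integral>a. iexp (\<tau> a b) \<partial>aux) = complex_of_real (\<integral>y. cos ((h y - h b) / sqrt (real n)) \<partial>M)" for b
  proof -
    let ?d = "\<lambda>y. (h y - h b) / sqrt (real n)"
    \<comment> \<open>The coin enters as a sign. The cosine ignores it and the sine is odd, so
      averaging over the coin leaves a real characteristic function for each exchanged
      point.\<close>
    define sg where "sg u = (if u < (1/2::real) then 1 else - 1 :: real)" for u
    have sgm[measurable]: "sg \<in> borel_measurable borel" unfolding sg_def by measurable
    have eq: "iexp (\<tau> a b) = complex_of_real (cos (?d (snd a))) + \<i> * complex_of_real (sg (fst a) * sin (?d (snd a)))" for a
    proof -
      have "iexp (\<tau> a b) = complex_of_real (cos (\<tau> a b)) + \<i> * complex_of_real (sin (\<tau> a b))"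
        by (simp add: complex_eq_iff Re_exp Im_exp)
      moreover have "\<tau> a b = sg (fst a) * ?d (snd a)" by (auto simp: \<tau>_def sg_def case_prod_beta' minus_divide_left)
      moreover have "cos (sg u * d) = cos d" "sin (sg u * d) = sg u * sin d" for u d
        by (cases "u < 1/2"; simp add: sg_def)+
      ultimately show ?thesis by (simp only:)
    qed
    have i1: "integrable aux (\<lambda>a. cos (?d (snd a)))"
      by (intro A.integrable_const_bound[where B=1]) auto
    have i2: "integrable aux (\<lambda>a. sg (fst a) * sin (?d (snd a)))"
      by (intro A.integrable_const_bound[where B=1]) (auto simp: sg_def abs_mult)
    have c: "(\<integral>a. cos (?d (snd a)) \<partial>aux) = (\<integral>y. cos (?d y) \<partial>M)"
      using UM.integral_fst'[OF i1] by (simp add: U.prob_space[unfolded space_unit_law])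
    have sg0: "(\<integral>u. sg u \<partial>unit_law) = 0"
    proof -
      have "sg u = indicator {u. u < 1/2} u - indicator {u. \<not> u < 1/2} u" for u by (auto simp: sg_def)
      then have "(\<integral>u. sg u \<partial>unit_law) = (\<integral>u. indicator {u. u < 1/2} u - indicator {u. \<not> u < 1/2} u \<partial>unit_law)" by simp
      also have "\<dots> = measure unit_law {u. u < 1/2} - measure unit_law {u. \<not> u < 1/2}"
        by (subst Bochner_Integration.integral_diff) (auto simp: U.emeasure_eq_measure)
      finally show ?thesis using measure_unit_law_less[of "1/2"] by simp
    qed
    have s: "(\<integral>a. sg (fst a) * sin (?d (snd a)) \<partial>aux) = 0"
      using UM.integral_fst'[OF i2] sg0 by simp
    have "(\<integral>a. iexp (\<tau> a b) \<partial>aux) = (\<integral>a. complex_of_real (cos (?d (snd a))) \<partial>aux) + (\<integral>a. \<i> * complex_of_real (sg (fst a) * sin (?d (snd a))) \<partial>aux)"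
      unfolding eq by (intro Bochner_Integration.integral_add integrable_of_real i1 integrable_mult_right i2)
    also have "\<dots> = complex_of_real (\<integral>a. cos (?d (snd a)) \<partial>aux) + \<i> * complex_of_real (\<integral>a. sg (fst a) * sin (?d (snd a)) \<partial>aux)"
      by (simp only: integral_complex_of_real integral_mult_right_zero)
    finally show ?thesis unfolding c s by simp
  qed
  have "(\<integral>a. iexp (\<Sum>i<n. \<tau> (a i) (x i)) \<partial>?Q) = (\<integral>a. (\<Prod>i<n. iexp (\<tau> (a i) (x i))) \<partial>?Q)"
    by (simp add: exp_sum sum_distrib_left)
  also have "\<dots> = (\<Prod>i<n. \<integral>a. iexp (\<tau> a (x i)) \<partial>aux)"
    by (intro PA.product_integral_prod A.integrable_const_bound[where B=1]) auto
  also have "\<dots> = complex_of_real (\<Prod>i<n. \<integral>y. cos ((h y - h (x i)) / sqrt (real n)) \<partial>M)"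
    unfolding ex by simp
  finally have eq: "(\<integral>a. iexp (\<Sum>i<n. \<tau> (a i) (x i)) \<partial>?Q)
      = complex_of_real (\<Prod>i<n. \<integral>y. cos ((h y - h (x i)) / sqrt (real n)) \<partial>M)" .
  have "Re (\<integral>a. iexp (\<Sum>i<n. \<tau> (a i) (x i)) \<partial>?Q) = (\<Prod>i<n. \<integral>y. cos ((h y - h (x i)) / sqrt (real n)) \<partial>M)"
    unfolding eq by (rule Re_complex_of_real)
  moreover have "Re (\<integral>a. iexp (\<Sum>i<n. \<tau> (a i) (x i)) \<partial>?Q) = (\<integral>a. Re (iexp (\<Sum>i<n. \<tau> (a i) (x i))) \<partial>?Q)"
  proof (rule integral_Re[symmetric])
    have [measurable]: "(\<lambda>a. \<tau> (a i) (x i)) \<in> borel_measurable ?Q" if "i \<in> {..<n}" for i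
      using measurable_compose[OF measurable_component_singleton[OF that] \<tau>m] .
    have "(\<lambda>a. \<Sum>i<n. \<tau> (a i) (x i)) \<in> borel_measurable ?Q" by measurable
    then show "integrable ?Q (\<lambda>a. iexp (\<Sum>i<n. \<tau> (a i) (x i)))"
      by (intro Q.integrable_iexp) auto
  qed
  ultimately have "(\<integral>a. cos (\<Sum>i<n. \<tau> (a i) (x i)) \<partial>?Q) = (\<Prod>i<n. \<integral>y. cos ((h y - h (x i)) / sqrt (real n)) \<partial>M)"
    by (simp add: Re_exp)
  also have "\<dots> \<le> (\<Prod>i<n. exp (- ((h (x i))\<^sup>2 / 2 - (\<epsilon> n)\<^sup>2) / (4 * real n)))"
  proof (rule prod_mono)
    fix i
    let ?d = "\<lambda>y. (h y - h (x i)) / sqrt (real n)"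
    have ic: "integrable M (\<lambda>y. cos (?d y))" by (intro M.integrable_const_bound[where B=1]) auto
    have "0 \<le> (\<integral>y. cos (?d y) \<partial>M)" by (intro Bochner_Integration.integral_nonneg cos_bounds(1)[OF d1])
    moreover have "(\<integral>y. cos (?d y) \<partial>M) \<le> exp (- ((h (x i))\<^sup>2 / 2 - (\<epsilon> n)\<^sup>2) / (4 * real n))"
    proof -
      have "(\<integral>y. cos (?d y) \<partial>M) \<le> (\<integral>y. 1 - ((h (x i))\<^sup>2 / 2 - (h y)\<^sup>2) / (4 * real n) \<partial>M)"
      proof (rule integral_mono[OF ic])
        show "integrable M (\<lambda>y. 1 - ((h (x i))\<^sup>2 / 2 - (h y)\<^sup>2) / (4 * real n))"
          using K_integrable(2)[OF h] by auto
        fix y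
        \<comment> \<open>Separates the observed point from its copy: the square of the difference
          dominates half of the observed square minus the square at the copy, and the mean of the
          latter is at most \<open>(\<epsilon> n)\<^sup>2\<close>.\<close>
        have "(h (x i))\<^sup>2 / 2 - (h y)\<^sup>2 \<le> (h y - h (x i))\<^sup>2"
          using zero_le_power2[of "2 * h y - h (x i)"] by (simp add: power2_eq_square algebra_simps)
        then have "((h (x i))\<^sup>2 / 2 - (h y)\<^sup>2) / (4 * real n) \<le> (h y - h (x i))\<^sup>2 / (4 * real n)"
          by (intro divide_right_mono) auto
        also have "\<dots> = (?d y)\<^sup>2 / 4" using n by (simp add: power_divide)
        finally show "cos (?d y) \<le> 1 - ((h (x i))\<^sup>2 / 2 - (h y)\<^sup>2) / (4 * real n)"
          using cos_bounds(2)[OF d1, of y "x i"] by linarith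
      qed
      also have "\<dots> = 1 - ((h (x i))\<^sup>2 / 2 - (\<integral>y. (h y)\<^sup>2 \<partial>M)) / (4 * real n)"
        using K_integrable(2)[OF h] by (simp add: M.prob_space)
      also have "\<dots> \<le> 1 - ((h (x i))\<^sup>2 / 2 - (\<epsilon> n)\<^sup>2) / (4 * real n)"
        using K_L2[OF h] by (intro diff_left_mono divide_right_mono) auto
      also have "1 - t / u \<le> exp (- t / u)" for t u :: real
        using exp_ge_add_one_self[of "- t / u"] by simp
      finally show ?thesis .
    qed
    ultimately show "0 \<le> (\<integral>y. cos (?d y) \<partial>M) \<and> (\<integral>y. cos (?d y) \<partial>M) \<le> exp (- ((h (x i))\<^sup>2 / 2 - (\<epsilon> n)\<^sup>2) / (4 * real n))"
      by simp
  qed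
  also have "\<dots> = exp (\<Sum>i<n. - ((h (x i))\<^sup>2 / 2 - (\<epsilon> n)\<^sup>2) / (4 * real n))"
    by (simp add: exp_sum)
  also have "(\<Sum>i<n. - ((h (x i))\<^sup>2 / 2 - (\<epsilon> n)\<^sup>2) / (4 * real n)) = - (emp_mean n x (\<lambda>x. (h x)\<^sup>2) / 2 - (\<epsilon> n)\<^sup>2) / 4"
    using n by (simp add: emp_mean_def sum_divide_distrib[symmetric] sum_negf sum_subtractf field_simps)
  finally show ?thesis .
qed

lemma emp_process_restrict [simp]:
  "emp_process N n (\<lambda>i\<in>{..<n}. f i) h = emp_process N n f h"
  by (simp add: emp_process_def emp_mean_def)

lemma emp_process_diff:
  assumes "n > 0"
  shows "emp_process N n x h - emp_process N n y h = (\<Sum>i<n. h (x i) - h (y i)) / sqrt (real n)"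
proof -
  have "sqrt (real n) * ((\<Sum>i<n. h (x i)) / real n - (\<Sum>i<n. h (y i)) / real n)
      = (\<Sum>i<n. h (x i) - h (y i)) * (sqrt (real n) / real n)"
    by (simp add: sum_subtractf diff_divide_distrib[symmetric])
  also have "sqrt (real n) / real n = 1 / sqrt (real n)" using assms by (simp add: field_simps)
  finally show ?thesis by (simp add: emp_process_def emp_mean_def right_diff_distrib)
qed

text \<open>The two choices of \<open>q\<close> are a coin and its complement. Each member of the
  class gets its own conditional probability given the sample; the quantifier over the class stays
  outside, so that the sets being measured are measurable. If one of these probabilities reaches
  \<open>p\<close>, resampling reaches a sample with a large process.\<close>

lemma whp_exchange_half:
  assumes c: "c > 0" and p: "p > 0" and q: "q = (\<lambda>u. u < 1/2) \<or> q = (\<lambda>u. \<not> u < (1/2::real))"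
  shows "whp P (\<lambda>n (x, s). \<forall>h\<in>K n. measure (Pi\<^sub>M {..<n} (\<lambda>_. aux))
     {a \<in> space (Pi\<^sub>M {..<n} (\<lambda>_. aux)).
        \<bar>emp_process M n (\<lambda>i. if q (fst (a i)) then snd (a i) else x i) h\<bar> > c} < p)"
proof (rule whp_resample[OF M prob_space_aux S P, where p=p and G="\<lambda>n x s. \<forall>h\<in>K n. \<bar>emp_process M n x h\<bar> \<le> c"
      and g="\<lambda>_ _ x a. if q (fst a) then snd a else x"])
  interpret U: prob_space unit_law by (rule prob_space_unit_law)
  have [measurable]: "Measurable.pred borel q" using q by auto
  show "(\<lambda>(s, x, a). if q (fst a) then snd a else x) \<in> S n \<Otimes>\<^sub>M (M \<Otimes>\<^sub>M aux) \<rightarrow>\<^sub>M M" for n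
    unfolding case_prod_beta' by measurable
  show "distr (M \<Otimes>\<^sub>M aux) M (\<lambda>(x, a). if q (fst a) then snd a else x) = M" for n s
  proof -
    have "Measurable.pred (unit_law \<Otimes>\<^sub>M M \<Otimes>\<^sub>M M) (\<lambda>(u, x, y). q u)"
      unfolding case_prod_beta' by measurable
    from distr_exchange[OF M prob_space_unit_law this refl] show ?thesis by (simp add: case_prod_beta')
  qed
  show "whp P (\<lambda>n (x, s). \<forall>h\<in>K n. \<bar>emp_process M n x h\<bar> \<le> c)" by (rule K_empirical[OF c])
  show "\<forall>\<^sub>F n in sequentially. \<forall>x s. (x, s) \<in> space (P n) \<longrightarrow>
      \<not> (\<forall>h\<in>K n. measure (Pi\<^sub>M {..<n} (\<lambda>_. aux))
         {a \<in> space (Pi\<^sub>M {..<n} (\<lambda>_. aux)). \<bar>emp_process M n (\<lambda>i. if q (fst (a i)) then snd (a i) else x i) h\<bar> > c} < p) \<longrightarrow>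
      (\<exists>B\<in>sets (Pi\<^sub>M {..<n} (\<lambda>_. aux)). ennreal p \<le> emeasure (Pi\<^sub>M {..<n} (\<lambda>_. aux)) B \<and>
        (\<forall>a\<in>B. \<not> (\<forall>h\<in>K n. \<bar>emp_process M n (\<lambda>i\<in>{..<n}. if q (fst (a i)) then snd (a i) else x i) h\<bar> \<le> c)))"
  proof (intro always_eventually allI impI)
    fix n :: nat and x s
    let ?Q = "Pi\<^sub>M {..<n} (\<lambda>_. aux)"
    let ?B = "\<lambda>h. {a \<in> space ?Q. \<bar>emp_process M n (\<lambda>i. if q (fst (a i)) then snd (a i) else x i) h\<bar> > c}"
    interpret Q: prob_space ?Q by (rule prob_space_PiM) (rule prob_space_aux)
    assume xs: "(x, s) \<in> space (P n)" and "\<not> (\<forall>h\<in>K n. measure ?Q (?B h) < p)"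
    then obtain h where h: "h \<in> K n" "p \<le> measure ?Q (?B h)" by (auto simp: not_less)
    note [measurable] = K_measurable[OF h(1)]
    have xi: "x i \<in> space M" if "i \<in> {..<n}" for i
      using xs that by (auto simp: P space_pair_measure space_PiM)
    have "(\<lambda>a. h (if q (fst (a i)) then snd (a i) else x i)) \<in> borel_measurable ?Q" if "i \<in> {..<n}" for i
      using that xi[OF that] by measurable
    then have "(\<lambda>a. \<Sum>i<n. h (if q (fst (a i)) then snd (a i) else x i)) \<in> borel_measurable ?Q"
      by (intro borel_measurable_sum)
    then have [measurable]: "(\<lambda>a. emp_process M n (\<lambda>i. if q (fst (a i)) then snd (a i) else x i) h) \<in> borel_measurable ?Q"
      unfolding emp_process_def emp_mean_def by measurable
    have B: "?B h \<in> sets ?Q" by measurable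
    show "\<exists>B\<in>sets ?Q. ennreal p \<le> emeasure ?Q B \<and>
        (\<forall>a\<in>B. \<not> (\<forall>h\<in>K n. \<bar>emp_process M n (\<lambda>i\<in>{..<n}. if q (fst (a i)) then snd (a i) else x i) h\<bar> \<le> c))"
    proof (rule bexI[OF _ B], intro conjI ballI)
      show "ennreal p \<le> emeasure ?Q (?B h)" using h(2) by (simp add: Q.emeasure_eq_measure)
      show "\<not> (\<forall>h\<in>K n. \<bar>emp_process M n (\<lambda>i\<in>{..<n}. if q (fst (a i)) then snd (a i) else x i) h\<bar> \<le> c)"
        if "a \<in> ?B h" for a
        using that h(1) unfolding emp_process_restrict by (auto simp: not_le)
    qed
  qed
qed (rule p)

text \<open>For a fixed \<open>h\<close> the processes of the two exchanged samples are both small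
  with high conditional probability, so the cosine of their difference has mean close to 1. A large
  empirical mean square would contradict the bound of \<open>half_exchange_cos\<close>.\<close>

lemma whp_squares:
  assumes \<eta>: "\<eta> > 0"
  shows "whp P (\<lambda>n (x, s). \<forall>h\<in>K n. emp_mean n x (\<lambda>v. (h v)\<^sup>2) \<le> \<eta>)"
proof -
  \<comment> \<open>The gap to be contradicted: a mean square above \<open>\<eta>\<close>, with
    \<open>(\<epsilon> n)\<^sup>2 \<le> \<eta> / 4\<close>, forces the mean cosine below
    \<open>exp (- \<eta> / 16)\<close>. With \<open>c\<^sup>2 = \<kappa> / 8\<close> the small
    difference costs at most \<open>\<kappa> / 4\<close>, and the two exceptional sets of mass below
    \<open>\<kappa> / 16\<close> cost at most \<open>\<kappa> / 8\<close> each, so the mean cosine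
    is at least \<open>1 - \<kappa> / 2\<close>.\<close>
  define \<kappa> where "\<kappa> = 1 - exp (- \<eta> / 16)"
  have \<kappa>: "\<kappa> > 0" using \<eta> by (simp add: \<kappa>_def)
  define c where "c = sqrt (\<kappa> / 8)"
  have c: "c > 0" "c\<^sup>2 = \<kappa> / 8" using \<kappa> by (auto simp: c_def)
  have p: "\<kappa> / 16 > 0" using \<kappa> by simp
  let ?Q = "\<lambda>n. Pi\<^sub>M {..<n} (\<lambda>_. aux)"
  let ?E = "\<lambda>q n x a h. emp_process M n (\<lambda>i. if q (fst (a i)) then snd (a i) else x i) h"
  let ?q1 = "\<lambda>u. u < (1/2::real)" and ?q2 = "\<lambda>u. \<not> u < (1/2::real)"
  have ev: "\<forall>\<^sub>F n in sequentially. n \<ge> 4 \<and> (\<epsilon> n)\<^sup>2 \<le> \<eta> / 4"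
    using \<epsilon>_small[of "\<eta> / 4"] \<eta> by (intro eventually_conj eventually_ge_at_top) auto
  show ?thesis
  proof (rule whp_mono[OF whp_conj[OF whp_exchange_half[OF c(1) p, of ?q1] whp_exchange_half[OF c(1) p, of ?q2]]])
    show "\<forall>\<^sub>F n in sequentially. \<forall>\<omega>\<in>space (P n).
       (case \<omega> of (x, s) \<Rightarrow> \<forall>h\<in>K n. measure (?Q n) {a \<in> space (?Q n). \<bar>?E ?q1 n x a h\<bar> > c} < \<kappa> / 16) \<and>
       (case \<omega> of (x, s) \<Rightarrow> \<forall>h\<in>K n. measure (?Q n) {a \<in> space (?Q n). \<bar>?E ?q2 n x a h\<bar> > c} < \<kappa> / 16) \<longrightarrow>
       (case \<omega> of (x, s) \<Rightarrow> \<forall>h\<in>K n. emp_mean n x (\<lambda>v. (h v)\<^sup>2) \<le> \<eta>)"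
      using ev
    proof eventually_elim
      case (elim n)
      show ?case
      proof (intro ballI impI, elim conjE, clarify)
        fix x s h
        assume xs: "(x, s) \<in> space (P n)" and h: "h \<in> K n"
          and "\<forall>h\<in>K n. measure (?Q n) {a \<in> space (?Q n). \<bar>?E ?q1 n x a h\<bar> > c} < \<kappa> / 16"
          and "\<forall>h\<in>K n. measure (?Q n) {a \<in> space (?Q n). \<bar>?E ?q2 n x a h\<bar> > c} < \<kappa> / 16"
        then have b: "measure (?Q n) {a \<in> space (?Q n). \<bar>?E ?q1 n x a h\<bar> > c} < \<kappa> / 16" (is "measure _ ?B1 < _")
          "measure (?Q n) {a \<in> space (?Q n). \<bar>?E ?q2 n x a h\<bar> > c} < \<kappa> / 16" (is "measure _ ?B2 < _")
          by auto
        interpret Q: prob_space "?Q n" by (rule prob_space_PiM) (rule prob_space_aux)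
        note [measurable] = K_measurable[OF h]
        have xi: "x i \<in> space M" if "i \<in> {..<n}" for i
          using xs that by (auto simp: P space_pair_measure space_PiM)
        have E: "(\<lambda>a. ?E q n x a h) \<in> borel_measurable (?Q n)" if [measurable]: "Measurable.pred borel q" for q
        proof -
          have "(\<lambda>a. h (if q (fst (a i)) then snd (a i) else x i)) \<in> borel_measurable (?Q n)" if "i \<in> {..<n}" for i
            using that xi[OF that] by measurable
          then have "(\<lambda>a. \<Sum>i<n. h (if q (fst (a i)) then snd (a i) else x i)) \<in> borel_measurable (?Q n)"
            by (intro borel_measurable_sum)
          then show ?thesis unfolding emp_process_def emp_mean_def by measurable
        qed
        have E1[measurable]: "(\<lambda>a. ?E ?q1 n x a h) \<in> borel_measurable (?Q n)"
          by (rule E[of ?q1]) measurable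
        have E2[measurable]: "(\<lambda>a. ?E ?q2 n x a h) \<in> borel_measurable (?Q n)"
          by (rule E[of ?q2]) measurable
        have B: "?B1 \<in> sets (?Q n)" "?B2 \<in> sets (?Q n)" by measurable
        show "emp_mean n x (\<lambda>v. (h v)\<^sup>2) \<le> \<eta>"
        proof (rule ccontr)
          assume "\<not> ?thesis"
          then have big: "emp_mean n x (\<lambda>v. (h v)\<^sup>2) > \<eta>" by simp
          let ?T = "\<lambda>a. ?E ?q1 n x a h - ?E ?q2 n x a h"
          have T: "?T a = (\<Sum>i<n. (case a i of (u, y) \<Rightarrow> \<lambda>b. (if u < 1/2 then h y - h b else h b - h y) / sqrt (real n)) (x i))" for a
            using elim by (subst emp_process_diff) (auto simp: sum_divide_distrib case_prod_beta' intro!: sum.cong)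
          have "(\<integral>a. cos (?T a) \<partial>?Q n) \<le> exp (- (emp_mean n x (\<lambda>x. (h x)\<^sup>2) / 2 - (\<epsilon> n)\<^sup>2) / 4)"
            unfolding T using elim by (intro half_exchange_cos[OF h]) simp
          also have "\<dots> \<le> exp (- \<eta> / 16)"
          proof -
            have "- (m / 2 - e) / 4 \<le> - \<eta> / 16" if "\<eta> < m" "e \<le> \<eta> / 4" for m e :: real
              using that by (simp add: field_simps)
            from this[OF big conjunct2[OF elim]] show ?thesis by (subst exp_le_cancel_iff)
          qed
          finally have up: "(\<integral>a. cos (?T a) \<partial>?Q n) \<le> 1 - \<kappa>" by (simp add: \<kappa>_def)
          have low: "1 - \<kappa> / 4 - 2 * indicator ?B1 a - 2 * indicator ?B2 a \<le> cos (?T a)" if a: "a \<in> space (?Q n)" for a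
          proof (cases "a \<in> ?B1 \<or> a \<in> ?B2")
            case True
            then have "2 \<le> 2 * indicator ?B1 a + (2 * indicator ?B2 a :: real)" by (auto simp: indicator_def)
            then show ?thesis using cos_ge_minus_one[of "?T a"] \<kappa> by linarith
          next
            case False
            then have "\<bar>?T a\<bar> \<le> 2 * c" using a by (auto simp: not_less)
            then have "(?T a)\<^sup>2 \<le> (2 * c)\<^sup>2" using c(1) by (intro abs_le_square_iff[THEN iffD1]) simp
            then have "(?T a)\<^sup>2 / 2 \<le> \<kappa> / 4" using c(2) by (simp add: power_mult_distrib)
            then show ?thesis using False cos_ge_quadratic[of "?T a"] by simp
          qed
          have i1: "integrable (?Q n) (\<lambda>a. indicator ?B1 a :: real)" "integrable (?Q n) (\<lambda>a. indicator ?B2 a :: real)"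
            using B by (auto simp: Q.emeasure_eq_measure)
          have "1 - \<kappa> / 4 - 2 * measure (?Q n) ?B1 - 2 * measure (?Q n) ?B2
              = (\<integral>a. 1 - \<kappa> / 4 - 2 * indicator ?B1 a - 2 * indicator ?B2 a \<partial>?Q n)"
            using i1 B by (simp add: Q.prob_space)
          also have "\<dots> \<le> (\<integral>a. cos (?T a) \<partial>?Q n)"
          proof (rule integral_mono)
            show "integrable (?Q n) (\<lambda>a. 1 - \<kappa> / 4 - 2 * indicator ?B1 a - 2 * indicator ?B2 a)"
              using i1 by (intro Bochner_Integration.integrable_diff integrable_mult_right) auto
            show "integrable (?Q n) (\<lambda>a. cos (?T a))"
            proof (rule Q.integrable_const_bound[where B=1])
              show "(\<lambda>a. cos (?T a)) \<in> borel_measurable (?Q n)" by measurable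
            qed simp
          qed (rule low)
          finally show False using up b \<kappa> by linarith
        qed
      qed
    qed
  qed auto
qed

text \<open>
  Exchanging \<open>x\<close> for an independent copy \<open>y\<close> with probability \<open>\<psi> x \<psi> y\<close> changes the empirical process of \<open>h\<close>
  on average by a multiple of that of \<open>\<psi> h\<close>, up to terms of the order of the norm of \<open>h\<close>.
\<close>

lemma whp_multiplier:
  fixes \<psi> :: "nat \<Rightarrow> 's \<Rightarrow> 'a \<Rightarrow> real"
  assumes \<psi>m: "\<And>n. (\<lambda>(s, x). \<psi> n s x) \<in> borel_measurable (S n \<Otimes>\<^sub>M M)"
    and \<psi>b: "\<And>n s x. 1/4 \<le> \<psi> n s x \<and> \<psi> n s x \<le> 3/4" and c: "c > 0"
  shows "whp P (\<lambda>n (x, s). \<forall>h\<in>K n. \<bar>emp_process M n x (\<lambda>v. \<psi> n s v * h v)\<bar> \<le> c)"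
proof -
  interpret U: prob_space unit_law by (rule prob_space_unit_law)
  interpret A: prob_space aux by (rule prob_space_aux)
  interpret UM: pair_prob_space unit_law M ..
  define pm where "pm n s = (\<integral>v. \<psi> n s v \<partial>M)" for n s
  \<comment> \<open>The constant makes the final Chebyshev bound
    \<open>(2 * \<eta> + 2 * \<eta>) * 256 / c\<^sup>2\<close> equal to 1/2, the complement of the
    success probability required in the resampling step.\<close>
  define \<eta> where "\<eta> = c\<^sup>2 / 2048"
  have \<eta>: "\<eta> > 0" using c by (simp add: \<eta>_def)
  have \<psi>s[measurable]: "\<psi> n s \<in> borel_measurable M" if "s \<in> space (S n)" for n s
    using measurable_Pair2[OF \<psi>m that] by simp
  have \<psi>i: "integrable M (\<psi> n s)" if "s \<in> space (S n)" for n s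
  proof (intro M.integrable_const_bound[where B=1] AE_I2)
    show "norm (\<psi> n s v) \<le> 1" for v using \<psi>b[of n s v] by (simp add: abs_le_iff)
  qed (rule \<psi>s[OF that])
  have pm: "1/4 \<le> pm n s" "pm n s \<le> 3/4" if s: "s \<in> space (S n)" for n s
  proof -
    have "(\<integral>v. 1/4 \<partial>M) \<le> (\<integral>v. \<psi> n s v \<partial>M)" "(\<integral>v. \<psi> n s v \<partial>M) \<le> (\<integral>v. 3/4 \<partial>M)"
      by (rule integral_mono; use \<psi>b \<psi>i[OF s] in simp)+
    then show "1/4 \<le> pm n s" "pm n s \<le> 3/4" by (simp_all add: pm_def M.prob_space)
  qed
  \<comment> \<open>In the exchange the fluctuation of the weights is multiplied by the mean of
    \<open>\<psi> * h\<close>, which is at most \<open>\<bar>\<epsilon> n\<bar>\<close>. Attaching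
    that factor here makes the variance tend to 0.\<close>
  let ?Z = "\<lambda>n s v. \<epsilon> n * (\<psi> n s v - pm n s)"
  have cheb: "whp P (\<lambda>n (x, s). \<bar>\<Sum>i<n. ?Z n s (x i)\<bar> \<le> (c / 16) * sqrt (real n))"
  proof (rule whp_Chebyshev[OF M S P, where B="\<lambda>n. \<bar>\<epsilon> n\<bar>" and v="\<lambda>n. (\<epsilon> n)\<^sup>2"])
    fix n
    have "pm n \<in> borel_measurable (S n)" unfolding pm_def[abs_def]
      using M.borel_measurable_lebesgue_integral[OF \<psi>m[of n]] by simp
    then have [measurable]: "(\<lambda>w. pm n (fst w)) \<in> borel_measurable (S n \<Otimes>\<^sub>M M)" by measurable
    have [measurable]: "(\<lambda>w. \<psi> n (fst w) (snd w)) \<in> borel_measurable (S n \<Otimes>\<^sub>M M)"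
      using \<psi>m[of n] by (simp add: case_prod_beta')
    show "(\<lambda>(s, v). ?Z n s v) \<in> borel_measurable (S n \<Otimes>\<^sub>M M)"
      unfolding case_prod_beta' by measurable
    fix s assume s: "s \<in> space (S n)"
    have zb: "\<bar>\<psi> n s v - pm n s\<bar> \<le> 1" for v using pm[OF s] \<psi>b[of n s v] by (simp add: abs_le_iff)
    show "\<bar>?Z n s v\<bar> \<le> \<bar>\<epsilon> n\<bar>" for v
      using mult_left_mono[OF zb, of "\<bar>\<epsilon> n\<bar>" v] by (simp add: abs_mult)
    show "(\<integral>v. ?Z n s v \<partial>M) = 0" using \<psi>i[OF s] by (simp add: pm_def M.prob_space)
    have "(\<integral>v. (?Z n s v)\<^sup>2 \<partial>M) \<le> (\<integral>v. (\<epsilon> n)\<^sup>2 \<partial>M)"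
    proof (rule integral_mono')
      fix v
      have "(\<psi> n s v - pm n s)\<^sup>2 \<le> 1" using zb by (simp add: abs_square_le_1)
      then show "(?Z n s v)\<^sup>2 \<le> (\<epsilon> n)\<^sup>2" by (simp add: power_mult_distrib mult_left_le)
    qed auto
    then show "(\<integral>v. (?Z n s v)\<^sup>2 \<partial>M) \<le> (\<epsilon> n)\<^sup>2" by (simp add: M.prob_space)
  next
    show "(\<lambda>n. (\<epsilon> n)\<^sup>2) \<longlonglongrightarrow> 0" using tendsto_power[OF \<epsilon>, of 2] by simp
    show "c / 16 > 0" using c by simp
  qed
  let ?W = "\<lambda>n x s. (\<forall>h\<in>K n. \<bar>emp_process M n x h\<bar> \<le> c / 16) \<and> (\<forall>h\<in>K n. emp_mean n x (\<lambda>v. (h v)\<^sup>2) \<le> \<eta>) \<and>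
       \<bar>\<Sum>i<n. ?Z n s (x i)\<bar> \<le> (c / 16) * sqrt (real n)"
  have W: "whp P (\<lambda>n (x, s). ?W n x s)"
    by (rule whp_mono[OF whp_conj[OF K_empirical[of "c / 16"] whp_conj[OF whp_squares[OF \<eta>] cheb]]])
      (use c in \<open>auto intro!: always_eventually\<close>)
  \<comment> \<open>The auxiliary bounds concern the sample before the exchange, so they are made a
    premise of the event being proved and discharged afterwards by \<open>W\<close>.\<close>
  have "whp P (\<lambda>n (x, s). ?W n x s \<longrightarrow> (\<forall>h\<in>K n. \<bar>emp_process M n x (\<lambda>v. \<psi> n s v * h v)\<bar> \<le> c))"
  proof (rule whp_resample[OF M prob_space_aux S P, where p="1/2" and G="\<lambda>n x s. \<forall>h\<in>K n. \<bar>emp_process M n x h\<bar> \<le> c / 16"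
      and g="\<lambda>n s x a. if fst a < \<psi> n s x * \<psi> n s (snd a) then snd a else x"])
    fix n
    have m1: "(\<lambda>w. \<psi> n (fst w) (fst (snd w))) \<in> borel_measurable (S n \<Otimes>\<^sub>M (M \<Otimes>\<^sub>M aux))"
      using measurable_compose[of "\<lambda>w. (fst w, fst (snd w))" "S n \<Otimes>\<^sub>M (M \<Otimes>\<^sub>M aux)" "S n \<Otimes>\<^sub>M M", OF _ \<psi>m[of n]]
      by (simp add: case_prod_beta')
    have m2: "(\<lambda>w. \<psi> n (fst w) (snd (snd (snd w)))) \<in> borel_measurable (S n \<Otimes>\<^sub>M (M \<Otimes>\<^sub>M aux))"
      using measurable_compose[of "\<lambda>w. (fst w, snd (snd (snd w)))" "S n \<Otimes>\<^sub>M (M \<Otimes>\<^sub>M aux)" "S n \<Otimes>\<^sub>M M", OF _ \<psi>m[of n]]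
      by (simp add: case_prod_beta')
    note [measurable] = m1 m2
    show "(\<lambda>(s, x, a). if fst a < \<psi> n s x * \<psi> n s (snd a) then snd a else x) \<in> S n \<Otimes>\<^sub>M (M \<Otimes>\<^sub>M aux) \<rightarrow>\<^sub>M M"
      unfolding case_prod_beta' fst_conv snd_conv by measurable
    fix s assume s: "s \<in> space (S n)"
    note [measurable] = \<psi>s[OF s]
    have "Measurable.pred (unit_law \<Otimes>\<^sub>M M \<Otimes>\<^sub>M M) (\<lambda>(u, x, y). u < \<psi> n s x * \<psi> n s y)"
      unfolding case_prod_beta' by measurable
    from distr_exchange[OF M prob_space_unit_law this]
    show "distr (M \<Otimes>\<^sub>M aux) M (\<lambda>(x, a). if fst a < \<psi> n s x * \<psi> n s (snd a) then snd a else x) = M"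
      by (simp add: case_prod_beta' mult.commute)
  next
    show "whp P (\<lambda>n (x, s). \<forall>h\<in>K n. \<bar>emp_process M n x h\<bar> \<le> c / 16)" using c by (intro K_empirical) simp
    show "\<forall>\<^sub>F n in sequentially. \<forall>x s. (x, s) \<in> space (P n) \<longrightarrow>
      \<not> (?W n x s \<longrightarrow> (\<forall>h\<in>K n. \<bar>emp_process M n x (\<lambda>v. \<psi> n s v * h v)\<bar> \<le> c)) \<longrightarrow>
      (\<exists>B\<in>sets (Pi\<^sub>M {..<n} (\<lambda>_. aux)). ennreal (1/2) \<le> emeasure (Pi\<^sub>M {..<n} (\<lambda>_. aux)) B \<and>
        (\<forall>a\<in>B. \<not> (\<forall>h\<in>K n. \<bar>emp_process M n
           (\<lambda>i\<in>{..<n}. if fst (a i) < \<psi> n s (x i) * \<psi> n s (snd (a i)) then snd (a i) else x i) h\<bar> \<le> c / 16)))"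
      using \<epsilon>_small[OF \<eta>] eventually_gt_at_top[of 0]
    proof eventually_elim
      case (elim n)
      show ?case
      proof (intro allI impI)
        fix x s
        assume xs: "(x, s) \<in> space (P n)"
          and "\<not> (?W n x s \<longrightarrow> (\<forall>h\<in>K n. \<bar>emp_process M n x (\<lambda>v. \<psi> n s v * h v)\<bar> \<le> c))"
        then obtain h where h: "h \<in> K n"
          and w1: "\<forall>h\<in>K n. \<bar>emp_process M n x h\<bar> \<le> c / 16"
          and w2: "\<forall>h\<in>K n. emp_mean n x (\<lambda>v. (h v)\<^sup>2) \<le> \<eta>"
          and w3: "\<bar>\<Sum>i<n. ?Z n s (x i)\<bar> \<le> (c / 16) * sqrt (real n)"
          and big: "\<not> \<bar>emp_process M n x (\<lambda>v. \<psi> n s v * h v)\<bar> \<le> c"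
          by blast
        let ?Q = "Pi\<^sub>M {..<n} (\<lambda>_. aux)"
        interpret Q: prob_space ?Q by (rule prob_space_PiM) (rule prob_space_aux)
        have s: "s \<in> space (S n)" and xi: "\<And>i. i \<in> {..<n} \<Longrightarrow> x i \<in> space M"
          using xs by (auto simp: P space_pair_measure space_PiM)
        note [measurable] = K_measurable[OF h] \<psi>s[OF s]
        note hb = K_bound[OF h]
        define r where "r b y = \<psi> n s b * \<psi> n s y" for b y
        have r: "0 \<le> r b y" "r b y \<le> 1" for b y
          using \<psi>b[of n s b] \<psi>b[of n s y] mult_mono[of "\<psi> n s b" 1 "\<psi> n s y" 1] by (auto simp: r_def)
        \<comment> \<open>The decrease of the \<open>h\<close>-sum caused by the possible exchange
          of one point. Its mean over coin and copy contains the desired weighted value times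
          \<open>pm n s\<close>, which explains the need for weights bounded away from 0.\<close>
        define Y where "Y b a = (if fst a < r b (snd a) then h b - h (snd a) else 0)" for b and a :: "real \<times> 'a"
        have Ym[measurable]: "Y b \<in> borel_measurable aux" for b
          unfolding Y_def[abs_def] r_def by measurable
        have Yb: "\<bar>Y b a\<bar> \<le> 2" for b a using hb[of b] hb[of "snd a"] by (auto simp: Y_def abs_le_iff)
        have Yi: "integrable aux (Y b)" for b
          using Yb by (intro A.integrable_const_bound[where B=2]) auto
        have Y2i: "integrable aux (\<lambda>a. (Y b a)\<^sup>2)" for b
        proof (intro A.integrable_const_bound[where B=4] AE_I2)
          show "norm ((Y b a)\<^sup>2) \<le> 4" for a
            using power_mono[OF Yb, of b a 2] by simp
        qed auto
        define m where "m = (\<integral>v. \<psi> n s v * h v \<partial>M)"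
        have \<psi>hi: "integrable M (\<lambda>v. \<psi> n s v * h v)"
        proof (intro M.integrable_const_bound[where B=1] AE_I2)
          show "norm (\<psi> n s v * h v) \<le> 1" for v
            unfolding real_norm_def abs_mult using \<psi>b[of n s v] hb[of v] by (intro mult_le_one) auto
        qed auto
        have m: "\<bar>m\<bar> \<le> \<bar>\<epsilon> n\<bar>"
        proof -
          have "\<bar>m\<bar> \<le> (\<integral>v. \<bar>\<psi> n s v * h v\<bar> \<partial>M)" unfolding m_def by (rule integral_abs_bound)
          also have "\<dots> \<le> (\<integral>v. \<bar>h v\<bar> \<partial>M)"
          proof (rule integral_mono)
            show "\<bar>\<psi> n s v * h v\<bar> \<le> \<bar>h v\<bar>" for v
              unfolding abs_mult using \<psi>b[of n s v] by (intro mult_left_le_one_le) auto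
          qed (use \<psi>hi K_integrable[OF h] in auto)
          also have "\<dots> \<le> \<bar>\<epsilon> n\<bar>" by (rule K_L1[OF h])
          finally show ?thesis .
        qed
        have EY: "(\<integral>a. Y b a \<partial>aux) = \<psi> n s b * (h b * pm n s - m)" for b
        proof -
          have "(\<integral>a. Y b a \<partial>aux) = (\<integral>y. \<integral>u. Y b (u, y) \<partial>unit_law \<partial>M)"
            using UM.integral_snd[of "\<lambda>u y. Y b (u, y)"] Yi[of b] by (simp add: case_prod_beta')
          also have "\<dots> = (\<integral>y. r b y * (h b - h y) \<partial>M)"
          proof (rule Bochner_Integration.integral_cong[OF refl])
            fix y
            have "(\<integral>u. Y b (u, y) \<partial>unit_law) = (\<integral>u. indicator {u. u < r b y} u * (h b - h y) \<partial>unit_law)"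
              by (intro Bochner_Integration.integral_cong) (auto simp: Y_def)
            also have "\<dots> = measure unit_law {u. u < r b y} * (h b - h y)" by simp
            finally show "(\<integral>u. Y b (u, y) \<partial>unit_law) = r b y * (h b - h y)"
              using measure_unit_law_less(1)[OF r] by simp
          qed
          also have "\<dots> = (\<integral>y. \<psi> n s b * h b * \<psi> n s y - \<psi> n s b * (\<psi> n s y * h y) \<partial>M)"
            by (intro Bochner_Integration.integral_cong) (auto simp: r_def algebra_simps)
          also have "\<dots> = \<psi> n s b * h b * pm n s - \<psi> n s b * m"
            using \<psi>i[OF s] \<psi>hi by (simp add: pm_def m_def)
          finally show ?thesis by (simp add: algebra_simps)
        qed
        define Z where "Z i a = Y (x i) a - (\<integral>a. Y (x i) a \<partial>aux)" for i and a :: "real \<times> 'a"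
        have Zvar: "(\<integral>a. (Z i a)\<^sup>2 \<partial>aux) \<le> 2 * (h (x i))\<^sup>2 + 2 * (\<epsilon> n)\<^sup>2" for i
        proof -
          have h2: "integrable aux (\<lambda>a. (h (snd a))\<^sup>2)"
          proof (intro A.integrable_const_bound[where B=1] AE_I2)
            show "norm ((h (snd a))\<^sup>2) \<le> 1" for a using hb[of "snd a"] by (simp add: abs_square_le_1)
          qed auto
          have "(\<integral>a. (Z i a)\<^sup>2 \<partial>aux) = (\<integral>a. (Y (x i) a)\<^sup>2 \<partial>aux) - (\<integral>a. Y (x i) a \<partial>aux)\<^sup>2"
            unfolding Z_def by (rule A.variance_eq[OF Yi Y2i])
          also have "\<dots> \<le> (\<integral>a. (Y (x i) a)\<^sup>2 \<partial>aux)" by simp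
          also have "\<dots> \<le> (\<integral>a. 2 * (h (x i))\<^sup>2 + 2 * (h (snd a))\<^sup>2 \<partial>aux)"
          proof (rule integral_mono[OF Y2i])
            show "integrable aux (\<lambda>a. 2 * (h (x i))\<^sup>2 + 2 * (h (snd a))\<^sup>2)" using h2 by auto
            fix a :: "real \<times> 'a"
            have "(h (x i) - h (snd a))\<^sup>2 \<le> 2 * (h (x i))\<^sup>2 + 2 * (h (snd a))\<^sup>2"
              using zero_le_power2[of "h (x i) + h (snd a)"] by (simp add: power2_eq_square algebra_simps)
            then show "(Y (x i) a)\<^sup>2 \<le> 2 * (h (x i))\<^sup>2 + 2 * (h (snd a))\<^sup>2" by (auto simp: Y_def)
          qed
          also have "\<dots> = 2 * (h (x i))\<^sup>2 + 2 * (\<integral>v. (h v)\<^sup>2 \<partial>M)"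
            using h2 UM.integral_fst'[OF h2] by (simp add: A.prob_space U.prob_space[unfolded space_unit_law])
          also have "\<dots> \<le> 2 * (h (x i))\<^sup>2 + 2 * (\<epsilon> n)\<^sup>2" using K_L2[OF h] by simp
          finally show ?thesis .
        qed
        have Zm: "Z i \<in> borel_measurable aux" for i unfolding Z_def[abs_def] by measurable
        have n0: "real n > 0" "sqrt (real n) > 0" using elim by auto
        let ?c = "sqrt (real n) * (c / 16)"
        let ?L = "{a \<in> space ?Q. \<bar>\<Sum>i<n. Z i (a i)\<bar> \<ge> ?c}"
        have "measure ?Q ?L \<le> (\<Sum>i<n. \<integral>a. (Z i a)\<^sup>2 \<partial>aux) / ?c\<^sup>2"
        proof (rule PiM_Chebyshev[OF finite_lessThan prob_space_aux])
          show "?c > 0" using c n0 by simp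
          show "(\<integral>a. Z i a \<partial>aux) = 0" for i using Yi[of "x i"] by (simp add: Z_def A.prob_space)
          show "\<bar>Z i a\<bar> \<le> 4" for i a
          proof -
            have "\<bar>\<integral>a. Y (x i) a \<partial>aux\<bar> \<le> (\<integral>a. \<bar>Y (x i) a\<bar> \<partial>aux)" by (rule integral_abs_bound)
            also have "\<dots> \<le> (\<integral>a. 2 \<partial>aux)" using Yi[of "x i"] Yb by (intro integral_mono) auto
            finally show ?thesis using Yb[of "x i" a] by (simp add: Z_def A.prob_space)
          qed
        qed (rule Zm)
        also have "\<dots> \<le> (\<Sum>i<n. 2 * (h (x i))\<^sup>2 + 2 * (\<epsilon> n)\<^sup>2) / ?c\<^sup>2"
          by (intro divide_right_mono sum_mono Zvar) auto
        also have "\<dots> = (2 * emp_mean n x (\<lambda>v. (h v)\<^sup>2) + 2 * (\<epsilon> n)\<^sup>2) * 256 / c\<^sup>2"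
          using n0 c by (simp add: sum.distrib sum_distrib_left[symmetric] emp_mean_def power_mult_distrib power_divide field_simps)
        also have "\<dots> \<le> (2 * \<eta> + 2 * \<eta>) * 256 / c\<^sup>2"
          using w2 h elim by (intro divide_right_mono mult_right_mono add_mono mult_left_mono) auto
        also have "\<dots> = 1/2" using c by (simp add: \<eta>_def)
        finally have L: "measure ?Q ?L \<le> 1/2" .
        have "(\<lambda>a. Z i (a i)) \<in> borel_measurable ?Q" if "i \<in> {..<n}" for i
          using measurable_compose[OF measurable_component_singleton[OF that] Zm] .
        then have [measurable]: "(\<lambda>a. \<Sum>i<n. Z i (a i)) \<in> borel_measurable ?Q" by (intro borel_measurable_sum)
        have Ls: "?L \<in> sets ?Q" by measurable
        show "\<exists>B\<in>sets ?Q. ennreal (1/2) \<le> emeasure ?Q B \<and>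
           (\<forall>a\<in>B. \<not> (\<forall>h\<in>K n. \<bar>emp_process M n
             (\<lambda>i\<in>{..<n}. if fst (a i) < \<psi> n s (x i) * \<psi> n s (snd (a i)) then snd (a i) else x i) h\<bar> \<le> c / 16))"
        proof (rule bexI[of _ "space ?Q - ?L"], intro conjI ballI)
          show "space ?Q - ?L \<in> sets ?Q" using Ls by auto
          show "ennreal (1/2) \<le> emeasure ?Q (space ?Q - ?L)"
            using L Q.prob_compl[OF Ls] unfolding Q.emeasure_eq_measure by (intro ennreal_leI) simp
          fix a assume a: "a \<in> space ?Q - ?L"
          let ?x = "\<lambda>i\<in>{..<n}. if fst (a i) < \<psi> n s (x i) * \<psi> n s (snd (a i)) then snd (a i) else x i"
          have "emp_process M n x h - emp_process M n ?x h = (\<Sum>i<n. h (x i) - h (?x i)) / sqrt (real n)"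
            using elim by (intro emp_process_diff) simp
          also have "(\<Sum>i<n. h (x i) - h (?x i)) = (\<Sum>i<n. Y (x i) (a i))"
            by (intro sum.cong) (auto simp: Y_def r_def case_prod_beta')
          also have "\<dots> = (\<Sum>i<n. Z i (a i)) + (\<Sum>i<n. \<psi> n s (x i) * (h (x i) * pm n s - m))"
            by (simp add: Z_def EY sum.distrib[symmetric])
          finally have D: "emp_process M n x h - emp_process M n ?x h =
              (\<Sum>i<n. Z i (a i)) / sqrt (real n) + (\<Sum>i<n. \<psi> n s (x i) * (h (x i) * pm n s - m)) / sqrt (real n)"
            by (simp only: add_divide_distrib)
          have "\<bar>\<Sum>i<n. Z i (a i)\<bar> \<le> ?c" using a by auto
          then have D1: "\<bar>(\<Sum>i<n. Z i (a i)) / sqrt (real n)\<bar> \<le> c / 16"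
            using n0 by (simp add: abs_divide field_simps)
          have sq: "sqrt (real n) / real n = 1 / sqrt (real n)" "sqrt (real n) * m = real n * m / sqrt (real n)"
            using n0 by (simp_all add: field_simps)
          have "emp_process M n x (\<lambda>v. \<psi> n s v * h v) = (\<Sum>i<n. \<psi> n s (x i) * h (x i)) * (sqrt (real n) / real n) - sqrt (real n) * m"
            by (simp add: emp_process_def emp_mean_def m_def right_diff_distrib)
          also have "\<dots> = ((\<Sum>i<n. \<psi> n s (x i) * h (x i)) - real n * m) / sqrt (real n)"
            unfolding sq by (simp add: diff_divide_distrib)
          finally have ep: "emp_process M n x (\<lambda>v. \<psi> n s v * h v) = ((\<Sum>i<n. \<psi> n s (x i) * h (x i)) - real n * m) / sqrt (real n)" .
          have "(\<Sum>i<n. \<psi> n s (x i) * (h (x i) * pm n s - m))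
             = pm n s * ((\<Sum>i<n. \<psi> n s (x i) * h (x i)) - real n * m) - m * (\<Sum>i<n. \<psi> n s (x i) - pm n s)"
            by (simp add: sum_subtractf sum_distrib_left right_diff_distrib mult_ac)
          then have D2: "(\<Sum>i<n. \<psi> n s (x i) * (h (x i) * pm n s - m)) / sqrt (real n)
              = pm n s * emp_process M n x (\<lambda>v. \<psi> n s v * h v) - m * (\<Sum>i<n. \<psi> n s (x i) - pm n s) / sqrt (real n)"
            unfolding ep by (simp only: diff_divide_distrib right_diff_distrib times_divide_eq_right)
          have "\<bar>m * (\<Sum>i<n. \<psi> n s (x i) - pm n s)\<bar> \<le> \<bar>\<epsilon> n\<bar> * \<bar>\<Sum>i<n. \<psi> n s (x i) - pm n s\<bar>"
            unfolding abs_mult using m by (intro mult_right_mono) auto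
          also have "\<dots> = \<bar>\<Sum>i<n. ?Z n s (x i)\<bar>" by (simp add: sum_distrib_left[symmetric] abs_mult)
          also have "\<dots> \<le> c / 16 * sqrt (real n)" by (rule w3)
          finally have D3: "\<bar>m * (\<Sum>i<n. \<psi> n s (x i) - pm n s) / sqrt (real n)\<bar> \<le> c / 16"
            using n0 by (simp add: abs_divide field_simps)
          have "1/4 * c < pm n s * \<bar>emp_process M n x (\<lambda>v. \<psi> n s v * h v)\<bar>"
            using pm[OF s] big c by (intro mult_le_less_imp_less) auto
          also have "\<dots> = \<bar>pm n s * emp_process M n x (\<lambda>v. \<psi> n s v * h v)\<bar>"
            using pm[OF s] by (simp add: abs_mult)
          finally have big': "1/4 * c < \<bar>pm n s * emp_process M n x (\<lambda>v. \<psi> n s v * h v)\<bar>" .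
          \<comment> \<open>The weighted process exceeds \<open>c\<close> and is multiplied by at
            least 1/4. Removing the original process, the noise and the weight fluctuation, each at
            most \<open>c / 16\<close>, leaves more than \<open>c / 16\<close> for the exchanged
            sample.\<close>
          have gen: "c / 16 < \<bar>\<beta>\<bar>" if "\<alpha> - \<beta> = e1 + (\<gamma> - e2)" "\<bar>e1\<bar> \<le> c / 16" "\<bar>e2\<bar> \<le> c / 16" "\<bar>\<alpha>\<bar> \<le> c / 16"
            "1/4 * c < \<bar>\<gamma>\<bar>" for \<alpha> \<beta> \<gamma> e1 e2 :: real
            using that by linarith
          have "c / 16 < \<bar>emp_process M n ?x h\<bar>"
            by (rule gen[OF D[unfolded D2] D1 D3 bspec[OF w1 h] big'])
          then show "\<not> (\<forall>h\<in>K n. \<bar>emp_process M n ?x h\<bar> \<le> c / 16)"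
            using h by (intro notI) (drule bspec, assumption, linarith)
        qed
      qed
    qed
  qed simp
  from whp_conj[OF W this] show ?thesis by (rule whp_mono) (auto intro!: always_eventually)
qed

end

section \<open>The observation model\<close>

locale obs_model =
  fixes a b :: "'z::topological_space \<Rightarrow> real" and F :: "'z measure"
  assumes F: "prob_space F" and sets_F [measurable_cong, simp]: "sets F = sets borel"
    and a_measurable [measurable]: "a \<in> borel_measurable borel" and b_measurable [measurable]: "b \<in> borel_measurable borel"
    and a_bounds: "\<And>z. 0 \<le> 1 / a z \<and> 1 / a z \<le> 1" and b_bounds: "\<And>z. 0 \<le> b z \<and> b z \<le> 1"
begin

sublocale F: prob_space F by (rule F)

lemma space_F [simp]: "space F = UNIV"
  using sets_eq_imp_space_eq[OF sets_F] by simp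

definition obs_kernel :: "'z \<Rightarrow> 'z obs measure" where
  "obs_kernel z = distr (measure_pmf (pair_pmf (bernoulli_pmf (1 / a z)) (bernoulli_pmf (b z))))
                obs_space (\<lambda>(r, y). (z, r, r \<and> y))"

text \<open>The conditional expectation of \<open>g\<close> given \<open>Z = z\<close>. Three terms
  suffice, since the outcome with second entry false and third entry true has probability 0.\<close>

definition obs_average :: "('z obs \<Rightarrow> real) \<Rightarrow> 'z \<Rightarrow> real" where
  "obs_average g z = b z / a z * g (z, True, True) + (1 - b z) / a z * g (z, True, False)
     + (1 - 1 / a z) * g (z, False, False)"

lemma obs_space_section: "(\<lambda>z. (z, r, y)) \<in> measurable borel obs_space"
  by measurable

lemma obs_average_measurable:
  assumes g: "g \<in> borel_measurable obs_space"
  shows "obs_average g \<in> borel_measurable borel"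
  unfolding obs_average_def[abs_def]
  using measurable_compose[OF obs_space_section g] by measurable

lemma prob_space_obs_kernel: "prob_space (obs_kernel z)"
  unfolding obs_kernel_def
  by (intro prob_space.prob_space_distr measure_pmf.prob_space_axioms) (simp add: space_pair_measure)

lemma nn_integral_obs_kernel:
  assumes g: "g \<in> borel_measurable obs_space" and g0: "\<And>v. 0 \<le> g v"
  shows "(\<integral>\<^sup>+v. ennreal (g v) \<partial>obs_kernel z) = ennreal (obs_average g z)"
proof -
  have m: "(\<lambda>(r, y). (z, r, r \<and> y)) \<in> measurable (measure_pmf (pair_pmf (bernoulli_pmf (1 / a z)) (bernoulli_pmf (b z)))) obs_space"
    by (simp add: space_pair_measure)
  have gen: "(ennreal x * ennreal p + ennreal y * ennreal (1 - p)) * ennreal q = ennreal ((x * p + y * (1 - p)) * q)"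
    if "0 \<le> x" "0 \<le> y" "0 \<le> p" "p \<le> 1" "0 \<le> q" for x y p q :: real
    using that by (simp add: ennreal_mult)
  have "(\<integral>\<^sup>+v. ennreal (g v) \<partial>obs_kernel z)
      = (\<integral>\<^sup>+v. ennreal (g (case v of (r, y) \<Rightarrow> (z, r, r \<and> y))) \<partial>pair_pmf (bernoulli_pmf (1 / a z)) (bernoulli_pmf (b z)))"
    unfolding obs_kernel_def
  proof (rule nn_integral_distr[OF m])
    have "(\<lambda>v. ennreal (g v)) \<in> borel_measurable obs_space"
      by (rule measurable_compose[OF g measurable_ennreal])
    then show "(\<lambda>v. ennreal (g v)) \<in> borel_measurable (distr (measure_pmf (pair_pmf (bernoulli_pmf (1 / a z)) (bernoulli_pmf (b z)))) obs_space (\<lambda>(r, y). (z, r, r \<and> y)))"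
      by (simp only: measurable_distr_eq1)
  qed
  also have "\<dots> = (\<integral>\<^sup>+r. \<integral>\<^sup>+y. ennreal (g (z, r, r \<and> y)) \<partial>bernoulli_pmf (b z) \<partial>bernoulli_pmf (1 / a z))"
    by (simp only: nn_integral_pair_pmf' prod.case)
  also have "\<dots> = (ennreal (g (z, True, True)) * ennreal (b z) + ennreal (g (z, True, False)) * ennreal (1 - b z)) * ennreal (1 / a z)
      + (ennreal (g (z, False, False)) * ennreal (b z) + ennreal (g (z, False, False)) * ennreal (1 - b z)) * ennreal (1 - 1 / a z)"
    using a_bounds[of z] b_bounds[of z] by (simp only: nn_integral_bernoulli_pmf simp_thms zero_le)
  also have "\<dots> = ennreal ((g (z, True, True) * b z + g (z, True, False) * (1 - b z)) * (1 / a z)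
      + (g (z, False, False) * b z + g (z, False, False) * (1 - b z)) * (1 - 1 / a z))"
    using a_bounds[of z] b_bounds[of z] g0
    by (subst (1 2) gen) (auto intro!: ennreal_plus[symmetric] mult_nonneg_nonneg add_nonneg_nonneg simp del: ennreal_plus)
  also have "(g (z, True, True) * b z + g (z, True, False) * (1 - b z)) * (1 / a z)
      + (g (z, False, False) * b z + g (z, False, False) * (1 - b z)) * (1 - 1 / a z) = obs_average g z"
    by (simp add: obs_average_def algebra_simps add_divide_distrib diff_divide_distrib)
  finally show ?thesis .
qed

lemma obs_kernel_measurable: "obs_kernel \<in> measurable F (subprob_algebra obs_space)"
proof (rule measurable_subprob_algebra)
  show "subprob_space (obs_kernel z)" for z
    by (intro prob_space_imp_subprob_space prob_space_obs_kernel)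
  show "sets (obs_kernel z) = sets obs_space" for z by (simp add: obs_kernel_def)
  fix A :: "'z obs set" assume A[measurable]: "A \<in> sets obs_space"
  have "emeasure (obs_kernel z) A = ennreal (obs_average (indicator A) z)" for z
  proof -
    have "emeasure (obs_kernel z) A = (\<integral>\<^sup>+v. indicator A v \<partial>obs_kernel z)"
      using A by (subst nn_integral_indicator) (simp_all add: obs_kernel_def)
    also have "\<dots> = (\<integral>\<^sup>+v. ennreal (indicator A v) \<partial>obs_kernel z)" by (simp add: ennreal_indicator)
    also have "\<dots> = ennreal (obs_average (indicator A) z)" by (intro nn_integral_obs_kernel) auto
    finally show ?thesis .
  qed
  moreover have "(\<lambda>z. ennreal (obs_average (indicator A) z)) \<in> borel_measurable F"
    unfolding measurable_cong_sets[OF sets_F refl]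
    by (rule measurable_compose[OF obs_average_measurable[OF borel_measurable_indicator[OF A]] measurable_ennreal])
  ultimately show "(\<lambda>z. emeasure (obs_kernel z) A) \<in> borel_measurable F" by (simp only:)
qed

lemma obs_law_eq: "obs_law a b F = F \<bind> obs_kernel"
  by (simp add: obs_law_def obs_kernel_def[abs_def])

lemma sets_obs_law [measurable_cong, simp]: "sets (obs_law a b F) = sets obs_space"
  unfolding obs_law_eq by (rule sets_bind) (auto simp: obs_kernel_def)

lemma space_obs_law [simp]: "space (obs_law a b F) = UNIV"
  using sets_eq_imp_space_eq[OF sets_obs_law] by (simp add: space_pair_measure)

lemma prob_space_obs_law: "prob_space (obs_law a b F)"
  unfolding obs_law_eq
  by (rule F.prob_space_bind[OF _ obs_kernel_measurable]) (simp add: prob_space_obs_kernel)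

sublocale O: prob_space "obs_law a b F" by (rule prob_space_obs_law)

lemma obs_integrable:
  fixes g :: "'z obs \<Rightarrow> real"
  assumes "g \<in> borel_measurable obs_space" "\<And>v. \<bar>g v\<bar> \<le> B"
  shows "integrable (obs_law a b F) g"
  using assms by (intro O.integrable_const_bound[where B=B]) (auto simp: measurable_cong_sets[OF sets_obs_law refl])

lemma obs_average_bound:
  assumes "\<And>v. \<bar>g v\<bar> \<le> B"
  shows "\<bar>obs_average g z\<bar> \<le> B"
proof -
  have w: "0 \<le> b z / a z" "0 \<le> (1 - b z) / a z" "0 \<le> 1 - 1 / a z"
    using a_bounds[of z] b_bounds[of z] by (auto simp: divide_simps split: if_splits)
  have "\<bar>obs_average g z\<bar> \<le> b z / a z * \<bar>g (z, True, True)\<bar> + (1 - b z) / a z * \<bar>g (z, True, False)\<bar>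
     + (1 - 1 / a z) * \<bar>g (z, False, False)\<bar>"
    unfolding obs_average_def using w
    by (intro order_trans[OF abs_triangle_ineq] add_mono) (simp_all only: abs_mult abs_of_nonneg order_refl)
  also have "\<dots> \<le> b z / a z * B + (1 - b z) / a z * B + (1 - 1 / a z) * B"
    using w assms by (intro add_mono mult_left_mono)
  also have "\<dots> = B" by (simp add: algebra_simps diff_divide_distrib)
  finally show ?thesis .
qed

lemma F_integrable:
  fixes g :: "'z \<Rightarrow> real"
  assumes "g \<in> borel_measurable borel" "\<And>v. \<bar>g v\<bar> \<le> B"
  shows "integrable F g"
  using assms by (intro F.integrable_const_bound[where B=B]) (auto simp: measurable_cong_sets[OF sets_F refl])

lemma obs_integral:
  fixes g :: "'z obs \<Rightarrow> real"
  assumes g: "g \<in> borel_measurable obs_space" and B: "\<And>v. \<bar>g v\<bar> \<le> B"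
  shows "(\<integral>v. g v \<partial>obs_law a b F) = (\<integral>z. obs_average g z \<partial>F)"
proof -
  have nonneg: "(\<integral>v. f v \<partial>obs_law a b F) = (\<integral>z. obs_average f z \<partial>F)"
    if f: "f \<in> borel_measurable obs_space" and f0: "\<And>v. 0 \<le> f v" for f :: "'z obs \<Rightarrow> real"
  proof -
    have "(\<integral>v. f v \<partial>obs_law a b F) = enn2real (\<integral>\<^sup>+v. ennreal (f v) \<partial>obs_law a b F)"
      using f f0 by (intro integral_eq_nn_integral) (auto simp: measurable_cong_sets[OF sets_obs_law refl])
    also have "(\<integral>\<^sup>+v. ennreal (f v) \<partial>obs_law a b F) = (\<integral>\<^sup>+z. \<integral>\<^sup>+v. ennreal (f v) \<partial>obs_kernel z \<partial>F)"
      unfolding obs_law_eq using f by (intro nn_integral_bind[OF _ obs_kernel_measurable]) auto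
    also have "\<dots> = (\<integral>\<^sup>+z. ennreal (obs_average f z) \<partial>F)"
      by (simp add: nn_integral_obs_kernel[OF f f0])
    also have "enn2real \<dots> = (\<integral>z. obs_average f z \<partial>F)"
    proof (rule integral_eq_nn_integral[symmetric])
      have "0 \<le> obs_average f z" for z
      proof -
        have "0 \<le> b z / a z" "0 \<le> (1 - b z) / a z" "0 \<le> 1 - 1 / a z"
          using a_bounds[of z] b_bounds[of z] by (auto simp: divide_simps split: if_splits)
        then show ?thesis unfolding obs_average_def using f0 by (intro add_nonneg_nonneg mult_nonneg_nonneg)
      qed
      then show "AE z in F. 0 \<le> obs_average f z" by simp
      show "obs_average f \<in> borel_measurable F"
        unfolding measurable_cong_sets[OF sets_F refl] by (rule obs_average_measurable[OF f])
    qed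
    finally show ?thesis .
  qed
  \<comment> \<open>Adding the bound makes the integrand nonnegative; the constant cancels at the
    end because both \<open>F\<close> and the law of an observation have mass 1.\<close>
  have "0 \<le> g v + B" for v using B[of v] by (simp add: abs_le_iff)
  then have "(\<integral>v. g v + B \<partial>obs_law a b F) = (\<integral>z. obs_average (\<lambda>v. g v + B) z \<partial>F)"
    using g by (intro nonneg) auto
  also have "obs_average (\<lambda>v. g v + B) = (\<lambda>z. obs_average g z + B)"
    by (simp add: obs_average_def fun_eq_iff algebra_simps diff_divide_distrib)
  finally show ?thesis
    using obs_integrable[OF g B] F_integrable[OF obs_average_measurable[OF g] obs_average_bound[OF B]]
    by (simp add: O.prob_space[unfolded space_obs_law] F.prob_space[unfolded space_F])
qed

text \<open>The sample space contains the impossible outcome in which \<open>RY\<close> is 1 and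
  \<open>R\<close> is 0. Excluding it almost surely allows \<open>R\<close> alone to mark the
  observations that contribute to the loglikelihood.\<close>

lemma AE_obs_law: "AE v in obs_law a b F. snd (snd v) \<longrightarrow> fst (snd v)"
proof -
  let ?g = "\<lambda>v. of_bool (snd (snd v) \<and> \<not> fst (snd v)) :: real"
  have m: "?g \<in> borel_measurable obs_space" unfolding of_bool_def by measurable
  have "(\<integral>v. ?g v \<partial>obs_law a b F) = (\<integral>z. obs_average ?g z \<partial>F)"
    by (rule obs_integral[OF m, of 1]) auto
  also have "\<dots> = 0" by (simp add: obs_average_def)
  finally have "(\<integral>v. ?g v \<partial>obs_law a b F) = 0" .
  then have "AE v in obs_law a b F. ?g v = 0"
    using obs_integrable[OF m, of 1] by (subst (asm) integral_nonneg_eq_0_iff_AE) auto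
  then show ?thesis by eventually_elim auto
qed

end

section \<open>Continuous paths and the prior\<close>

lemma space_path_space: "space path_space = {w :: 'z::topological_space \<Rightarrow> real. continuous_on UNIV w}"
  by (simp add: path_space_def space_restrict_space space_PiM)

lemma measurable_path_eval: "(\<lambda>w. w z) \<in> borel_measurable path_space"
  unfolding path_space_def by (intro measurable_restrict_space1 measurable_component_singleton) simp

text \<open>
  By continuity \<open>w z\<close> is the limit of the values of \<open>w\<close> at points of a countable dense set that
  approach \<open>z\<close> and depend measurably on \<open>z\<close>.
\<close>

lemma measurable_path_eval_pair:
  "(\<lambda>(w, z). w z) \<in> borel_measurable (path_space \<Otimes>\<^sub>M (borel :: 'z::polish_space measure))"
proof -
  obtain D :: "'z set" where D: "countable D" "\<And>X. open X \<Longrightarrow> X \<noteq> {} \<Longrightarrow> \<exists>d\<in>D. d \<in> X"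
    using countable_dense_setE by blast
  have "D \<noteq> {}" using D(2)[of UNIV] by auto
  then obtain d :: "nat \<Rightarrow> 'z" where d: "range d = D"
    using D(1) uncountable_def by blast
  have near: "\<exists>k. dist (d k) z < 1 / real (Suc m)" for z m
  proof -
    have "ball z (1 / real (Suc m)) \<noteq> {}" by simp
    then obtain e where "e \<in> D" "e \<in> ball z (1 / real (Suc m))" using D(2) by blast
    then show ?thesis using d by (auto simp: dist_commute)
  qed
  define K where "K m z = (LEAST k. dist (d k) z < 1 / real (Suc m))" for m z
  have K: "dist (d (K m z)) z < 1 / real (Suc m)" for m z
    unfolding K_def using near by (rule LeastI_ex)
  have K_m[measurable]: "K m \<in> measurable borel (count_space UNIV)" for m
    unfolding K_def[abs_def] by measurable
  have lim: "(\<lambda>m. d (K m z)) \<longlonglongrightarrow> z" for z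
  proof (rule metric_LIMSEQ_I)
    fix r :: real assume "0 < r"
    then obtain N where N: "1 / real (Suc N) < r"
      using reals_Archimedean by (auto simp: inverse_eq_divide)
    show "\<exists>no. \<forall>n\<ge>no. dist (d (K n z)) z < r"
    proof (intro exI allI impI)
      fix n assume "N \<le> n"
      then have "1 / real (Suc n) \<le> 1 / real (Suc N)" by (intro divide_left_mono) auto
      then show "dist (d (K n z)) z < r" using K[of n z] N by linarith
    qed
  qed
  have "(\<lambda>p. fst p (snd p)) \<in> borel_measurable (path_space \<Otimes>\<^sub>M (borel :: 'z measure))"
  proof (rule borel_measurable_LIMSEQ_real)
    fix p :: "('z \<Rightarrow> real) \<times> 'z" assume "p \<in> space (path_space \<Otimes>\<^sub>M (borel :: 'z measure))"
    then have "continuous_on UNIV (fst p)" by (auto simp: space_pair_measure space_path_space)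
    then show "(\<lambda>m. fst p (d (K m (snd p)))) \<longlonglongrightarrow> fst p (snd p)"
      using lim[of "snd p"] by (auto simp: continuous_on_eq_continuous_within intro: isCont_tendsto_compose)
  next
    fix m
    have "(\<lambda>p. (\<lambda>k p. fst p (d k)) (K m (snd p)) p) \<in> borel_measurable (path_space \<Otimes>\<^sub>M (borel :: 'z measure))"
    proof (rule measurable_compose_countable)
      show "(\<lambda>p. fst p (d k)) \<in> borel_measurable (path_space \<Otimes>\<^sub>M (borel :: 'z measure))" for k
        by (rule measurable_compose[OF measurable_fst measurable_path_eval])
      show "(\<lambda>p. K m (snd p)) \<in> measurable (path_space \<Otimes>\<^sub>M (borel :: 'z measure)) (count_space UNIV)"
        by measurable
    qed
    then show "(\<lambda>p. fst p (d (K m (snd p)))) \<in> borel_measurable (path_space \<Otimes>\<^sub>M (borel :: 'z measure))" .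
  qed
  then show ?thesis by (simp add: case_prod_beta')
qed

lemma logistic_pos: "0 < logistic x" and logistic_less_1: "logistic x < 1"
  by (auto simp: logistic_def add_pos_pos)

lemma logistic_bounds: "0 \<le> logistic x \<and> logistic x \<le> 1"
  using logistic_pos[of x] logistic_less_1[of x] by simp

lemma measurable_logistic [measurable]: "logistic \<in> borel_measurable borel"
  unfolding logistic_def[abs_def] by measurable

locale prior_model =
  fixes A :: "'z::polish_space \<Rightarrow> real" and Q :: "('z \<Rightarrow> real) measure" and \<sigma> :: real
  assumes A [measurable]: "A \<in> borel_measurable borel"
    and Q: "prob_space Q" and sets_Q [measurable_cong, simp]: "sets Q = sets path_space"
    and \<sigma>: "\<sigma> > 0"
begin

abbreviation "PR \<equiv> prior_law Q \<sigma>"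

abbreviation "bf \<equiv> \<lambda>p z. logistic (shift_path A (fst p) (snd p) z)"

lemma sets_prior: "sets PR = sets (path_space \<Otimes>\<^sub>M borel)"
  unfolding prior_law_def by (intro sets_pair_measure_cong) simp_all

sublocale Q: prob_space Q by (rule Q)
sublocale N: prob_space "normal_law 0 \<sigma>" by (rule prob_space_normal_law[OF \<sigma>])
sublocale QN: pair_prob_space Q "normal_law 0 \<sigma>" ..
sublocale prior: prob_space PR unfolding prior_law_def by (rule QN.prob_space_axioms)

lemma measurable_shift_path:
  "(\<lambda>(p, z). shift_path A (fst p) (snd p) z) \<in> borel_measurable (PR \<Otimes>\<^sub>M borel)"
proof -
  have e: "(\<lambda>q. (fst (fst q), snd q)) \<in> measurable (PR \<Otimes>\<^sub>M borel) (path_space \<Otimes>\<^sub>M (borel :: 'z measure))"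
    unfolding prior_law_def by measurable
  have [measurable]: "(\<lambda>q. fst (fst q) (snd q)) \<in> borel_measurable (PR \<Otimes>\<^sub>M (borel :: 'z measure))"
    using measurable_compose[OF e measurable_path_eval_pair] by (simp add: case_prod_beta')
  have [measurable]: "(\<lambda>q. snd (fst q)) \<in> borel_measurable (PR \<Otimes>\<^sub>M (borel :: 'z measure))"
    unfolding prior_law_def by measurable
  show ?thesis unfolding case_prod_beta' shift_path_def by measurable
qed

lemma measurable_bf: "(\<lambda>(p, z). bf p z) \<in> borel_measurable (PR \<Otimes>\<^sub>M borel)"
  using measurable_compose[OF measurable_shift_path measurable_logistic] by (simp add: case_prod_beta')

lemma measurable_bf_section:
  assumes "p \<in> space PR"
  shows "bf p \<in> borel_measurable borel" "shift_path A (fst p) (snd p) \<in> borel_measurable borel"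
  using measurable_Pair2[OF measurable_bf assms] measurable_Pair2[OF measurable_shift_path assms] by simp_all

end

context prior_model
begin

text \<open>Joint measurability in the parameter and \<open>F\<close> is what makes
  \<open>posterior_chi\<close> a genuine image law and gives access to Fubini. It is obtained by
  viewing the second component as a kernel.\<close>

lemma measurable_chi_bf:
  assumes D: "sets D = sets (prob_algebra borel)"
  shows "(\<lambda>(p, F). chi (bf p) F) \<in> borel_measurable (PR \<Otimes>\<^sub>M D)"
proof -
  have sP: "sets (PR \<Otimes>\<^sub>M D) = sets (PR \<Otimes>\<^sub>M prob_algebra borel)"
    using D by (intro sets_pair_measure_cong) auto
  have L: "snd \<in> measurable (PR \<Otimes>\<^sub>M prob_algebra borel) (subprob_algebra borel)"
    by (rule measurable_prob_algebraD) measurable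
  have "(\<lambda>(q, z). ennreal (bf (fst q) z)) \<in> borel_measurable ((PR \<Otimes>\<^sub>M prob_algebra borel) \<Otimes>\<^sub>M (borel :: 'z measure))"
  proof -
    have "(\<lambda>q. (fst (fst q), snd q)) \<in> measurable ((PR \<Otimes>\<^sub>M prob_algebra borel) \<Otimes>\<^sub>M borel) (PR \<Otimes>\<^sub>M (borel :: 'z measure))"
      by measurable
    from measurable_compose[OF measurable_compose[OF this measurable_bf] measurable_ennreal]
    show ?thesis by (simp add: case_prod_beta')
  qed
  then have "(\<lambda>q. \<integral>\<^sup>+z. ennreal (bf (fst q) z) \<partial>snd q) \<in> borel_measurable (PR \<Otimes>\<^sub>M prob_algebra borel)"
    by (rule nn_integral_measurable_subprob_algebra2[where f="\<lambda>q z. ennreal (bf (fst q) z)" and L=snd, OF _ L])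
  then have m: "(\<lambda>q. enn2real (\<integral>\<^sup>+z. ennreal (bf (fst q) z) \<partial>snd q)) \<in> borel_measurable (PR \<Otimes>\<^sub>M prob_algebra borel)"
    by (rule borel_measurable_enn2real)
  have eq: "enn2real (\<integral>\<^sup>+z. ennreal (bf (fst q) z) \<partial>snd q) = chi (bf (fst q)) (snd q)"
    if q: "q \<in> space (PR \<Otimes>\<^sub>M prob_algebra borel)" for q :: "(('z \<Rightarrow> real) \<times> real) \<times> 'z measure"
  proof -
    have p: "fst q \<in> space PR" and F': "snd q \<in> space (prob_algebra borel)"
      using q unfolding space_pair_measure mem_Times_iff by (rule conjunct1, rule conjunct2)
    have F: "sets (snd q) = sets borel" using F' unfolding space_prob_algebra by blast
    have b: "bf (fst q) \<in> borel_measurable (snd q)"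
      unfolding measurable_cong_sets[OF F refl] by (rule measurable_bf_section(1)[OF p])
    show ?thesis
      unfolding chi_def using logistic_bounds by (intro integral_eq_nn_integral[symmetric] b) simp
  qed
  have "(\<lambda>q. chi (bf (fst q)) (snd q)) \<in> borel_measurable (PR \<Otimes>\<^sub>M prob_algebra borel)"
    by (rule measurable_cong[OF eq, THEN iffD1, OF _ m])
  then show ?thesis unfolding measurable_cong_sets[OF sP refl] case_prod_beta' .
qed

lemma measurable_chi_bf_fixed:
  assumes F: "prob_space F" "sets F = sets borel"
  shows "(\<lambda>p. chi (bf p) F) \<in> borel_measurable PR"
proof -
  have "F \<in> space (prob_algebra borel)" using F by (simp add: space_prob_algebra)
  then show ?thesis using measurable_compose[OF measurable_Pair2' measurable_chi_bf[OF refl]] by simp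
qed

text \<open>The exponential factor is the ratio of the normal densities at \<open>l + \<tau>\<close>
  and at \<open>l\<close>. The path component is unaffected because it is independent of
  \<open>\<lambda>\<close>.\<close>

lemma nn_integral_prior_shift:
  assumes G[measurable]: "G \<in> borel_measurable PR"
  shows "(\<integral>\<^sup>+p. G p \<partial>PR) = (\<integral>\<^sup>+p. ennreal (exp (- (2 * snd p * \<tau> + \<tau>\<^sup>2) / (2 * \<sigma>\<^sup>2))) * G (fst p, snd p + \<tau>) \<partial>PR)"
proof -
  let ?e = "\<lambda>l. exp (- (2 * l * \<tau> + \<tau>\<^sup>2) / (2 * \<sigma>\<^sup>2))"
  have G'[measurable]: "G \<in> borel_measurable (Q \<Otimes>\<^sub>M normal_law 0 \<sigma>)" using G by (simp add: prior_law_def)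
  have Gb: "G \<in> borel_measurable (Q \<Otimes>\<^sub>M borel)"
    using G' by (simp cong: measurable_cong_sets sets_pair_measure_cong)
  have G2[measurable]: "(\<lambda>p. G (fst p, snd p + \<tau>)) \<in> borel_measurable (Q \<Otimes>\<^sub>M borel)"
    by (rule measurable_compose[OF _ Gb]) measurable
  have "(\<integral>\<^sup>+p. G p \<partial>PR) = (\<integral>\<^sup>+w. \<integral>\<^sup>+l. G (w, l) \<partial>normal_law 0 \<sigma> \<partial>Q)"
    unfolding prior_law_def by (intro N.nn_integral_fst[symmetric]) simp
  also have "\<dots> = (\<integral>\<^sup>+w. \<integral>\<^sup>+l. ennreal (?e l) * G (w, l + \<tau>) \<partial>normal_law 0 \<sigma> \<partial>Q)"
  proof (rule nn_integral_cong)
    fix w assume w: "w \<in> space Q"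
    have [measurable]: "(\<lambda>l. G (w, l)) \<in> borel_measurable borel"
      using measurable_Pair2[OF Gb w] .
    have "(\<integral>\<^sup>+l. G (w, l) \<partial>normal_law 0 \<sigma>) = (\<integral>\<^sup>+l. ennreal (normal_density 0 \<sigma> l) * G (w, l) \<partial>lborel)"
      unfolding normal_law_def by (subst nn_integral_density) auto
    also have "\<dots> = (\<integral>\<^sup>+l. ennreal (normal_density 0 \<sigma> (\<tau> + l)) * G (w, \<tau> + l) \<partial>lborel)"
      by (subst nn_integral_real_affine[where c=1 and t=\<tau>]) auto
    also have "\<dots> = (\<integral>\<^sup>+l. ennreal (normal_density 0 \<sigma> l) * (ennreal (?e l) * G (w, l + \<tau>)) \<partial>lborel)"
    proof (rule nn_integral_cong)
      fix l :: real
      have "- (\<tau> + l - 0)\<^sup>2 / (2 * \<sigma>\<^sup>2) = - (l - 0)\<^sup>2 / (2 * \<sigma>\<^sup>2) + - (2 * l * \<tau> + \<tau>\<^sup>2) / (2 * \<sigma>\<^sup>2)"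
        by (simp add: add_divide_distrib[symmetric] power2_eq_square algebra_simps)
      then have "normal_density 0 \<sigma> (\<tau> + l) = normal_density 0 \<sigma> l * ?e l"
        by (simp add: normal_density_def exp_add[symmetric])
      then show "ennreal (normal_density 0 \<sigma> (\<tau> + l)) * G (w, \<tau> + l) = ennreal (normal_density 0 \<sigma> l) * (ennreal (?e l) * G (w, l + \<tau>))"
        by (simp add: ennreal_mult mult.assoc add.commute)
    qed
    also have "\<dots> = (\<integral>\<^sup>+l. ennreal (?e l) * G (w, l + \<tau>) \<partial>normal_law 0 \<sigma>)"
      unfolding normal_law_def by (subst nn_integral_density) auto
    finally show "(\<integral>\<^sup>+l. G (w, l) \<partial>normal_law 0 \<sigma>) = (\<integral>\<^sup>+l. ennreal (?e l) * G (w, l + \<tau>) \<partial>normal_law 0 \<sigma>)" .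
  qed
  also have "\<dots> = (\<integral>\<^sup>+p. ennreal (?e (snd p)) * G (fst p, snd p + \<tau>) \<partial>(Q \<Otimes>\<^sub>M normal_law 0 \<sigma>))"
  proof -
    have "(\<lambda>p. ennreal (?e (snd p)) * G (fst p, snd p + \<tau>)) \<in> borel_measurable (Q \<Otimes>\<^sub>M borel)" by measurable
    then have "(\<lambda>p. ennreal (?e (snd p)) * G (fst p, snd p + \<tau>)) \<in> borel_measurable (Q \<Otimes>\<^sub>M normal_law 0 \<sigma>)"
      by (simp cong: measurable_cong_sets sets_pair_measure_cong)
    from N.nn_integral_fst[OF this] show ?thesis by simp
  qed
  finally show ?thesis by (simp add: prior_law_def)
qed
end

section \<open>Loglikelihood and posterior in the logit parametrisation\<close>

definition softplus :: "real \<Rightarrow> real" where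
  "softplus x = ln (1 + exp x)"

lemma logistic_softplus: "logistic x = exp (x - softplus x)" "1 - logistic x = exp (- softplus x)"
proof -
  have 1: "1 + exp x > 0" by (simp add: add_pos_pos)
  have "logistic x = exp x / (1 + exp x)"
    by (simp add: logistic_def exp_minus field_simps add_pos_pos less_imp_neq[OF 1, symmetric])
  then show *: "logistic x = exp (x - softplus x)" using 1 by (simp add: softplus_def exp_diff)
  have "1 - exp x / (1 + exp x) = 1 / (1 + exp x)" using 1 by (simp add: field_simps)
  then show "1 - logistic x = exp (- softplus x)"
    using \<open>logistic x = exp x / (1 + exp x)\<close> 1 by (simp add: softplus_def exp_minus inverse_eq_divide)
qed

text \<open>The disjunction of \<open>r\<close> and \<open>ry\<close>, rather than \<open>r\<close>
  alone, makes the identity with \<open>likelihood\<close> hold at every point of the sample space,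
  including the impossible outcome with \<open>ry\<close> but not \<open>r\<close>.\<close>

definition loglik :: "nat \<Rightarrow> (nat \<Rightarrow> 'z obs) \<Rightarrow> ('z \<Rightarrow> real) \<Rightarrow> real" where
  "loglik n x \<eta> = (\<Sum>i<n. case x i of (z, r, ry) \<Rightarrow> of_bool ry * \<eta> z - of_bool (r \<or> ry) * softplus (\<eta> z))"

lemma likelihood_logistic: "likelihood n x (\<lambda>z. logistic (\<eta> z)) = exp (loglik n x \<eta>)"
  unfolding likelihood_def loglik_def exp_sum[OF finite_lessThan]
  by (intro prod.cong refl) (auto simp: logistic_softplus(1) logistic_softplus(2)[unfolded logistic_softplus(1)] split: prod.split)

lemma likelihood_le_1: "likelihood n x (\<lambda>z. logistic (\<eta> z)) \<le> 1"
  unfolding likelihood_def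
  by (intro prod_le_1) (auto simp: logistic_bounds split: prod.split intro!: mult_le_one power_le_one mult_nonneg_nonneg)

context prior_model
begin

abbreviation "ll n x p \<equiv> loglik n x (shift_path A (fst p) (snd p))"

lemma measurable_shift_path_point [measurable]: "(\<lambda>p. shift_path A (fst p) (snd p) z) \<in> borel_measurable PR"
  using measurable_compose[OF measurable_Pair2' measurable_shift_path, of z] by simp

lemma measurable_ll [measurable]: "ll n x \<in> borel_measurable PR"
  unfolding loglik_def softplus_def case_prod_beta' by measurable

definition evidence :: "nat \<Rightarrow> (nat \<Rightarrow> 'z obs) \<Rightarrow> ennreal" where
  "evidence n x = (\<integral>\<^sup>+p. ennreal (exp (ll n x p)) \<partial>PR)"

lemma evidence: "0 < evidence n x" "evidence n x < top"
proof -
  have "evidence n x \<noteq> 0"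
    unfolding evidence_def by (subst nn_integral_0_iff_AE) (auto simp: prior.AE_False)
  then show "0 < evidence n x" by (simp add: zero_less_iff_neq_zero)
  have "evidence n x \<le> (\<integral>\<^sup>+p. 1 \<partial>PR)"
    unfolding evidence_def likelihood_logistic[symmetric]
    by (intro nn_integral_mono) (simp add: likelihood_le_1)
  also have "\<dots> = 1" by (simp add: prior.emeasure_space_1)
  finally show "evidence n x < top" using ennreal_one_less_top by (rule le_less_trans)
qed

lemma posterior_eq: "posterior A Q \<sigma> n x = density PR (\<lambda>p. ennreal (exp (ll n x p)) / evidence n x)"
  unfolding posterior_def Let_def evidence_def case_prod_beta' likelihood_logistic by (rule refl)

lemma sets_posterior [measurable_cong, simp]: "sets (posterior A Q \<sigma> n x) = sets PR"
  and space_posterior [simp]: "space (posterior A Q \<sigma> n x) = space PR"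
  by (simp_all add: posterior_eq)

lemma nn_integral_posterior:
  assumes [measurable]: "G \<in> borel_measurable PR"
  shows "(\<integral>\<^sup>+p. G p \<partial>posterior A Q \<sigma> n x) = (\<integral>\<^sup>+p. ennreal (exp (ll n x p)) * G p \<partial>PR) / evidence n x"
proof -
  have "(\<integral>\<^sup>+p. G p \<partial>posterior A Q \<sigma> n x) = (\<integral>\<^sup>+p. ennreal (exp (ll n x p)) / evidence n x * G p \<partial>PR)"
    unfolding posterior_eq by (rule nn_integral_density) measurable
  also have "\<dots> = (\<integral>\<^sup>+p. ennreal (exp (ll n x p)) * G p / evidence n x \<partial>PR)"
    by (intro nn_integral_cong) (simp add: ennreal_divide_times divide_ennreal_def mult_ac)
  also have "\<dots> = (\<integral>\<^sup>+p. ennreal (exp (ll n x p)) * G p \<partial>PR) / evidence n x"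
    by (rule nn_integral_divide) measurable
  finally show ?thesis .
qed

lemma prob_space_posterior: "prob_space (posterior A Q \<sigma> n x)"
proof
  have "emeasure (posterior A Q \<sigma> n x) (space (posterior A Q \<sigma> n x)) = (\<integral>\<^sup>+p. 1 \<partial>posterior A Q \<sigma> n x)" by simp
  also have "\<dots> = evidence n x / evidence n x"
    by (subst nn_integral_posterior) (simp_all add: evidence_def)
  also have "\<dots> = 1" using evidence[of n x] by (intro ennreal_divide_self) auto
  finally show "emeasure (posterior A Q \<sigma> n x) (space (posterior A Q \<sigma> n x)) = 1" .
qed

text \<open>
  Translating \<open>\<lambda>\<close> by \<open>\<tau>\<close> trades the exponential of \<open>t T\<close> for likelihood and prior ratios; if these
  almost cancel up to the constant \<open>c\<close>, the Laplace transform of \<open>T\<close> at \<open>t\<close> is close to \<open>exp c\<close>.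
\<close>

lemma posterior_tilt:
  assumes B[measurable]: "B \<in> sets PR" and T[measurable]: "T \<in> borel_measurable PR"
    and D: "\<And>w l. (w, l) \<in> space PR \<Longrightarrow> (w, l + \<tau>) \<in> B \<Longrightarrow>
      \<bar>t * T (w, l + \<tau>) + ll n x (w, l + \<tau>) - ll n x (w, l) - (2 * l * \<tau> + \<tau>\<^sup>2) / (2 * \<sigma>\<^sup>2) - c\<bar> \<le> \<kappa>"
  shows "(\<integral>\<^sup>+p. indicator B p * ennreal (exp (t * T p)) \<partial>posterior A Q \<sigma> n x) \<le> ennreal (exp (c + \<kappa>))"
    and "ennreal (exp (c - \<kappa>)) * emeasure (posterior A Q \<sigma> n x) {p \<in> space PR. (fst p, snd p + \<tau>) \<in> B}
      \<le> (\<integral>\<^sup>+p. indicator B p * ennreal (exp (t * T p)) \<partial>posterior A Q \<sigma> n x)"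
proof -
  let ?R = "\<lambda>p. (2 * snd p * \<tau> + \<tau>\<^sup>2) / (2 * \<sigma>\<^sup>2)"
  \<comment> \<open>\<open>B\<close> pulled back along the shift. Its posterior mass, close to 1 by
    the hypotheses on shifted paths, is the factor that is lost in the lower bound.\<close>
  let ?B' = "{p \<in> space PR. (fst p, snd p + \<tau>) \<in> B}"
  have "(\<lambda>p. (fst p, snd p + \<tau>)) \<in> measurable (path_space \<Otimes>\<^sub>M borel) (path_space \<Otimes>\<^sub>M (borel :: real measure))"
    by measurable
  then have sh[measurable]: "(\<lambda>p. (fst p, snd p + \<tau>)) \<in> measurable PR PR"
    unfolding measurable_cong_sets[OF sets_prior sets_prior] .
  have B'[measurable]: "?B' \<in> sets PR" by measurable
  have sp: "(fst p, snd p + \<tau>) \<in> space PR" if "p \<in> space PR" for p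
    using measurable_space[OF sh that] .
  have I: "(\<integral>\<^sup>+p. indicator B p * ennreal (exp (t * T p)) \<partial>posterior A Q \<sigma> n x)
      = (\<integral>\<^sup>+p. ennreal (exp (- (2 * snd p * \<tau> + \<tau>\<^sup>2) / (2 * \<sigma>\<^sup>2))) * (ennreal (exp (ll n x (fst p, snd p + \<tau>))) *
           (indicator B (fst p, snd p + \<tau>) * ennreal (exp (t * T (fst p, snd p + \<tau>))))) \<partial>PR) / evidence n x"
    by (subst nn_integral_posterior, measurable, subst nn_integral_prior_shift[of _ \<tau>], measurable)
  have pt: "ennreal (exp (- (2 * snd p * \<tau> + \<tau>\<^sup>2) / (2 * \<sigma>\<^sup>2))) * (ennreal (exp (ll n x (fst p, snd p + \<tau>))) *
           (indicator B (fst p, snd p + \<tau>) * ennreal (exp (t * T (fst p, snd p + \<tau>)))))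
      = indicator ?B' p * (ennreal (exp (ll n x p)) * ennreal (exp (t * T (fst p, snd p + \<tau>) + ll n x (fst p, snd p + \<tau>) - ll n x p - ?R p)))"
    (is "?L p = _ * (_ * ennreal (exp (?D p)))") if p: "p \<in> space PR" for p
  proof (cases "(fst p, snd p + \<tau>) \<in> B")
    case True
    have "exp (- (2 * snd p * \<tau> + \<tau>\<^sup>2) / (2 * \<sigma>\<^sup>2)) * (exp (ll n x (fst p, snd p + \<tau>)) * exp (t * T (fst p, snd p + \<tau>)))
        = exp (ll n x p) * exp (?D p)"
      unfolding exp_add[symmetric] by (simp add: minus_divide_left)
    with True p show ?thesis by (simp add: ennreal_mult[symmetric])
  qed (use p in simp)
  have Db: "c - \<kappa> \<le> ?D p" "?D p \<le> c + \<kappa>" if "p \<in> ?B'" for p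
    using D[of "fst p" "snd p"] that by (auto simp: abs_le_iff)
  show "(\<integral>\<^sup>+p. indicator B p * ennreal (exp (t * T p)) \<partial>posterior A Q \<sigma> n x) \<le> ennreal (exp (c + \<kappa>))"
  proof -
    have "(\<integral>\<^sup>+p. ?L p \<partial>PR) \<le> (\<integral>\<^sup>+p. ennreal (exp (c + \<kappa>)) * ennreal (exp (ll n x p)) \<partial>PR)"
    proof (rule nn_integral_mono)
      fix p assume p: "p \<in> space PR"
      show "?L p \<le> ennreal (exp (c + \<kappa>)) * ennreal (exp (ll n x p))"
      proof (cases "p \<in> ?B'")
        case True
        have "ennreal (exp (ll n x p)) * ennreal (exp (?D p)) \<le> ennreal (exp (ll n x p)) * ennreal (exp (c + \<kappa>))"
          using Db(2)[OF True] by (intro mult_left_mono ennreal_leI) auto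
        then show ?thesis unfolding pt[OF p] using True by (simp add: mult.commute)
      next
        case False
        then show ?thesis unfolding pt[OF p] by simp
      qed
    qed
    also have "\<dots> = ennreal (exp (c + \<kappa>)) * evidence n x"
      unfolding evidence_def by (rule nn_integral_cmult) measurable
    finally have "(\<integral>\<^sup>+p. ?L p \<partial>PR) / evidence n x \<le> ennreal (exp (c + \<kappa>)) * evidence n x / evidence n x"
      by (rule divide_right_mono_ennreal)
    also have "\<dots> = ennreal (exp (c + \<kappa>))"
      using evidence[of n x] by (intro mult_divide_eq_ennreal) auto
    finally show ?thesis unfolding I .
  qed
  show "ennreal (exp (c - \<kappa>)) * emeasure (posterior A Q \<sigma> n x) ?B'
      \<le> (\<integral>\<^sup>+p. indicator B p * ennreal (exp (t * T p)) \<partial>posterior A Q \<sigma> n x)"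
  proof -
    have "ennreal (exp (c - \<kappa>)) * emeasure (posterior A Q \<sigma> n x) ?B'
        = (\<integral>\<^sup>+p. ennreal (exp (c - \<kappa>)) * indicator ?B' p \<partial>posterior A Q \<sigma> n x)"
      using B' by (subst nn_integral_cmult_indicator) auto
    also have "\<dots> = (\<integral>\<^sup>+p. ennreal (exp (ll n x p)) * (ennreal (exp (c - \<kappa>)) * indicator ?B' p) \<partial>PR) / evidence n x"
      by (rule nn_integral_posterior) measurable
    also have "\<dots> \<le> (\<integral>\<^sup>+p. ?L p \<partial>PR) / evidence n x"
    proof (intro divide_right_mono_ennreal nn_integral_mono)
      fix p assume p: "p \<in> space PR"
      show "ennreal (exp (ll n x p)) * (ennreal (exp (c - \<kappa>)) * indicator ?B' p) \<le> ?L p"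
      proof (cases "p \<in> ?B'")
        case True
        have "ennreal (exp (ll n x p)) * ennreal (exp (c - \<kappa>)) \<le> ennreal (exp (ll n x p)) * ennreal (exp (?D p))"
          using Db(1)[OF True] by (intro mult_left_mono ennreal_leI) auto
        then show ?thesis unfolding pt[OF p] using True by simp
      next
        case False
        then show ?thesis by simp
      qed
    qed
    finally show ?thesis unfolding I .
  qed
qed

end

section \<open>Expansions and the Dirichlet posterior given the sample\<close>

lemma logistic_has_derivative:
  "(logistic has_real_derivative logistic x * (1 - logistic x)) (at x within S)"
proof -
  have "1 + exp (- x) \<noteq> 0" by (simp add: add_pos_pos less_imp_neq[symmetric])
  then have "((\<lambda>x. 1 / (1 + exp (- x))) has_real_derivative exp (- x) / (1 + exp (- x))\<^sup>2) (at x within S)"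
    by (auto intro!: derivative_eq_intros simp: power2_eq_square field_simps)
  moreover have "exp (- x) / (1 + exp (- x))\<^sup>2 = logistic x * (1 - logistic x)"
    using \<open>1 + exp (- x) \<noteq> 0\<close> by (simp add: logistic_def power2_eq_square field_simps)
  ultimately show ?thesis unfolding logistic_def[abs_def] by (simp add: logistic_def)
qed

lemma softplus_has_derivative:
  "(softplus has_real_derivative logistic x) (at x within S)"
proof -
  have 1: "1 + exp x > 0" by (simp add: add_pos_pos)
  then have "((\<lambda>x. ln (1 + exp x)) has_real_derivative exp x / (1 + exp x)) (at x within S)"
    by (auto intro!: derivative_eq_intros)
  moreover have "exp x / (1 + exp x) = logistic x"
    using 1 by (simp add: logistic_def exp_minus field_simps less_imp_neq[OF 1, symmetric] add_pos_pos)
  ultimately show ?thesis unfolding softplus_def[abs_def] by simp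
qed

text \<open>Integrates a derivative bound of order \<open>k\<close> to one of order
  \<open>k + 1\<close>. Three successive uses lead from a bounded third derivative of
  \<open>softplus\<close> to the cubic remainder.\<close>

lemma derivative_power_bound:
  fixes f :: "real \<Rightarrow> real"
  assumes "f 0 = 0" "\<And>z. (f has_real_derivative f' z) (at z)" "\<And>z. \<bar>f' z\<bar> \<le> \<bar>z\<bar> ^ k"
  shows "\<bar>f h\<bar> \<le> \<bar>h\<bar> ^ Suc k"
proof -
  have "norm (f h - f 0) \<le> \<bar>h\<bar> ^ k * norm (h - 0)"
  proof (rule field_differentiable_bound[where S="{-\<bar>h\<bar>..\<bar>h\<bar>}" and f'=f'])
    show "(f has_field_derivative f' z) (at z within {- \<bar>h\<bar>..\<bar>h\<bar>})" for z
      using assms(2)[of z] by (rule has_field_derivative_at_within)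
    show "norm (f' z) \<le> \<bar>h\<bar> ^ k" if "z \<in> {- \<bar>h\<bar>..\<bar>h\<bar>}" for z
      using assms(3)[of z] power_mono[of "\<bar>z\<bar>" "\<bar>h\<bar>" k] that by (auto simp: abs_le_iff)
  qed auto
  then show ?thesis using assms(1) by (simp add: mult.commute)
qed

text \<open>Expanded at the endpoint \<open>\<eta>\<close> with a step backwards: later
  \<open>\<eta>\<close> is the already shifted path, which belongs to the class on which the
  empirical processes are controlled, while the path before the shift need not belong to it.\<close>

lemma softplus_expansion:
  "\<bar>softplus \<eta> - softplus (\<eta> - h) - h * logistic \<eta> + h\<^sup>2 / 2 * (logistic \<eta> * (1 - logistic \<eta>))\<bar> \<le> \<bar>h\<bar> ^ 3"
proof -
  let ?v = "\<lambda>x. logistic x * (1 - logistic x)"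
  have v01: "0 \<le> ?v x" "?v x \<le> 1" for x
    using logistic_bounds[of x] by (auto intro: mult_le_one)
  note D = logistic_has_derivative[THEN DERIV_chain2] softplus_has_derivative[THEN DERIV_chain2]
  have 1: "\<bar>?v \<eta> - ?v (\<eta> - z)\<bar> \<le> \<bar>z\<bar> ^ Suc 0" for z
  proof (rule derivative_power_bound)
    show "((\<lambda>z. ?v \<eta> - ?v (\<eta> - z)) has_real_derivative ?v (\<eta> - z) * (1 - 2 * logistic (\<eta> - z))) (at z)" for z
      by (auto intro!: derivative_eq_intros D simp: algebra_simps)
    have "\<bar>?v x * (1 - 2 * logistic x)\<bar> \<le> 1" for x
      unfolding abs_mult using v01[of x] logistic_bounds[of x] by (intro mult_le_one) (auto simp: abs_le_iff)
    then show "\<bar>?v (\<eta> - z) * (1 - 2 * logistic (\<eta> - z))\<bar> \<le> \<bar>z\<bar> ^ 0" for z by simp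
  qed simp
  have 2: "\<bar>logistic (\<eta> - z) - logistic \<eta> + z * ?v \<eta>\<bar> \<le> \<bar>z\<bar> ^ Suc (Suc 0)" for z
  proof (rule derivative_power_bound)
    show "((\<lambda>z. logistic (\<eta> - z) - logistic \<eta> + z * ?v \<eta>) has_real_derivative ?v \<eta> - ?v (\<eta> - z)) (at z)" for z
      by (auto intro!: derivative_eq_intros D)
  qed (use 1 in auto)
  have "\<bar>softplus \<eta> - softplus (\<eta> - h) - h * logistic \<eta> + h\<^sup>2 / 2 * ?v \<eta>\<bar> \<le> \<bar>h\<bar> ^ Suc (Suc (Suc 0))"
  proof (rule derivative_power_bound[where f="\<lambda>h. softplus \<eta> - softplus (\<eta> - h) - h * logistic \<eta> + h\<^sup>2 / 2 * ?v \<eta>"])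
    show "((\<lambda>h. softplus \<eta> - softplus (\<eta> - h) - h * logistic \<eta> + h\<^sup>2 / 2 * ?v \<eta>) has_real_derivative
        logistic (\<eta> - z) - logistic \<eta> + z * ?v \<eta>) (at z)" for z
      by (auto intro!: derivative_eq_intros D)
  qed (use 2 in auto)
  then show ?thesis by (simp add: numeral_3_eq_3)
qed

definition oR :: "'z obs \<Rightarrow> real" where "oR v = of_bool (fst (snd v))"
definition oY :: "'z obs \<Rightarrow> real" where "oY v = of_bool (snd (snd v))"

lemma oR_bounds: "0 \<le> oR v" "oR v \<le> 1" and oY_bounds: "0 \<le> oY v" "oY v \<le> 1"
  by (auto simp: oR_def oY_def)

lemma oR_measurable [measurable]: "oR \<in> borel_measurable obs_space"
  and oY_measurable [measurable]: "oY \<in> borel_measurable obs_space"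
  unfolding oR_def[abs_def] oY_def[abs_def] of_bool_def by measurable

lemma loglik_expansion:
  fixes a \<eta> :: "'z \<Rightarrow> real"
  assumes valid: "\<And>i. i < n \<Longrightarrow> snd (snd (x i)) \<longrightarrow> fst (snd (x i))" and a: "\<And>z. \<bar>a z\<bar> \<le> A"
  shows "\<bar>loglik n x \<eta> - loglik n x (\<lambda>z. \<eta> z - \<tau> * a z)
      - \<tau> * (\<Sum>i<n. a (fst (x i)) * (oY (x i) - oR (x i) * logistic (\<eta> (fst (x i)))))
      - \<tau>\<^sup>2 / 2 * (\<Sum>i<n. oR (x i) * (a (fst (x i)))\<^sup>2 * (logistic (\<eta> (fst (x i))) * (1 - logistic (\<eta> (fst (x i))))))\<bar>
    \<le> real n * (\<bar>\<tau>\<bar> * A) ^ 3"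
proof -
  let ?e = "\<lambda>i. softplus (\<eta> (fst (x i))) - softplus (\<eta> (fst (x i)) - \<tau> * a (fst (x i))) - \<tau> * a (fst (x i)) * logistic (\<eta> (fst (x i)))
     + (\<tau> * a (fst (x i)))\<^sup>2 / 2 * (logistic (\<eta> (fst (x i))) * (1 - logistic (\<eta> (fst (x i)))))"
  have ll: "loglik n x \<zeta> = (\<Sum>i<n. oY (x i) * \<zeta> (fst (x i)) - oR (x i) * softplus (\<zeta> (fst (x i))))" for \<zeta>
    unfolding loglik_def using valid by (intro sum.cong refl) (auto simp: oR_def oY_def split: prod.split)
  have eq: "loglik n x \<eta> - loglik n x (\<lambda>z. \<eta> z - \<tau> * a z)
      - \<tau> * (\<Sum>i<n. a (fst (x i)) * (oY (x i) - oR (x i) * logistic (\<eta> (fst (x i)))))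
      - \<tau>\<^sup>2 / 2 * (\<Sum>i<n. oR (x i) * (a (fst (x i)))\<^sup>2 * (logistic (\<eta> (fst (x i))) * (1 - logistic (\<eta> (fst (x i))))))
      = (\<Sum>i<n. - (oR (x i) * ?e i))"
    unfolding ll sum_distrib_left sum_subtractf[symmetric]
    by (intro sum.cong refl) (simp add: field_simps power_mult_distrib)
  have "\<bar>\<Sum>i<n. - (oR (x i) * ?e i)\<bar> \<le> (\<Sum>i<n. (\<bar>\<tau>\<bar> * A) ^ 3)"
  proof (rule order_trans[OF sum_abs], rule sum_mono)
    fix i
    have "\<bar>?e i\<bar> \<le> \<bar>\<tau> * a (fst (x i))\<bar> ^ 3" by (rule softplus_expansion)
    also have "\<dots> \<le> (\<bar>\<tau>\<bar> * A) ^ 3"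
      unfolding abs_mult using a by (intro power_mono mult_left_mono) auto
    finally have "\<bar>?e i\<bar> \<le> (\<bar>\<tau>\<bar> * A) ^ 3" .
    moreover have "oR (x i) * \<bar>?e i\<bar> \<le> 1 * \<bar>?e i\<bar>" by (intro mult_right_mono oR_bounds) auto
    ultimately show "\<bar>- (oR (x i) * ?e i)\<bar> \<le> (\<bar>\<tau>\<bar> * A) ^ 3"
      using oR_bounds[of "x i"] by (simp add: abs_mult)
  qed
  then show ?thesis unfolding eq by simp
qed

lemma whp_LLN:
  fixes M :: "'a measure" and S :: "nat \<Rightarrow> 's measure" and f :: "nat \<Rightarrow> 's \<Rightarrow> 'a \<Rightarrow> real"
  assumes M: "prob_space M" and S: "\<And>n. prob_space (S n)"
    and P: "\<And>n. P n = Pi\<^sub>M {..<n} (\<lambda>_. M) \<Otimes>\<^sub>M S n"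
    and f: "\<And>n. (\<lambda>(s, x). f n s x) \<in> borel_measurable (S n \<Otimes>\<^sub>M M)"
    and bound: "\<And>n s x. \<bar>f n s x\<bar> \<le> B" and c: "c > 0"
  shows "whp P (\<lambda>n (x, s). \<bar>emp_mean n x (f n s) - (\<integral>v. f n s v \<partial>M)\<bar> \<le> c)"
proof -
  interpret M: prob_space M by fact
  have fs[measurable]: "f n s \<in> borel_measurable M" if "s \<in> space (S n)" for n s
    using measurable_Pair2[OF f that] by simp
  have fi: "integrable M (f n s)" if "s \<in> space (S n)" for n s
    using bound fs[OF that] by (intro M.integrable_const_bound[where B=B]) auto
  have mb: "\<bar>\<integral>v. f n s v \<partial>M\<bar> \<le> B" if s: "s \<in> space (S n)" for n s
  proof -
    have "\<bar>\<integral>v. f n s v \<partial>M\<bar> \<le> (\<integral>v. \<bar>f n s v\<bar> \<partial>M)" by (rule integral_abs_bound)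
    also have "\<dots> \<le> (\<integral>v. B \<partial>M)" using fi[OF s] bound by (intro integral_mono) auto
    finally show ?thesis by (simp add: M.prob_space)
  qed
  \<comment> \<open>Dividing by \<open>sqrt (real n)\<close> reduces the law of large numbers to
    \<open>whp_Chebyshev\<close>, with a variance of order \<open>1 / n\<close>.\<close>
  let ?Z = "\<lambda>n s v. (f n s v - (\<integral>v. f n s v \<partial>M)) / sqrt (real n)"
  have zb: "\<bar>f n s v - (\<integral>v. f n s v \<partial>M)\<bar> \<le> 2 * B" if "s \<in> space (S n)" for n s v
    using mb[OF that] bound[of n s v] by linarith
  have "whp P (\<lambda>n (x, s). \<bar>\<Sum>i<n. ?Z n s (x i)\<bar> \<le> c * sqrt (real n))"
  proof (rule whp_Chebyshev[OF M S P, where B="\<lambda>n. 2 * B / sqrt (real n)" and v="\<lambda>n. (2 * B)\<^sup>2 / real n", OF _ _ _ _ _ c])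
    fix n
    have [measurable]: "(\<lambda>s. \<integral>v. f n s v \<partial>M) \<in> borel_measurable (S n)"
      using M.borel_measurable_lebesgue_integral[OF f[of n]] by simp
    have [measurable]: "(\<lambda>w. f n (fst w) (snd w)) \<in> borel_measurable (S n \<Otimes>\<^sub>M M)"
      using f[of n] by (simp add: case_prod_beta')
    have [measurable]: "(\<lambda>w. \<integral>v. f n (fst w) v \<partial>M) \<in> borel_measurable (S n \<Otimes>\<^sub>M M)"
      by (rule measurable_compose[OF measurable_fst]) measurable
    show "(\<lambda>(s, v). ?Z n s v) \<in> borel_measurable (S n \<Otimes>\<^sub>M M)" unfolding case_prod_beta' by measurable
    fix s assume s: "s \<in> space (S n)"
    show "\<bar>?Z n s v\<bar> \<le> 2 * B / sqrt (real n)" for v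
      using zb[OF s] by (simp add: abs_divide divide_right_mono)
    show "(\<integral>v. ?Z n s v \<partial>M) = 0" using fi[OF s] by (simp add: M.prob_space)
    have "(\<integral>v. (?Z n s v)\<^sup>2 \<partial>M) \<le> (\<integral>v. (2 * B)\<^sup>2 / real n \<partial>M)"
    proof (rule integral_mono')
      fix v
      have "(f n s v - (\<integral>v. f n s v \<partial>M))\<^sup>2 \<le> (2 * B)\<^sup>2"
        using power_mono[OF zb[OF s, of v], of 2] by simp
      then show "(?Z n s v)\<^sup>2 \<le> (2 * B)\<^sup>2 / real n" by (simp add: power_divide divide_right_mono)
    qed auto
    then show "(\<integral>v. (?Z n s v)\<^sup>2 \<partial>M) \<le> (2 * B)\<^sup>2 / real n" by (simp add: M.prob_space)
  next
    have "(\<lambda>n. (2 * B)\<^sup>2 * (1 / real n)) \<longlonglongrightarrow> (2 * B)\<^sup>2 * 0"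
      by (intro tendsto_mult tendsto_const lim_1_over_n)
    then show "(\<lambda>n. (2 * B)\<^sup>2 / real n) \<longlonglongrightarrow> 0" by simp
  qed
  then show ?thesis
  proof (rule whp_mono)
    show "\<forall>\<^sub>F n in sequentially. \<forall>\<omega>\<in>space (P n). (case \<omega> of (x, s) \<Rightarrow> \<bar>\<Sum>i<n. ?Z n s (x i)\<bar> \<le> c * sqrt (real n)) \<longrightarrow>
        (case \<omega> of (x, s) \<Rightarrow> \<bar>emp_mean n x (f n s) - (\<integral>v. f n s v \<partial>M)\<bar> \<le> c)"
      using eventually_gt_at_top[of 0]
    proof eventually_elim
      case (elim n)
      show ?case
      proof (clarify)
        fix x s assume le: "\<bar>\<Sum>i<n. ?Z n s (x i)\<bar> \<le> c * sqrt (real n)"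
        let ?m = "\<integral>v. f n s v \<partial>M"
        have n: "real n > 0" "sqrt (real n) > 0" using elim by auto
        have "(\<Sum>i<n. ?Z n s (x i)) = (\<Sum>i<n. f n s (x i) - ?m) / sqrt (real n)"
          by (simp add: sum_divide_distrib)
        also have "(\<Sum>i<n. f n s (x i) - ?m) = real n * (emp_mean n x (f n s) - ?m)"
          using n by (simp add: emp_mean_def sum_subtractf field_simps)
        also have "\<dots> / sqrt (real n) = sqrt (real n) * (emp_mean n x (f n s) - ?m)"
        proof -
          have "real n * y / sqrt (real n) = (real n / sqrt (real n)) * y" for y by simp
          then show ?thesis by (simp add: real_div_sqrt)
        qed
        finally show "\<bar>emp_mean n x (f n s) - ?m\<bar> \<le> c" using le n by (simp add: abs_mult mult.commute)
      qed
    qed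
  qed
qed

lemma
  fixes \<nu> :: "'z::topological_space measure"
  assumes \<nu>: "finite_measure \<nu>" and s\<nu>: "sets \<nu> = sets borel"
  shows sets_dp_base: "sets (dp_base \<nu> n x) = sets borel"
    and emeasure_dp_base: "A \<in> sets borel \<Longrightarrow> emeasure (dp_base \<nu> n x) A = emeasure \<nu> A + (\<Sum>i<n. indicator A (fst (x i)))"
proof -
  show s: "sets (dp_base \<nu> n x) = sets borel"
    unfolding dp_base_def by (subst sets_measure_of) (auto simp: sets.sigma_sets_eq[of borel, simplified])
  show "emeasure (dp_base \<nu> n x) A = emeasure \<nu> A + (\<Sum>i<n. indicator A (fst (x i)))" if "A \<in> sets borel"
  proof (rule emeasure_measure_of[OF dp_base_def])
    show "countably_additive (sets (dp_base \<nu> n x)) (\<lambda>A. emeasure \<nu> A + (\<Sum>i<n. indicator A (fst (x i))))"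
      unfolding s countably_additive_def
    proof (intro allI impI)
      fix A :: "nat \<Rightarrow> 'z set" assume A: "range A \<subseteq> sets borel" "disjoint_family A" "\<Union>(range A) \<in> sets borel"
      have "(\<Sum>k. indicator (A k) z) = (indicator (\<Union>(range A)) z :: ennreal)" for z
        using A(2) by (rule suminf_indicator)
      moreover have "(\<Sum>k. emeasure \<nu> (A k)) = emeasure \<nu> (\<Union>(range A))"
        using A s\<nu> by (intro suminf_emeasure) auto
      ultimately show "(\<Sum>k. emeasure \<nu> (A k) + (\<Sum>i<n. indicator (A k) (fst (x i)))) = emeasure \<nu> (\<Union>(range A)) + (\<Sum>i<n. indicator (\<Union>(range A)) (fst (x i)))"
        by (subst suminf_add[symmetric]) (auto simp: suminf_sum)
    qed
    show "positive (sets (dp_base \<nu> n x)) (\<lambda>A. emeasure \<nu> A + (\<Sum>i<n. indicator A (fst (x i))))"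
      by (simp add: positive_def)
  qed (use that s in auto)
qed

lemma
  fixes \<nu> :: "'z::topological_space measure"
  assumes \<nu>: "finite_measure \<nu>" and s\<nu>: "sets \<nu> = sets borel"
  shows finite_measure_dp_base: "finite_measure (dp_base \<nu> n x)"
    and measure_dp_base_UNIV: "measure (dp_base \<nu> n x) UNIV = measure \<nu> UNIV + real n"
    and integral_dp_base: "g \<in> borel_measurable borel \<Longrightarrow> (\<And>z. 0 \<le> g z \<and> g z \<le> (1::real)) \<Longrightarrow>
      (\<integral>z. g z \<partial>dp_base \<nu> n x) = (\<integral>z. g z \<partial>\<nu>) + (\<Sum>i<n. g (fst (x i)))"
proof -
  interpret \<nu>: finite_measure \<nu> by fact
  note s = sets_dp_base[OF \<nu> s\<nu>, of n x]
  have sp: "space (dp_base \<nu> n x) = UNIV" using sets_eq_imp_space_eq[OF s] by simp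
  have U: "emeasure (dp_base \<nu> n x) UNIV = ennreal (measure \<nu> UNIV + real n)"
    by (simp add: emeasure_dp_base[OF \<nu> s\<nu>] \<nu>.emeasure_eq_measure ennreal_of_nat_eq_real_of_nat)
  then show "finite_measure (dp_base \<nu> n x)" by (intro finite_measureI) (simp add: sp)
  show "measure (dp_base \<nu> n x) UNIV = measure \<nu> UNIV + real n" by (rule measure_eq_emeasure_eq_ennreal[OF _ U]) simp
  assume g: "g \<in> borel_measurable borel" and g01: "\<And>z. 0 \<le> g z \<and> g z \<le> (1::real)"
  have nn: "(\<integral>\<^sup>+z. f z \<partial>dp_base \<nu> n x) = (\<integral>\<^sup>+z. f z \<partial>\<nu>) + (\<Sum>i<n. f (fst (x i)))"
    if "f \<in> borel_measurable borel" for f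
    using that
  proof (induction rule: borel_measurable_induct)
    case (cong f g)
    then show ?case using nn_integral_cong by (simp cong: nn_integral_cong)
  next
    case (set A)
    then show ?case by (simp add: emeasure_dp_base[OF \<nu> s\<nu>] s s\<nu>)
  next
    case (mult u v)
    then show ?case
      by (simp add: nn_integral_cmult measurable_cong_sets[OF s refl] measurable_cong_sets[OF s\<nu> refl] distrib_left sum_distrib_left)
  next
    case (add u v)
    then show ?case
      by (simp add: nn_integral_add measurable_cong_sets[OF s refl] measurable_cong_sets[OF s\<nu> refl] sum.distrib ac_simps)
  next
    case (seq U)
    have m: "U k \<in> borel_measurable \<nu>" "U k \<in> borel_measurable (dp_base \<nu> n x)" for k
      using seq by (simp_all add: measurable_cong_sets[OF s refl] measurable_cong_sets[OF s\<nu> refl])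
    have inc: "incseq (\<lambda>k. integral\<^sup>N \<nu> (U k))" "incseq (\<lambda>k. U k z)" for z
      using seq by (auto simp: incseq_def le_fun_def intro!: nn_integral_mono)
    have "(\<integral>\<^sup>+z. (SUP k. U k z) \<partial>dp_base \<nu> n x) = (SUP k. integral\<^sup>N (dp_base \<nu> n x) (U k))"
      using seq m by (intro nn_integral_monotone_convergence_SUP) auto
    also have "\<dots> = (SUP k. integral\<^sup>N \<nu> (U k) + (\<Sum>i<n. U k (fst (x i))))" using seq by simp
    also have "\<dots> = (SUP k. integral\<^sup>N \<nu> (U k)) + (\<Sum>i<n. SUP k. U k (fst (x i)))"
      using inc by (subst ennreal_SUP_add) (auto simp: incseq_sumI incseq_def intro!: sum_mono ennreal_SUP_sum arg_cong2[where f="(+)"])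
    also have "(SUP k. integral\<^sup>N \<nu> (U k)) = (\<integral>\<^sup>+z. (SUP k. U k z) \<partial>\<nu>)"
      using seq m by (intro nn_integral_monotone_convergence_SUP[symmetric]) auto
    finally show ?case by (simp add: image_comp)
  qed
  have b: "(\<integral>\<^sup>+z. ennreal (g z) \<partial>\<nu>) < top"
  proof -
    have "(\<integral>\<^sup>+z. ennreal (g z) \<partial>\<nu>) \<le> (\<integral>\<^sup>+z. 1 \<partial>\<nu>)" using g01 by (intro nn_integral_mono) auto
    also have "\<dots> < top" by (simp add: \<nu>.emeasure_eq_measure)
    finally show ?thesis .
  qed
  have "(\<integral>z. g z \<partial>dp_base \<nu> n x) = enn2real (\<integral>\<^sup>+z. ennreal (g z) \<partial>dp_base \<nu> n x)"
    using g g01 by (intro integral_eq_nn_integral) (auto simp: measurable_cong_sets[OF s refl])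
  also have "(\<integral>\<^sup>+z. ennreal (g z) \<partial>dp_base \<nu> n x) = (\<integral>\<^sup>+z. ennreal (g z) \<partial>\<nu>) + ennreal (\<Sum>i<n. g (fst (x i)))"
    using g g01 by (subst nn) (auto simp: sum_ennreal)
  also have "enn2real \<dots> = enn2real (\<integral>\<^sup>+z. ennreal (g z) \<partial>\<nu>) + (\<Sum>i<n. g (fst (x i)))"
    using b g01 by (subst enn2real_plus) (auto simp: sum_nonneg)
  also have "enn2real (\<integral>\<^sup>+z. ennreal (g z) \<partial>\<nu>) = (\<integral>z. g z \<partial>\<nu>)"
    using g g01 by (intro integral_eq_nn_integral[symmetric]) (auto simp: measurable_cong_sets[OF s\<nu> refl])
  finally show "(\<integral>z. g z \<partial>dp_base \<nu> n x) = (\<integral>z. g z \<partial>\<nu>) + (\<Sum>i<n. g (fst (x i)))" .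
qed

text \<open>Replaces the total mass and the mean of the base measure by \<open>n\<close> and the
  sample mean. The finite prior mass changes each by a negligible amount, uniformly in the sample,
  which enters only through the variance condition.\<close>

lemma dirichlet_process_clt_sample:
  fixes \<nu> :: "'z::topological_space measure"
  assumes \<nu>: "finite_measure \<nu>" and s\<nu>: "sets \<nu> = sets borel" and V: "V \<ge> 0" and e: "e > 0"
  obtains \<delta> n0 where "\<delta> > 0"
    "\<And>n x D g f. n0 \<le> n \<Longrightarrow> dirichlet_process (dp_base \<nu> n x) D \<Longrightarrow> g \<in> borel_measurable borel \<Longrightarrow>
       (\<And>z. 0 \<le> g z \<and> g z \<le> 1) \<Longrightarrow>
       \<bar>emp_mean n x (\<lambda>v. (g (fst v))\<^sup>2) - (emp_mean n x (\<lambda>v. g (fst v)))\<^sup>2 - V\<bar> \<le> \<delta> \<Longrightarrow> f \<in> BL_unit \<Longrightarrow>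
       \<bar>(\<integral>F. f (sqrt (real n) * (chi g F - emp_mean n x (\<lambda>v. g (fst v)))) \<partial>D) - (\<integral>y. f y \<partial>gauss V)\<bar> \<le> e"
proof -
  interpret \<nu>: finite_measure \<nu> by fact
  have sp\<nu>: "space \<nu> = UNIV" using sets_eq_imp_space_eq[OF s\<nu>] by simp
  obtain N0 \<delta> where \<delta>: "\<delta> > 0" and clt:
    "\<And>(\<alpha> :: 'z measure) D g f N m. finite_measure \<alpha> \<Longrightarrow> sets \<alpha> = sets borel \<Longrightarrow> dirichlet_process \<alpha> D \<Longrightarrow>
       N = measure \<alpha> UNIV \<Longrightarrow> N0 \<le> N \<Longrightarrow>
       g \<in> borel_measurable borel \<Longrightarrow> (\<And>z. 0 \<le> g z \<and> g z \<le> 1) \<Longrightarrow> m = (\<integral>z. g z \<partial>\<alpha>) / N \<Longrightarrow>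
       \<bar>(\<integral>z. (g z)\<^sup>2 \<partial>\<alpha>) / N - m\<^sup>2 - V\<bar> \<le> \<delta> \<Longrightarrow> f \<in> BL_unit \<Longrightarrow>
       \<bar>(\<integral>F. f (sqrt N * ((\<integral>z. g z \<partial>F) - m)) \<partial>D) - (\<integral>x. f x \<partial>gauss V)\<bar> \<le> e / 2"
    by (rule dirichlet_process_clt[OF V half_gt_zero[OF e], where 'z='z]) blast
  define M where "M = measure \<nu> UNIV"
  have M0: "0 \<le> M" by (simp add: M_def)
  \<comment> \<open>Write \<open>M\<close> for the mass of \<open>\<nu>\<close>. The second moment
    and the squared mean move by at most \<open>M / n\<close> and \<open>2 * M / n\<close>, giving
    \<open>6 * M / \<delta>\<close>; recentring and the change from \<open>sqrt N\<close> to
    \<open>sqrt (real n)\<close> each move the argument of \<open>f\<close> by at most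
    \<open>M / sqrt n\<close>, giving \<open>(4 * M / e)\<^sup>2\<close>.\<close>
  define n0 where "n0 = nat \<lceil>max 1 (max N0 (max (6 * M / \<delta>) ((4 * M / e)\<^sup>2)))\<rceil>"
  show ?thesis
  proof (rule that[of "\<delta> / 2" n0])
    show "0 < \<delta> / 2" using \<delta> by simp
    fix n x D g f
    assume n: "n0 \<le> n" and D: "dirichlet_process (dp_base \<nu> n x) D" and g: "g \<in> borel_measurable borel"
      and g01: "\<And>z. 0 \<le> g z \<and> g z \<le> (1::real)"
      and v: "\<bar>emp_mean n x (\<lambda>v. (g (fst v))\<^sup>2) - (emp_mean n x (\<lambda>v. g (fst v)))\<^sup>2 - V\<bar> \<le> \<delta> / 2" and f: "f \<in> BL_unit"
    have "max 1 (max N0 (max (6 * M / \<delta>) ((4 * M / e)\<^sup>2))) \<le> real n"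
      using n by (simp add: n0_def)
    then have n1: "1 \<le> real n" "N0 \<le> real n" "6 * M / \<delta> \<le> real n" "(4 * M / e)\<^sup>2 \<le> real n" by simp_all
    define N where "N = M + real n"
    have N: "N = measure (dp_base \<nu> n x) UNIV" "N0 \<le> N" "0 < N" "real n \<le> N"
      using n1 M0 by (simp_all add: N_def measure_dp_base_UNIV[OF \<nu> s\<nu>] M_def[symmetric])
    let ?E = "\<lambda>g. emp_mean n x (\<lambda>v. g (fst v))"
    have E01: "0 \<le> ?E p" "?E p \<le> 1" if "\<And>z. 0 \<le> p z \<and> p z \<le> (1::real)" for p
    proof -
      have "(\<Sum>i<n. p (fst (x i))) \<le> (\<Sum>i<n. 1)" using that by (intro sum_mono) auto
      then show "?E p \<le> 1" using n1 by (simp add: emp_mean_def)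
      show "0 \<le> ?E p" unfolding emp_mean_def using that by (intro divide_nonneg_nonneg sum_nonneg) auto
    qed
    have mean: "\<bar>(\<integral>z. p z \<partial>dp_base \<nu> n x) / N - ?E p\<bar> \<le> M / real n"
      if p: "p \<in> borel_measurable borel" "\<And>z. 0 \<le> p z \<and> p z \<le> (1::real)" for p
    proof -
      have i: "integrable \<nu> p"
        using p by (intro \<nu>.integrable_const_bound[where B=1]) (auto simp: measurable_cong_sets[OF s\<nu> refl])
      have "(\<integral>z. p z \<partial>\<nu>) \<le> (\<integral>z. 1 \<partial>\<nu>)" using i p by (intro integral_mono) auto
      then have I: "0 \<le> (\<integral>z. p z \<partial>\<nu>)" "(\<integral>z. p z \<partial>\<nu>) \<le> M"
        using p sp\<nu> by (auto simp: M_def intro!: Bochner_Integration.integral_nonneg)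
      have "(\<integral>z. p z \<partial>dp_base \<nu> n x) = (\<integral>z. p z \<partial>\<nu>) + real n * ?E p"
        using n1 by (simp add: integral_dp_base[OF \<nu> s\<nu> p] emp_mean_def)
      then have "(\<integral>z. p z \<partial>dp_base \<nu> n x) / N - ?E p = ((\<integral>z. p z \<partial>\<nu>) - M * ?E p) / N"
        using N(3) by (simp add: N_def field_simps)
      also have "\<bar>\<dots>\<bar> \<le> M / N"
      proof -
        have e: "0 \<le> ?E p" "?E p \<le> 1" using E01[of p] p by auto
        have "0 \<le> M * ?E p" "M * ?E p \<le> M" using mult_left_mono[OF e(2) M0] e(1) M0 by auto
        then have "\<bar>(\<integral>z. p z \<partial>\<nu>) - M * ?E p\<bar> \<le> M" using I by (simp add: abs_le_iff)
        then show ?thesis using N(3) by (simp add: abs_divide divide_right_mono)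
      qed
      also have "\<dots> \<le> M / real n" using N n1 M0 by (intro divide_left_mono) auto
      finally show ?thesis .
    qed
    define m where "m = (\<integral>z. g z \<partial>dp_base \<nu> n x) / N"
    have m: "\<bar>m - ?E g\<bar> \<le> M / real n" unfolding m_def by (rule mean[OF g g01])
    have m01: "0 \<le> m" "m \<le> 1"
    proof -
      interpret dp: finite_measure "dp_base \<nu> n x" by (rule finite_measure_dp_base[OF \<nu> s\<nu>])
      have sp: "space (dp_base \<nu> n x) = UNIV" using sets_eq_imp_space_eq[OF sets_dp_base[OF \<nu> s\<nu>]] by simp
      have i: "integrable (dp_base \<nu> n x) g"
        using g g01 by (intro dp.integrable_const_bound[where B=1]) (auto simp: measurable_cong_sets[OF sets_dp_base[OF \<nu> s\<nu>] refl])
      have "(\<integral>z. g z \<partial>dp_base \<nu> n x) \<le> (\<integral>z. 1 \<partial>dp_base \<nu> n x)" using i g01 by (intro integral_mono) auto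
      then show "m \<le> 1" using N sp by (simp add: m_def)
      show "0 \<le> m" unfolding m_def using g01 N by (intro divide_nonneg_nonneg Bochner_Integration.integral_nonneg) auto
    qed
    have g2: "(\<lambda>z. (g z)\<^sup>2) \<in> borel_measurable borel" "\<And>z. 0 \<le> (g z)\<^sup>2 \<and> (g z)\<^sup>2 \<le> 1"
      using g g01 by (auto simp: power_le_one)
    have "\<bar>(\<integral>z. (g z)\<^sup>2 \<partial>dp_base \<nu> n x) / N - m\<^sup>2 - V\<bar> \<le> \<delta>"
    proof -
      have "\<bar>m\<^sup>2 - (?E g)\<^sup>2\<bar> = \<bar>m - ?E g\<bar> * \<bar>m + ?E g\<bar>"
        by (simp add: power2_eq_square abs_mult[symmetric] algebra_simps)
      also have "\<dots> \<le> M / real n * 2" using m m01 E01[of g, OF g01] M0 by (intro mult_mono) auto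
      finally have 1: "\<bar>m\<^sup>2 - (?E g)\<^sup>2\<bar> \<le> 2 * (M / real n)" by (simp only: mult.commute)
      have "6 * M \<le> \<delta> * real n" using n1(3) \<delta> by (simp add: pos_divide_le_eq mult.commute)
      then have "3 * (M / real n) \<le> \<delta> / 2" using n1(1) by (simp add: field_simps)
      then show ?thesis using 1 mean[OF g2] v by linarith
    qed
    then have c: "\<bar>(\<integral>F. f (sqrt N * ((\<integral>z. g z \<partial>F) - m)) \<partial>D) - (\<integral>x. f x \<partial>gauss V)\<bar> \<le> e / 2"
      by (intro clt[OF finite_measure_dp_base[OF \<nu> s\<nu>] sets_dp_base[OF \<nu> s\<nu>] D N(1,2) g g01 m_def _ f])
    have pD: "prob_space D" and sD: "sets D = sets (prob_algebra borel)" using D by (auto simp: dirichlet_process_def)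
    interpret D: prob_space D by fact
    have mg: "(\<lambda>F. \<integral>z. g z \<partial>F) \<in> borel_measurable D"
      unfolding measurable_cong_sets[OF sD refl] by (rule measurable_chi_prob_algebra[OF g g01])
    have i1: "integrable D (\<lambda>F. f (sqrt N * ((\<integral>z. g z \<partial>F) - m)))"
      and i2: "integrable D (\<lambda>F. f (sqrt (real n) * (chi g F - ?E g)))"
      unfolding chi_def by (intro D.BL_unit_integrable[OF f] borel_measurable_times borel_measurable_diff borel_measurable_const mg)+
    have "\<bar>(\<integral>F. f (sqrt (real n) * (chi g F - ?E g)) \<partial>D) - (\<integral>F. f (sqrt N * ((\<integral>z. g z \<partial>F) - m)) \<partial>D)\<bar>
       = \<bar>\<integral>F. f (sqrt (real n) * (chi g F - ?E g)) - f (sqrt N * ((\<integral>z. g z \<partial>F) - m)) \<partial>D\<bar>"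
      using i1 i2 by simp
    also have "\<dots> \<le> (\<integral>F. \<bar>f (sqrt (real n) * (chi g F - ?E g)) - f (sqrt N * ((\<integral>z. g z \<partial>F) - m))\<bar> \<partial>D)"
      by (rule integral_abs_bound)
    also have "\<dots> \<le> (\<integral>F. e / 2 \<partial>D)"
    proof (rule integral_mono)
      show "integrable D (\<lambda>F. \<bar>f (sqrt (real n) * (chi g F - ?E g)) - f (sqrt N * ((\<integral>z. g z \<partial>F) - m))\<bar>)"
        using i1 i2 by (intro integrable_abs Bochner_Integration.integrable_diff)
      fix F assume F: "F \<in> space D"
      note FD = AE_space_dirichlet_process[OF D F]
      interpret F: prob_space F by (rule FD(1))
      define y where "y = (\<integral>z. g z \<partial>F)"
      have i: "integrable F g"
        using g g01 by (intro F.integrable_const_bound[where B=1]) (auto simp: measurable_cong_sets[OF FD(2) refl])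
      have "y \<le> (\<integral>z. 1 \<partial>F)" unfolding y_def using i g01 by (intro integral_mono) auto
      then have y: "0 \<le> y" "y \<le> 1"
        using g01 F.prob_space by (auto simp: y_def intro!: Bochner_Integration.integral_nonneg)
      have sq: "0 \<le> sqrt N - sqrt (real n)" "sqrt N - sqrt (real n) \<le> M / sqrt (real n)"
      proof -
        show p: "0 \<le> sqrt N - sqrt (real n)" using N(4) by simp
        have "(sqrt N - sqrt (real n)) * sqrt (real n) \<le> (sqrt N - sqrt (real n)) * (sqrt N + sqrt (real n))"
          using p by (intro mult_left_mono) auto
        also have "\<dots> = M" using N(3) n1 by (simp add: algebra_simps N_def)
        finally show "sqrt N - sqrt (real n) \<le> M / sqrt (real n)" using n1 by (simp add: pos_le_divide_eq)
      qed
      have "\<bar>f (sqrt (real n) * (chi g F - ?E g)) - f (sqrt N * (y - m))\<bar> \<le> \<bar>sqrt (real n) * (y - ?E g) - sqrt N * (y - m)\<bar>"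
        unfolding chi_def y_def by (rule BL_unitD(2)[OF f])
      also have "sqrt (real n) * (y - ?E g) - sqrt N * (y - m) = sqrt (real n) * (m - ?E g) - (sqrt N - sqrt (real n)) * (y - m)"
        by (simp add: algebra_simps)
      also have "\<bar>\<dots>\<bar> \<le> \<bar>sqrt (real n) * (m - ?E g)\<bar> + \<bar>(sqrt N - sqrt (real n)) * (y - m)\<bar>" by (rule abs_triangle_ineq4)
      also have "\<dots> \<le> sqrt (real n) * (M / real n) + (M / sqrt (real n)) * 1"
        unfolding abs_mult using m sq y m01 n1 M0 by (intro add_mono mult_mono) (auto simp: abs_le_iff)
      also have "sqrt (real n) * (M / real n) = M / sqrt (real n)"
      proof -
        have "sqrt (real n) * (M / real n) = M * (sqrt (real n) / real n)" by simp
        also have "sqrt (real n) / real n = 1 / sqrt (real n)" using n1 by (simp add: field_simps)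
        finally show ?thesis by simp
      qed
      also have "M / sqrt (real n) + M / sqrt (real n) * 1 = 2 * M / sqrt (real n)" by simp
      also have "\<dots> \<le> e / 2"
      proof -
        have "4 * M / e \<le> sqrt (real n)" using n1(4) by (rule real_le_rsqrt)
        then have "4 * M \<le> sqrt (real n) * e" using e by (simp add: pos_divide_le_eq)
        then have "2 * M \<le> e / 2 * sqrt (real n)" by (simp add: mult.commute)
        then show ?thesis using n1(1) by (simp add: pos_divide_le_eq)
      qed
      finally show "\<bar>f (sqrt (real n) * (chi g F - ?E g)) - f (sqrt N * ((\<integral>z. g z \<partial>F) - m))\<bar> \<le> e / 2" unfolding y_def .
    qed simp
    also have "\<dots> = e / 2" by (simp add: D.prob_space)
    finally show "\<bar>(\<integral>F. f (sqrt (real n) * (chi g F - ?E g)) \<partial>D) - (\<integral>y. f y \<partial>gauss V)\<bar> \<le> e"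
      using c by linarith
  qed
qed

context prior_model
begin

text \<open>
  Conditionally on \<open>b\<close> the posterior of \<open>F\<close> contributes a normal law of variance \<open>V2\<close>, and the centring
  \<open>T\<close> contributes an independent one of variance \<open>V1\<close>.
\<close>

lemma posterior_chi_BL:
  assumes D: "prob_space D" "sets D = sets (prob_algebra borel)"
    and B[measurable]: "B \<in> sets PR" and T[measurable]: "T \<in> borel_measurable PR"
    and V: "V1 \<ge> 0" "V2 \<ge> 0" and f: "f \<in> BL_unit" and e2: "e2 \<ge> 0" and c2: "c2 \<ge> 0"
    and PB: "measure (posterior A Q \<sigma> n x) B \<ge> 1 - c1"
    and centring: "\<And>f. f \<in> BL_unit \<Longrightarrow>
       \<bar>(\<integral>p. f (T p * indicator B p) \<partial>posterior A Q \<sigma> n x) - (\<integral>y. f y \<partial>gauss V1)\<bar> \<le> e1"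
    and conditional: "\<And>p f. p \<in> B \<Longrightarrow> f \<in> BL_unit \<Longrightarrow>
       \<bar>(\<integral>F. f (sqrt (real n) * (chi (bf p) F - \<mu> p)) \<partial>D) - (\<integral>y. f y \<partial>gauss V2)\<bar> \<le> e2"
    and approx: "\<And>p. p \<in> B \<Longrightarrow> \<bar>sqrt (real n) * (\<mu> p - h) - T p\<bar> \<le> c2"
  shows "\<bar>(\<integral>y. f y \<partial>distr (posterior_chi A Q \<sigma> D n x) borel (\<lambda>c. sqrt (real n) * (c - h)))
      - (\<integral>y. f y \<partial>gauss (V1 + V2))\<bar> \<le> e1 + e2 + c2 + 2 * c1"
proof -
  let ?PO = "posterior A Q \<sigma> n x"
  interpret PO: prob_space ?PO by (rule prob_space_posterior)
  interpret D: prob_space D by (rule D(1))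
  interpret PD: pair_prob_space ?PO D ..
  interpret G2: real_distribution "gauss V2" by (rule real_distribution_gauss[OF V(2)])
  note [measurable] = BL_unit_measurable[OF f]
  have "sets (?PO \<Otimes>\<^sub>M D) = sets (PR \<Otimes>\<^sub>M D)" by (intro sets_pair_measure_cong) auto
  then have chi[measurable]: "(\<lambda>(p, F). chi (bf p) F) \<in> borel_measurable (?PO \<Otimes>\<^sub>M D)"
    using measurable_chi_bf[OF D(2)] by (simp cong: measurable_cong_sets)
  define X where "X p F = sqrt (real n) * (chi (bf p) F - h)" for p F
  have X[measurable]: "(\<lambda>q. X (fst q) (snd q)) \<in> borel_measurable (?PO \<Otimes>\<^sub>M D)"
    unfolding X_def using chi by (simp add: case_prod_beta')
  have pc: "posterior_chi A Q \<sigma> D n x = distr (?PO \<Otimes>\<^sub>M D) borel (\<lambda>(p, F). chi (bf p) F)"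
    unfolding posterior_chi_def by (simp add: case_prod_beta')
  have "(\<integral>y. f y \<partial>distr (posterior_chi A Q \<sigma> D n x) borel (\<lambda>c. sqrt (real n) * (c - h)))
      = (\<integral>c. f (sqrt (real n) * (c - h)) \<partial>distr (?PO \<Otimes>\<^sub>M D) borel (\<lambda>(p, F). chi (bf p) F))"
    unfolding pc by (subst integral_distr) auto
  also have "\<dots> = (\<integral>q. f (X (fst q) (snd q)) \<partial>(?PO \<Otimes>\<^sub>M D))"
    using chi by (subst integral_distr) (auto simp: X_def case_prod_beta')
  also have "\<dots> = (\<integral>p. \<integral>F. f (X p F) \<partial>D \<partial>?PO)"
    using PD.integral_fst'[OF PD.BL_unit_integrable[OF f X]] by simp
  finally have start: "(\<integral>y. f y \<partial>distr (posterior_chi A Q \<sigma> D n x) borel (\<lambda>c. sqrt (real n) * (c - h)))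
      = (\<integral>p. \<integral>F. f (X p F) \<partial>D \<partial>?PO)" .
  define \<phi> where "\<phi> p = (\<integral>F. f (X p F) \<partial>D)" for p
  \<comment> \<open>Smoothing \<open>f\<close> by the conditional limit law keeps it in
    \<open>BL_unit\<close>, so the assumption on the centring applies to \<open>k\<close> itself;
    integrating \<open>k\<close> against \<open>gauss V1\<close> is the convolution of the two
    limits.\<close>
  define k where "k y = (\<integral>z. f (y + z) \<partial>gauss V2)" for y
  have fk: "integrable (gauss V2) (\<lambda>z. f (y + z))" for y
    by (intro G2.BL_unit_integrable[OF f]) auto
  have kk: "\<bar>k y - k z\<bar> \<le> \<bar>y - z\<bar>" for y z
  proof -
    have "\<bar>k y - k z\<bar> = \<bar>\<integral>u. f (y + u) - f (z + u) \<partial>gauss V2\<bar>" unfolding k_def using fk by simp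
    also have "\<dots> \<le> (\<integral>u. \<bar>f (y + u) - f (z + u)\<bar> \<partial>gauss V2)" by (rule integral_abs_bound)
    also have "\<dots> \<le> (\<integral>u. \<bar>y - z\<bar> \<partial>gauss V2)"
    proof (rule integral_mono)
      show "\<bar>f (y + u) - f (z + u)\<bar> \<le> \<bar>y - z\<bar>" for u
        using BL_unitD(2)[OF f, of "y + u" "z + u"] by simp
    qed (use fk in auto)
    finally show ?thesis using G2.prob_space by simp
  qed
  have k1: "\<bar>k y\<bar> \<le> 1" for y unfolding k_def by (intro G2.BL_unit_integral_bound[OF f]) auto
  have k: "k \<in> BL_unit" by (rule BL_unitI[OF k1 kk])
  note [measurable] = BL_unit_measurable[OF k]
  have \<phi>1: "\<bar>\<phi> p\<bar> \<le> 1" if p: "p \<in> space PR" for p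
    unfolding \<phi>_def using measurable_compose[OF measurable_Pair1' X, of p] p
    by (intro D.BL_unit_integral_bound[OF f]) simp
  have \<phi>m: "\<phi> \<in> borel_measurable ?PO"
  proof -
    have "(\<lambda>(p, F). f (X p F)) \<in> borel_measurable (?PO \<Otimes>\<^sub>M D)"
      using measurable_compose[OF X BL_unit_measurable[OF f]] by (simp add: case_prod_beta')
    then show ?thesis unfolding \<phi>_def[abs_def] by (rule D.borel_measurable_lebesgue_integral)
  qed
  have \<phi>i: "integrable ?PO \<phi>" using \<phi>1 \<phi>m by (intro PO.integrable_const_bound[where B=1]) auto
  have Tm: "(\<lambda>p. T p * indicator B p) \<in> borel_measurable ?PO" by measurable
  have ki: "integrable ?PO (\<lambda>p. k (T p * indicator B p))" by (rule PO.BL_unit_integrable[OF k Tm])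
  have B': "B \<in> sets ?PO" by simp
  \<comment> \<open>On \<open>B\<close> the conditional limit costs \<open>e2\<close> and the
    replacement of the centring by \<open>T\<close> costs \<open>c2\<close>. Outside
    \<open>B\<close> both terms are at most 1 in absolute value.\<close>
  have pt: "\<bar>\<phi> p - k (T p * indicator B p)\<bar> \<le> (e2 + c2) * indicator B p + 2 * indicator (space ?PO - B) p" if p: "p \<in> space PR" for p
  proof (cases "p \<in> B")
    case True
    let ?d = "sqrt (real n) * (\<mu> p - h)"
    have "X p F = sqrt (real n) * (chi (bf p) F - \<mu> p) + ?d" for F by (simp add: X_def algebra_simps)
    then have "\<bar>\<phi> p - k ?d\<bar> \<le> e2"
      unfolding \<phi>_def k_def using conditional[OF True BL_unit_translate[OF f, of ?d]] by (simp add: add.commute)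
    moreover have "\<bar>k ?d - k (T p)\<bar> \<le> c2" using kk[of ?d "T p"] approx[OF True] by linarith
    ultimately show ?thesis using True by simp
  next
    case False
    then show ?thesis using \<phi>1[OF p] k1[of 0] p by simp
  qed
  have "\<bar>(\<integral>p. \<phi> p \<partial>?PO) - (\<integral>p. k (T p * indicator B p) \<partial>?PO)\<bar> = \<bar>\<integral>p. \<phi> p - k (T p * indicator B p) \<partial>?PO\<bar>"
    using \<phi>i ki by simp
  also have "\<dots> \<le> (\<integral>p. \<bar>\<phi> p - k (T p * indicator B p)\<bar> \<partial>?PO)" by (rule integral_abs_bound)
  also have "\<dots> \<le> (\<integral>p. (e2 + c2) * indicator B p + 2 * indicator (space ?PO - B) p \<partial>?PO)"
  proof (rule integral_mono)
    show "integrable ?PO (\<lambda>p. \<bar>\<phi> p - k (T p * indicator B p)\<bar>)"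
      using \<phi>i ki by (intro integrable_abs Bochner_Integration.integrable_diff)
    show "integrable ?PO (\<lambda>p. (e2 + c2) * indicator B p + 2 * indicator (space ?PO - B) p :: real)"
      using B' by (intro Bochner_Integration.integrable_add integrable_mult_right) (auto simp: PO.emeasure_eq_measure)
  qed (use pt in simp)
  also have "\<dots> = (e2 + c2) * measure ?PO B + 2 * measure ?PO (space ?PO - B)"
    using B' by (subst Bochner_Integration.integral_add) (auto simp: PO.emeasure_eq_measure)
  also have "\<dots> \<le> (e2 + c2) + 2 * c1"
  proof (cases "B = {}")
    case True
    then show ?thesis using PB PO.prob_space e2 c2 by simp
  next
    case False
    have "0 \<le> e2 + c2" using e2 c2 by simp
    then have "(e2 + c2) * measure ?PO B \<le> (e2 + c2) * 1" by (intro mult_left_mono) auto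
    then show ?thesis using PB PO.prob_compl[OF B'] by simp
  qed
  finally have main: "\<bar>(\<integral>p. \<phi> p \<partial>?PO) - (\<integral>p. k (T p * indicator B p) \<partial>?PO)\<bar> \<le> e2 + c2 + 2 * c1" .
  have "(\<integral>y. k y \<partial>gauss V1) = (\<integral>y. f y \<partial>gauss (V1 + V2))"
    unfolding k_def by (rule gauss_convolution[OF V f])
  then show ?thesis using main centring[OF k] unfolding start \<phi>_def[symmetric] by linarith
qed

end

lemma Cauchy_Schwarz_bound:
  fixes f g :: "'a \<Rightarrow> real"
  assumes f[measurable]: "f \<in> borel_measurable M" and g[measurable]: "g \<in> borel_measurable M"
    and f2: "integrable M (\<lambda>x. (f x)\<^sup>2)" "(\<integral>x. (f x)\<^sup>2 \<partial>M) \<le> \<alpha>\<^sup>2"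
    and g2: "integrable M (\<lambda>x. (g x)\<^sup>2)" "(\<integral>x. (g x)\<^sup>2 \<partial>M) \<le> \<beta>\<^sup>2"
    and fg: "integrable M (\<lambda>x. f x * g x)"
  shows "(\<integral>x. \<bar>f x * g x\<bar> \<partial>M) \<le> \<bar>\<alpha>\<bar> * \<bar>\<beta>\<bar>"
proof -
  have sq: "(\<integral>\<^sup>+x. (ennreal \<bar>h x\<bar>)\<^sup>2 \<partial>M) = ennreal (\<integral>x. (h x)\<^sup>2 \<partial>M)"
    if "integrable M (\<lambda>x. (h x)\<^sup>2)" for h :: "'a \<Rightarrow> real"
    using nn_integral_eq_integral[OF that] by (simp add: ennreal_power)
  have fga: "integrable M (\<lambda>x. \<bar>f x * g x\<bar>)" using fg by (rule integrable_abs)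
  have "(\<integral>\<^sup>+x. ennreal \<bar>f x\<bar> * ennreal \<bar>g x\<bar> \<partial>M)\<^sup>2
      \<le> (\<integral>\<^sup>+x. (ennreal \<bar>f x\<bar>)\<^sup>2 \<partial>M) * (\<integral>\<^sup>+x. (ennreal \<bar>g x\<bar>)\<^sup>2 \<partial>M)"
    by (rule Cauchy_Schwarz_nn_integral) measurable
  also have "(\<integral>\<^sup>+x. ennreal \<bar>f x\<bar> * ennreal \<bar>g x\<bar> \<partial>M) = ennreal (\<integral>x. \<bar>f x * g x\<bar> \<partial>M)"
    using nn_integral_eq_integral[OF fga] by (simp add: abs_mult ennreal_mult)
  finally have "(\<integral>x. \<bar>f x * g x\<bar> \<partial>M)\<^sup>2 \<le> (\<integral>x. (f x)\<^sup>2 \<partial>M) * (\<integral>x. (g x)\<^sup>2 \<partial>M)"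
    unfolding sq[OF f2(1)] sq[OF g2(1)]
    by (simp add: ennreal_power ennreal_mult[symmetric])
  also have "\<dots> \<le> \<alpha>\<^sup>2 * \<beta>\<^sup>2" using f2(2) g2(2) by (intro mult_mono) auto
  also have "\<dots> = (\<bar>\<alpha>\<bar> * \<bar>\<beta>\<bar>)\<^sup>2" by (simp add: power_mult_distrib)
  finally show ?thesis by (rule power2_le_imp_le) simp
qed

section \<open>Local expansion under the observation law\<close>

context obs_model
begin

lemma integral_Z:
  fixes g :: "'z \<Rightarrow> real"
  assumes [measurable]: "g \<in> borel_measurable borel" and B: "\<And>z. \<bar>g z\<bar> \<le> B"
  shows "(\<integral>v. g (fst v) \<partial>obs_law a b F) = (\<integral>z. g z \<partial>F)"
proof -
  have "(\<integral>v. g (fst v) \<partial>obs_law a b F) = (\<integral>z. obs_average (\<lambda>v. g (fst v)) z \<partial>F)"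
    using B by (intro obs_integral[where B=B]) auto
  also have "obs_average (\<lambda>v. g (fst v)) = g"
    by (simp add: obs_average_def fun_eq_iff algebra_simps diff_divide_distrib add_divide_distrib)
  finally show ?thesis .
qed

lemma integral_R_Z:
  fixes g :: "'z \<Rightarrow> real"
  assumes [measurable]: "g \<in> borel_measurable borel" and B: "\<And>z. \<bar>g z\<bar> \<le> B"
  shows "(\<integral>v. oR v * g (fst v) \<partial>obs_law a b F) = (\<integral>z. g z / a z \<partial>F)"
proof -
  have "(\<integral>v. oR v * g (fst v) \<partial>obs_law a b F) = (\<integral>z. obs_average (\<lambda>v. oR v * g (fst v)) z \<partial>F)"
  proof (rule obs_integral[where B=B])
    show "\<bar>oR v * g (fst v)\<bar> \<le> B" for v
      using B[of "fst v"] by (auto simp: oR_def intro: order_trans[OF abs_ge_zero])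
  qed measurable
  also have "obs_average (\<lambda>v. oR v * g (fst v)) = (\<lambda>z. g z / a z)"
    by (simp add: obs_average_def oR_def fun_eq_iff algebra_simps diff_divide_distrib add_divide_distrib)
  finally show ?thesis .
qed

lemma residual_bound: "\<bar>oY v - oR v * b (fst v)\<bar> \<le> 1"
  using b_bounds[of "fst v"] by (auto simp: oY_def oR_def abs_le_iff)

lemma residual_Z_bound:
  fixes g :: "'z \<Rightarrow> real"
  assumes "\<And>z. \<bar>g z\<bar> \<le> B"
  shows "\<bar>g (fst v) * (oY v - oR v * b (fst v))\<bar> \<le> B"
proof -
  have "\<bar>g (fst v)\<bar> * \<bar>oY v - oR v * b (fst v)\<bar> \<le> B * 1"
    using assms[of "fst v"] residual_bound[of v] by (intro mult_mono) (auto intro: order_trans[OF abs_ge_zero])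
  then show ?thesis by (simp add: abs_mult)
qed

lemma integral_residual:
  fixes g :: "'z \<Rightarrow> real"
  assumes g[measurable]: "g \<in> borel_measurable borel" and B: "\<And>z. \<bar>g z\<bar> \<le> B"
  shows "(\<integral>v. g (fst v) * (oY v - oR v * b (fst v)) \<partial>obs_law a b F) = 0"
proof -
  have "(\<integral>v. g (fst v) * (oY v - oR v * b (fst v)) \<partial>obs_law a b F)
      = (\<integral>z. obs_average (\<lambda>v. g (fst v) * (oY v - oR v * b (fst v))) z \<partial>F)"
    by (intro obs_integral[OF _ residual_Z_bound[OF B]]) measurable
  also have "obs_average (\<lambda>v. g (fst v) * (oY v - oR v * b (fst v))) = (\<lambda>z. 0)"
    by (simp add: obs_average_def oR_def oY_def fun_eq_iff algebra_simps diff_divide_distrib)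
  finally show ?thesis by simp
qed

lemma integral_residual_square:
  fixes g :: "'z \<Rightarrow> real"
  assumes g[measurable]: "g \<in> borel_measurable borel" and B: "\<And>z. \<bar>g z\<bar> \<le> B"
  shows "(\<integral>v. (g (fst v) * (oY v - oR v * b (fst v)))\<^sup>2 \<partial>obs_law a b F) = (\<integral>z. (g z)\<^sup>2 * (b z * (1 - b z)) / a z \<partial>F)"
proof -
  have "(\<integral>v. (g (fst v) * (oY v - oR v * b (fst v)))\<^sup>2 \<partial>obs_law a b F)
      = (\<integral>z. obs_average (\<lambda>v. (g (fst v) * (oY v - oR v * b (fst v)))\<^sup>2) z \<partial>F)"
  proof (rule obs_integral[where B="B\<^sup>2"])
    show "\<bar>(g (fst v) * (oY v - oR v * b (fst v)))\<^sup>2\<bar> \<le> B\<^sup>2" for v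
      using power_mono[OF residual_Z_bound[where g=g and v=v, OF B] abs_ge_zero, of 2] by simp
  qed measurable
  also have "obs_average (\<lambda>v. (g (fst v) * (oY v - oR v * b (fst v)))\<^sup>2) = (\<lambda>z. (g z)\<^sup>2 * (b z * (1 - b z)) / a z)"
    by (simp add: obs_average_def oR_def oY_def fun_eq_iff power2_eq_square algebra_simps diff_divide_distrib add_divide_distrib)
  finally show ?thesis .
qed

definition score :: "nat \<Rightarrow> (nat \<Rightarrow> 'z obs) \<Rightarrow> real" where
  "score n x = (\<Sum>i<n. a (fst (x i)) * (oY (x i) - oR (x i) * b (fst (x i))))"

text \<open>The score in direction \<open>A\<close> splits into the score at the truth, the effect
  \<open>s1\<close> of replacing \<open>a\<close> by \<open>A\<close>, and \<open>- s2\<close>, the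
  effect of replacing \<open>b\<close> by \<open>logistic\<close> of \<open>\<eta>\<close>. The mean
  of \<open>s2 / n\<close> is \<open>I\<close>, the integral of \<open>A * h / a\<close>, which
  cancels against the same part of the integral of \<open>h\<close>. What remains is
  \<open>J\<close>, the integral of \<open>(1 - A / a) * h\<close>, and it vanishes when
  \<open>A\<close> is the least favourable direction \<open>a\<close>.\<close>

lemma lan_bound:
  fixes A \<eta> :: "'z \<Rightarrow> real"
  assumes n: "n > 0" and valid: "\<And>i. i < n \<Longrightarrow> snd (snd (x i)) \<longrightarrow> fst (snd (x i))"
    and A[measurable]: "A \<in> borel_measurable borel" and A_bound: "\<And>z. \<bar>A z\<bar> \<le> K"
    and \<eta>[measurable]: "\<eta> \<in> borel_measurable borel"
    and w1: "\<bar>\<Sum>i<n. (A (fst (x i)) - a (fst (x i))) * (oY (x i) - oR (x i) * b (fst (x i)))\<bar> \<le> c * sqrt (real n)"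
    and w2: "\<bar>emp_process (obs_law a b F) n x (\<lambda>v. oR v * A (fst v) * (logistic (\<eta> (fst v)) - b (fst v)))\<bar> \<le> c"
    and w3: "\<bar>sqrt (real n) * (\<integral>z. (1 - A z / a z) * (logistic (\<eta> z) - b z) \<partial>F)\<bar> \<le> c"
    and w4: "\<bar>emp_mean n x (\<lambda>v. oR v * (A (fst v))\<^sup>2 * (logistic (\<eta> (fst v)) * (1 - logistic (\<eta> (fst v))))) - V\<bar> \<le> c"
  shows "\<bar>t * (sqrt (real n) * ((\<integral>z. logistic (\<eta> z) \<partial>F) - (\<integral>z. b z \<partial>F)) - score n x / sqrt (real n))
      + loglik n x \<eta> - loglik n x (\<lambda>z. \<eta> z - t / sqrt (real n) * A z) - V * t\<^sup>2 / 2\<bar>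
    \<le> 3 * c * \<bar>t\<bar> + c * t\<^sup>2 / 2 + (\<bar>t\<bar> * K) ^ 3 / sqrt (real n)"
proof -
  define \<tau> where "\<tau> = t / sqrt (real n)"
  define h where "h z = logistic (\<eta> z) - b z" for z
  have hm[measurable]: "h \<in> borel_measurable borel" unfolding h_def[abs_def] by measurable
  have hb: "\<bar>h z\<bar> \<le> 1" for z using logistic_bounds[of "\<eta> z"] b_bounds[of z] by (simp add: h_def abs_le_iff)
  have n0: "sqrt (real n) > 0" "real n > 0" using n by auto
  have K: "0 \<le> K" using A_bound[of undefined] by (rule order_trans[OF abs_ge_zero])
  define s1 where "s1 = (\<Sum>i<n. (A (fst (x i)) - a (fst (x i))) * (oY (x i) - oR (x i) * b (fst (x i))))"
  define s2 where "s2 = (\<Sum>i<n. oR (x i) * A (fst (x i)) * h (fst (x i)))"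
  define s3 where "s3 = (\<Sum>i<n. oR (x i) * (A (fst (x i)))\<^sup>2 * (logistic (\<eta> (fst (x i))) * (1 - logistic (\<eta> (fst (x i))))))"
  define I where "I = (\<integral>z. A z * h z / a z \<partial>F)"
  define J where "J = (\<integral>z. (1 - A z / a z) * h z \<partial>F)"
  have Ahb: "\<bar>A z * h z\<bar> \<le> K" for z
    using mult_mono[OF A_bound[of z] hb[of z] K] by (simp add: abs_mult)
  have split: "(\<Sum>i<n. A (fst (x i)) * (oY (x i) - oR (x i) * logistic (\<eta> (fst (x i))))) = s1 + score n x - s2"
    unfolding s1_def s2_def score_def sum.distrib[symmetric] sum_subtractf[symmetric]
    by (intro sum.cong refl) (simp add: h_def algebra_simps)
  have P: "(\<integral>v. oR v * (A (fst v) * h (fst v)) \<partial>obs_law a b F) = I"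
    unfolding I_def by (rule integral_R_Z[OF _ Ahb]) measurable
  have emp: "emp_process (obs_law a b F) n x (\<lambda>v. oR v * A (fst v) * h (fst v)) = s2 / sqrt (real n) - sqrt (real n) * I"
  proof -
    have "sqrt (real n) / real n = 1 / sqrt (real n)" using n0 by (simp add: field_simps)
    then have "sqrt (real n) * (s2 / real n) = s2 / sqrt (real n)"
      by (metis times_divide_eq_left times_divide_eq_right mult.commute mult_1)
    then show ?thesis unfolding emp_process_def emp_mean_def s2_def[symmetric] mult.assoc P
      by (simp add: right_diff_distrib s2_def mult.assoc)
  qed
  have hi: "integrable F h" by (rule F_integrable[OF hm hb])
  have a1: "\<bar>1 / a z\<bar> \<le> 1" for z using a_bounds[of z] by simp
  have Ii: "integrable F (\<lambda>z. A z * h z / a z)"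
  proof (rule F_integrable[where B=K])
    show "\<bar>A z * h z / a z\<bar> \<le> K" for z
      using mult_mono[OF Ahb[of z] a1[of z] K] by (simp add: abs_mult abs_divide)
  qed measurable
  have J: "J = (\<integral>z. h z \<partial>F) - I"
    unfolding J_def I_def using hi Ii by (subst Bochner_Integration.integral_diff[symmetric]) (auto simp: algebra_simps)
  have bi: "integrable F b" using b_bounds by (intro F_integrable[where B=1]) (auto simp: abs_le_iff order_trans[of _ 0])
  have li: "integrable F (\<lambda>z. logistic (\<eta> z))"
    using logistic_bounds by (intro F_integrable[where B=1]) auto
  have Fh: "(\<integral>z. logistic (\<eta> z) \<partial>F) - (\<integral>z. b z \<partial>F) = J + I"
    using li bi unfolding J h_def by simp
  have q: "emp_mean n x (\<lambda>v. oR v * (A (fst v))\<^sup>2 * (logistic (\<eta> (fst v)) * (1 - logistic (\<eta> (fst v))))) = s3 / real n"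
    by (simp add: emp_mean_def s3_def)
  define r where "r = loglik n x \<eta> - loglik n x (\<lambda>z. \<eta> z - \<tau> * A z) - \<tau> * (s1 + score n x - s2) - \<tau>\<^sup>2 / 2 * s3"
  have rb: "\<bar>r\<bar> \<le> real n * (\<bar>\<tau>\<bar> * K) ^ 3"
    unfolding r_def split[symmetric] s3_def by (rule loglik_expansion[OF valid A_bound])
  have "real n * (\<bar>\<tau>\<bar> * K) ^ 3 = (\<bar>t\<bar> * K) ^ 3 * (real n / sqrt (real n) ^ 3)"
    by (simp add: \<tau>_def power_divide abs_divide power_mult_distrib)
  also have "real n / sqrt (real n) ^ 3 = 1 / sqrt (real n)"
    using n0 by (simp add: power3_eq_cube field_simps)
  finally have rb': "\<bar>r\<bar> \<le> (\<bar>t\<bar> * K) ^ 3 / sqrt (real n)" using rb by simp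
  have \<tau>2: "\<tau>\<^sup>2 = t\<^sup>2 / real n" using n0 by (simp add: \<tau>_def power_divide)
  define e2 where "e2 = s2 / sqrt (real n) - sqrt (real n) * I"
  have e2: "\<bar>e2\<bar> \<le> c" using w2 emp by (simp add: e2_def h_def)
  have e1: "\<bar>s1 / sqrt (real n)\<bar> \<le> c" using w1 n0 by (simp add: s1_def abs_divide field_simps)
  have e3: "\<bar>sqrt (real n) * J\<bar> \<le> c" using w3 by (simp add: J_def h_def)
  have e4: "\<bar>s3 / real n - V\<bar> \<le> c" using w4 unfolding q .
  \<comment> \<open>An exact decomposition: the score at the truth and \<open>I\<close> have
    cancelled. The four small terms are weight estimation, bias, empirical process and information,
    and \<open>r\<close> is the cubic remainder.\<close>
  have "t * (sqrt (real n) * ((\<integral>z. logistic (\<eta> z) \<partial>F) - (\<integral>z. b z \<partial>F)) - score n x / sqrt (real n))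
      + loglik n x \<eta> - loglik n x (\<lambda>z. \<eta> z - \<tau> * A z) - V * t\<^sup>2 / 2
     = t * (s1 / sqrt (real n)) + t * (sqrt (real n) * J) - t * e2 + t\<^sup>2 / 2 * (s3 / real n - V) + r"
  proof -
    have "loglik n x \<eta> - loglik n x (\<lambda>z. \<eta> z - \<tau> * A z) = r + \<tau> * (s1 + score n x - s2) + t\<^sup>2 / real n / 2 * s3"
      unfolding r_def \<tau>2 by simp
    then show ?thesis unfolding Fh e2_def \<tau>_def[symmetric]
      by (simp add: \<tau>_def algebra_simps add_divide_distrib diff_divide_distrib)
  qed
  also have "\<bar>\<dots>\<bar> \<le> \<bar>t\<bar> * c + \<bar>t\<bar> * c + \<bar>t\<bar> * c + t\<^sup>2 / 2 * c + (\<bar>t\<bar> * K) ^ 3 / sqrt (real n)"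
  proof -
    have "\<bar>t * (s1 / sqrt (real n))\<bar> \<le> \<bar>t\<bar> * c" "\<bar>t * (sqrt (real n) * J)\<bar> \<le> \<bar>t\<bar> * c" "\<bar>t * e2\<bar> \<le> \<bar>t\<bar> * c"
      using e1 e2 e3 by (simp_all only: abs_mult[of t] mult_left_mono abs_ge_zero)
    moreover have "\<bar>t\<^sup>2 / 2 * (s3 / real n - V)\<bar> \<le> t\<^sup>2 / 2 * c"
      using e4 by (simp only: abs_mult[of "t\<^sup>2 / 2"]) (intro mult_mono, auto)
    moreover have "\<bar>p + q - u + v + r\<bar> \<le> p' + q' + u' + v' + r'"
      if "\<bar>p\<bar> \<le> p'" "\<bar>q\<bar> \<le> q'" "\<bar>u\<bar> \<le> u'" "\<bar>v\<bar> \<le> v'" "\<bar>r\<bar> \<le> r'" for p q u v r p' q' u' v' r' :: real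
      using that by linarith
    ultimately show ?thesis using rb' by blast
  qed
  finally show ?thesis by (simp add: \<tau>_def mult.commute mult.left_commute)
qed

lemma eff_influence_eq:
  "(\<lambda>v. eff_influence a b F v) = (\<lambda>v. a (fst v) * (oY v - oR v * b (fst v)) + b (fst v) - chi b F)"
  by (auto simp: eff_influence_def oY_def oR_def fun_eq_iff)

text \<open>The residual part of the influence function has conditional mean 0 given
  \<open>Z\<close>, so it is orthogonal to the part that depends on \<open>Z\<close> alone. The two
  summands are the limiting variances contributed by \<open>b\<close> and by
  \<open>F\<close>.\<close>

lemma eff_variance_eq:
  assumes a: "\<And>z. \<bar>a z\<bar> \<le> K"
  shows "eff_variance a b F = (\<integral>z. a z * (b z * (1 - b z)) \<partial>F) + ((\<integral>z. (b z)\<^sup>2 \<partial>F) - (\<integral>z. b z \<partial>F)\<^sup>2)"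
proof -
  let ?m = "chi b F"
  let ?p = "\<lambda>v. a (fst v) * (oY v - oR v * b (fst v))"
  let ?q = "\<lambda>z. b z - ?m"
  have b1: "\<bar>b z\<bar> \<le> 1" for z using b_bounds[of z] by simp
  have bi: "integrable F b" by (rule F_integrable[OF b_measurable b1])
  have m: "0 \<le> ?m" "?m \<le> 1"
    using integral_mono[of F b "\<lambda>_. 1"] bi b_bounds F.prob_space
    by (auto simp: chi_def intro!: Bochner_Integration.integral_nonneg)
  have q1: "\<bar>?q z\<bar> \<le> 1" for z using m b_bounds[of z] by (simp add: abs_le_iff)
  have K: "0 \<le> K" using a[of undefined] by (rule order_trans[OF abs_ge_zero])
  have p1: "\<bar>?p v\<bar> \<le> K" for v by (rule residual_Z_bound[OF a])
  have aqb: "\<bar>a z * ?q z\<bar> \<le> K" for z using mult_mono[OF a[of z] q1[of z] K] by (simp add: abs_mult)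
  have i1: "integrable (obs_law a b F) (\<lambda>v. (?p v)\<^sup>2)"
  proof (rule obs_integrable[where B="K\<^sup>2"])
    show "\<bar>(?p v)\<^sup>2\<bar> \<le> K\<^sup>2" for v using power_mono[OF p1[of v] abs_ge_zero, of 2] by simp
  qed measurable
  have i2: "integrable (obs_law a b F) (\<lambda>v. a (fst v) * ?q (fst v) * (oY v - oR v * b (fst v)))"
    using residual_Z_bound[of "\<lambda>z. a z * ?q z", OF aqb] by (intro obs_integrable[where B=K]) auto
  have i3: "integrable (obs_law a b F) (\<lambda>v. (?q (fst v))\<^sup>2)"
  proof (rule obs_integrable[where B=1])
    show "\<bar>(?q (fst v))\<^sup>2\<bar> \<le> 1" for v using q1[of "fst v"] by (simp add: abs_square_le_1)
  qed measurable
  have "eff_variance a b F = (\<integral>v. (?p v)\<^sup>2 + 2 * (a (fst v) * ?q (fst v) * (oY v - oR v * b (fst v))) + (?q (fst v))\<^sup>2 \<partial>obs_law a b F)"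
    unfolding eff_variance_def fun_cong[OF eff_influence_eq]
    by (intro Bochner_Integration.integral_cong refl) (simp add: power2_eq_square algebra_simps)
  also have "\<dots> = (\<integral>v. (?p v)\<^sup>2 \<partial>obs_law a b F) + 2 * (\<integral>v. a (fst v) * ?q (fst v) * (oY v - oR v * b (fst v)) \<partial>obs_law a b F)
     + (\<integral>v. (?q (fst v))\<^sup>2 \<partial>obs_law a b F)"
    using i1 i2 i3 by simp
  also have "(\<integral>v. a (fst v) * ?q (fst v) * (oY v - oR v * b (fst v)) \<partial>obs_law a b F) = 0"
    using integral_residual[of "\<lambda>z. a z * ?q z", OF _ aqb] by simp
  also have "(\<integral>v. (?p v)\<^sup>2 \<partial>obs_law a b F) = (\<integral>z. a z * (b z * (1 - b z)) \<partial>F)"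
    unfolding integral_residual_square[OF a_measurable a]
    by (intro Bochner_Integration.integral_cong refl) (simp add: power2_eq_square)
  also have "(\<integral>v. (?q (fst v))\<^sup>2 \<partial>obs_law a b F) = (\<integral>z. (?q z)\<^sup>2 \<partial>F)"
  proof (rule integral_Z[where B=1])
    show "\<bar>(?q z)\<^sup>2\<bar> \<le> 1" for z using q1[of z] by (simp add: abs_square_le_1)
  qed measurable
  also have "\<dots> = (\<integral>z. (b z)\<^sup>2 \<partial>F) - (\<integral>z. b z \<partial>F)\<^sup>2"
  proof -
    have "integrable F (\<lambda>z. (b z)\<^sup>2)"
      using b1 by (intro F_integrable[where B=1]) (auto simp: abs_square_le_1)
    from F.variance_eq[OF bi this] show ?thesis by (simp add: chi_def)
  qed
  finally show ?thesis by simp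
qed

end

section \<open>The limit of the posterior\<close>

text \<open>A deterministic statement about one sample and one value \<open>A\<close> of the
  estimator, with all probabilistic input as numerical inequalities. It can therefore be applied
  pointwise on an intersection of events that need not be measurable.\<close>

lemma posterior_BvM_bound:
  fixes a b A :: "'z::polish_space \<Rightarrow> real" and x :: "nat \<Rightarrow> 'z obs"
  assumes O: "obs_model a b F" and R: "prior_model A Q \<sigma>" and n: "n > 0"
    and valid: "\<And>i. i < n \<Longrightarrow> snd (snd (x i)) \<longrightarrow> fst (snd (x i))"
    and A_bound: "\<And>z. \<bar>A z\<bar> \<le> K"
    and Hm: "\<And>\<eta>. \<eta> \<in> H \<Longrightarrow> \<eta> \<in> borel_measurable borel"
    and Hs: "{(w, l) \<in> space (prior_law Q \<sigma>). shift_path A w l \<in> H} \<in> sets (prior_law Q \<sigma>)"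
    and D: "prob_space D" "sets D = sets (prob_algebra borel)"
    and V: "V1 \<ge> 0" "V2 \<ge> 0"
    and w1: "\<bar>\<Sum>i<n. (A (fst (x i)) - a (fst (x i))) * (oY (x i) - oR (x i) * b (fst (x i)))\<bar> \<le> c * sqrt (real n)"
    and w2: "\<And>\<eta>. \<eta> \<in> H \<Longrightarrow> \<bar>emp_process (obs_law a b F) n x (\<lambda>v. oR v * A (fst v) * (logistic (\<eta> (fst v)) - b (fst v)))\<bar> \<le> c"
    and w3: "\<And>\<eta>. \<eta> \<in> H \<Longrightarrow> \<bar>sqrt (real n) * (\<integral>z. (1 - A z / a z) * (logistic (\<eta> z) - b z) \<partial>F)\<bar> \<le> c"
    and w4: "\<And>\<eta>. \<eta> \<in> H \<Longrightarrow> \<bar>emp_mean n x (\<lambda>v. oR v * (A (fst v))\<^sup>2 * (logistic (\<eta> (fst v)) * (1 - logistic (\<eta> (fst v))))) - V1\<bar> \<le> c"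
    and small: "\<And>t. t \<in> T \<Longrightarrow> 3 * c * \<bar>t\<bar> + c * t\<^sup>2 / 2 + (\<bar>t\<bar> * K) ^ 3 / sqrt (real n) + (u' * \<bar>t\<bar> + t\<^sup>2 / (2 * (real n * \<sigma>\<^sup>2))) \<le> \<kappa>"
    and shift: "\<And>t. t \<in> insert 0 T \<Longrightarrow> u + \<bar>t\<bar> / (real n * \<sigma>\<^sup>2) \<le> u'"
    and postX: "1 - q \<le> measure (posterior A Q \<sigma> n x) {(w, l) \<in> space (prior_law Q \<sigma>). \<bar>l\<bar> \<le> u * \<sigma>\<^sup>2 * sqrt (real n)}"
    and postY: "\<And>t. t \<in> insert 0 T \<Longrightarrow>
       1 - q \<le> measure (posterior A Q \<sigma> n x) {(w, l) \<in> space (prior_law Q \<sigma>). shift_path A w (l + t / sqrt (real n)) \<in> H}"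
    and q: "0 \<le> q" "2 * q \<le> \<kappa>" "\<And>t. t \<in> T \<Longrightarrow> 2 * q * exp (V1 * t\<^sup>2 / 2) \<le> \<kappa>"
    and crit: "\<And>M f. real_distribution M \<Longrightarrow>
       (\<And>t. t \<in> T \<Longrightarrow> integrable M (\<lambda>x. exp (t * x)) \<and>
          exp (V1 * t\<^sup>2 / 2 - \<kappa>) - \<kappa> \<le> (\<integral>x. exp (t * x) \<partial>M) \<and>
          (\<integral>x. exp (t * x) \<partial>M) \<le> exp (V1 * t\<^sup>2 / 2 + \<kappa>) + \<kappa>) \<Longrightarrow>
       f \<in> BL_unit \<Longrightarrow> \<bar>(\<integral>x. f x \<partial>M) - (\<integral>x. f x \<partial>gauss V1)\<bar> \<le> e1"
    and dp: "\<And>\<eta> f. \<eta> \<in> H \<Longrightarrow> f \<in> BL_unit \<Longrightarrow>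
       \<bar>(\<integral>F. f (sqrt (real n) * (chi (\<lambda>z. logistic (\<eta> z)) F - emp_mean n x (\<lambda>v. logistic (\<eta> (fst v))))) \<partial>D)
          - (\<integral>y. f y \<partial>gauss V2)\<bar> \<le> e2" "e2 \<ge> 0"
    and emp: "\<And>\<eta>. \<eta> \<in> H \<Longrightarrow> \<bar>emp_process (obs_law a b F) n x (\<lambda>v. logistic (\<eta> (fst v)) - b (fst v))\<bar> \<le> c3" "c3 \<ge> 0"
    and hat: "\<bar>sqrt (real n) * (h - (chi b F + emp_mean n x (eff_influence a b F)))\<bar> \<le> c4"
    and f: "f \<in> BL_unit"
  shows "\<bar>(\<integral>y. f y \<partial>distr (posterior_chi A Q \<sigma> D n x) borel (\<lambda>c. sqrt (real n) * (c - h)))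
      - (\<integral>y. f y \<partial>gauss (V1 + V2))\<bar> \<le> e1 + e2 + (c3 + c4) + 4 * q"
proof -
  interpret O: obs_model a b F by (rule O)
  interpret R: prior_model A Q \<sigma> by (rule R)
  let ?PR = "prior_law Q \<sigma>" and ?PO = "posterior A Q \<sigma> n x" and ?bf = "\<lambda>p z. logistic (shift_path A (fst p) (snd p) z)"
  interpret PO: prob_space ?PO by (rule R.prob_space_posterior)
  have n0: "sqrt (real n) > 0" "real n > 0" using n by auto
  have \<sigma>: "\<sigma>\<^sup>2 > 0" using R.\<sigma> by simp
  \<comment> \<open>The bound on \<open>\<lambda>\<close> uses \<open>u'\<close>, which exceeds
    \<open>u\<close> by room for the shift. Thus the set pulled back by \<open>t / sqrt n\<close>
    contains the intersection of the two sets whose posterior mass is assumed to be large.\<close>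
  define B where "B = {p \<in> space ?PR. shift_path A (fst p) (snd p) \<in> H \<and> \<bar>snd p\<bar> \<le> u' * \<sigma>\<^sup>2 * sqrt (real n)}"
  have snd_m[measurable]: "snd \<in> borel_measurable ?PR"
    unfolding measurable_cong_sets[OF R.sets_prior refl] by measurable
  have H_s: "{p \<in> space ?PR. shift_path A (fst p) (snd p) \<in> H} \<in> sets ?PR"
    using Hs by (simp add: case_prod_beta')
  have B[measurable]: "B \<in> sets ?PR"
  proof -
    have "B = {p \<in> space ?PR. shift_path A (fst p) (snd p) \<in> H} \<inter> {p \<in> space ?PR. \<bar>snd p\<bar> \<le> u' * \<sigma>\<^sup>2 * sqrt (real n)}"
      by (auto simp: B_def)
    moreover have "{p \<in> space ?PR. \<bar>snd p\<bar> \<le> u' * \<sigma>\<^sup>2 * sqrt (real n)} \<in> sets ?PR" by measurable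
    ultimately show ?thesis using H_s by auto
  qed
  define T1 where "T1 p = sqrt (real n) * (chi (?bf p) F - chi b F) - O.score n x / sqrt (real n)" for p
  have T1[measurable]: "T1 \<in> borel_measurable ?PR"
    unfolding T1_def[abs_def] using R.measurable_chi_bf_fixed[OF O.F O.sets_F] by measurable
  have shift_prob: "1 - 2 * q \<le> measure ?PO {p \<in> space ?PR. (fst p, snd p + t / sqrt (real n)) \<in> B}" if t: "t \<in> insert 0 T" for t
  proof -
    let ?\<tau> = "t / sqrt (real n)"
    have "(\<lambda>p. (fst p, snd p + ?\<tau>)) \<in> measurable (path_space \<Otimes>\<^sub>M borel) (path_space \<Otimes>\<^sub>M (borel :: real measure))"
      by measurable
    then have sh[measurable]: "(\<lambda>p. (fst p, snd p + ?\<tau>)) \<in> measurable ?PR ?PR"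
      unfolding measurable_cong_sets[OF R.sets_prior R.sets_prior] .
    let ?X = "{p \<in> space ?PR. \<bar>snd p\<bar> \<le> u * \<sigma>\<^sup>2 * sqrt (real n)}"
    let ?Y = "{p \<in> space ?PR. shift_path A (fst p) (snd p + ?\<tau>) \<in> H}"
    have X: "?X \<in> sets ?PO" by measurable
    have "?Y = (\<lambda>p. (fst p, snd p + ?\<tau>)) -` {p \<in> space ?PR. shift_path A (fst p) (snd p) \<in> H} \<inter> space ?PR"
      using measurable_space[OF sh] by auto
    then have Y: "?Y \<in> sets ?PO" using measurable_sets[OF sh H_s] by simp
    have "1 - q \<le> measure ?PO ?X" "1 - q \<le> measure ?PO ?Y"
      using postX postY[OF t] by (simp_all add: case_prod_beta')
    moreover have "measure ?PO ?X + measure ?PO ?Y \<le> measure ?PO (?X \<inter> ?Y) + 1"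
      using PO.finite_measure_Union'[OF X Y] PO.finite_measure_Diff'[OF Y X] PO.prob_le_1[of "?X \<union> ?Y"]
      by (simp add: Int_commute)
    moreover have "measure ?PO (?X \<inter> ?Y) \<le> measure ?PO {p \<in> space ?PR. (fst p, snd p + ?\<tau>) \<in> B}"
    proof (rule PO.finite_measure_mono)
      show "{p \<in> space ?PR. (fst p, snd p + ?\<tau>) \<in> B} \<in> sets ?PO" by measurable
      show "?X \<inter> ?Y \<subseteq> {p \<in> space ?PR. (fst p, snd p + ?\<tau>) \<in> B}"
      proof (clarsimp simp: B_def, intro conjI)
        fix w l assume wl: "(w, l) \<in> space ?PR" and l: "\<bar>l\<bar> \<le> u * \<sigma>\<^sup>2 * sqrt (real n)"
        show "(w, l + ?\<tau>) \<in> space ?PR" using measurable_space[OF sh wl] by simp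
        have "\<bar>l + ?\<tau>\<bar> \<le> u * \<sigma>\<^sup>2 * sqrt (real n) + \<bar>t\<bar> / sqrt (real n)"
          using l n0 by (intro order_trans[OF abs_triangle_ineq] add_mono) (simp_all add: abs_divide)
        also have "\<dots> = (u + \<bar>t\<bar> / (real n * \<sigma>\<^sup>2)) * (\<sigma>\<^sup>2 * sqrt (real n))"
        proof -
          have "\<bar>t\<bar> / (real n * \<sigma>\<^sup>2) * (\<sigma>\<^sup>2 * sqrt (real n)) = \<bar>t\<bar> * (sqrt (real n) / real n)" using \<sigma> by simp
          also have "sqrt (real n) / real n = 1 / sqrt (real n)" using n0 by (simp add: field_simps)
          finally show ?thesis by (simp add: distrib_right)
        qed
        also have "\<dots> \<le> u' * (\<sigma>\<^sup>2 * sqrt (real n))"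
          using shift[OF t] \<sigma> n0 by (intro mult_right_mono) auto
        finally show "\<bar>l + ?\<tau>\<bar> \<le> u' * \<sigma>\<^sup>2 * sqrt (real n)" by (simp add: mult.assoc)
      qed
    qed
    ultimately show ?thesis by linarith
  qed
  \<comment> \<open>The mass of \<open>B\<close> itself is the case of no shift, which is why the
    hypotheses on posterior mass range over \<open>insert 0 T\<close>.\<close>
  have B_eq: "{p \<in> space ?PR. (fst p, snd p + 0 / sqrt (real n)) \<in> B} = B" by (auto simp: B_def)
  have PB: "1 - 2 * q \<le> measure ?PO B" using shift_prob[of 0] unfolding B_eq by simp
  have B': "B \<in> sets ?PO" by simp
  have tilt: "\<bar>t * T1 (w, l + t / sqrt (real n)) + R.ll n x (w, l + t / sqrt (real n)) - R.ll n x (w, l)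
       - (2 * l * (t / sqrt (real n)) + (t / sqrt (real n))\<^sup>2) / (2 * \<sigma>\<^sup>2) - V1 * t\<^sup>2 / 2\<bar> \<le> \<kappa>"
    if t: "t \<in> T" and wl: "(w, l + t / sqrt (real n)) \<in> B" for t w l
  proof -
    let ?\<tau> = "t / sqrt (real n)"
    define \<eta> where "\<eta> = shift_path A w (l + ?\<tau>)"
    have \<eta>: "\<eta> \<in> H" and l: "\<bar>l + ?\<tau>\<bar> \<le> u' * \<sigma>\<^sup>2 * sqrt (real n)" using wl by (auto simp: B_def \<eta>_def)
    have \<eta>': "shift_path A w l = (\<lambda>z. \<eta> z - ?\<tau> * A z)"
      by (simp add: \<eta>_def shift_path_def fun_eq_iff algebra_simps)
    have "\<bar>t * (sqrt (real n) * ((\<integral>z. logistic (\<eta> z) \<partial>F) - (\<integral>z. b z \<partial>F)) - O.score n x / sqrt (real n))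
      + loglik n x \<eta> - loglik n x (\<lambda>z. \<eta> z - t / sqrt (real n) * A z) - V1 * t\<^sup>2 / 2\<bar>
      \<le> 3 * c * \<bar>t\<bar> + c * t\<^sup>2 / 2 + (\<bar>t\<bar> * K) ^ 3 / sqrt (real n)"
      by (rule O.lan_bound[OF n valid R.A A_bound Hm[OF \<eta>] w1 w2[OF \<eta>] w3[OF \<eta>] w4[OF \<eta>]])
    then have 1: "\<bar>t * T1 (w, l + ?\<tau>) + R.ll n x (w, l + ?\<tau>) - R.ll n x (w, l) - V1 * t\<^sup>2 / 2\<bar>
      \<le> 3 * c * \<bar>t\<bar> + c * t\<^sup>2 / 2 + (\<bar>t\<bar> * K) ^ 3 / sqrt (real n)"
      unfolding T1_def chi_def fst_conv snd_conv \<eta>' \<eta>_def[symmetric] .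
    \<comment> \<open>The log prior ratio is rewritten around the shifted value
      \<open>l + ?\<tau>\<close>, which is the one that membership in \<open>B\<close> bounds. Both
      resulting terms become small because \<open>n * \<sigma>\<^sup>2\<close> grows.\<close>
    have "(2 * l * ?\<tau> + ?\<tau>\<^sup>2) / (2 * \<sigma>\<^sup>2) = (l + ?\<tau>) * ?\<tau> / \<sigma>\<^sup>2 - ?\<tau>\<^sup>2 / (2 * \<sigma>\<^sup>2)"
      using \<sigma> by (simp add: add_divide_distrib power2_eq_square distrib_right)
    also have "\<bar>\<dots>\<bar> \<le> \<bar>(l + ?\<tau>) * ?\<tau> / \<sigma>\<^sup>2\<bar> + \<bar>?\<tau>\<^sup>2 / (2 * \<sigma>\<^sup>2)\<bar>" by (rule abs_triangle_ineq4)
    also have "\<bar>(l + ?\<tau>) * ?\<tau> / \<sigma>\<^sup>2\<bar> \<le> u' * \<bar>t\<bar>"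
    proof -
      have "\<bar>(l + ?\<tau>) * ?\<tau> / \<sigma>\<^sup>2\<bar> = \<bar>l + ?\<tau>\<bar> * (\<bar>t\<bar> / sqrt (real n) / \<sigma>\<^sup>2)" using \<sigma> n0 by (simp add: abs_mult abs_divide)
      also have "\<dots> \<le> u' * \<sigma>\<^sup>2 * sqrt (real n) * (\<bar>t\<bar> / sqrt (real n) / \<sigma>\<^sup>2)"
        using l \<sigma> n0 by (intro mult_right_mono) auto
      also have "\<dots> = u' * \<bar>t\<bar>" using \<sigma> n0 by simp
      finally show ?thesis .
    qed
    also have "\<bar>?\<tau>\<^sup>2 / (2 * \<sigma>\<^sup>2)\<bar> = t\<^sup>2 / (2 * (real n * \<sigma>\<^sup>2))"
      using n0 by (simp add: power_divide mult_ac)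
    finally have 2: "\<bar>(2 * l * ?\<tau> + ?\<tau>\<^sup>2) / (2 * \<sigma>\<^sup>2)\<bar> \<le> u' * \<bar>t\<bar> + t\<^sup>2 / (2 * (real n * \<sigma>\<^sup>2))" by simp
    have gen: "\<bar>\<alpha> - \<beta> - \<gamma>\<bar> \<le> \<kappa>" if "\<bar>\<alpha> - \<gamma>\<bar> \<le> e'" "\<bar>\<beta>\<bar> \<le> e''" "e' + e'' \<le> \<kappa>" for \<alpha> \<beta> \<gamma> e' e'' :: real
      using that by linarith
    show ?thesis by (rule gen[OF 1 2 small[OF t]])
  qed
  show ?thesis
  proof -
    have "\<bar>(\<integral>y. f y \<partial>distr (posterior_chi A Q \<sigma> D n x) borel (\<lambda>c. sqrt (real n) * (c - h)))
      - (\<integral>y. f y \<partial>gauss (V1 + V2))\<bar> \<le> e1 + e2 + (c3 + c4) + 2 * (2 * q)"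
    proof (rule R.posterior_chi_BL[OF D B T1 V f dp(2) _ PB])
      show "0 \<le> c3 + c4" using emp(2) hat by linarith
      fix p f assume p: "p \<in> B" and f: "f \<in> BL_unit"
      have "shift_path A (fst p) (snd p) \<in> H" using p by (simp add: B_def)
      from dp(1)[OF this f]
      show "\<bar>(\<integral>F. f (sqrt (real n) * (chi (?bf p) F - emp_mean n x (\<lambda>v. ?bf p (fst v)))) \<partial>D) - (\<integral>y. f y \<partial>gauss V2)\<bar> \<le> e2" .
    next
      fix p assume p: "p \<in> B"
      let ?\<eta> = "shift_path A (fst p) (snd p)"
      let ?h = "\<lambda>z. logistic (?\<eta> z) - b z"
      have \<eta>: "?\<eta> \<in> H" using p by (simp add: B_def)
      note [measurable] = Hm[OF \<eta>]
      have lb: "integrable F (\<lambda>z. logistic (?\<eta> z))"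
        using logistic_bounds by (intro O.F_integrable[where B=1]) auto
      have bi: "integrable F b"
        using O.b_bounds by (intro O.F_integrable[where B=1]) auto
      have "(\<integral>v. ?h (fst v) \<partial>obs_law a b F) = (\<integral>z. ?h z \<partial>F)"
      proof (rule O.integral_Z[where B=1])
        show "\<bar>?h z\<bar> \<le> 1" for z using logistic_bounds[of "?\<eta> z"] O.b_bounds[of z] by (simp add: abs_le_iff)
      qed measurable
      then have P: "(\<integral>v. ?h (fst v) \<partial>obs_law a b F) = chi (?bf p) F - chi b F"
        using lb bi by (simp add: chi_def)
      have E: "emp_process (obs_law a b F) n x (\<lambda>v. ?h (fst v))
          = sqrt (real n) * (emp_mean n x (\<lambda>v. ?bf p (fst v)) - emp_mean n x (\<lambda>v. b (fst v)) - (chi (?bf p) F - chi b F))"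
        unfolding emp_process_def P by (simp add: emp_mean_def sum_subtractf diff_divide_distrib)
      have I: "emp_mean n x (eff_influence a b F) = O.score n x / real n + emp_mean n x (\<lambda>v. b (fst v)) - chi b F"
        unfolding O.score_def using n0 fun_cong[OF O.eff_influence_eq]
        by (simp add: emp_mean_def sum.distrib sum_subtractf add_divide_distrib diff_divide_distrib)
      have sq: "sqrt (real n) * (O.score n x / real n) = O.score n x / sqrt (real n)"
      proof -
        have "sqrt (real n) * (O.score n x / real n) = O.score n x * (sqrt (real n) / real n)" by simp
        also have "sqrt (real n) / real n = 1 / sqrt (real n)" using n0 by (simp add: field_simps)
        finally show ?thesis by simp
      qed
      have "sqrt (real n) * (emp_mean n x (\<lambda>v. ?bf p (fst v)) - h) - T1 p
          = emp_process (obs_law a b F) n x (\<lambda>v. ?h (fst v)) - sqrt (real n) * (h - (chi b F + emp_mean n x (eff_influence a b F)))"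
        unfolding E I T1_def sq[symmetric] by (simp add: algebra_simps)
      also have "\<bar>\<dots>\<bar> \<le> c3 + c4" using emp(1)[OF \<eta>] hat by linarith
      finally show "\<bar>sqrt (real n) * (emp_mean n x (\<lambda>v. ?bf p (fst v)) - h) - T1 p\<bar> \<le> c3 + c4" .
    next
      fix f assume f: "f \<in> BL_unit"
      \<comment> \<open>Setting the centring to 0 outside \<open>B\<close> keeps its Laplace
        transform finite: the complement contributes \<open>exp 0\<close> times its mass, at most
        \<open>2 * q\<close>, which is absorbed by the additive \<open>\<kappa>\<close>.\<close>
      let ?X = "\<lambda>p. T1 p * indicator B p"
      have Xm[measurable]: "?X \<in> borel_measurable ?PO" by measurable
      have M: "real_distribution (distr ?PO borel ?X)"
        by (auto simp: real_distribution_def real_distribution_axioms_def intro!: PO.prob_space_distr)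
      have "\<bar>(\<integral>y. f y \<partial>distr ?PO borel ?X) - (\<integral>y. f y \<partial>gauss V1)\<bar> \<le> e1"
      proof (rule crit[OF M _ f])
        fix t assume t: "t \<in> T"
        let ?c = "V1 * t\<^sup>2 / 2"
        let ?I = "\<integral>\<^sup>+p. indicator B p * ennreal (exp (t * T1 p)) \<partial>?PO"
        note tl = R.posterior_tilt[OF B T1 tilt[OF t]]
        have up: "?I \<le> ennreal (exp (?c + \<kappa>))" using tl(1) by simp
        have lo: "ennreal (exp (?c - \<kappa>)) * emeasure ?PO {p \<in> space ?PR. (fst p, snd p + t / sqrt (real n)) \<in> B} \<le> ?I"
          using tl(2) by simp
        define r where "r = enn2real ?I"
        have fin: "?I < top" using up by (rule le_less_trans) simp
        have r: "?I = ennreal r" "0 \<le> r" using fin by (simp_all add: r_def)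
        have r_up: "r \<le> exp (?c + \<kappa>)" using up unfolding r(1) by simp
        have "ennreal (exp (?c - \<kappa>) * measure ?PO {p \<in> space ?PR. (fst p, snd p + t / sqrt (real n)) \<in> B}) \<le> ennreal r"
          using lo unfolding r(1) PO.emeasure_eq_measure by (simp add: ennreal_mult)
        then have r_lo: "exp (?c - \<kappa>) * measure ?PO {p \<in> space ?PR. (fst p, snd p + t / sqrt (real n)) \<in> B} \<le> r"
          using r(2) by simp
        have "exp (?c - \<kappa>) * (1 - 2 * q) \<le> exp (?c - \<kappa>) * measure ?PO {p \<in> space ?PR. (fst p, snd p + t / sqrt (real n)) \<in> B}"
          using shift_prob[of t] t by (intro mult_left_mono) auto
        moreover have "exp (?c - \<kappa>) * (1 - 2 * q) = exp (?c - \<kappa>) - 2 * q * exp (?c - \<kappa>)"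
          by (simp add: algebra_simps)
        ultimately have r_lo': "exp (?c - \<kappa>) - 2 * q * exp (?c - \<kappa>) \<le> r"
          using r_lo by linarith
        have \<kappa>: "0 \<le> \<kappa>" using q(1,2) by linarith
        have "2 * q * exp (?c - \<kappa>) \<le> 2 * q * exp ?c" using q(1) \<kappa> by (intro mult_left_mono) auto
        then have lower: "exp (?c - \<kappa>) - \<kappa> \<le> r" using r_lo' q(3)[OF t] by linarith
        let ?rest = "measure ?PO (space ?PO - B)"
        have rest: "0 \<le> ?rest" "?rest \<le> \<kappa>" using PO.prob_compl[OF B'] PB q(2) by (auto simp del: R.space_posterior)
        have "(\<integral>\<^sup>+p. ennreal (exp (t * ?X p)) \<partial>?PO) = (\<integral>\<^sup>+p. indicator B p * ennreal (exp (t * T1 p)) + indicator (space ?PO - B) p \<partial>?PO)"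
          by (intro nn_integral_cong) (auto simp: indicator_def)
        also have "\<dots> = ?I + emeasure ?PO (space ?PO - B)"
          using B' by (subst nn_integral_add) auto
        also have "\<dots> = ennreal (r + ?rest)" unfolding r(1) PO.emeasure_eq_measure using r(2) by simp
        finally have "(\<integral>\<^sup>+p. ennreal (exp (t * ?X p)) \<partial>?PO) = ennreal (r + ?rest)" .
        then have *: "integrable ?PO (\<lambda>p. exp (t * ?X p)) \<and> (\<integral>p. exp (t * ?X p) \<partial>?PO) = r + ?rest"
          using r(2) rest(1) by (subst (asm) nn_integral_eq_integrable) auto
        have "(\<integral>y. exp (t * y) \<partial>distr ?PO borel ?X) = r + ?rest" using * by (subst integral_distr) auto
        moreover have "integrable (distr ?PO borel ?X) (\<lambda>y. exp (t * y))" using * by (subst integrable_distr_eq) auto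
        ultimately show "integrable (distr ?PO borel ?X) (\<lambda>y. exp (t * y)) \<and> exp (?c - \<kappa>) - \<kappa> \<le> (\<integral>y. exp (t * y) \<partial>distr ?PO borel ?X) \<and>
            (\<integral>y. exp (t * y) \<partial>distr ?PO borel ?X) \<le> exp (?c + \<kappa>) + \<kappa>"
          using lower r_up rest by (intro conjI) linarith+
      qed
      then show "\<bar>(\<integral>p. f (?X p) \<partial>?PO) - (\<integral>y. f y \<partial>gauss V1)\<bar> \<le> e1"
        using BL_unit_measurable[OF f] by (subst (asm) integral_distr) auto
    qed
    then show ?thesis by simp
  qed
qed

lemma emp_process_linear:
  assumes "integrable M f" "integrable M g"
  shows "emp_process M n x (\<lambda>v. \<alpha> * f v + \<beta> * g v) = \<alpha> * emp_process M n x f + \<beta> * emp_process M n x g"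
  using assms
  by (simp add: emp_process_def emp_mean_def sum.distrib sum_distrib_left[symmetric] add_divide_distrib algebra_simps)

lemma emp_mean_diff_le:
  assumes "\<And>v. \<bar>f v - g v\<bar> \<le> C * h v"
  shows "\<bar>emp_mean n x f - emp_mean n x g\<bar> \<le> C * emp_mean n x h"
proof -
  have "emp_mean n x f - emp_mean n x g = (\<Sum>i<n. f (x i) - g (x i)) / real n"
    by (simp add: emp_mean_def sum_subtractf diff_divide_distrib)
  also have "\<bar>\<dots>\<bar> \<le> (\<Sum>i<n. C * h (x i)) / real n"
    unfolding abs_divide abs_of_nat using assms
    by (intro divide_right_mono order_trans[OF sum_abs] sum_mono) auto
  finally show ?thesis by (simp add: emp_mean_def sum_distrib_left)
qed

lemma emp_mean_abs_square: "(emp_mean n x (\<lambda>v. \<bar>h v\<bar>))\<^sup>2 \<le> emp_mean n x (\<lambda>v. (h v)\<^sup>2)"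
proof (cases "n = 0")
  case False
  have "(\<Sum>i<n. \<bar>h (x i)\<bar>)\<^sup>2 \<le> (\<Sum>i<n. \<bar>h (x i)\<bar>\<^sup>2) * real (card {..<n})"
    by (rule sum_squared_le_sum_of_squares)
  then show ?thesis using False by (simp add: emp_mean_def power_divide power2_eq_square field_simps)
qed (simp add: emp_mean_def)

lemma whp_AE:
  assumes "\<And>n. AE \<omega> in P n. A n \<omega>"
  shows "whp P A"
proof -
  have "outer_measure_of (P n) {\<omega> \<in> space (P n). \<not> A n \<omega>} = 0" for n
  proof -
    obtain N where N: "{\<omega> \<in> space (P n). \<not> A n \<omega>} \<subseteq> N" "emeasure (P n) N = 0" "N \<in> sets (P n)"
      using AE_E[OF assms[of n]] by blast
    show ?thesis using outer_measure_of_mono[OF N(1), of "P n"] outer_measure_of_eq[OF N(3)] N(2) by simp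
  qed
  then show ?thesis by (simp add: whp_def)
qed

text \<open>The moment and exchange lemmas require bounds for every value of the auxiliary variable.
  Truncating the estimator supplies them and changes nothing where the estimator is bounded by
  \<open>K\<close>.\<close>

definition clip :: "real \<Rightarrow> real \<Rightarrow> real" where
  "clip K y = max (- K) (min K y)"

lemma clip_bound: "K \<ge> 0 \<Longrightarrow> \<bar>clip K y\<bar> \<le> K"
  by (auto simp: clip_def)

lemma clip_id: "\<bar>y\<bar> \<le> K \<Longrightarrow> clip K y = y"
  by (auto simp: clip_def)

lemma clip_measurable [measurable]: "clip K \<in> borel_measurable borel"
  unfolding clip_def[abs_def] by measurable

locale estimated_weight = obs_model a b F for a b :: "'z::polish_space \<Rightarrow> real" and F +
  fixes S :: "nat \<Rightarrow> 's measure" and P :: "nat \<Rightarrow> ((nat \<Rightarrow> 'z obs) \<times> 's) measure"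
    and ahat :: "nat \<Rightarrow> 's \<Rightarrow> 'z \<Rightarrow> real" and H :: "nat \<Rightarrow> ('z \<Rightarrow> real) set"
    and \<epsilon> r :: "nat \<Rightarrow> real" and K L :: real
  assumes S: "\<And>n. prob_space (S n)" and P: "\<And>n. P n = sample_law a b F n \<Otimes>\<^sub>M S n"
    and ahat: "\<And>n. (\<lambda>(s, z). ahat n s z) \<in> borel_measurable (S n \<Otimes>\<^sub>M borel)"
    and H: "\<And>n \<eta>. \<eta> \<in> H n \<Longrightarrow> \<eta> \<in> borel_measurable borel"
    and H_rate: "\<And>n \<eta>. \<eta> \<in> H n \<Longrightarrow> (\<integral>z. (logistic (\<eta> z) - b z)\<^sup>2 \<partial>F) \<le> (\<epsilon> n)\<^sup>2"
    and \<epsilon>: "\<epsilon> \<longlonglongrightarrow> 0"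
    and H_empirical: "\<And>c. c > 0 \<Longrightarrow> whp P (\<lambda>n (x, s). \<forall>\<eta>\<in>H n.
           \<bar>emp_process (obs_law a b F) n x (\<lambda>v. logistic (\<eta> (fst v)) - b (fst v))\<bar> \<le> c)"
    and r: "r \<longlonglongrightarrow> 0" and K: "K > 0" and a_bound: "\<And>z. 0 < a z \<and> a z \<le> L"
begin

text \<open>A property of the auxiliary variable alone, kept as a premise in the limit statements
  below. Here \<open>K\<close> and \<open>r\<close> hold one fixed choice of constants in the
  stochastic bounds on the estimator.\<close>

definition good :: "nat \<Rightarrow> 's \<Rightarrow> bool" where
  "good n s \<longleftrightarrow> (\<forall>z. \<bar>ahat n s z\<bar> \<le> K) \<and> (\<integral>z. (ahat n s z - a z)\<^sup>2 \<partial>F) \<le> (r n)\<^sup>2"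

lemma P': "P n = Pi\<^sub>M {..<n} (\<lambda>_. obs_law a b F) \<Otimes>\<^sub>M S n"
  by (simp add: P sample_law_def)

lemma L: "L \<ge> 0"
  using a_bound by (meson less_le_trans less_imp_le)

lemma ahat_obs_measurable [measurable]: "(\<lambda>(s, v). ahat n s (fst v)) \<in> borel_measurable (S n \<Otimes>\<^sub>M obs_law a b F)"
proof -
  have "(\<lambda>(s, v). (s, fst v)) \<in> measurable (S n \<Otimes>\<^sub>M obs_space) (S n \<Otimes>\<^sub>M borel)"
    unfolding case_prod_beta' by measurable
  from measurable_compose[OF this ahat] show ?thesis
    by (simp add: case_prod_beta' cong: measurable_cong_sets[OF sets_pair_measure_cong[OF refl sets_obs_law] refl])
qed

lemma ahat_section: "s \<in> space (S n) \<Longrightarrow> ahat n s \<in> borel_measurable borel"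
  using measurable_Pair2[OF ahat, of s n] by simp

definition deviations :: "nat \<Rightarrow> ('z obs \<Rightarrow> real) set" where
  "deviations n = (\<lambda>\<eta> v. logistic (\<eta> (fst v)) - b (fst v)) ` H n"

lemma deviation_bound: "\<bar>logistic y - b z\<bar> \<le> 1"
  using logistic_bounds[of y] b_bounds[of z] by (auto simp: abs_le_iff)

sublocale E: empirical_class "obs_law a b F" S P deviations \<epsilon>
proof (rule empirical_class.intro)
  fix n h
  assume "h \<in> deviations n"
  then obtain \<eta> where \<eta>: "\<eta> \<in> H n" and h: "h = (\<lambda>v. logistic (\<eta> (fst v)) - b (fst v))" by (auto simp: deviations_def)
  note [measurable] = H[OF \<eta>]
  have m: "(\<lambda>z. (logistic (\<eta> z) - b z)\<^sup>2) \<in> borel_measurable borel" by measurable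
  show "h \<in> borel_measurable (obs_law a b F)" unfolding h by measurable
  show "\<bar>h v\<bar> \<le> 1" for v unfolding h by (rule deviation_bound)
  have "(\<integral>x. (h x)\<^sup>2 \<partial>obs_law a b F) = (\<integral>z. (logistic (\<eta> z) - b z)\<^sup>2 \<partial>F)"
    unfolding h by (rule integral_Z[OF m, where B=1]) (simp add: abs_square_le_1 deviation_bound)
  then show "(\<integral>x. (h x)\<^sup>2 \<partial>obs_law a b F) \<le> (\<epsilon> n)\<^sup>2" using H_rate[OF \<eta>] by simp
next
  fix c :: real
  assume "c > 0"
  from H_empirical[OF this]
  show "whp P (\<lambda>n (x, s). \<forall>h\<in>deviations n. \<bar>emp_process (obs_law a b F) n x h\<bar> \<le> c)"
    by (rule whp_mono, intro always_eventually) (auto simp: deviations_def)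
qed (fact O.prob_space_axioms S P' \<epsilon>)+

lemma whp_emp_abs:
  assumes c: "c > 0"
  shows "whp P (\<lambda>n (x, s). \<forall>\<eta>\<in>H n. emp_mean n x (\<lambda>v. \<bar>logistic (\<eta> (fst v)) - b (fst v)\<bar>) \<le> c)"
proof (rule whp_mono[OF E.whp_squares[of "c\<^sup>2"]])
  show "c\<^sup>2 > 0" using c by simp
  show "\<forall>\<^sub>F n in sequentially. \<forall>\<omega>\<in>space (P n). (case \<omega> of (x, s) \<Rightarrow> \<forall>h\<in>deviations n. emp_mean n x (\<lambda>v. (h v)\<^sup>2) \<le> c\<^sup>2) \<longrightarrow>
      (case \<omega> of (x, s) \<Rightarrow> \<forall>\<eta>\<in>H n. emp_mean n x (\<lambda>v. \<bar>logistic (\<eta> (fst v)) - b (fst v)\<bar>) \<le> c)"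
  proof (intro always_eventually allI ballI, clarsimp simp: deviations_def)
    fix n x s \<eta>
    assume 1: "\<forall>\<eta>\<in>H n. emp_mean n x (\<lambda>v. (logistic (\<eta> (fst v)) - b (fst v))\<^sup>2) \<le> c\<^sup>2" and \<eta>: "\<eta> \<in> H n"
    have "(emp_mean n x (\<lambda>v. \<bar>logistic (\<eta> (fst v)) - b (fst v)\<bar>))\<^sup>2 \<le> c\<^sup>2"
      by (rule order_trans[OF emp_mean_abs_square bspec[OF 1 \<eta>]])
    then show "emp_mean n x (\<lambda>v. \<bar>logistic (\<eta> (fst v)) - b (fst v)\<bar>) \<le> c"
      by (rule power2_le_imp_le) (use c in simp)
  qed
qed

text \<open>Given the estimator the summands are centred, because the residual has conditional mean
  0 given \<open>Z\<close>, and their variance is at most the squared error of the estimator, which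
  tends to 0.\<close>

lemma whp_score_difference:
  assumes c: "c > 0"
  shows "whp P (\<lambda>n (x, s). good n s \<longrightarrow>
    \<bar>\<Sum>i<n. (ahat n s (fst (x i)) - a (fst (x i))) * (oY (x i) - oR (x i) * b (fst (x i)))\<bar> \<le> c * sqrt (real n))"
proof -
  define d where "d n s z = clip K (ahat n s z) - a z" for n s z
  \<comment> \<open>Replacing the difference by 0 when its norm exceeds \<open>r n\<close> makes the
    variance bound hold for every \<open>s\<close>; for good \<open>s\<close> it is the original
    difference.\<close>
  define g where "g n s z = (if (\<integral>y. (d n s y)\<^sup>2 \<partial>F) \<le> (r n)\<^sup>2 then d n s z else 0)" for n s z
  have d_bound: "\<bar>d n s z\<bar> \<le> K + L" for n s z
    using clip_bound[of K "ahat n s z"] a_bound[of z] K unfolding d_def by (auto simp: abs_le_iff)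
  then have g_bound: "\<bar>g n s z\<bar> \<le> K + L" for n s z using K L by (auto simp: g_def)
  have [measurable]: "(\<lambda>(s, v). clip K (ahat n s (fst v))) \<in> borel_measurable (S n \<Otimes>\<^sub>M obs_law a b F)" for n
    unfolding case_prod_beta' by measurable
  have dz[measurable]: "(\<lambda>(s, z). d n s z) \<in> borel_measurable (S n \<Otimes>\<^sub>M F)" for n
  proof -
    have [measurable]: "(\<lambda>(s, z). ahat n s z) \<in> borel_measurable (S n \<Otimes>\<^sub>M borel)" by (rule ahat)
    have "(\<lambda>(s, z). d n s z) \<in> borel_measurable (S n \<Otimes>\<^sub>M borel)" unfolding d_def case_prod_beta' by measurable
    then show ?thesis by (simp cong: measurable_cong_sets[OF sets_pair_measure_cong[OF refl sets_F] refl])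
  qed
  have Im[measurable]: "(\<lambda>s. \<integral>y. (d n s y)\<^sup>2 \<partial>F) \<in> borel_measurable (S n)" for n
    by measurable
  have sec[measurable]: "d n s \<in> borel_measurable borel" if "s \<in> space (S n)" for n s
    using ahat_section[OF that] unfolding d_def[abs_def] by measurable
  have gsec[measurable]: "g n s \<in> borel_measurable borel" if "s \<in> space (S n)" for n s
    using sec[OF that] unfolding g_def[abs_def] by (cases "(\<integral>y. (d n s y)\<^sup>2 \<partial>F) \<le> (r n)\<^sup>2") auto
  have main: "whp P (\<lambda>n (x, s). \<bar>\<Sum>i<n. g n s (fst (x i)) * (oY (x i) - oR (x i) * b (fst (x i)))\<bar> \<le> c * sqrt (real n))"
  proof (rule whp_Chebyshev[OF O.prob_space_axioms S P', where B="\<lambda>_. K + L" and v="\<lambda>n. (r n)\<^sup>2"])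
    show "(\<lambda>(s, v). g n s (fst v) * (oY v - oR v * b (fst v))) \<in> borel_measurable (S n \<Otimes>\<^sub>M obs_law a b F)" for n
      unfolding g_def d_def[of n _ "fst _"] case_prod_beta' by measurable
    show "\<bar>g n s (fst v) * (oY v - oR v * b (fst v))\<bar> \<le> K + L" for n s v
      by (rule residual_Z_bound[OF g_bound])
    show "(\<integral>v. g n s (fst v) * (oY v - oR v * b (fst v)) \<partial>obs_law a b F) = 0" if "s \<in> space (S n)" for n s
      by (rule integral_residual[OF gsec[OF that] g_bound])
    show "(\<integral>v. (g n s (fst v) * (oY v - oR v * b (fst v)))\<^sup>2 \<partial>obs_law a b F) \<le> (r n)\<^sup>2" if s: "s \<in> space (S n)" for n s
    proof -
      note [measurable] = gsec[OF s]
      have bz: "0 \<le> b z * (1 - b z) / a z \<and> b z * (1 - b z) / a z \<le> 1" for z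
      proof -
        have "b z * (1 - b z) \<le> 1" using b_bounds[of z] by (intro mult_le_one) auto
        then have "(b z * (1 - b z)) * (1 / a z) \<le> 1" using b_bounds[of z] a_bounds[of z]
          by (intro mult_le_one) auto
        then show ?thesis using b_bounds[of z] a_bound[of z] by auto
      qed
      have g2: "(g n s z)\<^sup>2 \<le> (K + L)\<^sup>2" for z using power_mono[OF g_bound abs_ge_zero, of n s z 2] by simp
      have le: "(g n s z)\<^sup>2 * (b z * (1 - b z)) / a z \<le> (g n s z)\<^sup>2" for z
        using mult_left_mono[of "b z * (1 - b z) / a z" 1 "(g n s z)\<^sup>2"] bz[of z] by simp
      have nn: "0 \<le> (g n s z)\<^sup>2 * (b z * (1 - b z)) / a z" for z
        using mult_nonneg_nonneg[of "(g n s z)\<^sup>2" "b z * (1 - b z) / a z"] bz[of z] by simp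
      have "(\<integral>z. (g n s z)\<^sup>2 * (b z * (1 - b z)) / a z \<partial>F) \<le> (\<integral>z. (g n s z)\<^sup>2 \<partial>F)"
      proof (rule integral_mono)
        show "integrable F (\<lambda>z. (g n s z)\<^sup>2)" by (rule F_integrable[where B="(K + L)\<^sup>2"]) (use g2 in auto)
        show "integrable F (\<lambda>z. (g n s z)\<^sup>2 * (b z * (1 - b z)) / a z)"
        proof (rule F_integrable[where B="(K + L)\<^sup>2"])
          show "(\<lambda>z. (g n s z)\<^sup>2 * (b z * (1 - b z)) / a z) \<in> borel_measurable borel"
            using gsec[OF s] by measurable
          show "\<bar>(g n s z)\<^sup>2 * (b z * (1 - b z)) / a z\<bar> \<le> (K + L)\<^sup>2" for z
            unfolding abs_of_nonneg[OF nn] by (rule order_trans[OF le g2])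
        qed
      qed (rule le)
      also have "\<dots> \<le> (r n)\<^sup>2" by (cases "(\<integral>y. (d n s y)\<^sup>2 \<partial>F) \<le> (r n)\<^sup>2") (auto simp: g_def)
      finally show ?thesis by (simp add: integral_residual_square[OF gsec[OF s] g_bound])
    qed
    show "(\<lambda>n. (r n)\<^sup>2) \<longlonglongrightarrow> 0" using tendsto_power[OF r, of 2] by simp
  qed (rule c)
  show ?thesis
  proof (rule whp_mono[OF main], intro always_eventually allI ballI, clarify)
    fix n x s
    assume "\<bar>\<Sum>i<n. g n s (fst (x i)) * (oY (x i) - oR (x i) * b (fst (x i)))\<bar> \<le> c * sqrt (real n)" and gd: "good n s"
    moreover have "g n s = (\<lambda>z. ahat n s z - a z)"
      using gd by (auto simp: good_def g_def d_def clip_id fun_eq_iff)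
    ultimately show "\<bar>\<Sum>i<n. (ahat n s (fst (x i)) - a (fst (x i))) * (oY (x i) - oR (x i) * b (fst (x i)))\<bar> \<le> c * sqrt (real n)"
      by simp
  qed
qed

text \<open>The product \<open>R * ahat\<close> is an affine function of an admissible exchange
  weight, and empirical processes are linear, so \<open>whp_multiplier\<close> and the hypothesis on
  the unweighted process combine.\<close>

lemma whp_weighted_deviation:
  assumes c: "c > 0"
  shows "whp P (\<lambda>n (x, s). good n s \<longrightarrow> (\<forall>\<eta>\<in>H n.
    \<bar>emp_process (obs_law a b F) n x (\<lambda>v. oR v * ahat n s (fst v) * (logistic (\<eta> (fst v)) - b (fst v)))\<bar> \<le> c))"
proof -
  define c' where "c' = c / (8 * K)"
  have c': "c' > 0" using c K by (simp add: c'_def)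
  \<comment> \<open>The affine map sends values in \<open>- K\<close> to \<open>K\<close> into the
    interval from 1/4 to 3/4. Undoing it expresses the weighted process as \<open>4 * K\<close>
    times the \<open>\<psi>\<close>-process minus \<open>2 * K\<close> times the plain one, so
    \<open>c' = c / (8 * K)\<close> leaves room.\<close>
  define \<psi> where "\<psi> n s v = 1/2 + oR v * clip K (ahat n s (fst v)) / (4 * K)" for n s v
  have \<psi>: "1/4 \<le> \<psi> n s v \<and> \<psi> n s v \<le> 3/4" for n s v
  proof -
    have le: "\<bar>oR v * clip K (ahat n s (fst v)) / (4 * K)\<bar> \<le> 1 / 4"
      using clip_bound[of K "ahat n s (fst v)"] K by (auto simp: oR_def abs_mult field_simps)
    show ?thesis using abs_le_D1[OF le] abs_le_D2[OF le] unfolding \<psi>_def by linarith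
  qed
  have \<psi>m[measurable]: "(\<lambda>(s, v). \<psi> n s v) \<in> borel_measurable (S n \<Otimes>\<^sub>M obs_law a b F)" for n
    unfolding \<psi>_def case_prod_beta' by measurable
  show ?thesis
  proof (rule whp_mono[OF whp_conj[OF E.whp_multiplier[of \<psi>, OF \<psi>m \<psi> c'] H_empirical[OF c']]],
      intro always_eventually allI ballI, clarsimp)
    fix n x s \<eta>
    assume 1: "\<forall>h\<in>deviations n. \<bar>emp_process (obs_law a b F) n x (\<lambda>v. \<psi> n s v * h v)\<bar> \<le> c'"
      and 2: "\<forall>\<eta>\<in>H n. \<bar>emp_process (obs_law a b F) n x (\<lambda>v. logistic (\<eta> (fst v)) - b (fst v))\<bar> \<le> c'"
      and gd: "good n s" and \<eta>: "\<eta> \<in> H n" and "(x, s) \<in> space (P n)"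
    then have s: "s \<in> space (S n)" by (simp add: P' space_pair_measure)
    let ?h = "\<lambda>v. logistic (\<eta> (fst v)) - b (fst v)"
    have hd: "?h \<in> deviations n" using \<eta> by (simp add: deviations_def)
    have [measurable]: "\<psi> n s \<in> borel_measurable (obs_law a b F)" using measurable_Pair2[OF \<psi>m s] by simp
    have [measurable]: "?h \<in> borel_measurable (obs_law a b F)" by (rule E.K_measurable[OF hd])
    have i: "integrable (obs_law a b F) (\<lambda>v. \<psi> n s v * ?h v)"
    proof (rule O.integrable_const_bound[where B=1])
      have "\<bar>\<psi> n s v * ?h v\<bar> \<le> 1 * 1" for v
        unfolding abs_mult using \<psi>[of n s v] deviation_bound[of "\<eta> (fst v)" "fst v"] by (intro mult_mono) auto
      then show "AE v in obs_law a b F. norm (\<psi> n s v * ?h v) \<le> 1" by simp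
    qed measurable
    have eq: "oR v * ahat n s (fst v) * ?h v = (4 * K) * (\<psi> n s v * ?h v) + (- (2 * K)) * ?h v" for v
      using gd K by (simp add: good_def \<psi>_def clip_id field_simps)
    have "\<bar>emp_process (obs_law a b F) n x (\<lambda>v. oR v * ahat n s (fst v) * ?h v)\<bar>
       = \<bar>(4 * K) * emp_process (obs_law a b F) n x (\<lambda>v. \<psi> n s v * ?h v) + (- (2 * K)) * emp_process (obs_law a b F) n x ?h\<bar>"
      unfolding eq by (subst emp_process_linear[OF i E.K_integrable(1)[OF hd]]) (rule refl)
    also have "\<dots> \<le> (4 * K) * c' + (2 * K) * c'"
      using bspec[OF 1 hd] bspec[OF 2 \<eta>] K
      by (intro order_trans[OF abs_triangle_ineq] add_mono) (auto simp: abs_mult)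
    also have "\<dots> \<le> c" using K c by (simp add: c'_def)
    finally show "\<bar>emp_process (obs_law a b F) n x (\<lambda>v. oR v * ahat n s (fst v) * ?h v)\<bar> \<le> c" .
  qed
qed

text \<open>Three replacements, each costing at most \<open>c / 3\<close>: \<open>b\<close> for the
  fitted probability through the empirical mean of their distance, the expectation for the sample
  mean by the law of large numbers, and \<open>a\<close> for its estimator in the expectation. Since
  \<open>R\<close> has conditional mean \<open>1 / a\<close>, the limit carries a single factor
  \<open>a\<close>.\<close>

lemma whp_information:
  assumes c: "c > 0"
  shows "whp P (\<lambda>n (x, s). good n s \<longrightarrow> (\<forall>\<eta>\<in>H n.
    \<bar>emp_mean n x (\<lambda>v. oR v * (ahat n s (fst v))\<^sup>2 * (logistic (\<eta> (fst v)) * (1 - logistic (\<eta> (fst v)))))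
       - (\<integral>z. a z * (b z * (1 - b z)) \<partial>F)\<bar> \<le> c))"
proof -
  define \<phi> where "\<phi> n s v = oR v * ((clip K (ahat n s (fst v)))\<^sup>2 * (b (fst v) * (1 - b (fst v))))" for n s v
  have bz: "0 \<le> b z * (1 - b z)" "b z * (1 - b z) \<le> 1" for z
    using b_bounds[of z] by (auto intro: mult_le_one)
  have sq: "(clip K y)\<^sup>2 * (b z * (1 - b z)) \<le> K\<^sup>2" "0 \<le> (clip K y)\<^sup>2 * (b z * (1 - b z))" for y z
  proof -
    have "(clip K y)\<^sup>2 \<le> K\<^sup>2" using power_mono[OF clip_bound abs_ge_zero, of K y 2] K by simp
    then show "(clip K y)\<^sup>2 * (b z * (1 - b z)) \<le> K\<^sup>2"
      using mult_mono[of "(clip K y)\<^sup>2" "K\<^sup>2" "b z * (1 - b z)" 1] bz[of z] by simp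
  qed (use bz[of z] in simp)
  have \<phi>: "\<bar>\<phi> n s v\<bar> \<le> K\<^sup>2" for n s v
    using sq[of "ahat n s (fst v)" "fst v"] by (auto simp: \<phi>_def oR_def)
  have \<phi>m: "(\<lambda>(s, v). \<phi> n s v) \<in> borel_measurable (S n \<Otimes>\<^sub>M obs_law a b F)" for n
    unfolding \<phi>_def case_prod_beta' by measurable
  have "(\<lambda>n. (K + L) * \<bar>r n\<bar>) \<longlonglongrightarrow> (K + L) * \<bar>0\<bar>" by (intro tendsto_intros r)
  then have "\<forall>\<^sub>F n in sequentially. (K + L) * \<bar>r n\<bar> < c / 3" using c by (intro order_tendstoD) auto
  moreover have cK: "c / (3 * K\<^sup>2) > 0" "c / 3 > 0" using c K by auto
  ultimately show ?thesis
  proof (intro whp_mono[OF whp_conj[OF whp_emp_abs[OF cK(1)] whp_LLN[OF O.prob_space_axioms S P' \<phi>m \<phi> cK(2)]]])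
    assume "\<forall>\<^sub>F n in sequentially. (K + L) * \<bar>r n\<bar> < c / 3"
    then show "\<forall>\<^sub>F n in sequentially. \<forall>\<omega>\<in>space (P n).
        (case \<omega> of (x, s) \<Rightarrow> \<forall>\<eta>\<in>H n. emp_mean n x (\<lambda>v. \<bar>logistic (\<eta> (fst v)) - b (fst v)\<bar>) \<le> c / (3 * K\<^sup>2)) \<and>
        (case \<omega> of (x, s) \<Rightarrow> \<bar>emp_mean n x (\<phi> n s) - (\<integral>v. \<phi> n s v \<partial>obs_law a b F)\<bar> \<le> c / 3) \<longrightarrow>
        (case \<omega> of (x, s) \<Rightarrow> good n s \<longrightarrow> (\<forall>\<eta>\<in>H n.
           \<bar>emp_mean n x (\<lambda>v. oR v * (ahat n s (fst v))\<^sup>2 * (logistic (\<eta> (fst v)) * (1 - logistic (\<eta> (fst v)))))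
             - (\<integral>z. a z * (b z * (1 - b z)) \<partial>F)\<bar> \<le> c))"
    proof (eventually_elim, clarify)
      fix n x s \<eta>
      assume rn: "(K + L) * \<bar>r n\<bar> < c / 3" and "(x, s) \<in> space (P n)"
        and 1: "\<forall>\<eta>\<in>H n. emp_mean n x (\<lambda>v. \<bar>logistic (\<eta> (fst v)) - b (fst v)\<bar>) \<le> c / (3 * K\<^sup>2)"
        and 2: "\<bar>emp_mean n x (\<phi> n s) - (\<integral>v. \<phi> n s v \<partial>obs_law a b F)\<bar> \<le> c / 3"
        and gd: "good n s" and \<eta>: "\<eta> \<in> H n"
      then have s: "s \<in> space (S n)" by (simp add: P' space_pair_measure)
      note [measurable] = ahat_section[OF s]
      have A: "clip K (ahat n s z) = ahat n s z" "\<bar>ahat n s z\<bar> \<le> K" for z using gd by (auto simp: good_def clip_id)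
      let ?f = "\<lambda>v. oR v * (ahat n s (fst v))\<^sup>2 * (logistic (\<eta> (fst v)) * (1 - logistic (\<eta> (fst v))))"
      let ?h = "\<lambda>v. logistic (\<eta> (fst v)) - b (fst v)"
      have "\<bar>emp_mean n x ?f - emp_mean n x (\<phi> n s)\<bar> \<le> K\<^sup>2 * emp_mean n x (\<lambda>v. \<bar>?h v\<bar>)"
      proof (rule emp_mean_diff_le)
        fix v :: "'z obs"
        \<comment> \<open>The map \<open>p * (1 - p)\<close> differs at two points by their
          difference times a factor between -1 and 1, so the error is linear in the
          deviation.\<close>
        have eq: "?f v - \<phi> n s v = (oR v * (ahat n s (fst v))\<^sup>2) * (?h v * (1 - logistic (\<eta> (fst v)) - b (fst v)))"
          by (simp add: \<phi>_def A(1) algebra_simps)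
        have i: "(ahat n s (fst v))\<^sup>2 \<le> K\<^sup>2" using power_mono[OF A(2) abs_ge_zero, of "fst v" 2] by simp
        have ii: "\<bar>?h v * (1 - logistic (\<eta> (fst v)) - b (fst v))\<bar> \<le> \<bar>?h v\<bar> * 1"
          unfolding abs_mult using logistic_bounds[of "\<eta> (fst v)"] b_bounds[of "fst v"]
          by (intro mult_left_mono) (auto simp: abs_le_iff)
        have iii: "\<bar>oR v * (ahat n s (fst v))\<^sup>2\<bar> \<le> K\<^sup>2" using i by (auto simp: oR_def)
        show "\<bar>?f v - \<phi> n s v\<bar> \<le> K\<^sup>2 * \<bar>?h v\<bar>"
          unfolding eq abs_mult[of "oR v * (ahat n s (fst v))\<^sup>2"] using mult_mono[OF iii ii] by simp
      qed
      also have "\<dots> \<le> K\<^sup>2 * (c / (3 * K\<^sup>2))" using 1 \<eta> by (intro mult_left_mono) auto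
      finally have I: "\<bar>emp_mean n x ?f - emp_mean n x (\<phi> n s)\<bar> \<le> c / 3" using K by simp
      let ?g = "\<lambda>z. (ahat n s z)\<^sup>2 * (b z * (1 - b z))"
      have gB: "\<bar>?g z\<bar> \<le> K\<^sup>2" for z using sq[of "ahat n s z" z] by (simp add: A(1))
      have mean: "(\<integral>v. \<phi> n s v \<partial>obs_law a b F) = (\<integral>z. ?g z / a z \<partial>F)"
        unfolding \<phi>_def A(1) by (rule integral_R_Z[OF _ gB]) measurable
      let ?d = "\<lambda>z. ahat n s z - a z"
      have a0: "\<bar>a z\<bar> \<le> L" "a z \<noteq> 0" for z using a_bound[of z] by auto
      have dB: "\<bar>?d z\<bar> \<le> K + L" for z using A(2)[of z] a0[of z] by (auto simp: abs_le_iff)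
      have d2: "(?d z)\<^sup>2 \<le> (K + L)\<^sup>2" for z using power_mono[OF dB abs_ge_zero, of z 2] by simp
      have id2: "integrable F (\<lambda>z. (?d z)\<^sup>2)" by (rule F_integrable[where B="(K + L)\<^sup>2"]) (measurable, use d2 in simp)
      have id1: "integrable F (\<lambda>z. ?d z * 1)" by (rule F_integrable[where B="K + L"]) (measurable, use dB in simp)
      have L1: "(\<integral>z. \<bar>?d z * 1\<bar> \<partial>F) \<le> \<bar>r n\<bar> * \<bar>1\<bar>"
        using gd id2 id1 by (intro Cauchy_Schwarz_bound) (auto simp: good_def F.prob_space[unfolded space_F])
      have ga: "\<bar>?g z / a z\<bar> \<le> K\<^sup>2" for z
      proof -
        have "\<bar>?g z / a z\<bar> = \<bar>?g z\<bar> * (1 / a z)" using a_bound[of z] by (simp add: abs_divide)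
        also have "\<dots> \<le> K\<^sup>2 * 1" using gB[of z] a_bounds[of z] by (intro mult_mono) auto
        finally show ?thesis by simp
      qed
      have ab: "\<bar>a z * (b z * (1 - b z))\<bar> \<le> L" for z
        unfolding abs_mult[of "a z"] using mult_mono[of "\<bar>a z\<bar>" L "\<bar>b z * (1 - b z)\<bar>" 1] a0[of z] bz[of z] L by simp
      have ia: "integrable F (\<lambda>z. ?g z / a z)" by (rule F_integrable[OF _ ga]) measurable
      have ib: "integrable F (\<lambda>z. a z * (b z * (1 - b z)))" by (rule F_integrable[OF _ ab]) measurable
      have diff: "(\<integral>z. ?g z / a z \<partial>F) - (\<integral>z. a z * (b z * (1 - b z)) \<partial>F)
          = (\<integral>z. ?g z / a z - a z * (b z * (1 - b z)) \<partial>F)"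
        by (rule Bochner_Integration.integral_diff[OF ia ib, symmetric])
      have "\<bar>(\<integral>z. ?g z / a z \<partial>F) - (\<integral>z. a z * (b z * (1 - b z)) \<partial>F)\<bar>
          \<le> (\<integral>z. \<bar>?g z / a z - a z * (b z * (1 - b z))\<bar> \<partial>F)"
        unfolding diff by (rule integral_abs_bound)
      also have "\<dots> \<le> (\<integral>z. (K + L) * \<bar>?d z\<bar> \<partial>F)"
      proof (rule integral_mono)
        show "integrable F (\<lambda>z. \<bar>?g z / a z - a z * (b z * (1 - b z))\<bar>)" using ia ib by simp
        show "integrable F (\<lambda>z. (K + L) * \<bar>?d z\<bar>)" using id1 by simp
        fix z
        have eq: "?g z / a z - a z * (b z * (1 - b z)) = (?d z * (ahat n s z + a z)) * ((b z * (1 - b z)) * (1 / a z))"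
          using a0(2)[of z] by (simp add: field_simps power2_eq_square)
        have "\<bar>(?d z * (ahat n s z + a z)) * ((b z * (1 - b z)) * (1 / a z))\<bar> \<le> (\<bar>?d z\<bar> * (K + L)) * (1 * 1)"
          unfolding abs_mult[of "?d z * _"] abs_mult[of "?d z"] abs_mult[of "b z * (1 - b z)"] using A(2)[of z] a0[of z] bz[of z] a_bounds[of z] b_bounds[of z] K L
          by (intro mult_mono) (auto simp: abs_le_iff intro!: mult_nonneg_nonneg)
        then show "\<bar>?g z / a z - a z * (b z * (1 - b z))\<bar> \<le> (K + L) * \<bar>?d z\<bar>"
          unfolding eq by (simp only: mult_1_right mult.commute[of "K + L"])
      qed
      also have "\<dots> = (K + L) * (\<integral>z. \<bar>?d z\<bar> \<partial>F)" by simp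
      also have "\<dots> \<le> (K + L) * \<bar>r n\<bar>" using L1 K L by (intro mult_left_mono) auto
      finally show "\<bar>emp_mean n x ?f - (\<integral>z. a z * (b z * (1 - b z)) \<partial>F)\<bar> \<le> c"
        using I 2 rn unfolding mean by linarith
    qed
  qed
qed

text \<open>Since \<open>1 / a \<le> 1\<close>, the factor \<open>1 - ahat / a\<close> has norm at
  most that of \<open>ahat - a\<close>, and Cauchy-Schwarz gives the product of the two rates. For
  good \<open>s\<close> no randomness remains.\<close>

lemma eventually_bias_le:
  assumes re: "(\<lambda>n. sqrt (real n) * r n * \<epsilon> n) \<longlonglongrightarrow> 0" and c: "c > 0"
  shows "\<forall>\<^sub>F n in sequentially. \<forall>s\<in>space (S n). good n s \<longrightarrow> (\<forall>\<eta>\<in>H n.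
    \<bar>sqrt (real n) * (\<integral>z. (1 - ahat n s z / a z) * (logistic (\<eta> z) - b z) \<partial>F)\<bar> \<le> c)"
proof -
  have "\<forall>\<^sub>F n in sequentially. \<bar>sqrt (real n) * r n * \<epsilon> n\<bar> < c"
    using tendsto_rabs[OF re] c by (intro order_tendstoD(2)[where y="\<bar>0\<bar>"]) auto
  then show ?thesis
  proof (eventually_elim, clarify)
    fix n s \<eta>
    assume re: "\<bar>sqrt (real n) * r n * \<epsilon> n\<bar> < c" and s: "s \<in> space (S n)" and gd: "good n s" and \<eta>: "\<eta> \<in> H n"
    note [measurable] = ahat_section[OF s] H[OF \<eta>]
    let ?g = "\<lambda>z. 1 - ahat n s z / a z" and ?h = "\<lambda>z. logistic (\<eta> z) - b z" and ?d = "\<lambda>z. ahat n s z - a z"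
    have dB: "\<bar>?d z\<bar> \<le> K + L" for z
    proof -
      have "\<bar>ahat n s z\<bar> \<le> K" using gd by (simp add: good_def)
      then show ?thesis using a_bound[of z] by linarith
    qed
    have gd': "\<bar>?g z\<bar> \<le> \<bar>?d z\<bar>" for z
    proof -
      have "?g z = - ?d z * (1 / a z)" using a_bound[of z] by (simp add: field_simps)
      also have "\<bar>\<dots>\<bar> \<le> \<bar>?d z\<bar> * 1" unfolding abs_mult using a_bounds[of z] by (intro mult_mono) auto
      finally show ?thesis by simp
    qed
    have gB: "\<bar>?g z\<bar> \<le> K + L" for z using gd'[of z] dB[of z] by linarith
    have g2: "(?g z)\<^sup>2 \<le> (?d z)\<^sup>2" for z using gd'[of z] by (simp only: abs_le_square_iff)
    have d2: "(?d z)\<^sup>2 \<le> (K + L)\<^sup>2" for z using power_mono[OF dB abs_ge_zero, of z 2] by simp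
    have id2: "integrable F (\<lambda>z. (?d z)\<^sup>2)" by (rule F_integrable[where B="(K + L)\<^sup>2"]) (measurable, use d2 in simp)
    have ig2: "integrable F (\<lambda>z. (?g z)\<^sup>2)"
      by (rule F_integrable[where B="(K + L)\<^sup>2"]) (measurable, use order_trans[OF g2 d2] in simp)
    have ih2: "integrable F (\<lambda>z. (?h z)\<^sup>2)"
      by (rule F_integrable[where B=1]) (measurable, use deviation_bound in \<open>simp add: abs_square_le_1\<close>)
    have gh: "\<bar>?g z * ?h z\<bar> \<le> (K + L) * 1" for z
      unfolding abs_mult using gB[of z] deviation_bound[of "\<eta> z" z] K L by (intro mult_mono) auto
    have igh: "integrable F (\<lambda>z. ?g z * ?h z)" by (rule F_integrable[OF _ gh]) measurable
    have g2': "(\<integral>z. (?g z)\<^sup>2 \<partial>F) \<le> (r n)\<^sup>2"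
      using integral_mono[OF ig2 id2 g2] gd by (simp add: good_def)
    have "\<bar>\<integral>z. ?g z * ?h z \<partial>F\<bar> \<le> (\<integral>z. \<bar>?g z * ?h z\<bar> \<partial>F)" by (rule integral_abs_bound)
    also have "\<dots> \<le> \<bar>r n\<bar> * \<bar>\<epsilon> n\<bar>"
      by (rule Cauchy_Schwarz_bound[OF _ _ ig2 g2' ih2 H_rate[OF \<eta>] igh]) measurable
    finally have "sqrt (real n) * \<bar>\<integral>z. ?g z * ?h z \<partial>F\<bar> \<le> sqrt (real n) * (\<bar>r n\<bar> * \<bar>\<epsilon> n\<bar>)"
      by (intro mult_left_mono) auto
    then show "\<bar>sqrt (real n) * (\<integral>z. ?g z * ?h z \<partial>F)\<bar> \<le> c"
      using re by (simp add: abs_mult mult.assoc)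
  qed
qed

lemma whp_variance:
  assumes c: "c > 0"
  shows "whp P (\<lambda>n (x, s). \<forall>\<eta>\<in>H n.
    \<bar>emp_mean n x (\<lambda>v. (logistic (\<eta> (fst v)))\<^sup>2) - (emp_mean n x (\<lambda>v. logistic (\<eta> (fst v))))\<^sup>2
       - ((\<integral>z. (b z)\<^sup>2 \<partial>F) - (\<integral>z. b z \<partial>F)\<^sup>2)\<bar> \<le> c)"
proof -
  \<comment> \<open>Seven equal shares: two for replacing the fitted probability by \<open>b\<close>
    in the second moment, one for the law of large numbers there, and two each for the same two
    replacements in the squared mean.\<close>
  have c': "c / 7 > 0" using c by simp
  have m: "(\<lambda>(s, v). b (fst v)) \<in> borel_measurable (S n \<Otimes>\<^sub>M obs_law a b F)"
    "(\<lambda>(s, v). (b (fst v))\<^sup>2) \<in> borel_measurable (S n \<Otimes>\<^sub>M obs_law a b F)" for n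
    unfolding case_prod_beta' by measurable
  have b1: "\<bar>b z\<bar> \<le> 1" "\<bar>(b z)\<^sup>2\<bar> \<le> 1" for z using b_bounds[of z] by (auto simp: abs_square_le_1)
  have int: "(\<integral>v. b (fst v) \<partial>obs_law a b F) = (\<integral>z. b z \<partial>F)" "(\<integral>v. (b (fst v))\<^sup>2 \<partial>obs_law a b F) = (\<integral>z. (b z)\<^sup>2 \<partial>F)"
    by (rule integral_Z[OF _ b1(1)], measurable) (rule integral_Z[OF _ b1(2)], measurable)
  have sq: "\<bar>p\<^sup>2 - q\<^sup>2\<bar> \<le> 2 * \<bar>p - q\<bar>" if "0 \<le> p" "p \<le> 1" "0 \<le> q" "q \<le> 1" for p q :: real
  proof -
    have "p\<^sup>2 - q\<^sup>2 = (p + q) * (p - q)" by (simp add: power2_eq_square algebra_simps)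
    then show ?thesis using that by (simp add: abs_mult mult_right_mono)
  qed
  have em: "0 \<le> emp_mean n x g \<and> emp_mean n x g \<le> 1" if "\<And>v. 0 \<le> g v \<and> g v \<le> 1" for n and x :: "nat \<Rightarrow> 'z obs" and g
  proof -
    have "(\<Sum>i<n. g (x i)) \<le> real (card {..<n}) * 1" using that by (intro sum_bounded_above) auto
    moreover have "0 \<le> (\<Sum>i<n. g (x i))" by (rule sum_nonneg) (use that in blast)
    ultimately show ?thesis by (cases "n = 0") (simp_all add: emp_mean_def)
  qed
  show ?thesis
  proof (rule whp_mono[OF whp_conj[OF whp_emp_abs[OF c'] whp_conj[OF
        whp_LLN[OF O.prob_space_axioms S P' m(1) b1(1) c'] whp_LLN[OF O.prob_space_axioms S P' m(2) b1(2) c']]]],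
      intro always_eventually allI ballI, clarsimp simp only: prod.case int)
    fix n s \<eta> and x :: "nat \<Rightarrow> 'z obs"
    assume 1: "\<forall>\<eta>\<in>H n. emp_mean n x (\<lambda>v. \<bar>logistic (\<eta> (fst v)) - b (fst v)\<bar>) \<le> c / 7"
      and 2: "\<bar>emp_mean n x (\<lambda>v. b (fst v)) - (\<integral>z. b z \<partial>F)\<bar> \<le> c / 7"
        "\<bar>emp_mean n x (\<lambda>v. (b (fst v))\<^sup>2) - (\<integral>z. (b z)\<^sup>2 \<partial>F)\<bar> \<le> c / 7" and \<eta>: "\<eta> \<in> H n"
    let ?l = "\<lambda>v. logistic (\<eta> (fst v))" and ?b = "\<lambda>v. b (fst v)"
    have l: "0 \<le> ?l v \<and> ?l v \<le> 1" for v :: "'z obs" using logistic_bounds[of "\<eta> (fst v)"] by auto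
    have "\<bar>emp_mean n x ?l - emp_mean n x ?b\<bar> \<le> 1 * emp_mean n x (\<lambda>v. \<bar>?l v - ?b v\<bar>)"
      by (rule emp_mean_diff_le) simp
    then have A: "\<bar>emp_mean n x ?l - emp_mean n x ?b\<bar> \<le> c / 7" using bspec[OF 1 \<eta>] by linarith
    have "\<bar>emp_mean n x (\<lambda>v. (?l v)\<^sup>2) - emp_mean n x (\<lambda>v. (?b v)\<^sup>2)\<bar> \<le> 2 * emp_mean n x (\<lambda>v. \<bar>?l v - ?b v\<bar>)"
      by (rule emp_mean_diff_le) (use l b_bounds in \<open>auto intro!: sq\<close>)
    then have B: "\<bar>emp_mean n x (\<lambda>v. (?l v)\<^sup>2) - emp_mean n x (\<lambda>v. (?b v)\<^sup>2)\<bar> \<le> 2 * (c / 7)" using bspec[OF 1 \<eta>] by linarith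
    have ib: "0 \<le> (\<integral>z. b z \<partial>F)" by (rule Bochner_Integration.integral_nonneg) (rule conjunct1[OF b_bounds])
    have ib': "(\<integral>z. b z \<partial>F) \<le> 1"
      by (rule F.integral_le_const[OF F_integrable[OF b_measurable b1(1)]]) (rule AE_I2, rule conjunct2[OF b_bounds])
    have el: "0 \<le> emp_mean n x ?l \<and> emp_mean n x ?l \<le> 1" by (rule em) (rule l)
    have eb: "0 \<le> emp_mean n x ?b \<and> emp_mean n x ?b \<le> 1" by (rule em) (rule b_bounds)
    have "\<bar>(emp_mean n x ?l)\<^sup>2 - (emp_mean n x ?b)\<^sup>2\<bar> \<le> 2 * (c / 7)"
      by (rule order_trans[OF sq[OF conjunct1[OF el] conjunct2[OF el] conjunct1[OF eb] conjunct2[OF eb]] mult_left_mono[OF A]]) simp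
    moreover have "\<bar>(emp_mean n x ?b)\<^sup>2 - (\<integral>z. b z \<partial>F)\<^sup>2\<bar> \<le> 2 * (c / 7)"
      by (rule order_trans[OF sq[OF conjunct1[OF eb] conjunct2[OF eb] ib ib'] mult_left_mono[OF 2(1)]]) simp
    ultimately show "\<bar>emp_mean n x (\<lambda>v. (?l v)\<^sup>2) - (emp_mean n x ?l)\<^sup>2 - ((\<integral>z. (b z)\<^sup>2 \<partial>F) - (\<integral>z. b z \<partial>F)\<^sup>2)\<bar> \<le> c"
      using B 2(2) by linarith
  qed
qed

lemma whp_valid: "whp P (\<lambda>n (x, s). \<forall>i<n. snd (snd (x i)) \<longrightarrow> fst (snd (x i)))"
proof (rule whp_AE)
  fix n
  interpret S: prob_space "S n" by (rule S)
  let ?X = "Pi\<^sub>M {..<n} (\<lambda>_. obs_law a b F)"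
  have "AE x in ?X. snd (snd (x i)) \<longrightarrow> fst (snd (x i))" if "i < n" for i
    by (rule AE_PiM_component[where M="\<lambda>_. obs_law a b F" and P="\<lambda>v. snd (snd v) \<longrightarrow> fst (snd v)"])
       (use that AE_obs_law prob_space_obs_law in auto)
  then have "AE x in ?X. \<forall>i\<in>{..<n}. snd (snd (x i)) \<longrightarrow> fst (snd (x i))"
    by (intro AE_finite_allI) auto
  then have "AE x in distr (P n) ?X fst. \<forall>i\<in>{..<n}. snd (snd (x i)) \<longrightarrow> fst (snd (x i))"
    unfolding P' S.distr_pair_fst .
  from AE_distrD[OF _ this]
  show "AE \<omega> in P n. case \<omega> of (x, s) \<Rightarrow> \<forall>i<n. snd (snd (x i)) \<longrightarrow> fst (snd (x i))"
    by (simp add: P' case_prod_beta' Ball_def)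
qed

end

lemma d_BL_abs_le:
  assumes "\<And>f. f \<in> BL_unit \<Longrightarrow> \<bar>(\<integral>x. f x \<partial>M) - (\<integral>x. f x \<partial>N)\<bar> \<le> e"
  shows "\<bar>d_BL M N\<bar> \<le> e"
proof -
  let ?X = "{\<bar>(\<integral>x. (f x :: real) \<partial>M) - (\<integral>x. f x \<partial>N)\<bar> | f. 1-lipschitz_on UNIV f \<and> (\<forall>x. \<bar>f x\<bar> \<le> 1)}"
  have le: "y \<le> e" if "y \<in> ?X" for y using that assms by (auto simp: BL_unit_def)
  have "(\<lambda>_. 0) \<in> BL_unit" by (rule BL_unitI) auto
  then have 0: "0 \<in> ?X" unfolding BL_unit_def by (intro CollectI exI[of _ "\<lambda>_. 0"]) simp
  have "0 \<le> Sup ?X" using 0 le by (intro cSup_upper bdd_aboveI[of _ e]) auto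
  moreover have "Sup ?X \<le> e" using 0 le by (intro cSup_least) auto
  ultimately show ?thesis by (simp add: d_BL_def)
qed

lemma L2_norm_leD:
  assumes "L2_norm F f \<le> ennreal c"
  shows "(\<integral>z. (f z)\<^sup>2 \<partial>F) \<le> c\<^sup>2"
proof -
  have i: "integrable F (\<lambda>z. (f z)\<^sup>2)"
    using assms by (auto simp: L2_norm_def top_unique split: if_splits)
  let ?I = "\<integral>z. (f z)\<^sup>2 \<partial>F"
  have I: "0 \<le> ?I" by (rule Bochner_Integration.integral_nonneg) simp
  have "ennreal (sqrt ?I) \<le> ennreal c" using assms i by (simp add: L2_norm_def)
  then have "sqrt ?I \<le> \<bar>c\<bar>" using I by (cases "c \<ge> 0") (auto simp: ennreal_neg)
  then have "(sqrt ?I)\<^sup>2 \<le> \<bar>c\<bar>\<^sup>2" using I by (intro power_mono) auto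
  then show ?thesis using I by simp
qed

lemma sup_norm_leD:
  assumes "sup_norm f \<le> ennreal c"
  shows "\<bar>f z\<bar> \<le> max c 0"
proof -
  have "ennreal \<bar>f z\<bar> \<le> ennreal c" using assms by (auto simp: sup_norm_def SUP_le_iff)
  then show ?thesis by (cases "c \<ge> 0") (auto simp: ennreal_neg)
qed

text \<open>Finitely many test parameters \<open>T\<close> are fixed first, according to
  \<open>e\<close>. Only then are the finitely many random events intersected, together with the
  deterministic bounds valid for large \<open>n\<close>, and the bound for a fixed sample
  applied.\<close>

lemma (in estimated_weight) whp_BvM:
  fixes Q :: "nat \<Rightarrow> ('z \<Rightarrow> real) measure" and \<nu> :: "'z measure" and D :: "nat \<Rightarrow> (nat \<Rightarrow> 'z obs) \<Rightarrow> 'z measure measure"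
    and \<sigma> u :: "nat \<Rightarrow> real" and \<chi>hat :: "nat \<Rightarrow> (nat \<Rightarrow> 'z obs) \<times> 's \<Rightarrow> real"
  defines "V1 \<equiv> \<integral>z. a z * (b z * (1 - b z)) \<partial>F" and "V2 \<equiv> (\<integral>z. (b z)\<^sup>2 \<partial>F) - (\<integral>z. b z \<partial>F)\<^sup>2"
  assumes V: "V1 \<ge> 0" "V2 \<ge> 0"
    and Q: "\<And>n. prob_space (Q n)" "\<And>n. sets (Q n) = sets path_space" and \<sigma>: "\<And>n. \<sigma> n > 0"
    and \<nu>: "finite_measure \<nu>" "sets \<nu> = sets borel"
    and D: "\<And>n x. n \<ge> 1 \<Longrightarrow> dirichlet_process (dp_base \<nu> n x) (D n x)"
    and H_measurable: "\<And>n s. s \<in> space (S n) \<Longrightarrow>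
          {(w, l) \<in> space (prior_law (Q n) (\<sigma> n)). shift_path (ahat n s) w l \<in> H n} \<in> sets (prior_law (Q n) (\<sigma> n))"
    and u: "u \<longlonglongrightarrow> 0"
    and post_shift: "\<And>q. q > 0 \<Longrightarrow> whp P (\<lambda>n (x, s). 1 - q \<le> measure (posterior (ahat n s) (Q n) (\<sigma> n) n x)
             {(w, l) \<in> space (prior_law (Q n) (\<sigma> n)). \<bar>l\<bar> \<le> u n * (\<sigma> n)\<^sup>2 * sqrt (real n)})"
    and post_H: "\<And>t q. q > 0 \<Longrightarrow> whp P (\<lambda>n (x, s). 1 - q \<le> measure (posterior (ahat n s) (Q n) (\<sigma> n) n x)
             {(w, l) \<in> space (prior_law (Q n) (\<sigma> n)). shift_path (ahat n s) w (l + t / sqrt (real n)) \<in> H n})"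
    and n\<sigma>: "filterlim (\<lambda>n. real n * (\<sigma> n)\<^sup>2) at_top sequentially"
    and bias: "(\<lambda>n. sqrt (real n) * r n * \<epsilon> n) \<longlonglongrightarrow> 0"
    and hat: "\<And>c. c > 0 \<Longrightarrow> whp P (\<lambda>n (x, s).
           \<bar>sqrt (real n) * (\<chi>hat n (x, s) - (chi b F + emp_mean n x (eff_influence a b F)))\<bar> \<le> c)"
    and e: "e > 0"
  shows "whp P (\<lambda>n (x, s). good n s \<longrightarrow> (\<forall>f\<in>BL_unit.
     \<bar>(\<integral>y. f y \<partial>distr (posterior_chi (ahat n s) (Q n) (\<sigma> n) (D n x) n x) borel (\<lambda>c. sqrt (real n) * (c - \<chi>hat n (x, s))))
      - (\<integral>y. f y \<partial>gauss (V1 + V2))\<bar> \<le> e))"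
proof -
  have e8: "e / 8 > 0" "e / 16 > 0" using e by auto
  obtain T \<kappa> where T: "finite T" "\<kappa> > 0" and crit:
    "\<And>M f. real_distribution M \<Longrightarrow>
       (\<And>t. t \<in> T \<Longrightarrow> integrable M (\<lambda>x. exp (t * x)) \<and>
          exp (V1 * t\<^sup>2 / 2 - \<kappa>) - \<kappa> \<le> (\<integral>x. exp (t * x) \<partial>M) \<and>
          (\<integral>x. exp (t * x) \<partial>M) \<le> exp (V1 * t\<^sup>2 / 2 + \<kappa>) + \<kappa>) \<Longrightarrow>
       f \<in> BL_unit \<Longrightarrow> \<bar>(\<integral>x. f x \<partial>M) - (\<integral>x. f x \<partial>gauss V1)\<bar> \<le> e / 8"
    by (rule gauss_BL_criterion_exp[OF V(1) e8(1)]) blast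
  obtain \<delta> n0 where \<delta>: "\<delta> > 0" and clt:
    "\<And>n x D g f. n0 \<le> n \<Longrightarrow> dirichlet_process (dp_base \<nu> n x) D \<Longrightarrow> g \<in> borel_measurable borel \<Longrightarrow>
       (\<And>z. 0 \<le> g z \<and> g z \<le> 1) \<Longrightarrow>
       \<bar>emp_mean n x (\<lambda>v. (g (fst v))\<^sup>2) - (emp_mean n x (\<lambda>v. g (fst v)))\<^sup>2 - V2\<bar> \<le> \<delta> \<Longrightarrow> f \<in> BL_unit \<Longrightarrow>
       \<bar>(\<integral>F. f (sqrt (real n) * (chi g F - emp_mean n x (\<lambda>v. g (fst v)))) \<partial>D) - (\<integral>y. f y \<partial>gauss V2)\<bar> \<le> e / 8"
    by (rule dirichlet_process_clt_sample[OF \<nu> V(2) e8(1)]) blast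
  define m where "m = Max (insert 1 (abs ` T))"
  have m: "1 \<le> m" "\<And>t. t \<in> T \<Longrightarrow> \<bar>t\<bar> \<le> m" using T(1) by (auto simp: m_def intro!: Max_ge)
  define Bm where "Bm = Max (insert 1 ((\<lambda>t. exp (V1 * t\<^sup>2 / 2)) ` T))"
  have Bm: "1 \<le> Bm" "\<And>t. t \<in> T \<Longrightarrow> exp (V1 * t\<^sup>2 / 2) \<le> Bm" using T(1) by (auto simp: Bm_def intro!: Max_ge)
  \<comment> \<open>The first entry bounds the loss \<open>4 * q\<close> in the conclusion by
    \<open>e / 8\<close>; the second keeps the loss of posterior mass, multiplied by the largest
    limiting transform \<open>Bm\<close>, below \<open>\<kappa>\<close>.\<close>
  define q where "q = min (e / 32) (\<kappa> / (2 * Bm))"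
  have q0: "q > 0" using e T(2) Bm(1) by (simp add: q_def)
  have q1: "q \<le> e / 32" by (simp add: q_def)
  have qB: "2 * q * Bm \<le> \<kappa>"
  proof -
    have "q * (2 * Bm) \<le> \<kappa> / (2 * Bm) * (2 * Bm)" using Bm(1) by (intro mult_right_mono) (auto simp: q_def)
    then show ?thesis using Bm(1) by (simp add: mult_ac)
  qed
  have q2: "2 * q * X \<le> \<kappa>" if "X \<le> Bm" for X
    using mult_left_mono[OF that, of "2 * q"] q0 qB by linarith
  \<comment> \<open>With \<open>\<bar>t\<bar> \<le> m\<close> the terms linear in \<open>c\<close>
    sum to at most 7/16 of \<open>\<kappa>\<close>; the cubic remainder and the prior ratio receive
    the remaining half.\<close>
  define c where "c = \<kappa> / (8 * m\<^sup>2)"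
  have m2: "1 \<le> m\<^sup>2" "m \<le> m\<^sup>2" using m(1) by (auto simp: power2_eq_square mult_le_cancel_left1 one_le_power intro: mult_le_one order_trans)
  have c: "c > 0" using T(2) m(1) by (simp add: c_def)
  have cm: "c * m\<^sup>2 = \<kappa> / 8" using m(1) by (simp add: c_def)
  define u' where "u' n = \<bar>u n\<bar> + m / (real n * (\<sigma> n)\<^sup>2)" for n
  have inv: "(\<lambda>n. C / (real n * (\<sigma> n)\<^sup>2)) \<longlonglongrightarrow> 0" for C
    by (rule tendsto_divide_0[OF tendsto_const filterlim_at_top_imp_at_infinity[OF n\<sigma>]])
  have inv': "(\<lambda>n. C / sqrt (real n)) \<longlonglongrightarrow> 0" for C
    by (rule tendsto_divide_0[OF tendsto_const filterlim_at_top_imp_at_infinity])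
       (rule filterlim_compose[OF sqrt_at_top filterlim_real_sequentially])
  have "(\<lambda>n. (m * K) ^ 3 / sqrt (real n) + (u' n * m + m\<^sup>2 / 2 / (real n * (\<sigma> n)\<^sup>2))) \<longlonglongrightarrow> 0 + ((\<bar>0\<bar> + 0) * m + 0)"
    unfolding u'_def by (intro tendsto_intros inv inv' u)
  then have ev1: "\<forall>\<^sub>F n in sequentially. (m * K) ^ 3 / sqrt (real n) + (u' n * m + m\<^sup>2 / 2 / (real n * (\<sigma> n)\<^sup>2)) < \<kappa> / 2"
    using T(2) by (intro order_tendstoD) auto
  have post_H': "whp P (\<lambda>n (x, s). \<forall>t\<in>insert 0 T. 1 - q \<le> measure (posterior (ahat n s) (Q n) (\<sigma> n) n x)
             {(w, l) \<in> space (prior_law (Q n) (\<sigma> n)). shift_path (ahat n s) w (l + t / sqrt (real n)) \<in> H n})"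
    using whp_ball[OF finite.insertI[OF T(1), of 0] post_H[OF q0]]
    by (rule whp_mono, intro always_eventually) auto
  note W = whp_conj[OF whp_score_difference[OF c] whp_conj[OF whp_weighted_deviation[OF c]
      whp_conj[OF whp_information[OF c] whp_conj[OF whp_variance[OF \<delta>] whp_conj[OF H_empirical[OF e8(2)]
      whp_conj[OF hat[OF e8(2)] whp_conj[OF post_shift[OF q0] whp_conj[OF post_H' whp_valid]]]]]]]]
  have ev: "\<forall>\<^sub>F n in sequentially. 0 < n \<and> n0 \<le> n"
    using eventually_gt_at_top[of 0] eventually_ge_at_top[of n0] by eventually_elim simp
  show ?thesis
  proof (rule whp_mono[OF W], use ev ev1 eventually_bias_le[OF bias c] in eventually_elim, clarify)
    fix n s f and x :: "nat \<Rightarrow> 'z obs"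
    assume n: "0 < n" "n0 \<le> n"
      and sm: "(m * K) ^ 3 / sqrt (real n) + (u' n * m + m\<^sup>2 / 2 / (real n * (\<sigma> n)\<^sup>2)) < \<kappa> / 2"
      and w3: "\<forall>s\<in>space (S n). good n s \<longrightarrow> (\<forall>\<eta>\<in>H n.
         \<bar>sqrt (real n) * (\<integral>z. (1 - ahat n s z / a z) * (logistic (\<eta> z) - b z) \<partial>F)\<bar> \<le> c)"
      and xs: "(x, s) \<in> space (P n)" and gd: "good n s" and f: "f \<in> BL_unit"
      and w1: "\<bar>\<Sum>i<n. (ahat n s (fst (x i)) - a (fst (x i))) * (oY (x i) - oR (x i) * b (fst (x i)))\<bar> \<le> c * sqrt (real n)"
      and w2: "\<forall>\<eta>\<in>H n.
        \<bar>emp_process (obs_law a b F) n x (\<lambda>v. oR v * ahat n s (fst v) * (logistic (\<eta> (fst v)) - b (fst v)))\<bar> \<le> c"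
      and w4: "\<forall>\<eta>\<in>H n.
        \<bar>emp_mean n x (\<lambda>v. oR v * (ahat n s (fst v))\<^sup>2 * (logistic (\<eta> (fst v)) * (1 - logistic (\<eta> (fst v)))))
           - (\<integral>z. a z * (b z * (1 - b z)) \<partial>F)\<bar> \<le> c"
      and var: "\<forall>\<eta>\<in>H n. \<bar>emp_mean n x (\<lambda>v. (logistic (\<eta> (fst v)))\<^sup>2) - (emp_mean n x (\<lambda>v. logistic (\<eta> (fst v))))\<^sup>2
           - ((\<integral>z. (b z)\<^sup>2 \<partial>F) - (\<integral>z. b z \<partial>F)\<^sup>2)\<bar> \<le> \<delta>"
      and emp: "\<forall>\<eta>\<in>H n. \<bar>emp_process (obs_law a b F) n x (\<lambda>v. logistic (\<eta> (fst v)) - b (fst v))\<bar> \<le> e / 16"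
      and ht: "\<bar>sqrt (real n) * (\<chi>hat n (x, s) - (chi b F + emp_mean n x (eff_influence a b F)))\<bar> \<le> e / 16"
      and psh: "1 - q \<le> measure (posterior (ahat n s) (Q n) (\<sigma> n) n x)
             {(w, l) \<in> space (prior_law (Q n) (\<sigma> n)). \<bar>l\<bar> \<le> u n * (\<sigma> n)\<^sup>2 * sqrt (real n)}"
      and pH: "\<forall>t\<in>insert 0 T. 1 - q \<le> measure (posterior (ahat n s) (Q n) (\<sigma> n) n x)
             {(w, l) \<in> space (prior_law (Q n) (\<sigma> n)). shift_path (ahat n s) w (l + t / sqrt (real n)) \<in> H n}"
      and valid: "\<forall>i<n. snd (snd (x i)) \<longrightarrow> fst (snd (x i))"
    have s: "s \<in> space (S n)" using xs by (simp add: P' space_pair_measure)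
    have dp: "dirichlet_process (dp_base \<nu> n x) (D n x)" using D n(1) by simp
    have n\<sigma>2: "real n * (\<sigma> n)\<^sup>2 > 0" using n(1) \<sigma>[of n] by simp
    have "\<bar>(\<integral>y. f y \<partial>distr (posterior_chi (ahat n s) (Q n) (\<sigma> n) (D n x) n x) borel (\<lambda>c. sqrt (real n) * (c - \<chi>hat n (x, s))))
      - (\<integral>y. f y \<partial>gauss (V1 + V2))\<bar> \<le> e / 8 + e / 8 + (e / 16 + e / 16) + 4 * q"
    proof (rule posterior_BvM_bound[where T=T and \<kappa>=\<kappa> and c=c and K=K and H="H n" and u="u n" and u'="u' n"])
      show "obs_model a b F" by (rule obs_model_axioms)
      show "prior_model (ahat n s) (Q n) (\<sigma> n)" by (rule prior_model.intro[OF ahat_section[OF s] Q \<sigma>])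
      show "0 < n" by (rule n)
      show "snd (snd (x i)) \<longrightarrow> fst (snd (x i))" if "i < n" for i using valid that by blast
      show "\<bar>ahat n s z\<bar> \<le> K" for z using gd by (simp add: good_def)
      show "\<eta> \<in> borel_measurable borel" if "\<eta> \<in> H n" for \<eta> by (rule H[OF that])
      show "{(w, l) \<in> space (prior_law (Q n) (\<sigma> n)). shift_path (ahat n s) w l \<in> H n} \<in> sets (prior_law (Q n) (\<sigma> n))"
        by (rule H_measurable[OF s])
      show "prob_space (D n x)" "sets (D n x) = sets (prob_algebra borel)" using dp by (auto simp: dirichlet_process_def)
      show "3 * c * \<bar>t\<bar> + c * t\<^sup>2 / 2 + (\<bar>t\<bar> * K) ^ 3 / sqrt (real n) + (u' n * \<bar>t\<bar> + t\<^sup>2 / (2 * (real n * (\<sigma> n)\<^sup>2))) \<le> \<kappa>"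
        if "t \<in> T" for t
      proof -
        note t = m(2)[OF that]
        have t2: "t\<^sup>2 \<le> m\<^sup>2" using power_mono[OF t abs_ge_zero, of 2] by simp
        have "c * \<bar>t\<bar> \<le> \<kappa> / 8" "c * t\<^sup>2 \<le> \<kappa> / 8"
          unfolding cm[symmetric] using t t2 m2 c by (auto intro!: mult_left_mono)
        then have "3 * c * \<bar>t\<bar> \<le> 3 * (\<kappa> / 8)" "c * t\<^sup>2 / 2 \<le> \<kappa> / 8 / 2" by simp_all
        moreover have "(\<bar>t\<bar> * K) ^ 3 / sqrt (real n) \<le> (m * K) ^ 3 / sqrt (real n)"
          using t K by (intro divide_right_mono power_mono mult_right_mono) auto
        moreover have "u' n * \<bar>t\<bar> \<le> u' n * m"
          using t n\<sigma>2 m(1) by (intro mult_left_mono) (auto simp: u'_def intro!: add_nonneg_nonneg divide_nonneg_nonneg)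
        moreover have "t\<^sup>2 / (2 * (real n * (\<sigma> n)\<^sup>2)) \<le> m\<^sup>2 / 2 / (real n * (\<sigma> n)\<^sup>2)"
          using divide_right_mono[OF t2, of "2 * (real n * (\<sigma> n)\<^sup>2)"] n\<sigma>2 by simp
        ultimately have "3 * c * \<bar>t\<bar> + c * t\<^sup>2 / 2 + (\<bar>t\<bar> * K) ^ 3 / sqrt (real n) + (u' n * \<bar>t\<bar> + t\<^sup>2 / (2 * (real n * (\<sigma> n)\<^sup>2)))
          \<le> 3 * (\<kappa> / 8) + \<kappa> / 8 / 2 + (m * K) ^ 3 / sqrt (real n) + (u' n * m + m\<^sup>2 / 2 / (real n * (\<sigma> n)\<^sup>2))"
          by (intro add_mono)
        also have "\<dots> \<le> \<kappa>" using sm T(2) by linarith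
        finally show ?thesis .
      qed
      show "u n + \<bar>t\<bar> / (real n * (\<sigma> n)\<^sup>2) \<le> u' n" if "t \<in> insert 0 T" for t
      proof -
        have "\<bar>t\<bar> \<le> m" using that m by auto
        then have "\<bar>t\<bar> / (real n * (\<sigma> n)\<^sup>2) \<le> m / (real n * (\<sigma> n)\<^sup>2)" using n\<sigma>2 by (intro divide_right_mono) auto
        then show ?thesis unfolding u'_def by linarith
      qed
      show "2 * q \<le> \<kappa>" using q2[OF Bm(1)] by simp
      show "2 * q * exp (V1 * t\<^sup>2 / 2) \<le> \<kappa>" if "t \<in> T" for t by (rule q2[OF Bm(2)[OF that]])
      fix \<eta> assume \<eta>: "\<eta> \<in> H n"
      show "\<bar>(\<integral>F. f (sqrt (real n) * (chi (\<lambda>z. logistic (\<eta> z)) F - emp_mean n x (\<lambda>v. logistic (\<eta> (fst v))))) \<partial>D n x)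
          - (\<integral>y. f y \<partial>gauss V2)\<bar> \<le> e / 8" if "f \<in> BL_unit" for f
      proof (rule clt[OF n(2) dp _ _ _ that])
        show "(\<lambda>z. logistic (\<eta> z)) \<in> borel_measurable borel" using H[OF \<eta>] by measurable
        show "0 \<le> logistic (\<eta> z) \<and> logistic (\<eta> z) \<le> 1" for z using logistic_bounds[of "\<eta> z"] by auto
      qed (use var \<eta> V2_def in auto)
    qed (use V w1 w2 w3 w4 gd s psh pH q0 crit emp e ht f V1_def in auto)
    also have "\<dots> \<le> e" using q1 e by linarith
    finally show "\<bar>(\<integral>y. f y \<partial>distr (posterior_chi (ahat n s) (Q n) (\<sigma> n) (D n x) n x) borel (\<lambda>c. sqrt (real n) * (c - \<chi>hat n (x, s))))
      - (\<integral>y. f y \<partial>gauss (V1 + V2))\<bar> \<le> e" .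
  qed
qed

theorem theorem2:
  fixes a0 b0 f0 :: "'z::polish_space \<Rightarrow> real"
    and F0 \<mu> \<nu> :: "'z measure"
    and S :: "nat \<Rightarrow> 's measure"
    and P :: "nat \<Rightarrow> ((nat \<Rightarrow> 'z obs) \<times> 's) measure"
    and ahat :: "nat \<Rightarrow> 's \<Rightarrow> 'z \<Rightarrow> real"
    and Q :: "nat \<Rightarrow> ('z \<Rightarrow> real) measure"
    and D :: "nat \<Rightarrow> (nat \<Rightarrow> 'z obs) \<Rightarrow> 'z measure measure"
    and H :: "nat \<Rightarrow> ('z \<Rightarrow> real) set"
    and \<sigma> \<rho> u \<epsilon> :: "nat \<Rightarrow> real"
    and \<delta> c C :: real
  assumes F0: "prob_space F0" "sets F0 = sets borel"
    and F0_density: "sets \<mu> = sets borel" "f0 \<in> borel_measurable borel"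
          "F0 = density \<mu> (\<lambda>z. ennreal (f0 z))"
          "c > 0" "\<And>z. c \<le> f0 z \<and> f0 z \<le> C"
    and a0b0_measurable: "a0 \<in> borel_measurable borel" "b0 \<in> borel_measurable borel"
    and a0b0_bounds: "\<delta> > 0" "\<And>z. \<delta> \<le> 1 / a0 z \<and> 1 / a0 z \<le> 1 - \<delta>"
          "\<And>z. \<delta> \<le> b0 z \<and> b0 z \<le> 1 - \<delta>"
      \<comment> \<open>the estimator is a function of an auxiliary variable that is independent of the sample\<close>
    and S: "\<And>n. prob_space (S n)"
    and independent: "\<And>n. P n = sample_law a0 b0 F0 n \<Otimes>\<^sub>M S n"
    and ahat_measurable: "\<And>n. (\<lambda>(s, z). ahat n s z) \<in> borel_measurable (S n \<Otimes>\<^sub>M borel)"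
    and ahat_rate: "prob_bigo P (\<lambda>n (x, s). L2_norm F0 (\<lambda>z. ahat n s z - a0 z)) \<rho>"
    and \<rho>: "\<rho> \<longlonglongrightarrow> 0"
    and ahat_bounded: "prob_bigo P (\<lambda>n (x, s). sup_norm (ahat n s)) (\<lambda>_. 1)"
      \<comment> \<open>prior for \<open>b\<close>, and posterior for \<open>F\<close>\<close>
    and Q: "\<And>n. prob_space (Q n)" "\<And>n. sets (Q n) = sets path_space"
    and \<sigma>: "\<And>n. \<sigma> n > 0"
    and \<nu>: "finite_measure \<nu>" "sets \<nu> = sets borel"
    and D: "\<And>n x. n \<ge> 1 \<Longrightarrow> dirichlet_process (dp_base \<nu> n x) (D n x)"
      \<comment> \<open>measurability of \<open>H n\<close> is needed along the prior parametrisation only\<close>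
    and H_functions: "\<And>n. H n \<subseteq> borel_measurable borel"
    and H_measurable: "\<And>n s. s \<in> space (S n) \<Longrightarrow>
          {(w, l) \<in> space (prior_law (Q n) (\<sigma> n)). shift_path (ahat n s) w l \<in> H n}
            \<in> sets (prior_law (Q n) (\<sigma> n))"
    and u: "u \<longlonglongrightarrow> 0"
    and \<epsilon>: "\<epsilon> \<longlonglongrightarrow> 0"
    and post_shift: "prob_tendsto P
          (\<lambda>n (x, s). measure (posterior (ahat n s) (Q n) (\<sigma> n) n x)
             {(w, l) \<in> space (prior_law (Q n) (\<sigma> n)). \<bar>l\<bar> \<le> u n * (\<sigma> n)\<^sup>2 * sqrt (real n)}) 1"
    and post_H: "\<And>t :: real. prob_tendsto P
          (\<lambda>n (x, s). measure (posterior (ahat n s) (Q n) (\<sigma> n) n x)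
             {(w, l) \<in> space (prior_law (Q n) (\<sigma> n)).
                shift_path (ahat n s) w (l + t / sqrt (real n)) \<in> H n}) 1"
    and H_rate: "\<And>n. (SUP \<eta>\<in>H n. L2_norm F0 (\<lambda>z. logistic (\<eta> z) - b0 z)) \<le> ennreal (\<epsilon> n)"
    and H_empirical: "prob_tendsto_0 P
          (\<lambda>n (x, s). SUP \<eta>\<in>H n.
             ennreal \<bar>emp_process (obs_law a0 b0 F0) n x (\<lambda>(z, r, ry). logistic (\<eta> z) - b0 z)\<bar>)"
    and n\<sigma>: "filterlim (\<lambda>n. real n * (\<sigma> n)\<^sup>2) at_top sequentially"
    and n\<rho>\<epsilon>: "(\<lambda>n. sqrt (real n) * \<rho> n * \<epsilon> n) \<longlonglongrightarrow> 0"
  shows "semiparametric_BvM a0 b0 F0 P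
           (\<lambda>n (x, s). posterior_chi (ahat n s) (Q n) (\<sigma> n) (D n x) n x)"
proof -
  have a1: "0 < a0 z" "1 \<le> a0 z" "a0 z \<le> 1 / \<delta>" for z
  proof -
    have pos: "0 < 1 / a0 z" using a0b0_bounds(1) a0b0_bounds(2)[of z] by linarith
    then show a: "0 < a0 z" by simp
    have "1 / a0 z \<le> 1" using a0b0_bounds(1) a0b0_bounds(2)[of z] by linarith
    then show "1 \<le> a0 z" using a by simp
    show "a0 z \<le> 1 / \<delta>" using a0b0_bounds(1) a0b0_bounds(2)[of z] a by (simp add: field_simps)
  qed
  have b1: "0 \<le> b0 z" "b0 z \<le> 1" "\<delta>\<^sup>2 \<le> b0 z * (1 - b0 z)" for z
  proof -
    show "0 \<le> b0 z" "b0 z \<le> 1" using a0b0_bounds(1) a0b0_bounds(3)[of z] by auto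
    show "\<delta>\<^sup>2 \<le> b0 z * (1 - b0 z)"
      unfolding power2_eq_square using a0b0_bounds(1) a0b0_bounds(3)[of z] by (intro mult_mono) auto
  qed
  interpret M: obs_model a0 b0 F0
    by (rule obs_model.intro[OF F0 a0b0_measurable])
       (use a0b0_bounds(2) a1(1) b1 in \<open>auto simp: field_simps a1 less_imp_le\<close>)
  define V1 where "V1 = (\<integral>z. a0 z * (b0 z * (1 - b0 z)) \<partial>F0)"
  define V2 where "V2 = (\<integral>z. (b0 z)\<^sup>2 \<partial>F0) - (\<integral>z. b0 z \<partial>F0)\<^sup>2"
  have aK: "\<bar>a0 z\<bar> \<le> 1 / \<delta>" for z using a1[of z] by simp
  \<comment> \<open>Strict positivity makes the total variance positive even if \<open>V2\<close>
    vanishes, so that the normal law in the goal is nondegenerate and coincides with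
    \<open>gauss\<close>.\<close>
  have V1_pos: "V1 > 0"
  proof -
    have ub: "\<bar>a0 z * (b0 z * (1 - b0 z))\<bar> \<le> 1 / \<delta> * (1 * 1)" for z
      unfolding abs_mult[of "a0 z"] abs_mult[of "b0 z"]
      using aK[of z] b1[of z] a0b0_bounds(1) by (intro mult_mono) auto
    have lb: "\<delta>\<^sup>2 \<le> a0 z * (b0 z * (1 - b0 z))" for z
      using mult_mono[OF a1(2)[of z] b1(3)[of z]] a1[of z] by simp
    have "\<delta>\<^sup>2 \<le> V1" unfolding V1_def
      by (rule M.F.integral_ge_const[OF M.F_integrable[OF _ ub]]) (use lb in auto)
    then show ?thesis using a0b0_bounds(1) by (smt (verit) zero_less_power)
  qed
  have V2_nonneg: "V2 \<ge> 0"
  proof -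
    have i: "integrable F0 b0" "integrable F0 (\<lambda>z. (b0 z)\<^sup>2)"
      using b1 by (auto intro!: M.F_integrable[where B=1] simp: abs_square_le_1)
    show ?thesis using M.F.variance_positive[of b0] M.F.variance_eq[OF i] unfolding V2_def by simp
  qed
  have normal: "normal_law 0 (sqrt (eff_variance a0 b0 F0)) = gauss (V1 + V2)"
    using V1_pos V2_nonneg by (simp add: gauss_def M.eff_variance_eq[OF aK] V1_def[symmetric] V2_def[symmetric])
  let ?post = "\<lambda>n x s. posterior_chi (ahat n s) (Q n) (\<sigma> n) (D n x) n x"
  have post_shift': "whp P (\<lambda>n (x, s). 1 - q \<le> measure (posterior (ahat n s) (Q n) (\<sigma> n) n x)
             {(w, l) \<in> space (prior_law (Q n) (\<sigma> n)). \<bar>l\<bar> \<le> u n * (\<sigma> n)\<^sup>2 * sqrt (real n)})" if "q > 0" for q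
    using post_shift[unfolded prob_tendsto_whp, rule_format, OF that]
    by (rule whp_mono, intro always_eventually) (auto simp: abs_le_iff)
  have post_H': "whp P (\<lambda>n (x, s). 1 - q \<le> measure (posterior (ahat n s) (Q n) (\<sigma> n) n x)
             {(w, l) \<in> space (prior_law (Q n) (\<sigma> n)). shift_path (ahat n s) w (l + t / sqrt (real n)) \<in> H n})" if "q > 0" for t q
    using post_H[unfolded prob_tendsto_whp, rule_format, OF that, of t]
    by (rule whp_mono, intro always_eventually) (auto simp: abs_le_iff)
  have H_empirical': "whp P (\<lambda>n (x, s). \<forall>\<eta>\<in>H n.
      \<bar>emp_process (obs_law a0 b0 F0) n x (\<lambda>v. logistic (\<eta> (fst v)) - b0 (fst v))\<bar> \<le> e)" if "e > 0" for e
    using H_empirical[unfolded prob_tendsto_0_whp case_prod_beta', rule_format, OF that]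
    by (rule whp_mono, intro always_eventually) (use that in \<open>auto simp: SUP_le_iff case_prod_beta'\<close>)
  have H_rate': "(\<integral>z. (logistic (\<eta> z) - b0 z)\<^sup>2 \<partial>F0) \<le> (\<epsilon> n)\<^sup>2" if "\<eta> \<in> H n" for n \<eta>
    using H_rate[of n] that by (intro L2_norm_leD) (auto simp: SUP_le_iff)
  show ?thesis
    unfolding semiparametric_BvM_def
  proof (intro allI impI, elim conjE)
    fix \<chi>hat
    assume "prob_tendsto P (\<lambda>n \<omega>. sqrt (real n) *
             (\<chi>hat n \<omega> - (chi b0 F0 + emp_mean n (fst \<omega>) (eff_influence a0 b0 F0)))) 0"
    then have hat: "whp P (\<lambda>n (x, s).
           \<bar>sqrt (real n) * (\<chi>hat n (x, s) - (chi b0 F0 + emp_mean n x (eff_influence a0 b0 F0)))\<bar> \<le> e)" if "e > 0" for e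
      using that by (simp add: prob_tendsto_whp case_prod_beta')
    show "prob_tendsto P
          (\<lambda>n \<omega>. d_BL (distr ((case \<omega> of (x, s) \<Rightarrow> ?post n x s)) borel (\<lambda>c. sqrt (real n) * (c - \<chi>hat n \<omega>)))
                      (normal_law 0 (sqrt (eff_variance a0 b0 F0)))) 0"
      unfolding prob_tendsto_whp normal
    proof (intro allI impI)
      fix e :: real
      assume e: "e > 0"
      let ?G = "\<lambda>n \<omega>. \<bar>d_BL (distr ((case \<omega> of (x, s) \<Rightarrow> ?post n x s)) borel (\<lambda>c. sqrt (real n) * (c - \<chi>hat n \<omega>))) (gauss (V1 + V2)) - 0\<bar> \<le> e"
      \<comment> \<open>\<open>C0\<close> and \<open>K0\<close> are arbitrary: the two stochastic
        bounds become premises with fixed constants and are removed at the end by two uses of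
        \<open>prob_bigo_whp\<close>.\<close>
      have main: "whp P (\<lambda>n \<omega>. (case \<omega> of (x, s) \<Rightarrow> L2_norm F0 (\<lambda>z. ahat n s z - a0 z)) \<le> ennreal (C0 * \<bar>\<rho> n\<bar>) \<longrightarrow>
           (case \<omega> of (x, s) \<Rightarrow> sup_norm (ahat n s)) \<le> ennreal (K0 * \<bar>1\<bar>) \<longrightarrow> ?G n \<omega>)" for C0 K0
      proof -
        \<comment> \<open>The absolute value admits rates of either sign, and the maximum with 1
          makes the bound on the estimator positive even for a nonpositive
          \<open>K0\<close>.\<close>
        interpret E: estimated_weight a0 b0 F0 S P ahat H \<epsilon> "\<lambda>n. C0 * \<bar>\<rho> n\<bar>" "max K0 1" "1 / \<delta>"
        proof (rule estimated_weight.intro[OF M.obs_model_axioms], rule estimated_weight_axioms.intro)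
          show "(\<lambda>n. C0 * \<bar>\<rho> n\<bar>) \<longlonglongrightarrow> 0" using tendsto_mult_right_zero[OF tendsto_rabs_zero[OF \<rho>]] .
          show "\<eta> \<in> borel_measurable borel" if "\<eta> \<in> H n" for n \<eta> using H_functions that by auto
        qed (use S independent ahat_measurable H_rate' \<epsilon> H_empirical' a1 in auto)
        have "(\<lambda>n. \<bar>C0\<bar> * \<bar>sqrt (real n) * \<rho> n * \<epsilon> n\<bar>) \<longlonglongrightarrow> 0"
          by (rule tendsto_mult_right_zero[OF tendsto_rabs_zero[OF n\<rho>\<epsilon>]])
        then have "(\<lambda>n. \<bar>sqrt (real n) * (C0 * \<bar>\<rho> n\<bar>) * \<epsilon> n\<bar>) \<longlonglongrightarrow> 0" by (simp add: abs_mult mult_ac)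
        then have bias: "(\<lambda>n. sqrt (real n) * (C0 * \<bar>\<rho> n\<bar>) * \<epsilon> n) \<longlonglongrightarrow> 0" by (rule tendsto_rabs_zero_cancel)
        have "whp P (\<lambda>n (x, s). E.good n s \<longrightarrow> (\<forall>f\<in>BL_unit.
           \<bar>(\<integral>y. f y \<partial>distr (?post n x s) borel (\<lambda>c. sqrt (real n) * (c - \<chi>hat n (x, s))))
            - (\<integral>y. f y \<partial>gauss (V1 + V2))\<bar> \<le> e))"
          unfolding V1_def V2_def
          by (rule E.whp_BvM[where u=u and \<nu>=\<nu>])
             (fact V1_pos[THEN less_imp_le, unfolded V1_def] V2_nonneg[unfolded V2_def] Q \<sigma> \<nu> D H_measurable u
                post_shift' post_H' n\<sigma> bias hat e)+
        then show ?thesis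
        proof (rule whp_mono, intro always_eventually allI ballI impI, clarify)
          fix n x s
          assume P: "E.good n s \<longrightarrow> (\<forall>f\<in>BL_unit.
             \<bar>(\<integral>y. f y \<partial>distr (?post n x s) borel (\<lambda>c. sqrt (real n) * (c - \<chi>hat n (x, s))))
              - (\<integral>y. f y \<partial>gauss (V1 + V2))\<bar> \<le> e)"
            and L2: "L2_norm F0 (\<lambda>z. ahat n s z - a0 z) \<le> ennreal (C0 * \<bar>\<rho> n\<bar>)"
            and sup: "sup_norm (ahat n s) \<le> ennreal (K0 * \<bar>1\<bar>)"
          have "\<bar>ahat n s z\<bar> \<le> max K0 1" for z using sup_norm_leD[OF sup, of z] by auto
          then have "E.good n s" using L2_norm_leD[OF L2] by (simp add: E.good_def)
          then show "\<bar>d_BL (distr (?post n x s) borel (\<lambda>c. sqrt (real n) * (c - \<chi>hat n (x, s)))) (gauss (V1 + V2)) - 0\<bar> \<le> e"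
            using P d_BL_abs_le by simp
        qed
      qed
      show "whp P ?G"
        by (rule prob_bigo_whp[OF ahat_bounded], rule prob_bigo_whp[OF ahat_rate], rule main)
    qed
  qed
qed

end
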